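(* Let $(G,\sigma,K)$ be a Riemannian symmetric triple and let $P=\exp(\mathfrak{p})$. Then $P$ is a closed submanifold of $G$. The map $\varphi:G/K\to P$ defined by $\varphi([g])=g\sigma(g)^{-1}$ is a diffeomorphism. Moreover, $\varphi$ is equivariant with respect to the action of $G$ by left multiplication on $G/K$ and the twisted conjugate action $\tau_g(h)=gh\sigma(g)^{-1}$ of $G$ on $P$.
   Context: A Riemannian symmetric triple $(G,\sigma,K)$ consists of a connected Lie group $G$, an involution $\sigma$ of $G$ (a Lie group automorphism with $\sigma^2=\mathrm{id}$), and the closed subgroup $K=\{g\in G\mid\sigma(g)=g\}$, such that there exists a $G$-invariant Riemannian structure on $G/K$. Let $\mathfrak{g}$ be the Lie algebra of $G$ and $d\sigma$ the differential of $\sigma$ on $\mathfrak{g}$; $\mathfrak{p}$ is the eigenspace of $d\sigma$ with eigenvalue $-1$. The class of $g$ in $G/K$ is $[g]=gK$. The twisted conjugate action of $G$ on $G$ is $\tau_g(h)=gh\sigma(g)^{-1}$; the set $P$ equals the orbit $\{g\sigma(g)^{-1}\mid g\in G\}$ of $e$ under this action, so the action restricts to $P$. A closed submanifold is an embedded submanifold that is a closed subset. *)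

theory Defs
  imports "HOL-Analysis.Analysis" "HOL-Algebra.Left_Coset"
begin

section \<open>Smooth functions\<close>

text \<open>
  The first predicate is meant for open sets \<open>U\<close>: all iterated directional derivatives of order at
  most \<open>k\<close> exist as Frechet derivatives and are continuous, which in finite dimension is \<open>C\<^sup>k\<close>.
  On an arbitrary set a function is smooth if it locally extends to a smooth function on an open
  set; on open sets of a linear subspace this is ordinary smoothness.
\<close>

primrec Ck_on :: "nat \<Rightarrow> 'a::euclidean_space set \<Rightarrow> ('a \<Rightarrow> 'b::euclidean_space) \<Rightarrow> bool" where
  "Ck_on 0 U f \<longleftrightarrow> continuous_on U f"
| "Ck_on (Suc k) U f \<longleftrightarrow>
     (\<forall>x\<in>U. f differentiable (at x)) \<and> (\<forall>v. Ck_on k U (\<lambda>x. frechet_derivative f (at x) v))"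

definition smooth_on :: "'a::euclidean_space set \<Rightarrow> ('a \<Rightarrow> 'b::euclidean_space) \<Rightarrow> bool" where
  "smooth_on S f \<longleftrightarrow>
     (\<forall>x\<in>S. \<exists>U g. open U \<and> x \<in> U \<and> (\<forall>k. Ck_on k U g) \<and> (\<forall>y\<in>S \<inter> U. g y = f y))"


section \<open>Smooth manifolds\<close>

text \<open>
  A chart is a pair of a domain and a map, only the restriction of the map to the domain being
  relevant. Charts take values in a linear subspace \<open>model M\<close> of a Euclidean space, so that
  manifolds of different dimensions (including 0) share one type of coordinates: a Lie group, its
  submanifolds and its homogeneous spaces all have charts into subspaces of the same \<open>'e\<close>.
  The atlas need not be maximal; \<open>max_atlas\<close> is the smooth structure it generates.
\<close>

type_synonym ('a, 'e) chart = "'a set \<times> ('a \<Rightarrow> 'e)"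

record ('a, 'e) mfd =
  mtop :: "'a topology"
  model :: "'e set"
  atlas :: "('a, 'e) chart set"

definition chart_inv :: "('a, 'e) chart \<Rightarrow> 'e \<Rightarrow> 'a" where
  "chart_inv C = inv_into (fst C) (snd C)"

definition is_chart :: "('a, 'e::euclidean_space) mfd \<Rightarrow> ('a, 'e) chart \<Rightarrow> bool" where
  "is_chart M C \<longleftrightarrow>
     openin (mtop M) (fst C) \<and>
     openin (top_of_set (model M)) (snd C ` fst C) \<and>
     homeomorphic_map (subtopology (mtop M) (fst C)) (top_of_set (snd C ` fst C)) (snd C)"

definition compatible_charts ::
    "('a, 'e::euclidean_space) chart \<Rightarrow> ('a, 'e) chart \<Rightarrow> bool" where
  "compatible_charts C C' \<longleftrightarrow>
     smooth_on (snd C ` (fst C \<inter> fst C')) (snd C' \<circ> chart_inv C) \<and>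
     smooth_on (snd C' ` (fst C \<inter> fst C')) (snd C \<circ> chart_inv C')"

definition smooth_manifold :: "('a, 'e::euclidean_space) mfd \<Rightarrow> bool" where
  "smooth_manifold M \<longleftrightarrow>
     Hausdorff_space (mtop M) \<and> second_countable (mtop M) \<and> subspace (model M) \<and>
     (\<forall>C\<in>atlas M. is_chart M C) \<and>
     (\<Union>C\<in>atlas M. fst C) = topspace (mtop M) \<and>
     (\<forall>C\<in>atlas M. \<forall>C'\<in>atlas M. compatible_charts C C')"

definition max_atlas :: "('a, 'e::euclidean_space) mfd \<Rightarrow> ('a, 'e) chart set" where
  "max_atlas M = {C. is_chart M C \<and> (\<forall>C'\<in>atlas M. compatible_charts C C')}"

definition smooth_map ::
    "('a, 'e::euclidean_space) mfd \<Rightarrow> ('b, 'f::euclidean_space) mfd \<Rightarrow> ('a \<Rightarrow> 'b) \<Rightarrow> bool" where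
  "smooth_map M N f \<longleftrightarrow>
     continuous_map (mtop M) (mtop N) f \<and>
     (\<forall>C\<in>atlas M. \<forall>C'\<in>atlas N.
        smooth_on (snd C ` (fst C \<inter> f -` fst C')) (snd C' \<circ> f \<circ> chart_inv C))"

definition diffeomorphism ::
    "('a, 'e::euclidean_space) mfd \<Rightarrow> ('b, 'f::euclidean_space) mfd \<Rightarrow> ('a \<Rightarrow> 'b) \<Rightarrow> bool" where
  "diffeomorphism M N f \<longleftrightarrow>
     bij_betw f (topspace (mtop M)) (topspace (mtop N)) \<and>
     smooth_map M N f \<and> smooth_map N M (inv_into (topspace (mtop M)) f)"

definition prod_mfd ::
    "('a, 'e::euclidean_space) mfd \<Rightarrow> ('b, 'f::euclidean_space) mfd \<Rightarrow> ('a \<times> 'b, 'e \<times> 'f) mfd" where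
  "prod_mfd M N =
     \<lparr>mtop = prod_topology (mtop M) (mtop N),
      model = model M \<times> model N,
      atlas = {(fst C \<times> fst C', map_prod (snd C) (snd C')) | C C'. C \<in> atlas M \<and> C' \<in> atlas N}\<rparr>"

definition real_mfd :: "(real, real) mfd" where
  "real_mfd = \<lparr>mtop = euclideanreal, model = UNIV, atlas = {(UNIV, id)}\<rparr>"

text \<open>
  Embedded submanifolds, by slice charts: \<open>W\<close> is the linear subspace of the model that cuts out
  \<open>S\<close> in suitable charts, so its dimension is the dimension of \<open>S\<close>.
\<close>

definition slice_charts ::
    "('a, 'e::euclidean_space) mfd \<Rightarrow> 'e set \<Rightarrow> 'a set \<Rightarrow> ('a, 'e) chart set" where
  "slice_charts M W S = {C \<in> max_atlas M. snd C ` (fst C \<inter> S) = snd C ` fst C \<inter> W}"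

definition embedded_submanifold ::
    "('a, 'e::euclidean_space) mfd \<Rightarrow> 'e set \<Rightarrow> 'a set \<Rightarrow> bool" where
  "embedded_submanifold M W S \<longleftrightarrow>
     S \<subseteq> topspace (mtop M) \<and> subspace W \<and> W \<subseteq> model M \<and>
     (\<forall>p\<in>S. \<exists>C\<in>slice_charts M W S. p \<in> fst C)"

definition submfd ::
    "('a, 'e::euclidean_space) mfd \<Rightarrow> 'e set \<Rightarrow> 'a set \<Rightarrow> ('a, 'e) mfd" where
  "submfd M W S =
     \<lparr>mtop = subtopology (mtop M) S, model = W,
      atlas = (\<lambda>C. (fst C \<inter> S, snd C)) ` slice_charts M W S\<rparr>"


section \<open>Tangent vectors, differentials and Riemannian metrics\<close>

text \<open>
  A tangent vector at \<open>p\<close> is represented by the family of its coordinate vectors in all charts of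
  the atlas around \<open>p\<close>, related to each other by the differentials of the chart changes; it is 0 by
  convention at charts whose domain does not contain \<open>p\<close>. The vector space operations are
  pointwise.
\<close>

type_synonym ('a, 'e) tangent = "('a, 'e) chart \<Rightarrow> 'e"

definition charts_at :: "('a, 'e) mfd \<Rightarrow> 'a \<Rightarrow> ('a, 'e) chart set" where
  "charts_at M p = {C \<in> atlas M. p \<in> fst C}"

text \<open>The tangent vector at \<open>p\<close> whose coordinate vector in the chart \<open>C\<close> is \<open>u\<close>:\<close>

definition coord_vector ::
    "('a, 'e::euclidean_space) mfd \<Rightarrow> ('a, 'e) chart \<Rightarrow> 'a \<Rightarrow> 'e \<Rightarrow> ('a, 'e) tangent" where
  "coord_vector M C p u = (\<lambda>C'. if C' \<in> charts_at M p
     then frechet_derivative (snd C' \<circ> chart_inv C) (at (snd C p) within model M) u else 0)"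

definition tangent_space ::
    "('a, 'e::euclidean_space) mfd \<Rightarrow> 'a \<Rightarrow> ('a, 'e) tangent set" where
  "tangent_space M p =
     {v. \<forall>C\<in>charts_at M p. v C \<in> model M \<and> v = coord_vector M C p (v C)}"

text \<open>For a tangent vector the choice of the chart \<open>C\<close> below does not matter.\<close>

definition differential ::
    "('a, 'e::euclidean_space) mfd \<Rightarrow> ('b, 'f::euclidean_space) mfd \<Rightarrow> ('a \<Rightarrow> 'b) \<Rightarrow> 'a \<Rightarrow>
     ('a, 'e) tangent \<Rightarrow> ('b, 'f) tangent" where
  "differential M N f p v = (\<lambda>C'. if C' \<in> charts_at N (f p)
     then let C = SOME C. C \<in> charts_at M p
          in frechet_derivative (snd C' \<circ> f \<circ> chart_inv C) (at (snd C p) within model M) (v C)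
     else 0)"

definition velocity ::
    "('a, 'e::euclidean_space) mfd \<Rightarrow> (real \<Rightarrow> 'a) \<Rightarrow> real \<Rightarrow> ('a, 'e) tangent" where
  "velocity M \<gamma> t = (\<lambda>C. if C \<in> charts_at M (\<gamma> t)
     then vector_derivative (snd C \<circ> \<gamma>) (at t) else 0)"

definition submersion ::
    "('a, 'e::euclidean_space) mfd \<Rightarrow> ('b, 'f::euclidean_space) mfd \<Rightarrow> ('a \<Rightarrow> 'b) \<Rightarrow> bool" where
  "submersion M N f \<longleftrightarrow> smooth_map M N f \<and>
     (\<forall>p\<in>topspace (mtop M). differential M N f p ` tangent_space M p = tangent_space N (f p))"

definition riemannian_metric ::
    "('a, 'e::euclidean_space) mfd \<Rightarrow>
     ('a \<Rightarrow> ('a, 'e) tangent \<Rightarrow> ('a, 'e) tangent \<Rightarrow> real) \<Rightarrow> bool" where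
  "riemannian_metric M h \<longleftrightarrow>
     (\<forall>p\<in>topspace (mtop M).
        (\<forall>u\<in>tangent_space M p. \<forall>v\<in>tangent_space M p. h p u v = h p v u) \<and>
        (\<forall>u\<in>tangent_space M p. \<forall>v\<in>tangent_space M p. \<forall>w\<in>tangent_space M p. \<forall>a b.
           h p (\<lambda>C. a *\<^sub>R u C + b *\<^sub>R v C) w = a * h p u w + b * h p v w) \<and>
        (\<forall>u\<in>tangent_space M p. u \<noteq> (\<lambda>C. 0) \<longrightarrow> h p u u > 0)) \<and>
     (\<forall>C\<in>atlas M. \<forall>u\<in>model M. \<forall>v\<in>model M.
        smooth_on (snd C ` fst C)
          (\<lambda>x. let p = chart_inv C x in h p (coord_vector M C p u) (coord_vector M C p v)))"


section \<open>Lie groups\<close>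

definition lie_group :: "'g monoid \<Rightarrow> ('g, 'e::euclidean_space) mfd \<Rightarrow> bool" where
  "lie_group G M \<longleftrightarrow>
     group G \<and> smooth_manifold M \<and> topspace (mtop M) = carrier G \<and>
     smooth_map (prod_mfd M M) M (\<lambda>(x, y). x \<otimes>\<^bsub>G\<^esub> y) \<and>
     smooth_map M M (\<lambda>x. inv\<^bsub>G\<^esub> x)"

definition one_parameter_subgroup ::
    "'g monoid \<Rightarrow> ('g, 'e::euclidean_space) mfd \<Rightarrow> (real \<Rightarrow> 'g) \<Rightarrow> bool" where
  "one_parameter_subgroup G M \<gamma> \<longleftrightarrow>
     smooth_map real_mfd M \<gamma> \<and> (\<forall>s t. \<gamma> (s + t) = \<gamma> s \<otimes>\<^bsub>G\<^esub> \<gamma> t)"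

text \<open>The underlying vector space of the Lie algebra; the bracket is not needed.\<close>

definition lie_algebra :: "'g monoid \<Rightarrow> ('g, 'e::euclidean_space) mfd \<Rightarrow> ('g, 'e) tangent set" where
  "lie_algebra G M = tangent_space M \<one>\<^bsub>G\<^esub>"

definition lie_exp ::
    "'g monoid \<Rightarrow> ('g, 'e::euclidean_space) mfd \<Rightarrow> ('g, 'e) tangent \<Rightarrow> 'g" where
  "lie_exp G M v = (THE \<gamma>. one_parameter_subgroup G M \<gamma> \<and> velocity M \<gamma> 0 = v) 1"

definition lie_automorphism ::
    "'g monoid \<Rightarrow> ('g, 'e::euclidean_space) mfd \<Rightarrow> ('g \<Rightarrow> 'g) \<Rightarrow> bool" where
  "lie_automorphism G M \<sigma> \<longleftrightarrow> \<sigma> \<in> iso G G \<and> diffeomorphism M M \<sigma>"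

text \<open>
  The homogeneous space \<open>G/K\<close>: the left cosets with the quotient topology and the (unique) smooth
  structure for which the projection is a submersion.
\<close>

definition coset_manifold ::
    "'g monoid \<Rightarrow> ('g, 'e::euclidean_space) mfd \<Rightarrow> 'g set \<Rightarrow> ('g set, 'e) mfd \<Rightarrow> bool" where
  "coset_manifold G M K Q \<longleftrightarrow>
     smooth_manifold Q \<and> topspace (mtop Q) = lcosets\<^bsub>G\<^esub> K \<and>
     quotient_map (mtop M) (mtop Q) (\<lambda>g. g <#\<^bsub>G\<^esub> K) \<and>
     submersion M Q (\<lambda>g. g <#\<^bsub>G\<^esub> K)"

definition invariant_metric ::
    "'g monoid \<Rightarrow> ('g set, 'e::euclidean_space) mfd \<Rightarrow>
     ('g set \<Rightarrow> ('g set, 'e) tangent \<Rightarrow> ('g set, 'e) tangent \<Rightarrow> real) \<Rightarrow> bool" where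
  "invariant_metric G Q h \<longleftrightarrow>
     (\<forall>g\<in>carrier G. \<forall>p\<in>topspace (mtop Q). \<forall>u\<in>tangent_space Q p. \<forall>v\<in>tangent_space Q p.
        h (g <#\<^bsub>G\<^esub> p) (differential Q Q (\<lambda>x. g <#\<^bsub>G\<^esub> x) p u) (differential Q Q (\<lambda>x. g <#\<^bsub>G\<^esub> x) p v)
        = h p u v)"


section \<open>Riemannian symmetric triples\<close>

text \<open>Closedness of \<open>K\<close> is automatic, since \<open>K\<close> is the full fixed point set of \<open>\<sigma>\<close>.\<close>

definition riemannian_symmetric_triple ::
    "'g monoid \<Rightarrow> ('g, 'e::euclidean_space) mfd \<Rightarrow> ('g \<Rightarrow> 'g) \<Rightarrow> 'g set \<Rightarrow> bool" where
  "riemannian_symmetric_triple G M \<sigma> K \<longleftrightarrow>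
     lie_group G M \<and> connected_space (mtop M) \<and>
     lie_automorphism G M \<sigma> \<and> (\<forall>g\<in>carrier G. \<sigma> (\<sigma> g) = g) \<and>
     K = {g \<in> carrier G. \<sigma> g = g} \<and>
     (\<exists>Q h. coset_manifold G M K Q \<and> riemannian_metric Q h \<and> invariant_metric G Q h)"

definition minus_eigenspace ::
    "'g monoid \<Rightarrow> ('g, 'e::euclidean_space) mfd \<Rightarrow> ('g \<Rightarrow> 'g) \<Rightarrow> ('g, 'e) tangent set" where
  "minus_eigenspace G M \<sigma> =
     {v \<in> lie_algebra G M. differential M M \<sigma> \<one>\<^bsub>G\<^esub> v = (\<lambda>C. - v C)}"

definition symmetric_subset ::
    "'g monoid \<Rightarrow> ('g, 'e::euclidean_space) mfd \<Rightarrow> ('g \<Rightarrow> 'g) \<Rightarrow> 'g set" where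
  "symmetric_subset G M \<sigma> = lie_exp G M ` minus_eigenspace G M \<sigma>"

definition twisted_conj :: "'g monoid \<Rightarrow> ('g \<Rightarrow> 'g) \<Rightarrow> 'g \<Rightarrow> 'g \<Rightarrow> 'g" where
  "twisted_conj G \<sigma> g h = g \<otimes>\<^bsub>G\<^esub> h \<otimes>\<^bsub>G\<^esub> inv\<^bsub>G\<^esub> (\<sigma> g)"

end

theory Submission imports Defs
begin

text \<open>Write \<open>\<kappa> g = g \<sigma>(g)\<^sup>-\<^sup>1\<close>, so that \<open>\<kappa> (exp X) = exp (2 X)\<close> for \<open>X \<in> \<pp>\<close>. Hence \<open>P\<close> is the orbit
  \<open>\<kappa> G\<close> as soon as \<open>G = exp \<pp> K\<close>. This is proved without geodesics: the invariant metric gives an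
  energy on \<open>N\<close>-step products \<open>exp X\<^sub>1 \<dots> exp X\<^sub>N\<close> with \<open>X\<^sub>i \<in> \<pp>\<close> in a fixed class of \<open>G/K\<close>, and two
  consecutive short steps that are not equal can be replaced by shorter ones, so that a minimiser
  is \<open>exp (N X)\<close>.

  The exponential map is obtained by linearising the local square root of \<open>G\<close> at \<open>1\<close>, and it
  agrees with one-parameter subgroups because commutation and homomorphisms pass to unique square
  roots.

  Near \<open>h\<^sub>0\<close> every solution of \<open>\<sigma> h = h\<^sup>-\<^sup>1\<close> is \<open>\<tau>\<^sub>r h\<^sub>0\<close> with \<open>r\<close> the square root of \<open>h h\<^sub>0\<^sup>-\<^sup>1\<close>.
  So \<open>\<kappa> G\<close> is open in the closed set of these solutions, and so is each other orbit in it, which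
  makes \<open>\<kappa> G\<close> closed; the same formula is a smooth local inverse of \<open>\<phi>\<close>.\<close>

section \<open>Smooth functions on vector spaces\<close>

text \<open>The obstacle is regularity. No differential equation is solved, and the exponential map
  arises as a limit, so it is known only to be continuous, \<open>tame\<close> at 0 and smooth along
  lines through 0. Length estimates therefore rest on first and second differences alone, while
  charts of the orbit and the local inverse of \<phi> come from the square root, which is smooth by
  the inverse function theorem, and from averaging, never from exponential coordinates.

  The metric acts through a single object: the symmetric form that it induces at the base point,
  positive on \<pp> and invariant under \<open>Ad k\<close> for \<open>k \<in> K\<close>.
  Connectedness of \<open>G\<close> supplies some chain of exponentials into every class.

  The number of steps has to be large for the shortening to apply. Cutting each factor of a given
  chain into \<open>m\<close> equal parts divides its energy by \<open>m\<close>; a minimiser with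
  the same number of steps has no more energy, so for large \<open>m\<close> each of its steps lies
  below the threshold.\<close>

lemma Ck_on_subset: "Ck_on k U f \<Longrightarrow> V \<subseteq> U \<Longrightarrow> Ck_on k V f"
  by (induction k arbitrary: f) (auto intro: continuous_on_subset)

lemma Ck_on_Suc_imp: "Ck_on (Suc k) U f \<Longrightarrow> Ck_on k U f"
proof (induction k arbitrary: f)
  case 0
  then show ?case
    by (auto intro!: continuous_at_imp_continuous_on differentiable_imp_continuous_within)
next
  case (Suc k)
  have "Ck_on k U (\<lambda>x. frechet_derivative f (at x) v)" for v
    using Suc.prems by (intro Suc.IH) simp
  with Suc.prems show ?case by simp
qed

lemma Ck_on_le: "Ck_on k U f \<Longrightarrow> j \<le> k \<Longrightarrow> Ck_on j U f"
  by (induction k) (auto simp: le_Suc_eq simp del: Ck_on.simps dest: Ck_on_Suc_imp)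

lemma Ck_on_imp_continuous_on: "Ck_on k U f \<Longrightarrow> continuous_on U f"
  using Ck_on_le[of k U f 0] by simp

lemma Ck_on_cong:
  assumes "open U" "\<And>x. x \<in> U \<Longrightarrow> f x = g x" "Ck_on k U f"
  shows "Ck_on k U g"
  using assms(2,3)
proof (induction k arbitrary: f g)
  case 0
  then show ?case by (metis Ck_on.simps(1) continuous_on_cong)
next
  case (Suc k)
  have d: "g differentiable (at x)" if "x \<in> U" for x
    using Suc.prems that \<open>open U\<close> unfolding differentiable_def
    by (metis Ck_on.simps(2) differentiable_def has_derivative_transform_within_open)
  moreover have "Ck_on k U (\<lambda>x. frechet_derivative g (at x) v)" for v
  proof (rule Suc.IH)
    show "Ck_on k U (\<lambda>x. frechet_derivative f (at x) v)" using Suc.prems by simp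
    show "frechet_derivative f (at x) v = frechet_derivative g (at x) v" if "x \<in> U" for x
      using Suc.prems that \<open>open U\<close> by (metis Ck_on.simps(2) frechet_derivative_transform_within_open)
  qed
  ultimately show ?case by simp
qed

lemma Ck_on_SucI:
  assumes "open U" "\<And>x. x \<in> U \<Longrightarrow> (f has_derivative f' x) (at x)"
    and "\<And>v. Ck_on k U (\<lambda>x. f' x v)"
  shows "Ck_on (Suc k) U f"
proof -
  have "Ck_on k U (\<lambda>x. frechet_derivative f (at x) v)" for v
    by (rule Ck_on_cong[OF assms(1) _ assms(3)[of v]])
       (metis assms(2) frechet_derivative_at)
  then show ?thesis using assms(2) by (auto simp: differentiable_def)
qed

lemma Ck_on_SucD:
  assumes "Ck_on (Suc k) U f" "x \<in> U"
  shows "(f has_derivative frechet_derivative f (at x)) (at x)"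
  using assms by (simp add: frechet_derivative_works)

lemma Ck_on_const: "Ck_on k U (\<lambda>x. c)"
  by (induction k arbitrary: c) auto

lemma Ck_on_linear: "linear L \<Longrightarrow> Ck_on k UNIV L"
proof (cases k)
  case 0
  assume "linear L" then show ?thesis using 0 by (simp add: linear_continuous_on linear_conv_bounded_linear)
next
  case (Suc j)
  assume "linear L"
  then show ?thesis unfolding Suc
    by (intro Ck_on_SucI[where f' = "\<lambda>_. L"]) (auto intro: Ck_on_const simp: linear_imp_has_derivative)
qed

lemma Ck_on_compose_linear:
  assumes "open U" "linear L" "Ck_on k U f"
  shows "Ck_on k U (\<lambda>x. L (f x))"
  using assms(3)
proof (induction k arbitrary: f)
  case 0
  then show ?case
    using linear_continuous_on_compose[OF _ assms(2), of U f] by simp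
next
  case (Suc k)
  show ?case
  proof (rule Ck_on_SucI[OF assms(1)])
    show "((\<lambda>x. L (f x)) has_derivative (\<lambda>v. L (frechet_derivative f (at x) v))) (at x)" if "x \<in> U" for x
      using Ck_on_SucD[OF Suc.prems that] linear_imp_has_derivative[OF assms(2)]
      by (metis bounded_linear.has_derivative linear_conv_bounded_linear assms(2))
    show "Ck_on k U (\<lambda>x. L (frechet_derivative f (at x) v))" for v
      using Suc by simp
  qed
qed

lemma Ck_on_add:
  assumes "open U" "Ck_on k U f" "Ck_on k U g"
  shows "Ck_on k U (\<lambda>x. f x + g x)"
  using assms(2,3)
proof (induction k arbitrary: f g)
  case 0
  then show ?case by (simp add: continuous_on_add)
next
  case (Suc k)
  show ?case
    by (rule Ck_on_SucI[OF assms(1)], rule has_derivative_add, (erule Ck_on_SucD[OF Suc.prems(1)] Ck_on_SucD[OF Suc.prems(2)])+)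
       (use Suc in simp)
qed

lemma Ck_on_sum:
  assumes "open U" "\<And>i. i \<in> I \<Longrightarrow> Ck_on k U (f i)"
  shows "Ck_on k U (\<lambda>x. \<Sum>i\<in>I. f i x)"
  using assms(2) by (induction I rule: infinite_finite_induct) (auto intro: Ck_on_const Ck_on_add[OF assms(1)])

lemma Ck_on_scaleR:
  fixes f :: "'a::euclidean_space \<Rightarrow> real"
  assumes "open U" "Ck_on k U f" "Ck_on k U g"
  shows "Ck_on k U (\<lambda>x. f x *\<^sub>R g x)"
  using assms(2,3)
proof (induction k arbitrary: f g)
  case 0
  then show ?case by (simp add: continuous_on_scaleR)
next
  case (Suc k)
  show ?case
  proof (rule Ck_on_SucI[OF assms(1)])
    show "((\<lambda>x. f x *\<^sub>R g x) has_derivative (\<lambda>v. f x *\<^sub>R frechet_derivative g (at x) v +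
        frechet_derivative f (at x) v *\<^sub>R g x)) (at x)" if "x \<in> U" for x
      using Ck_on_SucD[OF Suc.prems(1) that] Ck_on_SucD[OF Suc.prems(2) that] by (rule has_derivative_scaleR)
    show "Ck_on k U (\<lambda>x. f x *\<^sub>R frechet_derivative g (at x) v + frechet_derivative f (at x) v *\<^sub>R g x)" for v
      using Suc.prems
      by (intro Ck_on_add assms(1) Suc.IH) (auto simp del: Ck_on.simps intro: Ck_on_Suc_imp, auto)
  qed
qed

lemma Ck_on_compose:
  assumes "open U" "open V" "f ` U \<subseteq> V" "Ck_on k U f" "Ck_on k V g"
  shows "Ck_on k U (\<lambda>x. g (f x))"
  using assms(3,4,5)
proof (induction k arbitrary: f g)
  case 0
  then show ?case by (auto intro: continuous_on_compose2)
next
  case (Suc k)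
  let ?f' = "\<lambda>x. frechet_derivative f (at x)" and ?g' = "\<lambda>x. frechet_derivative g (at x)"
  have g': "(g has_derivative ?g' (f x)) (at (f x))" if "x \<in> U" for x
    using Ck_on_SucD[OF Suc.prems(3)] that Suc.prems(1) by blast
  show ?case
  proof (rule Ck_on_SucI[OF assms(1)])
    show "((\<lambda>x. g (f x)) has_derivative (\<lambda>v. ?g' (f x) (?f' x v))) (at x)" if "x \<in> U" for x
      using diff_chain_at[OF Ck_on_SucD[OF Suc.prems(2) that] g'[OF that]] by (simp add: o_def)
    \<comment> \<open>\<open>Ck_on\<close> controls the derivative of \<open>g\<close> in fixed
      directions only, whereas the direction \<open>?f' x v\<close> moves with \<open>x\<close>.
      Expanding it in the basis leaves fixed directions with coefficients of class C^k.\<close>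
    show "Ck_on k U (\<lambda>x. ?g' (f x) (?f' x v))" for v
    proof (rule Ck_on_cong[OF assms(1)])
      show "(\<Sum>b\<in>Basis. (?f' x v \<bullet> b) *\<^sub>R ?g' (f x) b) = ?g' (f x) (?f' x v)" if "x \<in> U" for x
      proof -
        have l: "linear (?g' (f x))" using g'[OF that] has_derivative_linear by blast
        have "?g' (f x) (?f' x v) = ?g' (f x) (\<Sum>b\<in>Basis. (?f' x v \<bullet> b) *\<^sub>R b)"
          by (simp add: euclidean_representation)
        also have "\<dots> = (\<Sum>b\<in>Basis. (?f' x v \<bullet> b) *\<^sub>R ?g' (f x) b)"
          by (simp add: linear_sum[OF l] linear_cmul[OF l])
        finally show ?thesis by simp
      qed
      show "Ck_on k U (\<lambda>x. \<Sum>b\<in>Basis. (?f' x v \<bullet> b) *\<^sub>R ?g' (f x) b)"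
      proof (intro Ck_on_sum Ck_on_scaleR assms(1))
        fix b :: 'b
        have "linear (\<lambda>w. w \<bullet> b)" by (simp add: bounded_linear.linear bounded_linear_inner_left)
        from Ck_on_compose_linear[OF assms(1) this] show "Ck_on k U (\<lambda>x. ?f' x v \<bullet> b)"
          using Suc.prems(2) by simp
        show "Ck_on k U (\<lambda>x. ?g' (f x) b)"
          using Suc.prems Ck_on_Suc_imp[OF Suc.prems(2)] by (intro Suc.IH[of f "\<lambda>y. ?g' y b"]) auto
      qed
    qed
  qed
qed

lemma Ck_on_Pair:
  assumes "open U" "Ck_on k U f" "Ck_on k U g"
  shows "Ck_on k U (\<lambda>x. (f x, g x))"
proof -
  have "linear (\<lambda>y::'b. (y, 0::'c))" "linear (\<lambda>z::'c. (0::'b, z))"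
    by (auto intro!: linearI)
  from Ck_on_add[OF assms(1) Ck_on_compose_linear[OF assms(1) this(1) assms(2)]
     Ck_on_compose_linear[OF assms(1) this(2) assms(3)]]
  show ?thesis by simp
qed

text \<open>A product rule whose second factor is merely continuous: as \<open>q\<close> vanishes at
  \<open>y\<close>, the remainder \<open>q x *\<^sub>R (B x - B y)\<close> is of smaller order than
  \<open>x - y\<close>. It serves to differentiate a family of inverses of which only continuity is
  known so far.\<close>

lemma has_derivative_continuous_vanishing_product:
  fixes q :: "'a::euclidean_space \<Rightarrow> real" and B :: "'a \<Rightarrow> 'b::euclidean_space"
  assumes "(q has_derivative q') (at y)" "q y = 0" "isCont B y"
  shows "((\<lambda>x. q x *\<^sub>R B x) has_derivative (\<lambda>v. q' v *\<^sub>R B y)) (at y)"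
proof -
  have ql: "bounded_linear q'" using assms(1) by (rule has_derivative_bounded_linear)
  have "((\<lambda>x. q x *\<^sub>R B y) has_derivative (\<lambda>v. q' v *\<^sub>R B y)) (at y)"
    using assms(1) by (rule has_derivative_scaleR_left)
  moreover have "((\<lambda>x. q x *\<^sub>R (B x - B y)) has_derivative (\<lambda>v. 0)) (at y)"
  proof -
    obtain K where K: "K > 0" "\<And>v. norm (q' v) \<le> norm v * K" using bounded_linear.pos_bounded[OF ql] by blast
    have 1: "((\<lambda>x. norm (q x - q y - q' (x - y)) / norm (x - y)) \<longlongrightarrow> 0) (at y)"
      using assms(1) unfolding has_derivative_iff_norm by simp
    have 2: "((\<lambda>x. (norm (q x - q y - q' (x - y)) / norm (x - y) + K) * norm (B x - B y)) \<longlongrightarrow> (0 + K) * 0) (at y)"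
      using assms(3) by (intro tendsto_intros 1 tendsto_norm_zero) (simp add: isCont_def LIM_zero_iff)
    have "((\<lambda>x. norm (q x *\<^sub>R (B x - B y)) / norm (x - y)) \<longlongrightarrow> 0) (at y)"
    proof (rule tendsto_sandwich[OF _ _ tendsto_const])
      show "\<forall>\<^sub>F x in at y. 0 \<le> norm (q x *\<^sub>R (B x - B y)) / norm (x - y)" by simp
      show "\<forall>\<^sub>F x in at y. norm (q x *\<^sub>R (B x - B y)) / norm (x - y) \<le>
         (norm (q x - q y - q' (x - y)) / norm (x - y) + K) * norm (B x - B y)"
      proof (rule always_eventually, rule allI)
        fix x
        have "norm (q x) \<le> norm (q x - q y - q' (x - y)) + norm (x - y) * K"
          using K(2)[of "x - y"] assms(2) by (smt (verit) real_norm_def)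
        then have "norm (q x) * norm (B x - B y) / norm (x - y) \<le>
           (norm (q x - q y - q' (x - y)) + norm (x - y) * K) * norm (B x - B y) / norm (x - y)"
          by (intro divide_right_mono mult_right_mono) auto
        also have "\<dots> \<le> (norm (q x - q y - q' (x - y)) / norm (x - y) + K) * norm (B x - B y)"
          using K(1) by (cases "x = y") (auto simp: field_simps)
        finally show "norm (q x *\<^sub>R (B x - B y)) / norm (x - y) \<le>
         (norm (q x - q y - q' (x - y)) / norm (x - y) + K) * norm (B x - B y)" by simp
      qed
    qed (use 2 in simp)
    then show ?thesis unfolding has_derivative_iff_norm using assms(2) by simp
  qed
  ultimately have "((\<lambda>x. q x *\<^sub>R B y + q x *\<^sub>R (B x - B y)) has_derivative (\<lambda>v. q' v *\<^sub>R B y + 0)) (at y)"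
    by (rule has_derivative_add)
  then show ?thesis by (simp add: algebra_simps)
qed

text \<open>The derivative of \<open>y \<mapsto> A(y)\<^sup>-\<^sup>1 v\<close> in direction \<open>u\<close> is \<open>- A\<^sup>-\<^sup>1 (\<partial>\<^sub>u A) A\<^sup>-\<^sup>1 v\<close>, so that
  differentiability bootstraps.\<close>

lemma Ck_on_inverse_family:
  fixes A B :: "'a::euclidean_space \<Rightarrow> 'b::euclidean_space \<Rightarrow> 'b"
  assumes V: "open V" and lin: "\<And>y. y \<in> V \<Longrightarrow> linear (A y)" "\<And>y. y \<in> V \<Longrightarrow> linear (B y)"
    and inv: "\<And>y u. y \<in> V \<Longrightarrow> A y (B y u) = u" "\<And>y u. y \<in> V \<Longrightarrow> B y (A y u) = u"
    and bd: "\<And>y u. y \<in> V \<Longrightarrow> norm (B y u) \<le> c * norm u"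
    and A: "\<And>u. Ck_on k V (\<lambda>y. A y u)"
  shows "Ck_on k V (\<lambda>y. B y u)"
  using A
proof (induction k arbitrary: u)
  case 0
  \<comment> \<open>From \<open>B x u - B y u = B x (u - A x (B y u))\<close>: the uniform bound on
    \<open>B x\<close> reduces continuity of \<open>B\<close> to that of \<open>A\<close>.\<close>
  have "isCont (\<lambda>x. B x u) y" if y: "y \<in> V" for y
  proof -
    have "((\<lambda>x. A x (B y u)) \<longlongrightarrow> A y (B y u)) (at y)"
      using 0[of "B y u"] V y by (simp add: continuous_on_eq_continuous_at isCont_def)
    then have "((\<lambda>x. c * norm (u - A x (B y u))) \<longlongrightarrow> c * norm (u - u)) (at y)"
      by (intro tendsto_intros) (simp add: inv y)
    then have "((\<lambda>x. c * norm (u - A x (B y u))) \<longlongrightarrow> 0) (at y)" by simp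
    then have "((\<lambda>x. B x u - B y u) \<longlongrightarrow> 0) (at y)"
    proof (rule Lim_null_comparison[rotated])
      show "\<forall>\<^sub>F x in at y. norm (B x u - B y u) \<le> c * norm (u - A x (B y u))"
        using eventually_at_in_open'[OF V y]
      proof (rule eventually_mono)
        fix x assume x: "x \<in> V"
        have "B x u - B y u = B x (u - A x (B y u))" by (simp add: linear_diff[OF lin(2)[OF x]] inv x)
        then show "norm (B x u - B y u) \<le> c * norm (u - A x (B y u))" using bd[OF x] by metis
      qed
    qed
    then show ?thesis by (simp add: isCont_def LIM_zero_iff)
  qed
  then show ?case by (simp add: continuous_at_imp_continuous_on)
next
  case (Suc k)
  let ?D = "\<lambda>b y. frechet_derivative (\<lambda>x. A x b) (at y)"
  have IH: "Ck_on k V (\<lambda>y. B y u)" for u using Suc.IH Suc.prems Ck_on_Suc_imp by blast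
  have cont: "isCont (\<lambda>x. B x w) y" if "y \<in> V" for w y
    using Ck_on_imp_continuous_on[OF IH] V that continuous_on_eq_continuous_at by blast
  define f' where "f' = (\<lambda>y v. \<Sum>b\<in>Basis. (\<Sum>b'\<in>Basis. (- (B y u \<bullet> b')) * (?D b' y v \<bullet> b)) *\<^sub>R B y b)"
  show ?case
  proof (rule Ck_on_SucI[OF V, where f' = f'])
    fix y assume y: "y \<in> V"
    \<comment> \<open>\<open>B x u = B y u + B x (q x)\<close>, and \<open>q\<close> vanishes at
      \<open>y\<close>; so the product rule with a merely continuous factor applies to each
      \<open>(q x \<bullet> b) *\<^sub>R B x b\<close>.\<close>
    define q where "q = (\<lambda>x. u - (\<Sum>b'\<in>Basis. (B y u \<bullet> b') *\<^sub>R A x b'))"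
    have q: "q x = u - A x (B y u)" if "x \<in> V" for x
    proof -
      have "A x (B y u) = A x (\<Sum>b'\<in>Basis. (B y u \<bullet> b') *\<^sub>R b')" by (simp add: euclidean_representation)
      also have "\<dots> = (\<Sum>b'\<in>Basis. (B y u \<bullet> b') *\<^sub>R A x b')"
        by (simp add: linear_sum[OF lin(1)[OF that]] linear_cmul[OF lin(1)[OF that]])
      finally show ?thesis by (simp add: q_def)
    qed
    have d1: "((\<lambda>x. q x \<bullet> b) has_derivative (\<lambda>v. \<Sum>b'\<in>Basis. (- (B y u \<bullet> b')) * (?D b' y v \<bullet> b))) (at y)" for b
      unfolding q_def
      by (rule derivative_eq_intros Ck_on_SucD[OF Suc.prems y] refl)+
         (auto simp: inner_sum_left sum_negf)
    have "((\<lambda>x. B y u + (\<Sum>b\<in>Basis. (q x \<bullet> b) *\<^sub>R B x b)) has_derivative (\<lambda>v. 0 + f' y v)) (at y)"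
      unfolding f'_def
      by (intro has_derivative_add has_derivative_const has_derivative_sum
          has_derivative_continuous_vanishing_product d1 cont y) (simp add: q y inv)
    moreover have "B y u + (\<Sum>b\<in>Basis. (q x \<bullet> b) *\<^sub>R B x b) = B x u" if "x \<in> V" for x
    proof -
      have "(\<Sum>b\<in>Basis. (q x \<bullet> b) *\<^sub>R B x b) = B x (\<Sum>b\<in>Basis. (q x \<bullet> b) *\<^sub>R b)"
        by (simp add: linear_sum[OF lin(2)[OF that]] linear_cmul[OF lin(2)[OF that]])
      also have "\<dots> = B x (u - A x (B y u))" by (simp add: euclidean_representation q that)
      also have "\<dots> = B x u - B y u" by (simp add: linear_diff[OF lin(2)[OF that]] inv that)
      finally show ?thesis by simp
    qed
    ultimately show "((\<lambda>x. B x u) has_derivative f' y) (at y)"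
      using has_derivative_transform_within_open[OF _ V y] by fastforce
  next
    fix v
    have i: "Ck_on k V (\<lambda>x. h x \<bullet> b)" if "Ck_on k V h" for h :: "'a \<Rightarrow> 'b" and b
      using Ck_on_compose_linear[OF V _ that, of "\<lambda>w. w \<bullet> b"]
      by (simp add: bounded_linear.linear bounded_linear_inner_left)
    have m: "Ck_on k V (\<lambda>x. - h x * l x)" if "Ck_on k V h" "Ck_on k V l" for h l :: "'a \<Rightarrow> real"
      using Ck_on_scaleR[OF V Ck_on_compose_linear[OF V _ that(1), of uminus] that(2)]
      by (simp add: linear_uminus)
    have "Ck_on k V (\<lambda>y. ?D b' y v)" for b' using Suc.prems by simp
    then show "Ck_on k V (\<lambda>y. f' y v)"
      unfolding f'_def by (intro Ck_on_sum V Ck_on_scaleR IH m i)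
  qed
qed

text \<open>If the inverse \<open>g\<close> is of class C^k, then so is \<open>f' (g y)\<close>,
  hence also its inverse, which is the derivative of \<open>g\<close>. The C^1 theorem thus
  bootstraps.\<close>

theorem smooth_inverse_function:
  fixes f :: "'a::euclidean_space \<Rightarrow> 'a"
  assumes U: "open U" "x0 \<in> U" and f: "\<And>k. Ck_on k U f" and id: "(f has_derivative (\<lambda>v. v)) (at x0)"
  obtains U' V g where "open U'" "U' \<subseteq> U" "x0 \<in> U'" "open V" "f x0 \<in> V" "homeomorphism U' V f g"
    "\<And>k. Ck_on k V g"
proof -
  define f' where "f' = (\<lambda>x. Blinfun (frechet_derivative f (at x)))"
  have f1: "(f has_derivative frechet_derivative f (at x)) (at x)" if "x \<in> U" for x
    using Ck_on_SucD[OF f that] .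
  have app: "blinfun_apply (f' x) = frechet_derivative f (at x)" if "x \<in> U" for x
    unfolding f'_def using f1[OF that] by (simp add: bounded_linear_Blinfun_apply has_derivative_bounded_linear)
  have "continuous_on U (\<lambda>x. blinfun_apply (f' x) i)" for i
    by (rule continuous_on_eq[of U "\<lambda>x. frechet_derivative f (at x) i"]) (use f[of "Suc 0"] app in auto)
  then have cont: "continuous_on U f'" by (intro continuous_on_blinfun_componentwise)
  \<comment> \<open>At distance below 1/2 from the identity a linear map has an inverse of norm at
    most 2; this is the uniform bound \<open>c = 2\<close> used below.\<close>
  define U1 where "U1 = {x \<in> U. norm (f' x - id_blinfun) < 1/2}"
  have fx0: "f' x0 = id_blinfun"
  proof (rule blinfun_eqI)
    have "frechet_derivative f (at x0) = (\<lambda>v. v)" using frechet_derivative_at[OF id] by simp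
    then show "blinfun_apply (f' x0) i = blinfun_apply id_blinfun i" for i by (simp add: app U(2))
  qed
  have "open U1"
  proof -
    have "open (U \<inter> (\<lambda>x. norm (f' x - id_blinfun)) -` {..<1/2})"
      by (intro continuous_open_preimage continuous_intros cont U(1))
    moreover have "U1 = U \<inter> (\<lambda>x. norm (f' x - id_blinfun)) -` {..<1/2}" by (auto simp: U1_def)
    ultimately show ?thesis by simp
  qed
  have "x0 \<in> U1" using U(2) fx0 by (simp add: U1_def)
  obtain U' V g g' where *: "open U'" "U' \<subseteq> U1" "x0 \<in> U'" "open V" "f x0 \<in> V" "homeomorphism U' V f g"
    "\<And>y. y \<in> V \<Longrightarrow> (g has_derivative (g' y)) (at y)"
    "\<And>y. y \<in> V \<Longrightarrow> g' y = inv_into UNIV (blinfun_apply (f'(g y)))"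
    "\<And>y. y \<in> V \<Longrightarrow> bij (blinfun_apply (f'(g y)))"
  proof (rule inverse_function_theorem[of U1 f f' x0 id_blinfun])
    show "(f has_derivative blinfun_apply (f' x)) (at x)" if "x \<in> U1" for x
      using that f1 app by (auto simp: U1_def)
    show "continuous_on U1 f'" using cont by (rule continuous_on_subset) (auto simp: U1_def)
  qed (use \<open>open U1\<close> \<open>x0 \<in> U1\<close> fx0 in \<open>auto intro!: blinfun_eqI\<close>)
  have gU: "g y \<in> U1" "g y \<in> U" if "y \<in> V" for y
    using *(2,6) that by (auto simp: homeomorphism_def U1_def)
  have "Ck_on k V g" for k
  proof (induction k)
    case 0
    then show ?case using *(6) by (simp add: homeomorphism_def)
  next
    case (Suc k)
    show ?case
    proof (rule Ck_on_SucI[OF *(4)])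
      show "(g has_derivative g' y) (at y)" if "y \<in> V" for y using *(7) that .
      show "Ck_on k V (\<lambda>y. g' y u)" for u
      proof (rule Ck_on_inverse_family[OF *(4), where A = "\<lambda>y. blinfun_apply (f' (g y))" and c = 2])
        fix y u assume y: "y \<in> V"
        show "linear (blinfun_apply (f' (g y)))" by (simp add: linear_conv_bounded_linear blinfun.bounded_linear_right)
        show "linear (g' y)" using *(7)[OF y] has_derivative_linear by blast
        show "f' (g y) (g' y u) = u" "g' y (f' (g y) u) = u"
          using *(8,9)[OF y] by (simp_all add: bij_is_surj surj_f_inv_f bij_is_inj inv_f_f)
        have "norm (u - f' (g y) u) \<le> 1/2 * norm u" for u
        proof -
          have "norm ((f' (g y) - id_blinfun) u) \<le> norm (f' (g y) - id_blinfun) * norm u"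
            by (rule norm_blinfun)
          also have "\<dots> \<le> 1/2 * norm u" using gU(1)[OF y] by (intro mult_right_mono) (auto simp: U1_def)
          finally show ?thesis by (simp add: blinfun.diff_left norm_minus_commute)
        qed
        from this[of "g' y u"] \<open>f' (g y) (g' y u) = u\<close>
        show "norm (g' y u) \<le> 2 * norm u" using norm_triangle_ineq2[of "g' y u" u] by simp
      next
        fix u
        have "Ck_on k U (\<lambda>x. frechet_derivative f (at x) u)" using f[of "Suc k"] by simp
        then have "Ck_on k V (\<lambda>y. frechet_derivative f (at (g y)) u)"
          using Suc by (intro Ck_on_compose[OF *(4) U(1) _ Suc, of "\<lambda>x. frechet_derivative f (at x) u"]) (auto simp: gU)
        then show "Ck_on k V (\<lambda>y. f' (g y) u)"
          by (rule Ck_on_cong[OF *(4), rotated]) (simp add: app gU)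
      qed
    qed
  qed
  moreover have "U' \<subseteq> U" using *(2) by (auto simp: U1_def)
  ultimately show thesis using that * by blast
qed

section \<open>Smooth germs and derivatives along a linear subspace\<close>

definition smooth_germ :: "'a::euclidean_space set \<Rightarrow> ('a \<Rightarrow> 'b::euclidean_space) \<Rightarrow> 'a \<Rightarrow> bool" where
  "smooth_germ E f x \<longleftrightarrow> (\<exists>U g. open U \<and> x \<in> U \<and> (\<forall>k. Ck_on k U g) \<and> (\<forall>y\<in>E \<inter> U. g y = f y))"

lemma smooth_on_iff_germ: "smooth_on S f \<longleftrightarrow> (\<forall>x\<in>S. smooth_germ S f x)"
  by (simp add: smooth_on_def smooth_germ_def)

lemma smooth_germI:
  "open U \<Longrightarrow> x \<in> U \<Longrightarrow> (\<And>k. Ck_on k U g) \<Longrightarrow> (\<And>y. y \<in> E \<Longrightarrow> y \<in> U \<Longrightarrow> g y = f y) \<Longrightarrow> smooth_germ E f x"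
  unfolding smooth_germ_def by blast

lemma smooth_germE:
  assumes "smooth_germ E f x" "open W" "x \<in> W"
  obtains U g where "open U" "x \<in> U" "U \<subseteq> W" "\<And>k. Ck_on k U g" "\<And>y. y \<in> E \<Longrightarrow> y \<in> U \<Longrightarrow> g y = f y"
proof -
  obtain U g where *: "open U" "x \<in> U" "\<And>k. Ck_on k U g" "\<And>y. y \<in> E \<inter> U \<Longrightarrow> g y = f y"
    using assms(1) unfolding smooth_germ_def by blast
  show thesis
    by (rule that[of "U \<inter> W" g]) (use * assms(2,3) Ck_on_subset[of _ U g "U \<inter> W"] in auto)
qed

lemma smooth_germ_local:
  assumes "smooth_germ E f x" "open W" "x \<in> W" "\<And>y. y \<in> E' \<Longrightarrow> y \<in> W \<Longrightarrow> y \<in> E \<and> f y = g y"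
  shows "smooth_germ E' g x"
proof -
  obtain U h where *: "open U" "x \<in> U" "U \<subseteq> W" "\<And>k. Ck_on k U h" "\<And>y. y \<in> E \<Longrightarrow> y \<in> U \<Longrightarrow> h y = f y"
    using smooth_germE[OF assms(1-3)] by metis
  show ?thesis
    by (rule smooth_germI[of U _ h]) (use * assms(4) in \<open>auto simp del: Ck_on.simps\<close>)
qed

lemma smooth_germ_mono: "smooth_germ E f x \<Longrightarrow> E' \<subseteq> E \<Longrightarrow> smooth_germ E' f x"
  by (erule smooth_germ_local[OF _ open_UNIV UNIV_I]) auto

lemma smooth_germ_compose:
  assumes "smooth_germ E f x" "x \<in> E" "open W" "x \<in> W" "\<And>y. y \<in> E \<Longrightarrow> y \<in> W \<Longrightarrow> f y \<in> E'"
    and "smooth_germ E' h (f x)"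
  shows "smooth_germ E (\<lambda>y. h (f y)) x"
proof -
  obtain V h' where V: "open V" "f x \<in> V" "\<And>k. Ck_on k V h'" "\<And>y. y \<in> E' \<Longrightarrow> y \<in> V \<Longrightarrow> h' y = h y"
    using smooth_germE[OF assms(6) open_UNIV] by (metis UNIV_I)
  obtain U f' where U: "open U" "x \<in> U" "U \<subseteq> W" "\<And>k. Ck_on k U f'" "\<And>y. y \<in> E \<Longrightarrow> y \<in> U \<Longrightarrow> f' y = f y"
    using smooth_germE[OF assms(1,3,4)] by metis
  have o: "open (U \<inter> f' -` V)"
    using Ck_on_imp_continuous_on[OF U(4)] U(1) V(1) by (rule continuous_open_preimage)
  show ?thesis
  proof (rule smooth_germI[OF o, where g = "\<lambda>y. h' (f' y)"])
    show "x \<in> U \<inter> f' -` V" using U V assms(2) by auto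
    show "Ck_on k (U \<inter> f' -` V) (\<lambda>y. h' (f' y))" for k
      by (rule Ck_on_compose[OF o V(1) _ Ck_on_subset[OF U(4)] V(3)]) auto
    show "h' (f' y) = h (f y)" if "y \<in> E" "y \<in> U \<inter> f' -` V" for y
      using that U(3,5) V(4) assms(5) by auto
  qed
qed

lemma smooth_germ_Pair:
  assumes "smooth_germ E f x" "smooth_germ E g x"
  shows "smooth_germ E (\<lambda>y. (f y, g y)) x"
proof -
  obtain U f' where U: "open U" "x \<in> U" "\<And>k. Ck_on k U f'" "\<And>y. y \<in> E \<Longrightarrow> y \<in> U \<Longrightarrow> f' y = f y"
    using smooth_germE[OF assms(1) open_UNIV] by (metis UNIV_I)
  obtain V g' where V: "open V" "x \<in> V" "V \<subseteq> U" "\<And>k. Ck_on k V g'" "\<And>y. y \<in> E \<Longrightarrow> y \<in> V \<Longrightarrow> g' y = g y"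
    using smooth_germE[OF assms(2) U(1,2)] by metis
  show ?thesis
    by (rule smooth_germI[OF V(1,2), where g = "\<lambda>y. (f' y, g' y)"])
       (use U V in \<open>auto intro!: Ck_on_Pair intro: Ck_on_subset simp del: Ck_on.simps\<close>)
qed

lemma smooth_germ_linear: "linear L \<Longrightarrow> smooth_germ E L x"
  by (rule smooth_germI[OF open_UNIV, where g = L]) (auto intro: Ck_on_linear)

lemma smooth_germ_const: "smooth_germ E (\<lambda>y. c) x"
  by (rule smooth_germI[OF open_UNIV, where g = "\<lambda>y. c"]) (auto intro: Ck_on_const)

lemma smooth_germ_compose_linear:
  "smooth_germ E f x \<Longrightarrow> x \<in> E \<Longrightarrow> linear L \<Longrightarrow> smooth_germ E (\<lambda>y. L (f y)) x"
  by (rule smooth_germ_compose[where W = UNIV and E' = UNIV]) (auto intro: smooth_germ_linear)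

lemma smooth_germ_add:
  assumes "smooth_germ E f x" "smooth_germ E g x" "x \<in> E"
  shows "smooth_germ E (\<lambda>y. f y + g y) x"
proof -
  have "linear (\<lambda>p::'b \<times> 'b. fst p + snd p)"
    by (auto intro!: linearI simp: algebra_simps)
  from smooth_germ_compose_linear[OF smooth_germ_Pair[OF assms(1,2)] assms(3) this] show ?thesis by simp
qed

lemma smooth_germ_has_derivative:
  assumes "smooth_germ E f x" "x \<in> E"
  obtains D where "(f has_derivative D) (at x within E)"
proof -
  obtain U g where *: "open U" "x \<in> U" "\<And>k. Ck_on k U g" "\<And>y. y \<in> E \<Longrightarrow> y \<in> U \<Longrightarrow> g y = f y"
    using smooth_germE[OF assms(1) open_UNIV] by (metis UNIV_I)
  have "(g has_derivative frechet_derivative g (at x)) (at x within E)"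
    using Ck_on_SucD[OF *(3,2)] by (rule has_derivative_at_withinI)
  then have "(f has_derivative frechet_derivative g (at x)) (at x within E)"
  proof -
    assume d: "(g has_derivative frechet_derivative g (at x)) (at x within E)"
    obtain e where "e > 0" "ball x e \<subseteq> U" using *(1,2) open_contains_ball by blast
    then show ?thesis
      using has_derivative_transform_within[OF d, of e f] assms(2) *(4) by (auto simp: subset_iff dist_commute)
  qed
  then show thesis by (rule that)
qed

lemma smooth_germ_continuous:
  "smooth_germ E f x \<Longrightarrow> x \<in> E \<Longrightarrow> continuous (at x within E) f"
  by (meson has_derivative_continuous smooth_germ_has_derivative)

lemma subspace_projection:
  fixes E :: "'a::euclidean_space set"
  assumes "subspace E"
  obtains p :: "'a \<Rightarrow> 'a" where "linear p" "\<And>v. p v \<in> E" "\<And>v. v \<in> E \<Longrightarrow> p v = v"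
proof -
  obtain g :: "'a \<Rightarrow> 'a" where "range g \<subseteq> E" "linear g" "\<forall>v\<in>E. g (id v) = v"
    using linear_exists_left_inverse_on[OF linear_id assms] by auto
  then show thesis by (intro that[of g]) auto
qed

lemma has_derivative_within_local:
  assumes "(f has_derivative D) (at x within E)" "open W" "x \<in> W" "x \<in> E"
    and "\<And>y. y \<in> E \<Longrightarrow> y \<in> W \<Longrightarrow> f y = g y"
  shows "(g has_derivative D) (at x within E)"
proof -
  obtain e where "e > 0" "ball x e \<subseteq> W" using assms(2,3) open_contains_ball by blast
  then show ?thesis
    using has_derivative_transform_within[OF assms(1), of e g] assms(4,5) by (auto simp: subset_iff dist_commute)
qed

lemma has_derivative_along_subspace:
  assumes "subspace E" "x \<in> E" "(f has_derivative D) (at x within E)" "v \<in> E"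
  shows "((\<lambda>t. f (x + t *\<^sub>R v)) has_vector_derivative D v) (at 0)"
proof -
  have sub: "range (\<lambda>t. x + t *\<^sub>R v) \<subseteq> E"
    using assms by (auto intro!: subspace_add subspace_scale)
  have "((\<lambda>t. x + t *\<^sub>R v) has_derivative (\<lambda>t. t *\<^sub>R v)) (at (0::real))"
    by (auto intro!: derivative_eq_intros)
  moreover have "(f has_derivative D) (at (x + 0 *\<^sub>R v) within range (\<lambda>t. x + t *\<^sub>R v))"
    using has_derivative_subset[OF assms(3) sub] by simp
  ultimately have "(f \<circ> (\<lambda>t. x + t *\<^sub>R v) has_derivative D \<circ> (\<lambda>t. t *\<^sub>R v)) (at 0)"
    by (rule diff_chain_within)
  moreover have "linear D" using assms(3) by (rule has_derivative_linear)
  ultimately show ?thesis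
    by (simp add: has_vector_derivative_def o_def linear_cmul)
qed

text \<open>Lines inside \<open>E\<close> test a derivative within \<open>E\<close> only in
  directions of \<open>E\<close>; elsewhere its values are arbitrary. Derivatives in charts are
  therefore compared on model vectors throughout.\<close>

lemma has_derivative_unique_subspace:
  assumes "subspace E" "x \<in> E" "(f has_derivative D) (at x within E)" "(f has_derivative D') (at x within E)" "v \<in> E"
  shows "D v = D' v"
  using has_derivative_along_subspace[OF assms(1,2,3,5)] has_derivative_along_subspace[OF assms(1,2,4,5)]
  by (rule vector_derivative_unique_at)

lemma has_derivative_chain_subspace:
  assumes "(f has_derivative D) (at x within E)" "x \<in> E" "open W" "x \<in> W" "\<And>y. y \<in> E \<Longrightarrow> y \<in> W \<Longrightarrow> f y \<in> E'"
    and "(h has_derivative D') (at (f x) within E')"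
  shows "((\<lambda>y. h (f y)) has_derivative (\<lambda>v. D' (D v))) (at x within E)"
proof -
  have a: "at x within (E \<inter> W) = at x within E"
    using assms(3,4) by (intro at_within_nhd[of x W]) auto
  have "f ` (E \<inter> W) \<subseteq> E'" using assms(5) by auto
  from has_derivative_subset[OF assms(6) this]
  have "(h has_derivative D') (at (f x) within f ` (E \<inter> W))" .
  moreover have "(f has_derivative D) (at x within (E \<inter> W))" using assms(1) a by simp
  ultimately have "(h \<circ> f has_derivative D' \<circ> D) (at x within (E \<inter> W))"
    by (intro diff_chain_within)
  then show ?thesis using a by (simp add: o_def)
qed

text \<open>Composition with a linear retraction onto \<open>E'\<close> leaves \<open>f\<close>
  unchanged near \<open>x\<close> on \<open>E\<close>, so by uniqueness it leaves \<open>D v\<close>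
  unchanged.\<close>

lemma has_derivative_in_subspace:
  fixes E' :: "'b::euclidean_space set"
  assumes "(f has_derivative D) (at x within E)" "subspace E" "x \<in> E" "open W" "x \<in> W"
    and "\<And>y. y \<in> E \<Longrightarrow> y \<in> W \<Longrightarrow> f y \<in> E'" "subspace E'" "v \<in> E"
  shows "D v \<in> E'"
proof -
  obtain p where p: "linear p" "\<And>v. p v \<in> E'" "\<And>v. v \<in> E' \<Longrightarrow> p v = v"
    using subspace_projection[OF assms(7)] by blast
  have "((\<lambda>y. p (f y)) has_derivative (\<lambda>v. p (D v))) (at x within E)"
    using assms(1) p(1) by (simp add: bounded_linear.has_derivative linear_conv_bounded_linear)
  then have "(f has_derivative (\<lambda>v. p (D v))) (at x within E)"
    by (rule has_derivative_within_local[OF _ assms(4,5,3)]) (use assms(6) p(3) in auto)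
  from has_derivative_unique_subspace[OF assms(2,3,1) this assms(8)] show ?thesis using p(2) by metis
qed

text \<open>The inverse function theorem works in the ambient space, so \<open>f\<close> is first
  extended off \<open>E\<close> by the identity in the directions complementary to \<open>E\<close>.
  The inverse found there then has to be shown to preserve \<open>E\<close>.\<close>

theorem smooth_germ_inverse:
  fixes f :: "'a::euclidean_space \<Rightarrow> 'a"
  assumes E: "subspace E" "x0 \<in> E" and f: "smooth_germ E f x0" and W: "open W" "x0 \<in> W"
    and fE: "\<And>x. x \<in> E \<Longrightarrow> x \<in> W \<Longrightarrow> f x \<in> E"
    and D: "(f has_derivative D) (at x0 within E)" "\<And>v. v \<in> E \<Longrightarrow> D v = v"
  obtains U V g where "open U" "open V" "x0 \<in> U" "U \<subseteq> W" "f x0 \<in> V"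
    "f ` (E \<inter> U) = E \<inter> V" "g ` (E \<inter> V) = E \<inter> U"
    "\<And>x. x \<in> E \<Longrightarrow> x \<in> U \<Longrightarrow> g (f x) = x" "\<And>y. y \<in> E \<Longrightarrow> y \<in> V \<Longrightarrow> f (g y) = y"
    "\<And>x. x \<in> E \<Longrightarrow> x \<in> U \<Longrightarrow> smooth_germ E f x"
    "\<And>y. y \<in> E \<Longrightarrow> y \<in> V \<Longrightarrow> smooth_germ E g y"
proof -
  obtain p where p: "linear p" "\<And>v. p v \<in> E" "\<And>v. v \<in> E \<Longrightarrow> p v = v"
    using subspace_projection[OF E(1)] by blast
  obtain W1 F where F: "open W1" "x0 \<in> W1" "W1 \<subseteq> W" "\<And>k. Ck_on k W1 F" "\<And>y. y \<in> E \<Longrightarrow> y \<in> W1 \<Longrightarrow> F y = f y"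
    using smooth_germE[OF f W] by metis
  define W2 where "W2 = W1 \<inter> p -` W1"
  have pc: "continuous_on UNIV p" using p(1) by (simp add: linear_continuous_on linear_conv_bounded_linear)
  have W2: "open W2" "x0 \<in> W2"
    using open_vimage[OF F(1) pc] F(1,2) p(3) E(2) by (auto simp: W2_def)
  \<comment> \<open>With \<open>p\<close> the retraction onto \<open>E\<close>, this agrees with
    \<open>f\<close> on \<open>E\<close> near \<open>x0\<close>, and its derivative at
    \<open>x0\<close> is \<open>p v + (v - p v) = v\<close>.\<close>
  define f' where "f' = (\<lambda>x. F (p x) + (x + - p x))"
  have Ckp: "Ck_on k W2 p" for k using Ck_on_linear[OF p(1)] by (rule Ck_on_subset) auto
  have Ckid: "Ck_on k W2 (\<lambda>x. x)" for k using Ck_on_subset[OF Ck_on_linear[OF linear_id] subset_UNIV, of k W2] by (simp add: id_def del: Ck_on.simps)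
  have f'C: "Ck_on k W2 f'" for k
    unfolding f'_def
    by (intro Ck_on_add W2 Ckid Ck_on_compose[OF W2(1) F(1) _ Ckp F(4)] Ck_on_compose_linear[OF W2(1) _ Ckp])
       (auto simp: W2_def linear_uminus)
  have f'x0: "f' x0 = f x0" using F(5) E(2) F(2) p(3) by (simp add: f'_def)
  let ?D = "frechet_derivative F (at x0)"
  have dF: "(F has_derivative ?D) (at x0)" using Ck_on_SucD[OF F(4,2)] .
  have "(f has_derivative ?D) (at x0 within E)"
    by (rule has_derivative_within_local[OF has_derivative_at_withinI[OF dF] F(1,2) E(2)]) (use F(5) in auto)
  then have DE: "?D v = v" if "v \<in> E" for v
    using has_derivative_unique_subspace[OF E D(1)] D(2) that by metis
  have dp: "(p has_derivative p) (at x0)" using p(1) by (rule linear_imp_has_derivative)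
  have "((\<lambda>x. F (p x)) has_derivative (\<lambda>v. ?D (p v))) (at x0)"
    using diff_chain_at[OF dp, of F ?D] dF p(3)[OF E(2)] by (simp add: o_def)
  then have "(f' has_derivative (\<lambda>v. ?D (p v) + (v + - p v))) (at x0)"
    unfolding f'_def by (intro derivative_intros dp)
  then have "(f' has_derivative (\<lambda>v. v)) (at x0)" by (simp add: DE p(2))
  from smooth_inverse_function[OF W2 f'C this]
  obtain U V g where g: "open U" "U \<subseteq> W2" "x0 \<in> U" "open V" "f' x0 \<in> V" "homeomorphism U V f' g"
    "\<And>k. Ck_on k V g" by metis
  have 1: "f' x = f x" "f x \<in> E" if "x \<in> E" "x \<in> U" for x
    using that g(2) F(3,5) fE p(3) by (auto simp: f'_def W2_def)
  \<comment> \<open>If \<open>f' x\<close> and \<open>F (p x)\<close> lie in \<open>E\<close>, then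
    so does their difference \<open>x - p x\<close>, and with it \<open>x\<close>.\<close>
  have 2: "g y \<in> E" if "y \<in> E" "y \<in> V" for y
  proof -
    let ?x = "g y"
    have x: "?x \<in> U" "f' ?x = y" using g(6) that by (auto simp: homeomorphism_def)
    then have "p ?x \<in> W1" using g(2) by (auto simp: W2_def)
    then have "F (p ?x) \<in> E" using F(3,5) fE p(2) by auto
    moreover have "F (p ?x) + (?x + - p ?x) \<in> E" using x(2) that by (simp add: f'_def)
    ultimately have "?x - p ?x \<in> E" using subspace_diff[OF E(1), of "F (p ?x) + (?x + - p ?x)" "F (p ?x)"] by simp
    then show ?thesis using subspace_add[OF E(1) p(2)[of ?x]] by fastforce
  qed
  show thesis
  proof (rule that[of U V g])
    have gf: "g (f' x) = x" "f' x \<in> V" if "x \<in> U" for x using g(6) that by (auto simp: homeomorphism_def)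
    have fg: "f' (g y) = y" "g y \<in> U" if "y \<in> V" for y using g(6) that by (auto simp: homeomorphism_def)
    show "f ` (E \<inter> U) = E \<inter> V"
    proof (intro equalityI subsetI)
      fix y assume "y \<in> f ` (E \<inter> U)" then obtain x where "y = f x" "x \<in> E" "x \<in> U" by auto
      then show "y \<in> E \<inter> V" using 1[of x] gf[of x] by auto
    next
      fix y assume "y \<in> E \<inter> V" then show "y \<in> f ` (E \<inter> U)" using 1 2 fg by (metis IntD1 IntD2 IntI image_eqI)
    qed
    show "g ` (E \<inter> V) = E \<inter> U"
    proof (intro equalityI subsetI)
      fix x assume "x \<in> g ` (E \<inter> V)" then show "x \<in> E \<inter> U" using 2 fg by auto
    next
      fix x assume "x \<in> E \<inter> U" then show "x \<in> g ` (E \<inter> V)" using 1 gf by (metis IntD1 IntD2 IntI image_eqI)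
    qed
    show "g (f x) = x" if "x \<in> E" "x \<in> U" for x using 1 gf that by metis
    show "f (g y) = y" if "y \<in> E" "y \<in> V" for y using 1 2 fg that by metis
    show "smooth_germ E f x" if "x \<in> E" "x \<in> U" for x
      by (rule smooth_germI[OF F(1) _ F(4)]) (use that g(2) F(5) in \<open>auto simp: W2_def\<close>)
    show "smooth_germ E g y" if "y \<in> E" "y \<in> V" for y
      by (rule smooth_germI[OF g(4) _ g(7)]) (use that in auto)
  qed (use g f'x0 F(3) in \<open>auto simp: W2_def\<close>)
qed

section \<open>Linearisation at a fixed point\<close>

lemma C1_lipschitz_on_cball:
  fixes h :: "'a::euclidean_space \<Rightarrow> 'b::euclidean_space"
  assumes "Ck_on 1 U h" "cball 0 R \<subseteq> U"
  obtains c where "c \<ge> 0" "\<And>x y. x \<in> cball 0 R \<Longrightarrow> y \<in> cball 0 R \<Longrightarrow> norm (h x - h y) \<le> c * norm (x - y)"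
proof -
  let ?h = "\<lambda>x. frechet_derivative h (at x)"
  have d: "(h has_derivative ?h x) (at x)" if "x \<in> U" for x using Ck_on_SucD[of 0 U h x] assms(1) that by simp
  have "\<exists>B. \<forall>x\<in>cball 0 R. norm (?h x b) \<le> B" for b
  proof -
    have "continuous_on (cball 0 R) (\<lambda>x. ?h x b)"
      using assms by (auto intro: continuous_on_subset)
    then have "compact ((\<lambda>x. ?h x b) ` cball 0 R)" by (intro compact_continuous_image compact_cball)
    then have "bounded ((\<lambda>x. ?h x b) ` cball 0 R)" by (rule compact_imp_bounded)
    then obtain B where "\<And>y. y \<in> (\<lambda>x. ?h x b) ` cball 0 R \<Longrightarrow> norm y \<le> B" unfolding bounded_iff by blast
    then show ?thesis by (intro exI[of _ B] ballI) simp
  qed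
  then obtain B where B: "\<And>b x. x \<in> cball 0 R \<Longrightarrow> norm (?h x b) \<le> B b" by metis
  define c where "c = (\<Sum>b\<in>Basis. \<bar>B b\<bar>)"
  have on: "onorm (?h x) \<le> c" if x: "x \<in> cball 0 R" for x
  proof (rule onorm_le)
    fix v :: 'a
    have l: "linear (?h x)" using d[of x] x assms(2) has_derivative_linear by blast
    have "norm (?h x v) = norm (\<Sum>b\<in>Basis. (v \<bullet> b) *\<^sub>R ?h x b)"
      by (metis (no_types, lifting) euclidean_representation linear_cmul[OF l] linear_sum[OF l] sum.cong)
    also have "\<dots> \<le> (\<Sum>b\<in>Basis. \<bar>v \<bullet> b\<bar> * norm (?h x b))"
      by (rule order_trans[OF norm_sum]) simp
    also have "\<dots> \<le> (\<Sum>b\<in>Basis. norm v * \<bar>B b\<bar>)"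
      by (intro sum_mono mult_mono) (use B[OF x] Basis_le_norm order_trans abs_ge_self in \<open>auto, blast\<close>)
    also have "\<dots> = c * norm v" by (simp add: c_def sum_distrib_left mult.commute)
    finally show "norm (?h x v) \<le> c * norm v" .
  qed
  show thesis
  proof (rule that[of c])
    show "norm (h x - h y) \<le> c * norm (x - y)" if "x \<in> cball 0 R" "y \<in> cball 0 R" for x y
    proof (rule differentiable_bound[OF convex_cball[of 0 R] _ on])
      show "(h has_derivative ?h z) (at z within cball 0 R)" if "z \<in> cball 0 R" for z
        using has_derivative_at_withinI[OF d[of z]] subsetD[OF assms(2) that] by simp
    qed (use that in auto)
  qed (simp add: c_def sum_nonneg)
qed

lemma C2_derivative_lipschitz_on_cball:
  fixes g :: "'a::euclidean_space \<Rightarrow> 'b::euclidean_space"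
  assumes "Ck_on 2 U g" "cball 0 R \<subseteq> U"
  obtains c where "c \<ge> 0" "\<And>x y. x \<in> cball 0 R \<Longrightarrow> y \<in> cball 0 R \<Longrightarrow>
    onorm (\<lambda>v. frechet_derivative g (at x) v - frechet_derivative g (at y) v) \<le> c * norm (x - y)"
proof -
  let ?h = "\<lambda>b x. frechet_derivative g (at x) b"
  have g2: "Ck_on (Suc 1) U g" using assms(1) by (simp add: numeral_2_eq_2)
  then have "Ck_on 1 U (?h b)" for b by simp
  then have "\<exists>c\<ge>0. \<forall>x\<in>cball 0 R. \<forall>y\<in>cball 0 R. norm (?h b x - ?h b y) \<le> c * norm (x - y)" for b
    using C1_lipschitz_on_cball[OF _ assms(2), of "?h b"] by metis
  then obtain C where C: "\<And>b. C b \<ge> 0"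
    "\<And>b x y. x \<in> cball 0 R \<Longrightarrow> y \<in> cball 0 R \<Longrightarrow> norm (?h b x - ?h b y) \<le> C b * norm (x - y)" by metis
  show thesis
  proof (rule that[of "\<Sum>b\<in>Basis. C b"])
    fix x y :: 'a assume xy: "x \<in> cball 0 R" "y \<in> cball 0 R"
    let ?D = "\<lambda>v. frechet_derivative g (at x) v - frechet_derivative g (at y) v"
    show "onorm ?D \<le> (\<Sum>b\<in>Basis. C b) * norm (x - y)"
    proof (rule onorm_le)
      fix v :: 'a
      have "linear (frechet_derivative g (at x))" "linear (frechet_derivative g (at y))"
        using Ck_on_SucD[OF g2] xy assms(2) has_derivative_linear by blast+
      then have l: "linear ?D" by (rule linear_compose_sub)
      have "norm (?D v) = norm (\<Sum>b\<in>Basis. (v \<bullet> b) *\<^sub>R ?D b)"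
        using linear_sum[OF l, of "\<lambda>b. (v \<bullet> b) *\<^sub>R b" Basis] linear_cmul[OF l]
        by (simp add: euclidean_representation)
      also have "\<dots> \<le> (\<Sum>b\<in>Basis. \<bar>v \<bullet> b\<bar> * norm (?D b))"
        by (rule order_trans[OF norm_sum]) simp
      also have "\<dots> \<le> (\<Sum>b\<in>Basis. norm v * (C b * norm (x - y)))"
        by (intro sum_mono mult_mono C xy) (auto simp: Basis_le_norm)
      also have "\<dots> = (\<Sum>b\<in>Basis. C b) * norm (x - y) * norm v"
        by (simp add: sum_distrib_left sum_distrib_right mult_ac)
      finally show "norm (?D v) \<le> (\<Sum>b\<in>Basis. C b) * norm (x - y) * norm v" .
    qed
  qed (simp add: C sum_nonneg)
qed

text \<open>A quantitative substitute for \<open>C\<^sup>2\<close> near 0 that survives pointwise limits: the deviation from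
  the linear part has small Lipschitz constant near 0, and second differences are quadratic.\<close>

definition tame_on :: "'a::euclidean_space set \<Rightarrow> ('a \<Rightarrow> 'b::euclidean_space) \<Rightarrow> ('a \<Rightarrow> 'b) \<Rightarrow> real \<Rightarrow> real \<Rightarrow> bool" where
  "tame_on E f L R c \<longleftrightarrow>
     (\<forall>s x y. x \<in> E \<longrightarrow> y \<in> E \<longrightarrow> norm x \<le> s \<longrightarrow> norm y \<le> s \<longrightarrow> s \<le> R \<longrightarrow>
        norm (f x - f y - L (x - y)) \<le> c * s * norm (x - y)) \<and>
     (\<forall>x d. x \<in> E \<longrightarrow> d \<in> E \<longrightarrow> norm x \<le> R \<longrightarrow> norm (x + d) \<le> R \<longrightarrow> norm (x - d) \<le> R \<longrightarrow>
        norm (f (x + d) + f (x - d) - 2 *\<^sub>R f x) \<le> c * (norm d)\<^sup>2)"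

definition tame :: "'a::euclidean_space set \<Rightarrow> ('a \<Rightarrow> 'b::euclidean_space) \<Rightarrow> ('a \<Rightarrow> 'b) \<Rightarrow> bool" where
  "tame E f L \<longleftrightarrow> f 0 = 0 \<and> linear L \<and> (\<exists>R>0. \<exists>c\<ge>0. tame_on E f L R c)"

lemma tame_onD1:
  "tame_on E f L R c \<Longrightarrow> x \<in> E \<Longrightarrow> y \<in> E \<Longrightarrow> norm x \<le> s \<Longrightarrow> norm y \<le> s \<Longrightarrow> s \<le> R \<Longrightarrow>
    norm (f x - f y - L (x - y)) \<le> c * s * norm (x - y)"
  unfolding tame_on_def by blast

lemma tame_onD2:
  "tame_on E f L R c \<Longrightarrow> x \<in> E \<Longrightarrow> d \<in> E \<Longrightarrow> norm x \<le> R \<Longrightarrow> norm (x + d) \<le> R \<Longrightarrow> norm (x - d) \<le> R \<Longrightarrow>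
    norm (f (x + d) + f (x - d) - 2 *\<^sub>R f x) \<le> c * (norm d)\<^sup>2"
  unfolding tame_on_def by blast

lemma tame_on_mono: "tame_on E f L R c \<Longrightarrow> R' \<le> R \<Longrightarrow> tame_on E f L R' c"
  unfolding tame_on_def by (meson order_trans)

text \<open>The constant \<open>c\<close> survives a decrease of \<open>R\<close>, so
  \<open>c * R\<close> can be made as small as desired; this is what turns \<open>f - L\<close> into
  a contraction or keeps a ball invariant.\<close>

lemma tameE:
  assumes "tame E f L" "K > 0"
  obtains R c where "R > 0" "R \<le> K" "c \<ge> 0" "tame_on E f L R c" "c * R \<le> K"
proof -
  obtain R c where *: "R > 0" "c \<ge> 0" "tame_on E f L R c" using assms unfolding tame_def by blast
  define R' where "R' = min (min R K) (K / (c + 1))"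
  have "c * R' \<le> c * (K / (c + 1))" using *(2) by (intro mult_left_mono) (auto simp: R'_def)
  also have "\<dots> \<le> K" using *(2) assms(2) by (simp add: field_simps)
  finally have "c * R' \<le> K" .
  then show thesis
    by (intro that[of R' c]) (use * assms(2) tame_on_mono[OF *(3), of R'] in \<open>auto simp: R'_def\<close>)
qed

text \<open>The derivative of a local extension \<open>g\<close> is Lipschitz near 0. The mean value
  inequality for \<open>g\<close> minus its derivative at a point \<open>x\<close> gives the first
  estimate when \<open>x = 0\<close>; at general \<open>x\<close> it is applied to the steps
  \<open>d\<close> and \<open>- d\<close>, whose linear parts cancel, which accounts for the factor
  2.\<close>

lemma smooth_imp_tame:
  fixes f :: "'a::euclidean_space \<Rightarrow> 'b::euclidean_space"
  assumes E: "subspace E" and f: "smooth_germ E f 0" "f 0 = 0" and D: "(f has_derivative L) (at 0 within E)"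
  shows "tame E f L"
proof -
  have 0: "0 \<in> E" using E by (rule subspace_0)
  obtain U g where g: "open U" "0 \<in> U" "\<And>k. Ck_on k U g" "\<And>y. y \<in> E \<Longrightarrow> y \<in> U \<Longrightarrow> g y = f y"
    using smooth_germE[OF f(1) open_UNIV] by (metis UNIV_I)
  obtain R where R: "R > 0" "cball 0 R \<subseteq> U" using g(1,2) open_contains_cball by blast
  let ?D = "\<lambda>x. frechet_derivative g (at x)"
  have d: "(g has_derivative ?D x) (at x)" if "x \<in> U" for x using Ck_on_SucD[OF g(3) that] .
  have bl: "bounded_linear (?D x)" if "x \<in> U" for x using d[OF that] by (rule has_derivative_bounded_linear)
  have L: "?D 0 v = L v" if "v \<in> E" for v
  proof (rule has_derivative_unique_subspace[OF E 0 _ D that])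
    show "(f has_derivative ?D 0) (at 0 within E)"
      by (rule has_derivative_within_local[OF has_derivative_at_withinI[OF d[OF g(2)]] g(1,2) 0]) (use g(4) in auto)
  qed
  obtain c where c: "c \<ge> 0" "\<And>x y. x \<in> cball 0 R \<Longrightarrow> y \<in> cball 0 R \<Longrightarrow>
    onorm (\<lambda>v. ?D x v - ?D y v) \<le> c * norm (x - y)"
    using C2_derivative_lipschitz_on_cball[OF g(3) R(2)] by metis
  have key: "norm (g y - g z - ?D x (y - z)) \<le> c * s * norm (y - z)"
    if "x \<in> cball 0 R" "y \<in> cball 0 R" "z \<in> cball 0 R" "norm (y - x) \<le> s" "norm (z - x) \<le> s" for x y z s
  proof -
    have xU: "x \<in> U" using that R by auto
    have "norm ((g y - ?D x y) - (g z - ?D x z)) \<le> (c * s) * norm (y - z)"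
    proof (rule differentiable_bound[where S = "cball 0 R \<inter> cball x s"])
      show "convex (cball 0 R \<inter> cball x s)" by (intro convex_Int convex_cball)
      fix w assume w: "w \<in> cball 0 R \<inter> cball x s"
      show "((\<lambda>w. g w - ?D x w) has_derivative (\<lambda>v. ?D w v - ?D x v)) (at w within cball 0 R \<inter> cball x s)"
        using w R(2)
        by (intro has_derivative_diff has_derivative_at_withinI[OF d] bounded_linear_imp_has_derivative bl[OF xU]) auto
      have "onorm (\<lambda>v. ?D w v - ?D x v) \<le> c * norm (w - x)" using c(2) w that by blast
      also have "\<dots> \<le> c * s" using w c(1) by (intro mult_left_mono) (auto simp: dist_norm norm_minus_commute)
      finally show "onorm (\<lambda>v. ?D w v - ?D x v) \<le> c * s" .
    qed (use that in \<open>auto simp: dist_norm norm_minus_commute\<close>)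
    then show ?thesis using bl[OF xU] by (simp add: linear_diff linear_conv_bounded_linear algebra_simps)
  qed
  have "tame_on E f L R (2 * c)"
    unfolding tame_on_def
  proof (intro conjI allI impI)
    fix s x y assume *: "x \<in> E" "y \<in> E" "norm x \<le> s" "norm y \<le> s" "s \<le> R"
    then have "x \<in> U" "y \<in> U" using R(2) by (auto simp: subset_iff)
    moreover have "norm (g x - g y - ?D 0 (x - y)) \<le> c * s * norm (x - y)" using * R(1) by (intro key) auto
    ultimately have "norm (f x - f y - L (x - y)) \<le> c * s * norm (x - y)"
      using * g(4) L[OF subspace_diff[OF E]] by auto
    also have "\<dots> \<le> 2 * c * s * norm (x - y)"
      using c(1) order_trans[OF norm_ge_zero *(3)] by (intro mult_right_mono) auto
    finally show "norm (f x - f y - L (x - y)) \<le> 2 * c * s * norm (x - y)" .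
  next
    fix x d assume *: "x \<in> E" "d \<in> E" "norm x \<le> R" "norm (x + d) \<le> R" "norm (x - d) \<le> R"
    then have U: "x \<in> U" "x + d \<in> U" "x - d \<in> U" using R(2) by (auto simp: subset_iff)
    have E': "x + d \<in> E" "x - d \<in> E" using * E by (auto intro: subspace_add subspace_diff)
    have "norm (g (x + d) - g x - ?D x ((x + d) - x)) \<le> c * norm d * norm ((x + d) - x)"
      using * by (intro key) auto
    moreover have "norm (g (x - d) - g x - ?D x ((x - d) - x)) \<le> c * norm d * norm ((x - d) - x)"
      using * by (intro key) auto
    moreover have "?D x ((x - d) - x) = - ?D x d"
      using bl[OF U(1)] by (simp add: linear_neg linear_conv_bounded_linear)
    ultimately have "norm ((g (x + d) - g x - ?D x d) + (g (x - d) - g x + ?D x d)) \<le> c * norm d * norm d + c * norm d * norm d"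
      by (intro norm_triangle_mono) auto
    then show "norm (f (x + d) + f (x - d) - 2 *\<^sub>R f x) \<le> 2 * c * (norm d)\<^sup>2"
      using g(4)[OF *(1) U(1)] g(4)[OF E'(1) U(2)] g(4)[OF E'(2) U(3)]
      by (simp add: power2_eq_square algebra_simps scaleR_2)
  qed
  then show ?thesis
    unfolding tame_def using f(2) has_derivative_linear[OF D] R(1) c(1) by (intro conjI exI[of _ R] exI[of _ "2 * c"]) auto
qed

lemma tame_linear: "linear L \<Longrightarrow> tame E L L"
  unfolding tame_def tame_on_def
  by (intro conjI exI[of _ "1::real"] exI[of _ "0::real"]) (auto simp: linear_diff linear_add linear_0 scaleR_2)

lemma tame_lipschitz:
  assumes "tame E f L" "subspace E"
  obtains R K where "R > 0" "K \<ge> 1" "\<And>x y. x \<in> E \<Longrightarrow> y \<in> E \<Longrightarrow> norm x \<le> R \<Longrightarrow> norm y \<le> R \<Longrightarrow>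
      norm (f x - f y) \<le> K * norm (x - y)"
    "\<And>x. x \<in> E \<Longrightarrow> norm x \<le> R \<Longrightarrow> norm (f x) \<le> K * norm x"
proof -
  obtain R c where *: "R > 0" "R \<le> 1" "c \<ge> 0" "tame_on E f L R c" "c * R \<le> 1" using tameE[OF assms(1), of 1] by auto
  have L: "bounded_linear L" using assms by (simp add: tame_def linear_conv_bounded_linear)
  have 1: "norm (f x - f y) \<le> (onorm L + 1) * norm (x - y)" if "x \<in> E" "y \<in> E" "norm x \<le> R" "norm y \<le> R" for x y
  proof -
    have "norm (f x - f y) \<le> norm (f x - f y - L (x - y)) + norm (L (x - y))" by (metis diff_add_cancel norm_triangle_ineq)
    also have "\<dots> \<le> c * R * norm (x - y) + onorm L * norm (x - y)"
      using tame_onD1[OF *(4) that] onorm[OF L] by (intro add_mono) auto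
    also have "\<dots> \<le> 1 * norm (x - y) + onorm L * norm (x - y)" using *(5) by (intro add_mono mult_right_mono) auto
    finally show ?thesis by (simp add: algebra_simps)
  qed
  show thesis
  proof (rule that[OF *(1)])
    show "norm (f x - f y) \<le> (onorm L + 1) * norm (x - y)" if "x \<in> E" "y \<in> E" "norm x \<le> R" "norm y \<le> R" for x y
      using 1[OF that] .
    show "norm (f x) \<le> (onorm L + 1) * norm x" if "x \<in> E" "norm x \<le> R" for x
      using 1[OF that(1) subspace_0[OF assms(2)] that(2)] assms(1) *(1) by (simp add: tame_def)
  qed (simp add: onorm_pos_le[OF L])
qed

lemma tame_Pair:
  assumes "tame E f L" "tame E g M"
  shows "tame E (\<lambda>x. (f x, g x)) (\<lambda>x. (L x, M x))"
proof -
  obtain R c where f: "R > 0" "R \<le> 1" "c \<ge> 0" "tame_on E f L R c" using tameE[OF assms(1), of 1] by (metis zero_less_one)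
  obtain R' c' where g: "R' > 0" "R' \<le> R" "c' \<ge> 0" "tame_on E g M R' c'" using tameE[OF assms(2) f(1)] by metis
  note f' = tame_on_mono[OF f(4) g(2)]
  have "tame_on E (\<lambda>x. (f x, g x)) (\<lambda>x. (L x, M x)) R' (c + c')"
    unfolding tame_on_def
  proof (intro conjI allI impI)
    fix s x y assume *: "x \<in> E" "y \<in> E" "norm x \<le> s" "norm y \<le> s" "s \<le> R'"
    show "norm ((f x, g x) - (f y, g y) - (L (x - y), M (x - y))) \<le> (c + c') * s * norm (x - y)"
      using tame_onD1[OF f' *] tame_onD1[OF g(4) *]
        norm_Pair_le[of "f x - f y - L (x - y)" "g x - g y - M (x - y)"] by (simp add: algebra_simps)
  next
    fix x d assume *: "x \<in> E" "d \<in> E" "norm x \<le> R'" "norm (x + d) \<le> R'" "norm (x - d) \<le> R'"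
    show "norm ((f (x + d), g (x + d)) + (f (x - d), g (x - d)) - 2 *\<^sub>R (f x, g x)) \<le> (c + c') * (norm d)\<^sup>2"
      using tame_onD2[OF f' *] tame_onD2[OF g(4) *]
        norm_Pair_le[of "f (x + d) + f (x - d) - 2 *\<^sub>R f x" "g (x + d) + g (x - d) - 2 *\<^sub>R g x"] by (simp add: algebra_simps)
  qed
  moreover have "linear (\<lambda>x. (L x, M x))" using assms unfolding tame_def by (auto intro!: linearI simp: linear_add linear_cmul)
  ultimately show ?thesis unfolding tame_def using assms g(1,3) f(3)
    by (intro conjI exI[of _ R'] exI[of _ "c + c'"]) (auto simp: tame_def zero_prod_def)
qed

text \<open>For the second difference, \<open>f (x + d)\<close> and \<open>f (x - d)\<close> are
  written as \<open>m + e\<close> and \<open>m - e\<close>. Then \<open>h\<close> has a second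
  difference at \<open>m\<close> of order \<open>(norm e)\<^sup>2\<close>, while
  \<open>m - f x\<close> is half the second difference of \<open>f\<close>, to which
  \<open>h\<close> responds in a Lipschitz way. No derivative of \<open>f\<close> away from 0
  occurs.\<close>

lemma tame_compose:
  assumes f: "tame E f L" "subspace E" and h: "tame E' h M" "subspace E'"
    and map: "R0 > 0" "\<And>x. x \<in> E \<Longrightarrow> norm x \<le> R0 \<Longrightarrow> f x \<in> E'"
  shows "tame E (\<lambda>x. h (f x)) (\<lambda>x. M (L x))"
proof -
  obtain Rh Kh where lh: "Rh > 0" "Kh \<ge> 1"
    "\<And>x y. x \<in> E' \<Longrightarrow> y \<in> E' \<Longrightarrow> norm x \<le> Rh \<Longrightarrow> norm y \<le> Rh \<Longrightarrow> norm (h x - h y) \<le> Kh * norm (x - y)"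
    using tame_lipschitz[OF h] by metis
  obtain Rh' c' where ch: "Rh' > 0" "Rh' \<le> Rh" "c' \<ge> 0" "tame_on E' h M Rh' c'" using tameE[OF h(1) lh(1)] by metis
  obtain Rf K where lf: "Rf > 0" "K \<ge> 1"
    "\<And>x y. x \<in> E \<Longrightarrow> y \<in> E \<Longrightarrow> norm x \<le> Rf \<Longrightarrow> norm y \<le> Rf \<Longrightarrow> norm (f x - f y) \<le> K * norm (x - y)"
    "\<And>x. x \<in> E \<Longrightarrow> norm x \<le> Rf \<Longrightarrow> norm (f x) \<le> K * norm x"
    using tame_lipschitz[OF f] by metis
  define R1 where "R1 = min (min Rf R0) (Rh' / K)"
  have R1: "R1 > 0" "R1 \<le> Rf" "R1 \<le> R0" "K * R1 \<le> Rh'"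
  proof -
    have "K * R1 \<le> K * (Rh' / K)" using lf(2) by (intro mult_left_mono) (auto simp: R1_def)
    then show "K * R1 \<le> Rh'" using lf(2) by simp
  qed (use lf ch map in \<open>auto simp: R1_def\<close>)
  obtain R c where R: "R > 0" "R \<le> R1" "c \<ge> 0" "tame_on E f L R c" using tameE[OF f(1) R1(1)] by metis
  have RK: "K * R \<le> Rh'" using R(2) R1(4) lf(2) by (smt (verit) mult_left_mono)
  have M: "bounded_linear M" using h by (simp add: tame_def linear_conv_bounded_linear)
  have fE: "f x \<in> E'" if "x \<in> E" "norm x \<le> R" for x using that map R R1 by auto
  have fn: "norm (f x) \<le> K * s" if "x \<in> E" "norm x \<le> s" "s \<le> R" for x s
    using lf(4)[of x] that R R1 lf(2) by (smt (verit) mult_left_mono)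
  have fl: "norm (f x - f y) \<le> K * norm (x - y)" if "x \<in> E" "norm x \<le> R" "y \<in> E" "norm y \<le> R" for x y
    using lf(3)[of x y] that R R1 by auto
  define C where "C = c' * K * K + onorm M * c + Kh * c"
  have om: "onorm M \<ge> 0" by (rule onorm_pos_le[OF M])
  have "tame_on E (\<lambda>x. h (f x)) (\<lambda>x. M (L x)) R C"
    unfolding tame_on_def
  proof (intro conjI allI impI)
    fix s x y assume *: "x \<in> E" "y \<in> E" "norm x \<le> s" "norm y \<le> s" "s \<le> R"
    have s0: "s \<ge> 0" using *(3) norm_ge_zero order_trans by blast
    have Ks: "K * s \<le> Rh'" using *(5) RK lf(2) by (smt (verit) mult_left_mono)
    have "norm (h (f x) - h (f y) - M (f x - f y)) \<le> c' * (K * s) * norm (f x - f y)"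
      using * by (intro tame_onD1[OF ch(4)] fE fn Ks) auto
    also have "\<dots> \<le> c' * (K * s) * (K * norm (x - y))"
      using * s0 lf(2) ch(3) by (intro mult_left_mono fl) auto
    finally have 1: "norm (h (f x) - h (f y) - M (f x - f y)) \<le> c' * (K * s) * (K * norm (x - y))" .
    have "norm (M (f x - f y - L (x - y))) \<le> onorm M * norm (f x - f y - L (x - y))" using onorm[OF M] .
    also have "\<dots> \<le> onorm M * (c * s * norm (x - y))" by (intro mult_left_mono tame_onD1[OF R(4) *] om)
    finally have 2: "norm (M (f x - f y - L (x - y))) \<le> onorm M * (c * s * norm (x - y))" .
    have eq: "h (f x) - h (f y) - M (L (x - y)) = (h (f x) - h (f y) - M (f x - f y)) + M (f x - f y - L (x - y))"
      using bounded_linear.linear[OF M] by (simp add: linear_diff)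
    have "norm (h (f x) - h (f y) - M (L (x - y))) \<le> c' * (K * s) * (K * norm (x - y)) + onorm M * (c * s * norm (x - y))"
      unfolding eq by (intro norm_triangle_le add_mono 1 2)
    also have "\<dots> = (c' * K * K + onorm M * c) * (s * norm (x - y))" by (simp add: algebra_simps)
    also have "\<dots> \<le> C * (s * norm (x - y))" using s0 lh(2) R(3) by (intro mult_right_mono) (auto simp: C_def)
    finally show "norm (h (f x) - h (f y) - M (L (x - y))) \<le> C * s * norm (x - y)" by (simp add: mult_ac)
  next
    fix x d assume *: "x \<in> E" "d \<in> E" "norm x \<le> R" "norm (x + d) \<le> R" "norm (x - d) \<le> R"
    have E': "x + d \<in> E" "x - d \<in> E" using * f(2) by (auto intro: subspace_add subspace_diff)
    define m where "m = (1/2) *\<^sub>R (f (x + d) + f (x - d))"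
    define e where "e = (1/2) *\<^sub>R (f (x + d) - f (x - d))"
    have me: "m + e = f (x + d)" "m - e = f (x - d)"
      by (auto simp: m_def e_def scaleR_add_right scaleR_diff_right simp flip: scaleR_add_left)
    have mE: "m \<in> E'" "e \<in> E'" unfolding m_def e_def
      by (intro subspace_scale subspace_add subspace_diff h(2) fE E' *)+
    have fb: "norm (f (x + d)) \<le> Rh'" "norm (f (x - d)) \<le> Rh'" "norm (f x) \<le> Rh'"
      using fn[OF E'(1) *(4)] fn[OF E'(2) *(5)] fn[OF *(1,3)] RK by auto
    have mn: "norm m \<le> Rh'" using norm_triangle_ineq[of "f (x + d)" "f (x - d)"] fb by (simp add: m_def)
    have "norm (f (x + d) - f (x - d)) \<le> K * norm ((x + d) - (x - d))" by (intro fl E' *)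
    then have en: "norm e \<le> K * norm d" by (simp add: e_def flip: scaleR_2)
    have "norm (h (f (x + d)) + h (f (x - d)) - 2 *\<^sub>R h m) \<le> c' * (norm e)\<^sup>2"
      using tame_onD2[OF ch(4) mE mn] me fb by simp
    also have "\<dots> \<le> c' * (K * norm d)\<^sup>2" using en ch(3) by (intro mult_left_mono power_mono) auto
    finally have 1: "norm (h (f (x + d)) + h (f (x - d)) - 2 *\<^sub>R h m) \<le> c' * (K * norm d)\<^sup>2" .
    have "2 *\<^sub>R (m - f x) = f (x + d) + f (x - d) - 2 *\<^sub>R f x" by (simp add: m_def algebra_simps)
    then have "2 * norm (m - f x) = norm (f (x + d) + f (x - d) - 2 *\<^sub>R f x)" by (metis norm_scaleR abs_numeral)
    also have "\<dots> \<le> c * (norm d)\<^sup>2" by (rule tame_onD2[OF R(4) *])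
    finally have "2 * norm (m - f x) \<le> c * (norm d)\<^sup>2" .
    moreover have "norm (h m - h (f x)) \<le> Kh * norm (m - f x)"
      using fE[OF *(1,3)] mE mn fb ch(2) by (intro lh(3)) auto
    ultimately have 2: "norm (2 *\<^sub>R (h m - h (f x))) \<le> Kh * (c * (norm d)\<^sup>2)"
    proof -
      assume a: "2 * norm (m - f x) \<le> c * (norm d)\<^sup>2" "norm (h m - h (f x)) \<le> Kh * norm (m - f x)"
      have "norm (2 *\<^sub>R (h m - h (f x))) \<le> Kh * (2 * norm (m - f x))" using a(2) by simp
      also have "\<dots> \<le> Kh * (c * (norm d)\<^sup>2)" using a(1) lh(2) by (intro mult_left_mono) auto
      finally show ?thesis .
    qed
    have eq: "h (f (x + d)) + h (f (x - d)) - 2 *\<^sub>R h (f x)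
        = (h (f (x + d)) + h (f (x - d)) - 2 *\<^sub>R h m) + 2 *\<^sub>R (h m - h (f x))" by (simp add: algebra_simps)
    have "norm (h (f (x + d)) + h (f (x - d)) - 2 *\<^sub>R h (f x)) \<le> c' * (K * norm d)\<^sup>2 + Kh * (c * (norm d)\<^sup>2)"
      unfolding eq by (intro norm_triangle_le add_mono 1 2)
    also have "\<dots> = (c' * K * K + Kh * c) * (norm d)\<^sup>2" by (simp add: power2_eq_square algebra_simps)
    also have "\<dots> \<le> C * (norm d)\<^sup>2" using om R(3) by (intro mult_right_mono) (auto simp: C_def)
    finally show "norm (h (f (x + d)) + h (f (x - d)) - 2 *\<^sub>R h (f x)) \<le> C * (norm d)\<^sup>2" .
  qed
  moreover have "C \<ge> 0" using ch(3) lf(2) om R(3) lh(2) by (auto simp: C_def)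
  moreover have "linear (\<lambda>x. M (L x))" using f h by (auto simp: tame_def linear_compose[unfolded o_def])
  ultimately show ?thesis unfolding tame_def using R(1) f(1) h(1) by (auto simp: tame_def)
qed

lemma tendsto_norm_le:
  assumes "(f \<longlongrightarrow> (l::'a::real_normed_vector)) sequentially" "\<And>n. norm (f n) \<le> B"
  shows "norm l \<le> B"
  by (rule LIMSEQ_le_const2[OF tendsto_norm[OF assms(1)]]) (use assms(2) in auto)

text \<open>Koenigs linearisation at a fixed point with derivative \<open>1/2\<close>: the rescaled iterates
  converge, and being tame passes to the limit since \<open>2 (2/3)\<^sup>2 < 1\<close>.\<close>

theorem koenigs_linearization:
  fixes r :: "'a::euclidean_space \<Rightarrow> 'a"
  assumes E: "subspace E" and r: "tame E r (\<lambda>v. (1/2) *\<^sub>R v)"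
    and rE: "R0 > 0" "\<And>x. x \<in> E \<Longrightarrow> norm x \<le> R0 \<Longrightarrow> r x \<in> E"
  obtains \<Phi> R where "R > 0" "tame E \<Phi> (\<lambda>v. v)"
    "\<And>x. x \<in> E \<Longrightarrow> norm x \<le> R \<Longrightarrow> \<Phi> x \<in> E \<and> r x \<in> E \<and> norm (r x) \<le> (2/3) * norm x"
    "\<And>x. x \<in> E \<Longrightarrow> norm x \<le> R \<Longrightarrow> (\<lambda>n. 2 ^ n *\<^sub>R (r ^^ n) x) \<longlonglongrightarrow> \<Phi> x"
proof -
  define h where "h = (\<lambda>v::'a. (1/2) *\<^sub>R v)"
  \<comment> \<open>The bound \<open>c * R \<le> 1/36\<close> serves twice:
    \<open>1/2 + 1/36 < 2/3\<close> controls the Lipschitz constant of \<open>r\<close>, and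
    \<open>36 * c * R \<le> 1\<close> is wanted for the constant \<open>C\<close> below.\<close>
  obtain R c where R: "R > 0" "R \<le> min R0 (1/36)" "c \<ge> 0" "tame_on E r h R c" "c * R \<le> min R0 (1/36)"
    using tameE[OF r[folded h_def], of "min R0 (1/36)"] rE(1) by auto
  have cR: "c * R \<le> 1/36" "R \<le> R0" using R by auto
  have r0: "r 0 = 0" using r by (simp add: tame_def)
  have E0: "0 \<in> E" using E by (rule subspace_0)
  have rl: "norm (r x - r y) \<le> (2/3) * norm (x - y)" if "x \<in> E" "y \<in> E" "norm x \<le> R" "norm y \<le> R" for x y
  proof -
    have "norm (r x - r y) \<le> norm (r x - r y - h (x - y)) + norm (h (x - y))" by (metis diff_add_cancel norm_triangle_ineq)
    also have "\<dots> \<le> c * R * norm (x - y) + (1/2) * norm (x - y)"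
      using tame_onD1[OF R(4) that order_refl] by (simp add: h_def)
    also have "\<dots> \<le> (1/36) * norm (x - y) + (1/2) * norm (x - y)" using cR by (intro add_mono mult_right_mono) auto
    also have "\<dots> \<le> (2/3) * norm (x - y)" by simp
    finally show ?thesis .
  qed
  have rn: "norm (r x) \<le> (2/3) * norm x" if "x \<in> E" "norm x \<le> R" for x
    using rl[OF that(1) E0 that(2)] R(1) r0 by simp
  have rnR: "norm (r x) \<le> R" if "x \<in> E" "norm x \<le> R" for x using rn[OF that] that norm_ge_zero[of x] by linarith
  have rin: "r x \<in> E" if "x \<in> E" "norm x \<le> R" for x using rE(2) that cR by auto
  have it: "(r ^^ n) x \<in> E \<and> norm ((r ^^ n) x) \<le> (2/3) ^ n * norm x" if "x \<in> E" "norm x \<le> R" for n x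
  proof (induction n)
    case (Suc n)
    have "(2/3) ^ n * norm x \<le> 1 * norm x" by (intro mult_right_mono power_le_one) auto
    then have "norm ((r ^^ n) x) \<le> R" using Suc that by simp
    then show ?case using Suc rin rn[of "(r ^^ n) x"] by (auto simp: mult_ac)
  qed (use that in auto)
  define P where "P = (\<lambda>n x. 2 ^ n *\<^sub>R (r ^^ n) x)"
  have PS: "P (Suc n) x = 2 *\<^sub>R P n (r x)" for n x
    by (simp add: P_def funpow_swap1)
  have PE: "P n x \<in> E" if "x \<in> E" "norm x \<le> R" for n x
    unfolding P_def using it[OF that] E by (intro subspace_scale) auto
  \<comment> \<open>The recursion for second differences is
    \<open>C = 2 * (2/3)\<^sup>2 * C + 4 * c\<close>, whose fixed point is \<open>36 * c\<close>;
    the Lipschitz part of the induction uses \<open>34 * c\<close> of it.\<close>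
  define C where "C = 36 * c"
  have C0: "C \<ge> 0" and CR: "C * R \<le> 1" using R(3) cR by (auto simp: C_def)
  have tame_P: "tame_on E (P n) (\<lambda>v. v) R C" for n
  proof (induction n)
    case 0
    show ?case using R(3) by (auto simp: tame_on_def P_def C_def scaleR_2) (metis mult_nonneg_nonneg norm_ge_zero order_trans)
  next
    case (Suc n)
    show ?case
      unfolding tame_on_def
    proof (intro conjI allI impI)
      fix s x y assume *: "x \<in> E" "y \<in> E" "norm x \<le> s" "norm y \<le> s" "s \<le> R"
      have s0: "s \<ge> 0" using *(3) norm_ge_zero order_trans by blast
      have "norm (P n (r x) - P n (r y) - (r x - r y)) \<le> C * ((2/3) * s) * norm (r x - r y)"
        using rn[of x] rn[of y] * s0 by (intro tame_onD1[OF Suc] rin) auto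
      also have "\<dots> \<le> C * ((2/3) * s) * ((2/3) * norm (x - y))"
        using * s0 C0 by (intro mult_left_mono rl) auto
      finally have 1: "norm (2 *\<^sub>R (P n (r x) - P n (r y) - (r x - r y))) \<le> 2 * (C * ((2/3) * s) * ((2/3) * norm (x - y)))"
        by simp
      have 2: "norm (2 *\<^sub>R (r x - r y - h (x - y))) \<le> 2 * (c * s * norm (x - y))"
        using tame_onD1[OF R(4) *] by simp
      have eq: "P (Suc n) x - P (Suc n) y - (x - y) =
         2 *\<^sub>R (P n (r x) - P n (r y) - (r x - r y)) + 2 *\<^sub>R (r x - r y - h (x - y))"
        by (simp add: PS h_def algebra_simps)
      have "norm (P (Suc n) x - P (Suc n) y - (x - y)) \<le> 2 * (C * ((2/3) * s) * ((2/3) * norm (x - y))) + 2 * (c * s * norm (x - y))"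
        unfolding eq by (intro norm_triangle_le add_mono 1 2)
      also have "\<dots> = (34 * c) * (s * norm (x - y))" by (simp add: C_def algebra_simps)
      also have "\<dots> \<le> C * (s * norm (x - y))" using s0 R(3) by (intro mult_right_mono) (auto simp: C_def)
      finally show "norm (P (Suc n) x - P (Suc n) y - (x - y)) \<le> C * s * norm (x - y)" by (simp add: mult_ac)
    next
      fix x d assume *: "x \<in> E" "d \<in> E" "norm x \<le> R" "norm (x + d) \<le> R" "norm (x - d) \<le> R"
      have E': "x + d \<in> E" "x - d \<in> E" using * E by (auto intro: subspace_add subspace_diff)
      define m where "m = (1/2) *\<^sub>R (r (x + d) + r (x - d))"
      define e where "e = (1/2) *\<^sub>R (r (x + d) - r (x - d))"
      have me: "m + e = r (x + d)" "m - e = r (x - d)"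
        by (auto simp: m_def e_def scaleR_add_right scaleR_diff_right simp flip: scaleR_add_left)
      have mE: "m \<in> E" "e \<in> E" unfolding m_def e_def
        by (intro subspace_scale subspace_add subspace_diff E rin E' *)+
      have fb: "norm (r (x + d)) \<le> R" "norm (r (x - d)) \<le> R" "norm (r x) \<le> R"
        using rnR E' * by auto
      have mn: "norm m \<le> R" using norm_triangle_ineq[of "r (x + d)" "r (x - d)"] fb by (simp add: m_def)
      have "norm (r (x + d) - r (x - d)) \<le> (2/3) * norm ((x + d) - (x - d))" by (intro rl E' *)
      then have en: "norm e \<le> (2/3) * norm d" by (simp add: e_def flip: scaleR_2)
      have "norm (P n (r (x + d)) + P n (r (x - d)) - 2 *\<^sub>R P n m) \<le> C * (norm e)\<^sup>2"
        using tame_onD2[OF Suc mE mn] me fb by simp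
      also have "\<dots> \<le> C * ((2/3) * norm d)\<^sup>2" using en C0 by (intro mult_left_mono power_mono) auto
      finally have 1: "norm (2 *\<^sub>R (P n (r (x + d)) + P n (r (x - d)) - 2 *\<^sub>R P n m)) \<le> 2 * (C * ((2/3) * norm d)\<^sup>2)"
        by simp
      have "2 *\<^sub>R (m - r x) = r (x + d) + r (x - d) - 2 *\<^sub>R r x" by (simp add: m_def algebra_simps)
      then have "2 * norm (m - r x) = norm (r (x + d) + r (x - d) - 2 *\<^sub>R r x)" by (metis norm_scaleR abs_numeral)
      also have "\<dots> \<le> c * (norm d)\<^sup>2" by (rule tame_onD2[OF R(4) *])
      finally have mr: "2 * norm (m - r x) \<le> c * (norm d)\<^sup>2" .
      \<comment> \<open>By \<open>C * R \<le> 1\<close> each \<open>P n\<close> is Lipschitz with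
        constant 2 on the ball, uniformly in \<open>n\<close>.\<close>
      have "norm (P n m - P n (r x)) \<le> norm (P n m - P n (r x) - (m - r x)) + norm (m - r x)"
        by (metis diff_add_cancel norm_triangle_ineq)
      also have "\<dots> \<le> C * R * norm (m - r x) + norm (m - r x)"
        using tame_onD1[OF Suc mE(1) rin[OF *(1,3)] mn fb(3) order_refl] by simp
      also have "\<dots> \<le> 1 * norm (m - r x) + norm (m - r x)" using CR by (intro add_mono mult_right_mono) auto
      also have "\<dots> \<le> c * (norm d)\<^sup>2" using mr by simp
      finally have 2: "norm (4 *\<^sub>R (P n m - P n (r x))) \<le> 4 * (c * (norm d)\<^sup>2)" by simp
      have eq: "P (Suc n) (x + d) + P (Suc n) (x - d) - 2 *\<^sub>R P (Suc n) x =
        2 *\<^sub>R (P n (r (x + d)) + P n (r (x - d)) - 2 *\<^sub>R P n m) + 4 *\<^sub>R (P n m - P n (r x))"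
        by (simp add: PS algebra_simps)
      have "norm (P (Suc n) (x + d) + P (Suc n) (x - d) - 2 *\<^sub>R P (Suc n) x) \<le>
         2 * (C * ((2/3) * norm d)\<^sup>2) + 4 * (c * (norm d)\<^sup>2)"
        unfolding eq by (intro norm_triangle_le add_mono 1 2)
      also have "\<dots> = C * (norm d)\<^sup>2" by (simp add: C_def power2_eq_square)
      finally show "norm (P (Suc n) (x + d) + P (Suc n) (x - d) - 2 *\<^sub>R P (Suc n) x) \<le> C * (norm d)\<^sup>2" .
    qed
  qed
  have "\<exists>l. (\<lambda>n. P n x) \<longlonglongrightarrow> l" if x: "x \<in> E" "norm x \<le> R" for x
  proof -
    let ?d = "\<lambda>n. P (Suc n) x - P n x"
    \<comment> \<open>\<open>r\<close> differs from halving by a quadratic term, which decays like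
      \<open>(4/9) ^ n\<close> along the iterates; the factor \<open>2 ^ n\<close> leaves the ratio
      \<open>8/9\<close>.\<close>
    have "norm (?d n) \<le> (2 * c * (norm x)\<^sup>2) * (8/9) ^ n" for n
    proof -
      let ?y = "(r ^^ n) x"
      have y: "?y \<in> E" "norm ?y \<le> (2/3) ^ n * norm x" using it[OF x] by auto
      have "(2/3) ^ n * norm x \<le> 1 * norm x" by (intro mult_right_mono power_le_one) auto
      then have yR: "norm ?y \<le> R" using y x by simp
      have "norm (r ?y - h ?y) \<le> c * norm ?y * norm ?y"
        using tame_onD1[OF R(4) y(1) E0 order_refl _ yR] r0 by simp
      also have "\<dots> \<le> c * ((2/3) ^ n * norm x) * ((2/3) ^ n * norm x)"
        using y(2) R(3) by (intro mult_mono) auto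
      finally have "2 ^ n * (2 * norm (r ?y - h ?y)) \<le> 2 ^ n * (2 * (c * ((2/3) ^ n * norm x) * ((2/3) ^ n * norm x)))" by simp
      also have "\<dots> = (2 * c * (norm x)\<^sup>2) * (2 ^ n * ((2/3) ^ n * (2/3) ^ n))" by (simp add: power2_eq_square mult_ac)
      also have "2 ^ n * ((2/3) ^ n * (2/3) ^ n) = (8/9::real) ^ n"
        by (simp flip: power_mult_distrib)
      finally have "2 ^ n * (2 * norm (r ?y - h ?y)) \<le> (2 * c * (norm x)\<^sup>2) * (8/9) ^ n" .
      moreover have "?d n = (2 ^ n * 2) *\<^sub>R (r ?y - h ?y)" by (simp add: P_def h_def algebra_simps)
      ultimately show ?thesis by simp
    qed
    then have "summable ?d"
      by (rule summable_comparison_test'[rotated, of 0 _ "\<lambda>n. (2 * c * (norm x)\<^sup>2) * (8/9) ^ n"])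
         (auto intro!: summable_mult summable_geometric)
    then have "convergent (\<lambda>n. \<Sum>i<n. ?d i)" by (simp add: summable_iff_convergent)
    then have "convergent (\<lambda>n. P n x - P 0 x)" using sum_lessThan_telescope[of "\<lambda>n. P n x"] by simp
    then have "convergent (\<lambda>n. P n x)" using convergent_diff_const_right_iff by blast
    then show ?thesis by (simp add: convergent_def)
  qed
  then obtain \<Phi> where \<Phi>: "\<And>x. x \<in> E \<Longrightarrow> norm x \<le> R \<Longrightarrow> (\<lambda>n. P n x) \<longlonglongrightarrow> \<Phi> x" by metis
  have "tame_on E \<Phi> (\<lambda>v. v) R C"
    unfolding tame_on_def
  proof (intro conjI allI impI)
    fix s x y assume *: "x \<in> E" "y \<in> E" "norm x \<le> s" "norm y \<le> s" "s \<le> R"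
    show "norm (\<Phi> x - \<Phi> y - (x - y)) \<le> C * s * norm (x - y)"
      by (rule tendsto_norm_le[of "\<lambda>n. P n x - P n y - (x - y)"])
         (use * in \<open>auto intro!: tendsto_intros \<Phi> tame_onD1[OF tame_P]\<close>)
  next
    fix x d assume *: "x \<in> E" "d \<in> E" "norm x \<le> R" "norm (x + d) \<le> R" "norm (x - d) \<le> R"
    show "norm (\<Phi> (x + d) + \<Phi> (x - d) - 2 *\<^sub>R \<Phi> x) \<le> C * (norm d)\<^sup>2"
      by (rule tendsto_norm_le[of "\<lambda>n. P n (x + d) + P n (x - d) - 2 *\<^sub>R P n x"])
         (use * E in \<open>auto intro!: tendsto_intros \<Phi> tame_onD2[OF tame_P] subspace_add subspace_diff\<close>)
  qed
  moreover have "\<Phi> 0 = 0"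
  proof (rule LIMSEQ_unique)
    show "(\<lambda>n. P n 0) \<longlonglongrightarrow> \<Phi> 0" using \<Phi>[OF E0] R(1) by simp
    have "(r ^^ n) 0 = 0" for n by (induction n) (auto simp: r0)
    then show "(\<lambda>n. P n 0) \<longlonglongrightarrow> 0" by (simp add: P_def)
  qed
  ultimately have "tame E \<Phi> (\<lambda>v. v)" using R(1) C0 linear_id by (auto simp: tame_def id_def)
  moreover have "\<Phi> x \<in> E" if "x \<in> E" "norm x \<le> R" for x
    using closed_subspace[OF E] \<Phi>[OF that] PE[OF that] closed_sequentially by metis
  ultimately show thesis using that[OF R(1), of \<Phi>] \<Phi> rin rn unfolding P_def by blast
qed

text \<open>As a limit, \<open>\<Phi>\<close> is not known to be differentiable away from 0, so its
  inverse comes from the contraction \<open>x \<mapsto> X - (\<Phi> x - x)\<close>. Tameness passes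
  to the inverse by the midpoint argument used for compositions.\<close>

theorem tame_local_inverse:
  fixes \<Phi> :: "'a::euclidean_space \<Rightarrow> 'a"
  assumes E: "subspace E" and t: "tame E \<Phi> (\<lambda>v. v)"
    and map: "R0 > 0" "\<And>x. x \<in> E \<Longrightarrow> norm x \<le> R0 \<Longrightarrow> \<Phi> x \<in> E"
  obtains \<epsilon> R where "R > 0" "tame E \<epsilon> (\<lambda>v. v)"
    "\<And>X. X \<in> E \<Longrightarrow> norm X \<le> R \<Longrightarrow> \<epsilon> X \<in> E \<and> \<Phi> (\<epsilon> X) = X \<and> norm (\<epsilon> X) \<le> 2 * norm X"
    "\<And>x. x \<in> E \<Longrightarrow> norm x \<le> R \<Longrightarrow> \<epsilon> (\<Phi> x) = x"
proof -
  obtain R c where R: "R > 0" "R \<le> min R0 (1/2)" "c \<ge> 0" "tame_on E \<Phi> (\<lambda>v. v) R c" "c * R \<le> min R0 (1/2)"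
    using tameE[OF t, of "min R0 (1/2)"] map(1) by auto
  have cR: "c * R \<le> 1/2" "R \<le> R0" using R by auto
  have \<Phi>0: "\<Phi> 0 = 0" using t by (simp add: tame_def)
  have E0: "0 \<in> E" using E by (rule subspace_0)
  have dev: "norm (\<Phi> x - \<Phi> y - (x - y)) \<le> (1/2) * norm (x - y)" if "x \<in> E" "y \<in> E" "norm x \<le> R" "norm y \<le> R" for x y
    using tame_onD1[OF R(4) that order_refl] mult_right_mono[OF cR(1) norm_ge_zero[of "x - y"]] by linarith
  have low: "norm (x - y) \<le> 2 * norm (\<Phi> x - \<Phi> y)" if "x \<in> E" "y \<in> E" "norm x \<le> R" "norm y \<le> R" for x y
    using dev[OF that] norm_triangle_ineq2[of "x - y" "\<Phi> x - \<Phi> y"] by (simp add: norm_minus_commute)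
  define S where "S = E \<inter> cball 0 R"
  have S: "x \<in> S \<longleftrightarrow> x \<in> E \<and> norm x \<le> R" for x by (auto simp: S_def)
  have inj: "inj_on \<Phi> S" by (rule inj_onI) (use low in \<open>fastforce simp: S\<close>)
  have ex: "\<exists>x\<in>S. \<Phi> x = X" if X: "X \<in> E" "norm X \<le> R / 2" for X
  proof -
    have "\<exists>!x\<in>S. X - (\<Phi> x - x) = x"
    proof (rule Banach_fix[where c = "1/2"])
      show "complete S" unfolding S_def
        by (intro compact_imp_complete closed_Int_compact closed_subspace E compact_cball)
      show "S \<noteq> {}" using E0 R(1) by (auto simp: S_def)
      show "(\<lambda>x. X - (\<Phi> x - x)) ` S \<subseteq> S"
      proof (rule image_subsetI)
        fix x assume "x \<in> S"
        then have x: "x \<in> E" "norm x \<le> R" by (auto simp: S)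
        have "norm (\<Phi> x - x) \<le> (1/2) * norm x" using dev[OF x(1) E0 x(2)] R(1) \<Phi>0 by simp
        then have "norm (X - (\<Phi> x - x)) \<le> R" using norm_triangle_ineq4[of X "\<Phi> x - x"] X(2) x(2) by linarith
        moreover have "X - (\<Phi> x - x) \<in> E" using map(2)[OF x(1)] x cR(2) X(1) E by (intro subspace_diff) auto
        ultimately show "X - (\<Phi> x - x) \<in> S" by (simp add: S)
      qed
      show "dist (X - (\<Phi> x - x)) (X - (\<Phi> y - y)) \<le> 1/2 * dist x y" if "x \<in> S" "y \<in> S" for x y
        using dev[of x y] that by (simp add: dist_norm S algebra_simps norm_minus_commute)
    qed auto
    then show ?thesis by (metis add_diff_cancel_left' diff_eq_eq diff_add_cancel)
  qed
  define \<epsilon> where "\<epsilon> = inv_into S \<Phi>"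
  have \<epsilon>: "\<epsilon> X \<in> E" "norm (\<epsilon> X) \<le> R" "\<Phi> (\<epsilon> X) = X" if "X \<in> E" "norm X \<le> R / 2" for X
  proof -
    have "X \<in> \<Phi> ` S" using ex[OF that] by auto
    then show "\<epsilon> X \<in> E" "norm (\<epsilon> X) \<le> R" "\<Phi> (\<epsilon> X) = X"
      unfolding \<epsilon>_def using inv_into_into[of X \<Phi> S] f_inv_into_f[of X \<Phi> S] by (auto simp: S)
  qed
  have \<epsilon>l: "norm (\<epsilon> X - \<epsilon> Y) \<le> 2 * norm (X - Y)" if "X \<in> E" "norm X \<le> R/2" "Y \<in> E" "norm Y \<le> R/2" for X Y
    using low[OF \<epsilon>(1)[OF that(1,2)] \<epsilon>(1)[OF that(3,4)] \<epsilon>(2)[OF that(1,2)] \<epsilon>(2)[OF that(3,4)]] \<epsilon>(3) that by simp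
  have \<epsilon>0: "\<epsilon> 0 = 0" unfolding \<epsilon>_def using inv_into_f_f[OF inj, of 0] \<Phi>0 E0 R(1) by (simp add: S)
  have \<epsilon>n: "norm (\<epsilon> X) \<le> 2 * norm X" if "X \<in> E" "norm X \<le> R/2" for X
    using \<epsilon>l[OF that E0] R(1) \<epsilon>0 by simp
  have "tame_on E \<epsilon> (\<lambda>v. v) (R/2) (8 * c)"
    unfolding tame_on_def
  proof (intro conjI allI impI)
    fix s x y assume *: "x \<in> E" "y \<in> E" "norm x \<le> s" "norm y \<le> s" "s \<le> R / 2"
    have s0: "s \<ge> 0" using *(3) norm_ge_zero order_trans by blast
    have n: "norm x \<le> R/2" "norm y \<le> R/2" using * by auto
    have "norm (\<Phi> (\<epsilon> x) - \<Phi> (\<epsilon> y) - (\<epsilon> x - \<epsilon> y)) \<le> c * (2 * s) * norm (\<epsilon> x - \<epsilon> y)"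
      using * n \<epsilon>n[of x] \<epsilon>n[of y] by (intro tame_onD1[OF R(4)] \<epsilon>) auto
    also have "\<dots> \<le> c * (2 * s) * (2 * norm (x - y))" using R(3) s0 * n by (intro mult_left_mono \<epsilon>l) auto
    also have "\<dots> \<le> 8 * c * s * norm (x - y)" using R(3) s0 by (simp add: mult_right_mono)
    finally show "norm (\<epsilon> x - \<epsilon> y - (x - y)) \<le> 8 * c * s * norm (x - y)"
      using \<epsilon>(3) * n by (simp add: norm_minus_commute)
  next
    fix x d assume *: "x \<in> E" "d \<in> E" "norm x \<le> R/2" "norm (x + d) \<le> R/2" "norm (x - d) \<le> R/2"
    have E': "x + d \<in> E" "x - d \<in> E" using * E by (auto intro: subspace_add subspace_diff)
    define a b where "a = \<epsilon> (x + d)" and "b = \<epsilon> (x - d)"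
    have a: "a \<in> E" "norm a \<le> R" "\<Phi> a = x + d" and b: "b \<in> E" "norm b \<le> R" "\<Phi> b = x - d"
      unfolding a_def b_def using \<epsilon>[OF E'(1) *(4)] \<epsilon>[OF E'(2) *(5)] by auto
    \<comment> \<open>\<open>m\<close> is the midpoint of the preimages \<open>a\<close> and
      \<open>b\<close>, not the preimage of \<open>x\<close>. Since \<open>\<Phi> m\<close> misses
      \<open>x\<close> only by order \<open>(norm d)\<^sup>2\<close>, the lower Lipschitz bound
      places \<open>m\<close> equally close to \<open>\<epsilon> x\<close>.\<close>
    define m e where "m = (1/2) *\<^sub>R (a + b)" and "e = (1/2) *\<^sub>R (a - b)"
    have me: "m + e = a" "m - e = b"
      by (auto simp: m_def e_def scaleR_add_right scaleR_diff_right simp flip: scaleR_add_left)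
    have mE: "m \<in> E" "e \<in> E" unfolding m_def e_def by (intro subspace_scale subspace_add subspace_diff E a b)+
    have mn: "norm m \<le> R" using norm_triangle_ineq[of a b] a b by (simp add: m_def)
    have "norm (a - b) \<le> 2 * norm ((x + d) - (x - d))" unfolding a_def b_def by (intro \<epsilon>l E' *)
    then have en: "norm e \<le> 2 * norm d" by (simp add: e_def flip: scaleR_2)
    have "norm (\<Phi> a + \<Phi> b - 2 *\<^sub>R \<Phi> m) \<le> c * (norm e)\<^sup>2"
      using tame_onD2[OF R(4) mE mn] me a b by simp
    also have "\<dots> \<le> c * (2 * norm d)\<^sup>2" using en R(3) by (intro mult_left_mono power_mono) auto
    also have "\<Phi> a + \<Phi> b - 2 *\<^sub>R \<Phi> m = 2 *\<^sub>R (x - \<Phi> m)" by (simp add: a b algebra_simps scaleR_2)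
    finally have 1: "norm (x - \<Phi> m) \<le> 2 * c * (norm d)\<^sup>2" by (simp add: power2_eq_square)
    have "norm (m - \<epsilon> x) \<le> 2 * norm (\<Phi> m - \<Phi> (\<epsilon> x))" by (intro low mE mn \<epsilon> *)
    then have "norm (m - \<epsilon> x) \<le> 4 * c * (norm d)\<^sup>2" using 1 \<epsilon>(3)[OF *(1,3)] by (simp add: norm_minus_commute)
    moreover have "a + b - 2 *\<^sub>R \<epsilon> x = 2 *\<^sub>R (m - \<epsilon> x)" by (simp add: m_def algebra_simps)
    ultimately have "norm (a + b - 2 *\<^sub>R \<epsilon> x) \<le> 8 * c * (norm d)\<^sup>2" by simp
    then show "norm (\<epsilon> (x + d) + \<epsilon> (x - d) - 2 *\<^sub>R \<epsilon> x) \<le> 8 * c * (norm d)\<^sup>2" by (simp add: a_def b_def)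
  qed
  then have "tame E \<epsilon> (\<lambda>v. v)" using \<epsilon>0 R(1,3) linear_id
    unfolding tame_def by (intro conjI exI[of _ "R/2"] exI[of _ "8 * c"]) (auto simp: id_def)
  moreover have "\<epsilon> (\<Phi> x) = x" if "x \<in> E" "norm x \<le> R/2" for x
    unfolding \<epsilon>_def using inv_into_f_f[OF inj, of x] that R(1) by (simp add: S)
  ultimately show thesis using that[of "R/2" \<epsilon>] R(1) \<epsilon>(1,3) \<epsilon>n by auto
qed

section \<open>Maps that are smooth at a point of a manifold\<close>

lemma smooth_manifold_subspace: "smooth_manifold M \<Longrightarrow> subspace (model M)"
  by (simp add: smooth_manifold_def)

lemma max_atlas_is_chart: "C \<in> max_atlas M \<Longrightarrow> is_chart M C"
  by (simp add: max_atlas_def)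

lemma is_chart_subset: "is_chart M C \<Longrightarrow> fst C \<subseteq> topspace (mtop M)"
  by (simp add: is_chart_def openin_subset)

lemma is_chart_model: "is_chart M C \<Longrightarrow> p \<in> fst C \<Longrightarrow> snd C p \<in> model M"
  unfolding is_chart_def using openin_imp_subset by blast

lemma is_chart_inj: "is_chart M C \<Longrightarrow> inj_on (snd C) (fst C)"
  unfolding is_chart_def using is_chart_subset[of M C, unfolded is_chart_def]
  by (auto dest!: homeomorphic_imp_injective_map simp: topspace_subtopology Int_absorb1)

lemma chart_inv_snd: "is_chart M C \<Longrightarrow> p \<in> fst C \<Longrightarrow> chart_inv C (snd C p) = p"
  unfolding chart_inv_def by (rule inv_into_f_f[OF is_chart_inj])

text \<open>Trades a neighbourhood in the manifold for an open set \<open>Q\<close> of the ambient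
  Euclidean space. On the model part of \<open>Q\<close> the map \<open>chart_inv\<close> is a
  genuine inverse, whereas outside the chart image its values are arbitrary.\<close>

lemma chart_nhd:
  assumes "is_chart M C" "openin (mtop M) W" "p \<in> W" "p \<in> fst C"
  obtains Q where "open Q" "snd C p \<in> Q"
    "\<And>x. x \<in> model M \<Longrightarrow> x \<in> Q \<Longrightarrow> chart_inv C x \<in> W \<and> chart_inv C x \<in> fst C \<and> snd C (chart_inv C x) = x"
proof -
  have "open_map (subtopology (mtop M) (fst C)) (top_of_set (snd C ` fst C)) (snd C)"
    using assms(1) by (simp add: is_chart_def homeomorphic_map_def homeomorphic_imp_open_map)
  moreover have "openin (subtopology (mtop M) (fst C)) (fst C \<inter> W)"
    using assms(2) by (auto simp: openin_subtopology)
  ultimately have "openin (top_of_set (snd C ` fst C)) (snd C ` (fst C \<inter> W))"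
    by (auto simp: open_map_def)
  then have "openin (top_of_set (model M)) (snd C ` (fst C \<inter> W))"
    using assms(1) openin_trans unfolding is_chart_def by blast
  then obtain Q where Q: "open Q" "snd C ` (fst C \<inter> W) = model M \<inter> Q" by (auto simp: openin_open)
  show thesis
  proof (rule that[OF Q(1)])
    show "snd C p \<in> Q" using Q(2) assms(3,4) by blast
    fix x assume "x \<in> model M" "x \<in> Q"
    then obtain q where "q \<in> fst C" "q \<in> W" "x = snd C q" using Q(2) by blast
    then show "chart_inv C x \<in> W \<and> chart_inv C x \<in> fst C \<and> snd C (chart_inv C x) = x"
      using chart_inv_snd[OF assms(1)] by simp
  qed
qed

lemma chart_open_vimage:
  assumes "is_chart M C" "open Q"
  shows "openin (mtop M) {q \<in> fst C. snd C q \<in> Q}"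
proof -
  have "continuous_map (subtopology (mtop M) (fst C)) (top_of_set (snd C ` fst C)) (snd C)"
    using assms(1) by (simp add: is_chart_def homeomorphic_imp_continuous_map)
  moreover have "openin (top_of_set (snd C ` fst C)) (snd C ` fst C \<inter> Q)" using assms(2) by (auto simp: openin_open)
  ultimately have "openin (subtopology (mtop M) (fst C))
     {q \<in> topspace (subtopology (mtop M) (fst C)). snd C q \<in> snd C ` fst C \<inter> Q}"
    by (rule openin_continuous_map_preimage)
  moreover have "{q \<in> topspace (subtopology (mtop M) (fst C)). snd C q \<in> snd C ` fst C \<inter> Q} = {q \<in> fst C. snd C q \<in> Q}"
    using is_chart_subset[OF assms(1)] by auto
  ultimately show ?thesis
    using assms(1) openin_trans_full unfolding is_chart_def by fastforce
qed

text \<open>One pair of charts suffices, by \<open>smooth_at_charts\<close>. The neighbourhood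
  \<open>W\<close> keeps \<open>f\<close> inside the target chart, where the coordinate expression
  has meaning, and makes continuity at \<open>p\<close> a consequence.\<close>

definition smooth_at :: "('a, 'e::euclidean_space) mfd \<Rightarrow> ('b, 'f::euclidean_space) mfd \<Rightarrow> ('a \<Rightarrow> 'b) \<Rightarrow> 'a \<Rightarrow> bool" where
  "smooth_at M N f p \<longleftrightarrow> (\<exists>C\<in>max_atlas M. \<exists>C'\<in>max_atlas N. \<exists>W. openin (mtop M) W \<and> p \<in> W \<and> W \<subseteq> fst C \<and>
     f ` W \<subseteq> fst C' \<and> smooth_germ (model M) (snd C' \<circ> f \<circ> chart_inv C) (snd C p))"

lemma smooth_atI:
  "C \<in> max_atlas M \<Longrightarrow> C' \<in> max_atlas N \<Longrightarrow> openin (mtop M) W \<Longrightarrow> p \<in> W \<Longrightarrow> W \<subseteq> fst C \<Longrightarrow> (\<And>q. q \<in> W \<Longrightarrow> f q \<in> fst C') \<Longrightarrow>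
    smooth_germ (model M) (snd C' \<circ> f \<circ> chart_inv C) (snd C p) \<Longrightarrow> smooth_at M N f p"
  unfolding smooth_at_def by blast

lemma smooth_at_topspace:
  assumes "smooth_at M N f p" shows "p \<in> topspace (mtop M)" "f p \<in> topspace (mtop N)"
  using assms is_chart_subset[OF max_atlas_is_chart] unfolding smooth_at_def by blast+

lemma smooth_at_continuous:
  assumes "smooth_manifold M" "smooth_at M N f p" "openin (mtop N) V" "f p \<in> V"
  obtains W where "openin (mtop M) W" "p \<in> W" "f ` W \<subseteq> V"
proof -
  obtain C C' W0 where *: "C \<in> max_atlas M" "C' \<in> max_atlas N" "openin (mtop M) W0" "p \<in> W0" "W0 \<subseteq> fst C"
     "f ` W0 \<subseteq> fst C'" "smooth_germ (model M) (snd C' \<circ> f \<circ> chart_inv C) (snd C p)"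
    using assms(2) unfolding smooth_at_def by blast
  have C: "is_chart M C" "is_chart N C'" using * max_atlas_is_chart by blast+
  let ?g = "snd C' \<circ> f \<circ> chart_inv C"
  have p: "p \<in> fst C" "chart_inv C (snd C p) = p" "f p \<in> fst C'" using * chart_inv_snd[OF C(1)] by auto
  obtain Q where Q: "open Q" "snd C' (f p) \<in> Q"
    "\<And>x. x \<in> model N \<Longrightarrow> x \<in> Q \<Longrightarrow> chart_inv C' x \<in> V"
    using chart_nhd[OF C(2) assms(3,4) p(3)] by metis
  have "continuous (at (snd C p) within model M) ?g"
    using smooth_germ_continuous[OF *(7)] is_chart_model[OF C(1) p(1)] by blast
  then obtain S where S: "open S" "snd C p \<in> S" "\<And>x. x \<in> model M \<Longrightarrow> x \<in> S \<Longrightarrow> ?g x \<in> Q"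
    unfolding continuous_within_topological using Q(1,2) p(2) by (metis comp_apply)
  show thesis
  proof (rule that)
    show "openin (mtop M) (W0 \<inter> {q \<in> fst C. snd C q \<in> S})"
      using *(3) chart_open_vimage[OF C(1) S(1)] by (rule openin_Int)
    show "p \<in> W0 \<inter> {q \<in> fst C. snd C q \<in> S}" using * S(2) p by auto
    show "f ` (W0 \<inter> {q \<in> fst C. snd C q \<in> S}) \<subseteq> V"
    proof (rule image_subsetI)
      fix q assume q: "q \<in> W0 \<inter> {q \<in> fst C. snd C q \<in> S}"
      then have "f q \<in> fst C'" using * by blast
      moreover have "snd C' (f q) \<in> Q"
        using S(3)[of "snd C q"] q is_chart_model[OF C(1)] chart_inv_snd[OF C(1)] by auto
      ultimately show "f q \<in> V" using Q(3) is_chart_model[OF C(2)] chart_inv_snd[OF C(2)] by metis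
    qed
  qed
qed

lemma smooth_at_local:
  assumes "smooth_manifold M" "smooth_at M N f p" "openin (mtop M) V" "p \<in> V" "\<And>q. q \<in> V \<Longrightarrow> f q = g q"
  shows "smooth_at M N g p"
proof -
  obtain C C' W0 where *: "C \<in> max_atlas M" "C' \<in> max_atlas N" "openin (mtop M) W0" "p \<in> W0" "W0 \<subseteq> fst C"
     "f ` W0 \<subseteq> fst C'" "smooth_germ (model M) (snd C' \<circ> f \<circ> chart_inv C) (snd C p)"
    using assms(2) unfolding smooth_at_def by blast
  have C: "is_chart M C" using * max_atlas_is_chart by blast
  obtain Q where Q: "open Q" "snd C p \<in> Q"
    "\<And>x. x \<in> model M \<Longrightarrow> x \<in> Q \<Longrightarrow> chart_inv C x \<in> V"
    using chart_nhd[OF C assms(3,4)] *(4,5) by (metis subsetD)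
  show ?thesis
  proof (rule smooth_atI[OF *(1,2) openin_Int[OF *(3) assms(3)]])
    show "smooth_germ (model M) (snd C' \<circ> g \<circ> chart_inv C) (snd C p)"
      by (rule smooth_germ_local[OF *(7) Q(1,2)]) (use Q(3) assms(5) in auto)
    show "g q \<in> fst C'" if "q \<in> W0 \<inter> V" for q using that assms(5) *(6) by (metis IntE image_subset_iff)
  qed (use * assms in auto)
qed

lemma atlas_subset_max_atlas: "smooth_manifold M \<Longrightarrow> atlas M \<subseteq> max_atlas M"
  by (auto simp: smooth_manifold_def max_atlas_def)

lemma atlas_cover:
  assumes "smooth_manifold M" "p \<in> topspace (mtop M)"
  obtains A where "A \<in> atlas M" "A \<in> max_atlas M" "is_chart M A" "p \<in> fst A"
  using assms atlas_subset_max_atlas[OF assms(1)] unfolding smooth_manifold_def by blast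

lemma compatible_charts_germ:
  assumes "is_chart M C" "compatible_charts C C'" "is_chart M C'" "p \<in> fst C" "p \<in> fst C'"
  shows "smooth_germ (model M) (snd C' \<circ> chart_inv C) (snd C p)"
proof -
  have "openin (mtop M) (fst C')" using assms(3) by (simp add: is_chart_def)
  then obtain Q where Q: "open Q" "snd C p \<in> Q"
    "\<And>x. x \<in> model M \<Longrightarrow> x \<in> Q \<Longrightarrow> chart_inv C x \<in> fst C' \<and> chart_inv C x \<in> fst C \<and> snd C (chart_inv C x) = x"
    using chart_nhd[OF assms(1) _ assms(5,4)] by metis
  have "smooth_germ (snd C ` (fst C \<inter> fst C')) (snd C' \<circ> chart_inv C) (snd C p)"
    using assms(2,4,5) unfolding compatible_charts_def smooth_on_iff_germ by blast
  then show ?thesis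
    by (rule smooth_germ_local[OF _ Q(1,2)]) (use Q(3) in \<open>force intro!: image_eqI\<close>)
qed

lemma compatible_charts_sym: "compatible_charts C C' \<Longrightarrow> compatible_charts C' C"
  by (auto simp: compatible_charts_def Int_commute)

text \<open>Two charts of the maximal atlas are by definition compatible with the atlas, not with
  each other, so the change of charts is factored through an atlas chart around
  \<open>p\<close>.\<close>

lemma max_atlas_transition:
  assumes M: "smooth_manifold M" and C: "C \<in> max_atlas M" "C' \<in> max_atlas M" "p \<in> fst C" "p \<in> fst C'"
  shows "smooth_germ (model M) (snd C' \<circ> chart_inv C) (snd C p)"
proof -
  have ch: "is_chart M C" "is_chart M C'" using C max_atlas_is_chart by blast+
  obtain A where A: "A \<in> atlas M" "is_chart M A" "p \<in> fst A"
    using atlas_cover[OF M] is_chart_subset[OF ch(1)] C(3) by blast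
  have 1: "smooth_germ (model M) (snd A \<circ> chart_inv C) (snd C p)"
    using compatible_charts_germ[OF ch(1) _ A(2) C(3) A(3)] C(1) A(1) unfolding max_atlas_def by blast
  have "compatible_charts A C'" using C(2) A(1) compatible_charts_sym unfolding max_atlas_def by blast
  then have 2: "smooth_germ (model M) (snd C' \<circ> chart_inv A) (snd A p)"
    using compatible_charts_germ[OF A(2) _ ch(2) A(3) C(4)] by blast
  have oA: "openin (mtop M) (fst A)" using A(2) by (simp add: is_chart_def)
  obtain Q where Q: "open Q" "snd C p \<in> Q"
    "\<And>x. x \<in> model M \<Longrightarrow> x \<in> Q \<Longrightarrow> chart_inv C x \<in> fst A"
    using chart_nhd[OF ch(1) oA A(3) C(3)] by metis
  have cp: "snd C p \<in> model M" using is_chart_model[OF ch(1) C(3)] .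
  have "smooth_germ (model M) (\<lambda>x. (snd C' \<circ> chart_inv A) ((snd A \<circ> chart_inv C) x)) (snd C p)"
    by (rule smooth_germ_compose[OF 1 cp Q(1,2), where E' = "model M"])
       (use Q(3) is_chart_model[OF A(2)] 2 chart_inv_snd[OF ch(1) C(3)] in \<open>auto simp: o_def image_subset_iff subset_iff\<close>)
  then show ?thesis
    by (rule smooth_germ_local[OF _ Q(1,2)]) (use Q(3) chart_inv_snd[OF A(2)] in auto)
qed

text \<open>Transition maps on both sides carry the coordinate expression from the charts that
  witness smoothness to any others. The second claim says that nearby coordinates stay in the chart
  domains, which the chain rule demands.\<close>

lemma smooth_at_charts:
  assumes M: "smooth_manifold M" and N: "smooth_manifold N" and f: "smooth_at M N f p"
    and C: "C \<in> max_atlas M" "p \<in> fst C" and C': "C' \<in> max_atlas N" "f p \<in> fst C'"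
  shows "smooth_germ (model M) (snd C' \<circ> f \<circ> chart_inv C) (snd C p)"
    and "\<exists>Q. open Q \<and> snd C p \<in> Q \<and> (\<forall>x\<in>model M. x \<in> Q \<longrightarrow> chart_inv C x \<in> fst C \<and> snd C (chart_inv C x) = x \<and> f (chart_inv C x) \<in> fst C')"
proof -
  obtain D D' W0 where *: "D \<in> max_atlas M" "D' \<in> max_atlas N" "openin (mtop M) W0" "p \<in> W0" "W0 \<subseteq> fst D"
     "f ` W0 \<subseteq> fst D'" and g: "smooth_germ (model M) (snd D' \<circ> f \<circ> chart_inv D) (snd D p)"
    using f unfolding smooth_at_def by blast
  note ch = max_atlas_is_chart[OF C(1)] max_atlas_is_chart[OF C'(1)] max_atlas_is_chart[OF *(1)] max_atlas_is_chart[OF *(2)]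
  have p: "p \<in> fst D" "f p \<in> fst D'" using * by auto
  have o': "openin (mtop N) (fst C' \<inter> fst D')" using ch by (auto simp: is_chart_def)
  obtain W1 where W1: "openin (mtop M) W1" "p \<in> W1" "f ` W1 \<subseteq> fst C' \<inter> fst D'"
    using smooth_at_continuous[OF M f o'] C' p by blast
  have oW: "openin (mtop M) (W0 \<inter> W1)" "p \<in> W0 \<inter> W1" using * W1 by auto
  obtain Q where Q: "open Q" "snd C p \<in> Q"
    "\<And>x. x \<in> model M \<Longrightarrow> x \<in> Q \<Longrightarrow> chart_inv C x \<in> W0 \<inter> W1 \<and> chart_inv C x \<in> fst C \<and> snd C (chart_inv C x) = x"
    using chart_nhd[OF ch(1) oW C(2)] by metis
  show "\<exists>Q. open Q \<and> snd C p \<in> Q \<and> (\<forall>x\<in>model M. x \<in> Q \<longrightarrow> chart_inv C x \<in> fst C \<and> snd C (chart_inv C x) = x \<and> f (chart_inv C x) \<in> fst C')"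
    by (rule exI[of _ Q]) (use Q W1 in auto)
  obtain Q' where Q': "open Q'" "snd D p \<in> Q'"
    "\<And>x. x \<in> model M \<Longrightarrow> x \<in> Q' \<Longrightarrow> chart_inv D x \<in> W0 \<inter> W1 \<and> chart_inv D x \<in> fst D \<and> snd D (chart_inv D x) = x"
    using chart_nhd[OF ch(3) oW p(1)] by metis
  have cp: "snd C p \<in> model M" "snd D p \<in> model M" "chart_inv C (snd C p) = p" "chart_inv D (snd D p) = p"
    using is_chart_model chart_inv_snd ch C p by metis+
  have t1: "smooth_germ (model M) (snd D \<circ> chart_inv C) (snd C p)" by (rule max_atlas_transition[OF M C(1) *(1) C(2) p(1)])
  have t2: "smooth_germ (model N) (snd C' \<circ> chart_inv D') (snd D' (f p))" by (rule max_atlas_transition[OF N *(2) C'(1) p(2) C'(2)])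
  have "smooth_germ (model M) (\<lambda>x. (snd C' \<circ> chart_inv D') ((snd D' \<circ> f \<circ> chart_inv D) x)) (snd D p)"
    by (rule smooth_germ_compose[OF g cp(2) Q'(1,2), where E' = "model N"])
       (use Q'(3) *(6) is_chart_model[OF ch(4)] t2 cp in \<open>auto simp: o_def image_subset_iff subset_iff\<close>)
  then have "smooth_germ (model M) (snd C' \<circ> f \<circ> chart_inv D) (snd D p)"
    by (rule smooth_germ_local[OF _ Q'(1,2)]) (use Q'(3) *(6) chart_inv_snd[OF ch(4)] in \<open>auto simp: o_def image_subset_iff subset_iff\<close>)
  then have "smooth_germ (model M) (\<lambda>x. (snd C' \<circ> f \<circ> chart_inv D) ((snd D \<circ> chart_inv C) x)) (snd C p)"
    by (intro smooth_germ_compose[OF t1 cp(1) Q(1,2), where E' = "model M"])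
       (use Q(3) *(5) is_chart_model[OF ch(3)] cp in \<open>auto simp: o_def image_subset_iff subset_iff\<close>)
  then show "smooth_germ (model M) (snd C' \<circ> f \<circ> chart_inv C) (snd C p)"
    by (rule smooth_germ_local[OF _ Q(1,2)]) (use Q(3) *(5) chart_inv_snd[OF ch(3)] in \<open>auto simp: o_def image_subset_iff subset_iff\<close>)
qed

lemma max_atlas_cover:
  assumes "smooth_manifold M" "p \<in> topspace (mtop M)"
  obtains C where "C \<in> max_atlas M" "p \<in> fst C"
  using atlas_cover[OF assms] by blast

lemma smooth_at_compose:
  assumes M: "smooth_manifold M" and N: "smooth_manifold N" and L: "smooth_manifold L"
    and f: "smooth_at M N f p" and g: "smooth_at N L g (f p)"
  shows "smooth_at M L (\<lambda>x. g (f x)) p"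
proof -
  obtain C where C: "C \<in> max_atlas M" "p \<in> fst C" using max_atlas_cover[OF M smooth_at_topspace(1)[OF f]] .
  obtain C' where C': "C' \<in> max_atlas N" "f p \<in> fst C'" using max_atlas_cover[OF N smooth_at_topspace(2)[OF f]] .
  obtain C'' where C'': "C'' \<in> max_atlas L" "g (f p) \<in> fst C''" using max_atlas_cover[OF L smooth_at_topspace(2)[OF g]] .
  note ch = max_atlas_is_chart[OF C(1)] max_atlas_is_chart[OF C'(1)] max_atlas_is_chart[OF C''(1)]
  have o: "openin (mtop M) (fst C)" "openin (mtop N) (fst C')" "openin (mtop L) (fst C'')"
    using ch by (auto simp: is_chart_def)
  obtain V where V: "openin (mtop N) V" "f p \<in> V" "g ` V \<subseteq> fst C''"
    using smooth_at_continuous[OF N g o(3) C''(2)] .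
  have oV: "openin (mtop N) (V \<inter> fst C')" "f p \<in> V \<inter> fst C'" using V o C' by auto
  obtain W where W: "openin (mtop M) W" "p \<in> W" "f ` W \<subseteq> V \<inter> fst C'"
    using smooth_at_continuous[OF M f oV] .
  have oW: "openin (mtop M) (W \<inter> fst C)" "p \<in> W \<inter> fst C" using W o C by auto
  obtain Q where Q: "open Q" "snd C p \<in> Q"
    "\<And>x. x \<in> model M \<Longrightarrow> x \<in> Q \<Longrightarrow> chart_inv C x \<in> W \<inter> fst C"
    using chart_nhd[OF ch(1) oW C(2)] by metis
  note gf = smooth_at_charts(1)[OF M N f C C']
  note gg = smooth_at_charts(1)[OF N L g C' C'']
  have cp: "snd C p \<in> model M" "chart_inv C (snd C p) = p" using is_chart_model chart_inv_snd ch C by metis+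
  have "smooth_germ (model M) (\<lambda>x. (snd C'' \<circ> g \<circ> chart_inv C') ((snd C' \<circ> f \<circ> chart_inv C) x)) (snd C p)"
    by (rule smooth_germ_compose[OF gf cp(1) Q(1,2), where E' = "model N"])
       (use Q(3) W(3) is_chart_model[OF ch(2)] gg cp in \<open>auto simp: o_def image_subset_iff subset_iff\<close>)
  then have "smooth_germ (model M) (snd C'' \<circ> (\<lambda>x. g (f x)) \<circ> chart_inv C) (snd C p)"
    by (rule smooth_germ_local[OF _ Q(1,2)]) (use Q(3) W(3) chart_inv_snd[OF ch(2)] in \<open>auto simp: o_def image_subset_iff subset_iff\<close>)
  then show ?thesis by (intro smooth_atI[OF C(1) C''(1) oW]) (use W V in auto)
qed

lemma smooth_map_imp_smooth_at:
  assumes M: "smooth_manifold M" and N: "smooth_manifold N" and f: "smooth_map M N f" and p: "p \<in> topspace (mtop M)"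
  shows "smooth_at M N f p"
proof -
  have c: "continuous_map (mtop M) (mtop N) f" using f by (simp add: smooth_map_def)
  have fp: "f p \<in> topspace (mtop N)" using c p by (auto simp: continuous_map_def)
  obtain A where A: "A \<in> atlas M" "A \<in> max_atlas M" "is_chart M A" "p \<in> fst A" using atlas_cover[OF M p] .
  obtain B where B: "B \<in> atlas N" "B \<in> max_atlas N" "is_chart N B" "f p \<in> fst B" using atlas_cover[OF N fp] .
  have o: "openin (mtop M) {x \<in> topspace (mtop M). f x \<in> fst B}"
    by (rule openin_continuous_map_preimage[OF c]) (use B(3) in \<open>simp add: is_chart_def\<close>)
  have oA: "openin (mtop M) (fst A)" using A(3) by (simp add: is_chart_def)
  let ?W = "{x \<in> topspace (mtop M). f x \<in> fst B} \<inter> fst A"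
  have oW: "openin (mtop M) ?W" "p \<in> ?W" using o oA A B p by auto
  obtain Q where Q: "open Q" "snd A p \<in> Q"
    "\<And>x. x \<in> model M \<Longrightarrow> x \<in> Q \<Longrightarrow> chart_inv A x \<in> ?W \<and> chart_inv A x \<in> fst A \<and> snd A (chart_inv A x) = x"
    by (rule chart_nhd[OF A(3) oW A(4)]) (rule that)
  have "smooth_germ (snd A ` (fst A \<inter> f -` fst B)) (snd B \<circ> f \<circ> chart_inv A) (snd A p)"
    using f A B unfolding smooth_map_def smooth_on_iff_germ by blast
  then have "smooth_germ (model M) (snd B \<circ> f \<circ> chart_inv A) (snd A p)"
  proof (rule smooth_germ_local[OF _ Q(1,2)])
    fix y assume "y \<in> model M" "y \<in> Q"
    from Q(3)[OF this] show "y \<in> snd A ` (fst A \<inter> f -` fst B) \<and> (snd B \<circ> f \<circ> chart_inv A) y = (snd B \<circ> f \<circ> chart_inv A) y"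
      by (auto intro!: image_eqI[of y "snd A" "chart_inv A y"])
  qed
  then show ?thesis by (intro smooth_atI[OF A(2) B(2) oW]) auto
qed

lemma smooth_at_imp_continuous_map_open:
  assumes M: "smooth_manifold M" and U: "openin (mtop M) U" and f: "\<And>p. p \<in> U \<Longrightarrow> smooth_at M N f p"
  shows "continuous_map (subtopology (mtop M) U) (mtop N) f"
  unfolding continuous_map_def
proof (intro conjI allI impI)
  have UT: "topspace (subtopology (mtop M) U) = U" using openin_subset[OF U] by auto
  show "f \<in> topspace (subtopology (mtop M) U) \<rightarrow> topspace (mtop N)" using smooth_at_topspace(2)[OF f] UT by auto
  fix V assume V: "openin (mtop N) V"
  have "openin (mtop M) {x \<in> U. f x \<in> V}"
  proof (subst openin_subopen, intro ballI)
    fix p assume p: "p \<in> {x \<in> U. f x \<in> V}"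
    then obtain W where W: "openin (mtop M) W" "p \<in> W" "f ` W \<subseteq> V"
      using smooth_at_continuous[OF M f V] by blast
    show "\<exists>T. openin (mtop M) T \<and> p \<in> T \<and> T \<subseteq> {x \<in> U. f x \<in> V}"
      by (rule exI[of _ "W \<inter> U"]) (use W p U in auto)
  qed
  then show "openin (subtopology (mtop M) U) {x \<in> topspace (subtopology (mtop M) U). f x \<in> V}"
    unfolding UT by (subst openin_open_subtopology[OF U]) auto
qed

lemma smooth_at_imp_continuous_map:
  assumes "smooth_manifold M" "\<And>p. p \<in> topspace (mtop M) \<Longrightarrow> smooth_at M N f p"
  shows "continuous_map (mtop M) (mtop N) f"
  using smooth_at_imp_continuous_map_open[OF assms(1) openin_topspace assms(2)] by simp

lemma smooth_at_imp_smooth_map: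
  assumes M: "smooth_manifold M" and N: "smooth_manifold N" and f: "\<And>p. p \<in> topspace (mtop M) \<Longrightarrow> smooth_at M N f p"
  shows "smooth_map M N f"
  unfolding smooth_map_def
proof (intro conjI ballI)
  show "continuous_map (mtop M) (mtop N) f" using smooth_at_imp_continuous_map[OF M f] .
  fix C C' assume "C \<in> atlas M" "C' \<in> atlas N"
  then have C: "C \<in> max_atlas M" "C' \<in> max_atlas N" using atlas_subset_max_atlas M N by blast+
  note ch = max_atlas_is_chart[OF C(1)] max_atlas_is_chart[OF C(2)]
  show "smooth_on (snd C ` (fst C \<inter> f -` fst C')) (snd C' \<circ> f \<circ> chart_inv C)"
    unfolding smooth_on_iff_germ
  proof (intro ballI)
    fix x assume "x \<in> snd C ` (fst C \<inter> f -` fst C')"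
    then obtain p where p: "p \<in> fst C" "f p \<in> fst C'" "x = snd C p" by auto
    have "smooth_germ (model M) (snd C' \<circ> f \<circ> chart_inv C) x"
      unfolding p(3) using is_chart_subset[OF ch(1)] p by (intro smooth_at_charts(1)[OF M N f] C) auto
    then show "smooth_germ (snd C ` (fst C \<inter> f -` fst C')) (snd C' \<circ> f \<circ> chart_inv C) x"
      by (rule smooth_germ_mono) (use is_chart_model[OF ch(1)] in auto)
  qed
qed

text \<open>With the identity as chart of a subspace, charts and their inverses are themselves
  smooth maps between manifolds, and coordinate calculations reduce to composition.\<close>

definition subspace_mfd :: "'e::euclidean_space set \<Rightarrow> ('e, 'e) mfd" where
  "subspace_mfd E = \<lparr>mtop = top_of_set E, model = E, atlas = {(E, id)}\<rparr>"

lemma subspace_mfd_simps [simp]: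
  "mtop (subspace_mfd E) = top_of_set E" "model (subspace_mfd E) = E" "atlas (subspace_mfd E) = {(E, id)}"
  by (simp_all add: subspace_mfd_def)

lemma chart_inv_id: "x \<in> E \<Longrightarrow> chart_inv (E, id) x = x"
  unfolding chart_inv_def by (metis fst_conv snd_conv id_apply inv_into_f_f inj_on_id)

lemma smooth_manifold_subspace_mfd:
  assumes "subspace E" shows "smooth_manifold (subspace_mfd E)"
proof -
  have "smooth_on E (id \<circ> chart_inv (E, id))"
    unfolding smooth_on_iff_germ
    by (intro ballI smooth_germ_local[OF smooth_germ_linear[OF linear_id] open_UNIV UNIV_I]) (simp add: chart_inv_id)
  then have "compatible_charts (E, id) (E, id)" by (simp add: compatible_charts_def)
  moreover have "second_countable (top_of_set E)"
  proof (rule second_countable_subtopology)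
    obtain \<B> :: "'a set set" where "countable \<B>" "topological_basis \<B>"
      using ex_countable_basis by blast
    then show "second_countable (euclidean :: 'a topology)"
      unfolding second_countable_def open_openin[symmetric]
      by (metis topological_basis_open topological_basisE)
  qed
  ultimately show ?thesis
    using assms by (simp add: smooth_manifold_def is_chart_def Hausdorff_space_subtopology subtopology_subtopology)
qed

lemma subspace_mfd_max_atlas: "subspace E \<Longrightarrow> (E, id) \<in> max_atlas (subspace_mfd E)"
  using atlas_subset_max_atlas[OF smooth_manifold_subspace_mfd] by auto

lemma smooth_at_subspaceI:
  assumes "subspace E" "subspace E'" "smooth_germ E f x" "x \<in> E" "open Q" "x \<in> Q" "\<And>y. y \<in> E \<Longrightarrow> y \<in> Q \<Longrightarrow> f y \<in> E'"
  shows "smooth_at (subspace_mfd E) (subspace_mfd E') f x"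
proof (rule smooth_atI[OF subspace_mfd_max_atlas[OF assms(1)] subspace_mfd_max_atlas[OF assms(2)]])
  show "openin (mtop (subspace_mfd E)) (E \<inter> Q)" using assms(5) by auto
  show "smooth_germ (model (subspace_mfd E)) (snd (E', id) \<circ> f \<circ> chart_inv (E, id)) (snd (E, id) x)"
    unfolding subspace_mfd_simps snd_conv
    by (rule smooth_germ_local[of E f "id x" Q]) (use assms in \<open>auto simp: chart_inv_id\<close>)
qed (use assms in auto)

lemma smooth_at_chart:
  assumes M: "smooth_manifold M" and C: "C \<in> max_atlas M" "p \<in> fst C"
  shows "smooth_at M (subspace_mfd (model M)) (snd C) p"
proof (rule smooth_atI[OF C(1) subspace_mfd_max_atlas[OF smooth_manifold_subspace[OF M]] _ C(2)])
  note ch = max_atlas_is_chart[OF C(1)]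
  show "openin (mtop M) (fst C)" using ch by (simp add: is_chart_def)
  obtain Q where Q: "open Q" "snd C p \<in> Q"
    "\<And>x. x \<in> model M \<Longrightarrow> x \<in> Q \<Longrightarrow> chart_inv C x \<in> fst C \<and> chart_inv C x \<in> fst C \<and> snd C (chart_inv C x) = x"
    using chart_nhd[OF ch \<open>openin (mtop M) (fst C)\<close> C(2) C(2)] by metis
  show "smooth_germ (model M) (snd (model M, id) \<circ> snd C \<circ> chart_inv C) (snd C p)"
    by (rule smooth_germ_local[OF smooth_germ_linear[OF linear_id] Q(1,2)]) (use Q in auto)
qed (use is_chart_model[OF max_atlas_is_chart[OF C(1)]] in auto)

lemma smooth_at_chart_inv:
  assumes M: "smooth_manifold M" and C: "C \<in> max_atlas M" "x \<in> snd C ` fst C"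
  shows "smooth_at (subspace_mfd (model M)) M (chart_inv C) x"
proof -
  note ch = max_atlas_is_chart[OF C(1)]
  have o: "openin (top_of_set (model M)) (snd C ` fst C)" using ch by (simp add: is_chart_def)
  then obtain Q where Q: "open Q" "snd C ` fst C = model M \<inter> Q" by (auto simp: openin_open)
  have 1: "chart_inv C y \<in> fst C" "snd C (chart_inv C y) = y" if "y \<in> snd C ` fst C" for y
    using that chart_inv_snd[OF ch] by auto
  show ?thesis
  proof (rule smooth_atI[OF subspace_mfd_max_atlas[OF smooth_manifold_subspace[OF M]] C(1) _ C(2)])
    show "smooth_germ (model (subspace_mfd (model M))) (snd C \<circ> chart_inv C \<circ> chart_inv (model M, id)) (snd (model M, id) x)"
      unfolding subspace_mfd_simps snd_conv
      by (rule smooth_germ_local[OF smooth_germ_linear[OF linear_id] Q(1)])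
         (use Q C 1 in \<open>auto simp: chart_inv_id\<close>)
  qed (use o 1 is_chart_model[OF ch] in auto)
qed

lemma smooth_at_const:
  assumes "smooth_manifold M" "smooth_manifold N" "p \<in> topspace (mtop M)" "q \<in> topspace (mtop N)"
  shows "smooth_at M N (\<lambda>_. q) p"
proof -
  obtain C where C: "C \<in> max_atlas M" "p \<in> fst C" using max_atlas_cover[OF assms(1,3)] .
  obtain C' where C': "C' \<in> max_atlas N" "q \<in> fst C'" using max_atlas_cover[OF assms(2,4)] .
  have "openin (mtop M) (fst C)" using max_atlas_is_chart[OF C(1)] by (simp add: is_chart_def)
  then show ?thesis
    by (rule smooth_atI[OF C(1) C'(1) _ C(2)]) (use C'(2) smooth_germ_const in \<open>auto simp: o_def\<close>)
qed

lemma smooth_at_id: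
  assumes "smooth_manifold M" "p \<in> topspace (mtop M)"
  shows "smooth_at M M (\<lambda>x. x) p"
proof -
  obtain C where C: "C \<in> max_atlas M" "p \<in> fst C" using max_atlas_cover[OF assms(1,2)] .
  have "openin (mtop M) (fst C)" using max_atlas_is_chart[OF C(1)] by (simp add: is_chart_def)
  then show ?thesis
    by (rule smooth_atI[OF C(1) C(1) _ C(2)])
       (use max_atlas_transition[OF assms(1) C(1) C(1) C(2) C(2)] in \<open>auto simp: o_def\<close>)
qed

text \<open>A map that is smooth in both directions composes with every atlas chart, which is
  compatibility. This is the source of all new charts below: the one centred at the identity, the
  slice chart there, and its translates.\<close>

theorem max_atlasI:
  assumes M: "smooth_manifold M" and U: "openin (mtop M) U" and V: "openin (top_of_set (model M)) V"
    and \<kappa>: "\<kappa> ` U = V" "\<And>q. q \<in> U \<Longrightarrow> \<xi> (\<kappa> q) = q"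
    and s: "\<And>q. q \<in> U \<Longrightarrow> smooth_at M (subspace_mfd (model M)) \<kappa> q"
      "\<And>x. x \<in> V \<Longrightarrow> smooth_at (subspace_mfd (model M)) M \<xi> x"
  shows "(U, \<kappa>) \<in> max_atlas M"
proof -
  let ?E = "model M"
  have E: "subspace ?E" using M by (rule smooth_manifold_subspace)
  note ME = smooth_manifold_subspace_mfd[OF E]
  have VE: "V \<subseteq> ?E" using V openin_imp_subset by blast
  have \<xi>: "\<xi> x \<in> U" "\<kappa> (\<xi> x) = x" if "x \<in> V" for x using that \<kappa> by auto
  have UT: "topspace (subtopology (mtop M) U) = U" using openin_subset[OF U] by auto
  have "continuous_map (subtopology (mtop M) U) (top_of_set ?E) \<kappa>"
    using smooth_at_imp_continuous_map_open[OF M U s(1)] by simp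
  then have c1: "continuous_map (subtopology (mtop M) U) (top_of_set V) \<kappa>"
    using \<kappa>(1) UT by (auto simp: continuous_map_in_subtopology)
  have "continuous_map (subtopology (top_of_set ?E) V) (mtop M) \<xi>"
    using smooth_at_imp_continuous_map_open[OF ME _ s(2)] V by simp
  then have "continuous_map (top_of_set V) (mtop M) \<xi>"
    using VE by (simp add: subtopology_subtopology Int_absorb1)
  then have c2: "continuous_map (top_of_set V) (subtopology (mtop M) U) \<xi>"
    using \<xi> by (auto simp: continuous_map_in_subtopology)
  have "homeomorphic_maps (subtopology (mtop M) U) (top_of_set V) \<kappa> \<xi>"
    unfolding homeomorphic_maps_def using c1 c2 \<xi>(2) \<kappa>(2) UT by simp
  then have ch: "is_chart M (U, \<kappa>)"
    unfolding is_chart_def using U V \<kappa>(1) homeomorphic_maps_map by (metis fst_conv snd_conv)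
  have ci: "chart_inv (U, \<kappa>) x = \<xi> x" if "x \<in> V" for x
    using chart_inv_snd[OF ch, of "\<xi> x"] \<xi>[OF that] by simp
  have "compatible_charts (U, \<kappa>) A" if A: "A \<in> atlas M" for A
  proof -
    have A': "A \<in> max_atlas M" "is_chart M A" using A atlas_subset_max_atlas[OF M] max_atlas_is_chart by blast+
    show ?thesis
      unfolding compatible_charts_def smooth_on_iff_germ fst_conv snd_conv
    proof (intro conjI ballI)
      fix x assume "x \<in> \<kappa> ` (U \<inter> fst A)"
      then obtain q where q: "q \<in> U" "q \<in> fst A" "x = \<kappa> q" by auto
      then have x: "x \<in> V" "\<xi> x = q" using \<kappa> by auto
      have "smooth_germ ?E (snd A \<circ> \<xi> \<circ> chart_inv (?E, id)) x"
        using smooth_at_charts(1)[OF ME M s(2)[OF x(1)] subspace_mfd_max_atlas[OF E] _ A'(1)] x VE q by auto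
      then show "smooth_germ (\<kappa> ` (U \<inter> fst A)) (snd A \<circ> chart_inv (U, \<kappa>)) x"
      proof (rule smooth_germ_local[OF _ open_UNIV UNIV_I])
        fix y assume "y \<in> \<kappa> ` (U \<inter> fst A)"
        then have "y \<in> V" using \<kappa> by auto
        then show "y \<in> ?E \<and> (snd A \<circ> \<xi> \<circ> chart_inv (?E, id)) y = (snd A \<circ> chart_inv (U, \<kappa>)) y"
          using VE ci chart_inv_id[of y ?E] by auto
      qed
    next
      fix x assume "x \<in> snd A ` (U \<inter> fst A)"
      then obtain q where q: "q \<in> U" "q \<in> fst A" "x = snd A q" by auto
      have "smooth_germ ?E (snd (?E, id) \<circ> \<kappa> \<circ> chart_inv A) (snd A q)"
        using smooth_at_charts(1)[OF M ME s(1)[OF q(1)] A'(1) q(2) subspace_mfd_max_atlas[OF E]] \<kappa>(1) VE q(1) by auto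
      then show "smooth_germ (snd A ` (U \<inter> fst A)) (\<kappa> \<circ> chart_inv A) x"
        unfolding q(3)
        by (rule smooth_germ_local[OF _ open_UNIV UNIV_I]) (use is_chart_model[OF A'(2)] in auto)
    qed
  qed
  with ch show ?thesis by (simp add: max_atlas_def)
qed

text \<open>The germ of \<open>m\<close> is read in the product chart \<open>AB\<close> and composed
  with the pair of coordinate expressions of \<open>f\<close> and \<open>g\<close>; continuity for
  the product topology provides the neighbourhoods.\<close>

theorem smooth_at_binary:
  assumes L: "smooth_manifold L" and M: "smooth_manifold M" and N: "smooth_manifold N" and R: "smooth_manifold R"
    and m: "smooth_map (prod_mfd M N) R (\<lambda>(x, y). m x y)"
    and f: "smooth_at L M f p" and g: "smooth_at L N g p"
  shows "smooth_at L R (\<lambda>x. m (f x) (g x)) p"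
proof -
  have c: "continuous_map (prod_topology (mtop M) (mtop N)) (mtop R) (\<lambda>(x, y). m x y)"
    using m by (simp add: smooth_map_def prod_mfd_def)
  obtain C where C: "C \<in> max_atlas L" "p \<in> fst C" using max_atlas_cover[OF L smooth_at_topspace(1)[OF f]] .
  have fp: "f p \<in> topspace (mtop M)" "g p \<in> topspace (mtop N)" using smooth_at_topspace(2)[OF f] smooth_at_topspace(2)[OF g] by auto
  have mp: "m (f p) (g p) \<in> topspace (mtop R)" using c fp by (auto simp: continuous_map_def Pi_iff)
  obtain A where A: "A \<in> atlas M" "A \<in> max_atlas M" "is_chart M A" "f p \<in> fst A" using atlas_cover[OF M fp(1)] .
  obtain B where B: "B \<in> atlas N" "B \<in> max_atlas N" "is_chart N B" "g p \<in> fst B" using atlas_cover[OF N fp(2)] .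
  obtain D where D: "D \<in> atlas R" "D \<in> max_atlas R" "is_chart R D" "m (f p) (g p) \<in> fst D" using atlas_cover[OF R mp] .
  define AB where "AB = (fst A \<times> fst B, map_prod (snd A) (snd B))"
  have AB: "AB \<in> atlas (prod_mfd M N)" using A(1) B(1) unfolding prod_mfd_def AB_def mfd.simps by blast
  have injAB: "inj_on (map_prod (snd A) (snd B)) (fst A \<times> fst B)"
    using is_chart_inj[OF A(3)] is_chart_inj[OF B(3)] by (rule map_prod_inj_on)
  have ciAB: "chart_inv AB (snd A u, snd B v) = (u, v)" if "u \<in> fst A" "v \<in> fst B" for u v
    using inv_into_f_f[OF injAB, of "(u, v)"] that by (simp add: chart_inv_def AB_def)
  let ?S = "snd AB ` (fst AB \<inter> (\<lambda>(x, y). m x y) -` fst D)"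
  have sm: "smooth_on ?S (snd D \<circ> (\<lambda>(x, y). m x y) \<circ> chart_inv AB)"
    using m AB D(1) unfolding smooth_map_def by blast
  have S: "(snd A u, snd B v) \<in> ?S" if "u \<in> fst A" "v \<in> fst B" "m u v \<in> fst D" for u v
    using that by (force simp: AB_def intro!: image_eqI[of _ _ "(u, v)"])
  have gm: "smooth_germ ?S (snd D \<circ> (\<lambda>(x, y). m x y) \<circ> chart_inv AB) (snd A (f p), snd B (g p))"
    using sm S[OF A(4) B(4) D(4)] unfolding smooth_on_iff_germ by blast
  have "openin (prod_topology (mtop M) (mtop N)) {z \<in> topspace (prod_topology (mtop M) (mtop N)). (\<lambda>(x, y). m x y) z \<in> fst D}"
    by (rule openin_continuous_map_preimage[OF c]) (use D(3) in \<open>simp add: is_chart_def\<close>)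
  then obtain U V where UV: "openin (mtop M) U" "openin (mtop N) V" "f p \<in> U" "g p \<in> V"
     "U \<times> V \<subseteq> {z \<in> topspace (prod_topology (mtop M) (mtop N)). (\<lambda>(x, y). m x y) z \<in> fst D}"
  proof -
    assume a: "openin (prod_topology (mtop M) (mtop N)) {z \<in> topspace (prod_topology (mtop M) (mtop N)). (\<lambda>(x, y). m x y) z \<in> fst D}"
    have "(f p, g p) \<in> {z \<in> topspace (prod_topology (mtop M) (mtop N)). (\<lambda>(x, y). m x y) z \<in> fst D}" using fp D(4) by simp
    from iffD1[OF openin_prod_topology_alt a, rule_format, OF this] show thesis
      by (elim exE conjE) (rule that)
  qed
  have mD: "m u v \<in> fst D" if "u \<in> U" "v \<in> V" for u v using UV(5) that by auto
  have oU: "openin (mtop M) (U \<inter> fst A)" "f p \<in> U \<inter> fst A" using UV A by (auto simp: is_chart_def)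
  have oV: "openin (mtop N) (V \<inter> fst B)" "g p \<in> V \<inter> fst B" using UV B by (auto simp: is_chart_def)
  obtain W1 where W1: "openin (mtop L) W1" "p \<in> W1" "f ` W1 \<subseteq> U \<inter> fst A" using smooth_at_continuous[OF L f oU] .
  obtain W2 where W2: "openin (mtop L) W2" "p \<in> W2" "g ` W2 \<subseteq> V \<inter> fst B" using smooth_at_continuous[OF L g oV] .
  note chC = max_atlas_is_chart[OF C(1)]
  have oC: "openin (mtop L) (fst C)" using chC by (simp add: is_chart_def)
  define W where "W = W1 \<inter> W2 \<inter> fst C"
  have W: "openin (mtop L) W" "p \<in> W" "W \<subseteq> fst C" using W1 W2 oC C by (auto simp: W_def)
  have fW: "f q \<in> U" "f q \<in> fst A" "g q \<in> V" "g q \<in> fst B" if "q \<in> W" for q using that W1 W2 by (auto simp: W_def)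
  obtain Q where Q: "open Q" "snd C p \<in> Q" "\<And>x. x \<in> model L \<Longrightarrow> x \<in> Q \<Longrightarrow> chart_inv C x \<in> W"
    using chart_nhd[OF chC W(1,2) C(2)] by metis
  have cp: "snd C p \<in> model L" "chart_inv C (snd C p) = p" using is_chart_model[OF chC] chart_inv_snd[OF chC] C by auto
  note gf = smooth_at_charts(1)[OF L M f C A(2,4)]
  note gg = smooth_at_charts(1)[OF L N g C B(2,4)]
  have "smooth_germ (model L) (\<lambda>x. (snd D \<circ> (\<lambda>(x, y). m x y) \<circ> chart_inv AB) ((snd A \<circ> f \<circ> chart_inv C) x, (snd B \<circ> g \<circ> chart_inv C) x)) (snd C p)"
  proof (rule smooth_germ_compose[OF smooth_germ_Pair[OF gf gg] cp(1) Q(1,2), where E' = ?S])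
    fix x assume "x \<in> model L" "x \<in> Q"
    then have "chart_inv C x \<in> W" by (rule Q(3))
    then show "((snd A \<circ> f \<circ> chart_inv C) x, (snd B \<circ> g \<circ> chart_inv C) x) \<in> ?S"
      using S[OF fW(2) fW(4) mD[OF fW(1,3)]] unfolding o_apply by blast
  next
    show "smooth_germ ?S (snd D \<circ> (\<lambda>(x, y). m x y) \<circ> chart_inv AB) ((snd A \<circ> f \<circ> chart_inv C) (snd C p), (snd B \<circ> g \<circ> chart_inv C) (snd C p))"
      using gm unfolding o_apply cp(2) .
  qed
  then have "smooth_germ (model L) (snd D \<circ> (\<lambda>x. m (f x) (g x)) \<circ> chart_inv C) (snd C p)"
    by (rule smooth_germ_local[OF _ Q(1,2)]) (use Q(3) fW ciAB in auto)
  then show ?thesis by (intro smooth_atI[OF C(1) D(2) W]) (use fW mD in auto)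
qed

section \<open>Derivatives of maps in coordinates\<close>

definition cderiv :: "('a, 'e::euclidean_space) mfd \<Rightarrow> ('a, 'e) chart \<Rightarrow> ('b, 'f::euclidean_space) chart \<Rightarrow> ('a \<Rightarrow> 'b) \<Rightarrow> 'a \<Rightarrow> 'e \<Rightarrow> 'f" where
  "cderiv M C C' f p = frechet_derivative (snd C' \<circ> f \<circ> chart_inv C) (at (snd C p) within model M)"

lemma cderiv_has_derivative:
  assumes "smooth_manifold M" "smooth_manifold N" "smooth_at M N f p" "C \<in> max_atlas M" "p \<in> fst C" "C' \<in> max_atlas N" "f p \<in> fst C'"
  shows "((snd C' \<circ> f \<circ> chart_inv C) has_derivative cderiv M C C' f p) (at (snd C p) within model M)"
  using smooth_germ_has_derivative[OF smooth_at_charts(1)[OF assms] is_chart_model[OF max_atlas_is_chart[OF assms(4)] assms(5)]]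
  unfolding cderiv_def by (metis differentiableI frechet_derivative_works)

lemma cderiv_linear:
  assumes "smooth_manifold M" "smooth_manifold N" "smooth_at M N f p" "C \<in> max_atlas M" "p \<in> fst C" "C' \<in> max_atlas N" "f p \<in> fst C'"
  shows "linear (cderiv M C C' f p)"
  using cderiv_has_derivative[OF assms] has_derivative_linear by blast

lemma cderiv_unique:
  assumes "smooth_manifold M" "C \<in> max_atlas M" "p \<in> fst C"
    "((snd C' \<circ> f \<circ> chart_inv C) has_derivative D) (at (snd C p) within model M)" "v \<in> model M"
  shows "cderiv M C C' f p v = D v"
proof -
  have "((snd C' \<circ> f \<circ> chart_inv C) has_derivative cderiv M C C' f p) (at (snd C p) within model M)"
    using assms(4) unfolding cderiv_def by (metis differentiableI frechet_derivative_works)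
  from has_derivative_unique_subspace[OF smooth_manifold_subspace[OF assms(1)] is_chart_model[OF max_atlas_is_chart[OF assms(2)] assms(3)] this assms(4,5)]
  show ?thesis .
qed

lemma cderiv_in:
  assumes "smooth_manifold M" "smooth_manifold N" "smooth_at M N f p" "C \<in> max_atlas M" "p \<in> fst C" "C' \<in> max_atlas N" "f p \<in> fst C'"
    and "v \<in> model M"
  shows "cderiv M C C' f p v \<in> model N"
proof -
  obtain Q where Q: "open Q" "snd C p \<in> Q" "\<forall>x\<in>model M. x \<in> Q \<longrightarrow> f (chart_inv C x) \<in> fst C'"
    using smooth_at_charts(2)[OF assms(1-7)] by blast
  show ?thesis
    by (rule has_derivative_in_subspace[OF cderiv_has_derivative[OF assms(1-7)] _ _ Q(1,2) _ _ assms(8)])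
       (use Q(3) is_chart_model[OF max_atlas_is_chart[OF assms(4)] assms(5)] is_chart_model[OF max_atlas_is_chart[OF assms(6)]]
         smooth_manifold_subspace assms(1,2) in \<open>auto simp: o_def\<close>)
qed

lemma cderiv_compose:
  assumes M: "smooth_manifold M" and N: "smooth_manifold N" and L: "smooth_manifold L"
    and f: "smooth_at M N f p" and g: "smooth_at N L g (f p)"
    and C: "C \<in> max_atlas M" "p \<in> fst C" and C': "C' \<in> max_atlas N" "f p \<in> fst C'"
    and C'': "C'' \<in> max_atlas L" "g (f p) \<in> fst C''" and v: "v \<in> model M"
  shows "cderiv M C C'' (\<lambda>x. g (f x)) p v = cderiv N C' C'' g (f p) (cderiv M C C' f p v)"
proof -
  obtain Q where Q: "open Q" "snd C p \<in> Q" "\<forall>x\<in>model M. x \<in> Q \<longrightarrow> f (chart_inv C x) \<in> fst C'"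
    using smooth_at_charts(2)[OF M N f C C'] by blast
  note ch = max_atlas_is_chart[OF C(1)] max_atlas_is_chart[OF C'(1)]
  have cp: "snd C p \<in> model M" "chart_inv C (snd C p) = p" using is_chart_model chart_inv_snd ch C by metis+
  have "((\<lambda>x. (snd C'' \<circ> g \<circ> chart_inv C') ((snd C' \<circ> f \<circ> chart_inv C) x)) has_derivative
     (\<lambda>v. cderiv N C' C'' g (f p) (cderiv M C C' f p v))) (at (snd C p) within model M)"
    by (rule has_derivative_chain_subspace[OF cderiv_has_derivative[OF M N f C C'] cp(1) Q(1,2), where E' = "model N"])
       (use Q(3) is_chart_model[OF ch(2)] cderiv_has_derivative[OF N L g C' C''] cp in \<open>auto simp: o_def\<close>)
  then have "((snd C'' \<circ> (\<lambda>x. g (f x)) \<circ> chart_inv C) has_derivative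
     (\<lambda>v. cderiv N C' C'' g (f p) (cderiv M C C' f p v))) (at (snd C p) within model M)"
    by (rule has_derivative_within_local[OF _ Q(1,2) cp(1)]) (use Q(3) chart_inv_snd[OF ch(2)] in auto)
  from cderiv_unique[OF M C this v] show ?thesis .
qed

lemma cderiv_local:
  assumes M: "smooth_manifold M" and N: "smooth_manifold N" and f: "smooth_at M N f p"
    and C: "C \<in> max_atlas M" "p \<in> fst C" and C': "C' \<in> max_atlas N" "f p \<in> fst C'"
    and W: "openin (mtop M) W" "p \<in> W" "\<And>q. q \<in> W \<Longrightarrow> f q = g q" and v: "v \<in> model M"
  shows "cderiv M C C' g p v = cderiv M C C' f p v"
proof -
  note ch = max_atlas_is_chart[OF C(1)]
  obtain Q where Q: "open Q" "snd C p \<in> Q" "\<And>x. x \<in> model M \<Longrightarrow> x \<in> Q \<Longrightarrow> chart_inv C x \<in> W"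
    using chart_nhd[OF ch W(1,2) C(2)] by metis
  have "((snd C' \<circ> g \<circ> chart_inv C) has_derivative cderiv M C C' f p) (at (snd C p) within model M)"
    by (rule has_derivative_within_local[OF cderiv_has_derivative[OF M N f C C'] Q(1,2) is_chart_model[OF ch C(2)]])
       (use Q(3) W(3) in auto)
  from cderiv_unique[OF M C this v] show ?thesis .
qed

lemma cderiv_id:
  assumes M: "smooth_manifold M" and C: "C \<in> max_atlas M" "p \<in> fst C" and v: "v \<in> model M"
  shows "cderiv M C C (\<lambda>x. x) p v = v"
proof -
  note ch = max_atlas_is_chart[OF C(1)]
  have o: "openin (mtop M) (fst C)" using ch by (simp add: is_chart_def)
  obtain Q where Q: "open Q" "snd C p \<in> Q" "\<And>x. x \<in> model M \<Longrightarrow> x \<in> Q \<Longrightarrow> snd C (chart_inv C x) = x"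
    using chart_nhd[OF ch o C(2) C(2)] by metis
  have "((snd C \<circ> (\<lambda>x. x) \<circ> chart_inv C) has_derivative (\<lambda>v. v)) (at (snd C p) within model M)"
    by (rule has_derivative_within_local[OF has_derivative_ident Q(1,2) is_chart_model[OF ch C(2)]]) (use Q(3) in auto)
  from cderiv_unique[OF M C this v] show ?thesis .
qed

section \<open>Exponential coordinates of a Lie group\<close>

lemma tame_cong:
  assumes "tame E f L" "\<delta> > 0" "0 \<in> E" "subspace E" "\<And>x. x \<in> E \<Longrightarrow> norm x \<le> \<delta> \<Longrightarrow> f x = g x"
  shows "tame E g L"
proof -
  obtain R c where R: "R > 0" "R \<le> \<delta>" "c \<ge> 0" "tame_on E f L R c" using tameE[OF assms(1,2)] by metis
  have fg: "f x = g x" if "x \<in> E" "norm x \<le> R" for x using assms(5) that R(2) by auto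
  have "tame_on E g L R c"
    unfolding tame_on_def
  proof (intro conjI allI impI)
    fix s x y assume *: "x \<in> E" "y \<in> E" "norm x \<le> s" "norm y \<le> s" "s \<le> R"
    show "norm (g x - g y - L (x - y)) \<le> c * s * norm (x - y)"
      using tame_onD1[OF R(4) *] fg[of x] fg[of y] * by auto
  next
    fix x d assume *: "x \<in> E" "d \<in> E" "norm x \<le> R" "norm (x + d) \<le> R" "norm (x - d) \<le> R"
    show "norm (g (x + d) + g (x - d) - 2 *\<^sub>R g x) \<le> c * (norm d)\<^sup>2"
      using tame_onD2[OF R(4) *] fg[OF *(1,3)] fg[OF subspace_add[OF assms(4) *(1,2)] *(4)]
        fg[OF subspace_diff[OF assms(4) *(1,2)] *(5)] by simp
  qed
  moreover have "g 0 = 0" using assms fg[of 0] R(1) by (simp add: tame_def)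
  ultimately show ?thesis using assms(1) R unfolding tame_def by blast
qed

lemma tame_linear_cong:
  assumes "tame E f L" "linear L'" "\<And>v. v \<in> E \<Longrightarrow> L v = L' v" "subspace E"
  shows "tame E f L'"
proof -
  have "tame_on E f L R c = tame_on E f L' R c" for R c
    unfolding tame_on_def using assms(3) subspace_diff[OF assms(4)] by (simp cong: imp_cong)
  then show ?thesis using assms unfolding tame_def by blast
qed

lemma smooth_at_subspaceD:
  assumes "subspace E" "subspace E'" "smooth_at (subspace_mfd E) (subspace_mfd E') f x"
  shows "smooth_germ E f x" "\<exists>Q. open Q \<and> x \<in> Q \<and> (\<forall>y\<in>E. y \<in> Q \<longrightarrow> f y \<in> E')"
proof -
  note ME = smooth_manifold_subspace_mfd[OF assms(1)] smooth_manifold_subspace_mfd[OF assms(2)]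
  note C = subspace_mfd_max_atlas[OF assms(1)] subspace_mfd_max_atlas[OF assms(2)]
  have x: "x \<in> fst (E, id)" "f x \<in> fst (E', id)" using smooth_at_topspace[OF assms(3)] by auto
  note 1 = smooth_at_charts[OF ME assms(3) C(1) x(1) C(2) x(2), unfolded subspace_mfd_simps snd_conv fst_conv]
  have "smooth_germ E (id \<circ> f \<circ> chart_inv (E, id)) x" using 1(1) by simp
  then show "smooth_germ E f x"
    by (rule smooth_germ_local[OF _ open_UNIV UNIV_I]) (simp add: chart_inv_id)
  show "\<exists>Q. open Q \<and> x \<in> Q \<and> (\<forall>y\<in>E. y \<in> Q \<longrightarrow> f y \<in> E')"
  proof -
    obtain Q where Q: "open Q" "id x \<in> Q" "\<forall>u\<in>E. u \<in> Q \<longrightarrow> f (chart_inv (E, id) u) \<in> E'"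
      using 1(2) by auto
    show ?thesis by (rule exI[of _ Q]) (use Q chart_inv_id[of _ E] in auto)
  qed
qed

lemma open_contains_cball_subspace:
  assumes "open Q" "(0::'a::real_normed_vector) \<in> Q"
  obtains \<delta> where "\<delta> > 0" "\<And>x. norm x \<le> \<delta> \<Longrightarrow> x \<in> Q"
proof -
  obtain \<delta> where "\<delta> > 0" "cball 0 \<delta> \<subseteq> Q" using assms open_contains_cball[of Q] by metis
  then show thesis using that[of \<delta>] by (simp add: subset_iff)
qed

section \<open>Coordinates centred at the identity\<close>

locale lie =
  fixes G :: "'g monoid" (structure) and M :: "('g, 'e::euclidean_space) mfd"
  assumes LG: "lie_group G M"
begin

abbreviation "E \<equiv> model M"

lemma group: "group G" and M: "smooth_manifold M" and top: "topspace (mtop M) = carrier G"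
  using LG by (auto simp: lie_group_def)

sublocale group G by (rule group)

lemma subE: "subspace E" using M by (rule smooth_manifold_subspace)
lemma ME: "smooth_manifold (subspace_mfd E)" by (rule smooth_manifold_subspace_mfd[OF subE])
lemma E0: "0 \<in> E" using subE by (rule subspace_0)

lemma smooth_at_mult:
  assumes "smooth_manifold L" "smooth_at L M f p" "smooth_at L M g p"
  shows "smooth_at L M (\<lambda>x. f x \<otimes> g x) p"
proof -
  have "smooth_map (prod_mfd M M) M (\<lambda>(x, y). x \<otimes> y)" using LG by (simp add: lie_group_def)
  from smooth_at_binary[OF assms(1) M M M this assms(2,3)] show ?thesis .
qed

lemma smooth_at_inverse:
  assumes "smooth_manifold L" "smooth_at L M f p"
  shows "smooth_at L M (\<lambda>x. inv (f x)) p"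
proof (rule smooth_at_compose[OF assms(1) M M assms(2)])
  have "smooth_map M M (\<lambda>x. inv x)" using LG by (simp add: lie_group_def)
  from smooth_map_imp_smooth_at[OF M M this smooth_at_topspace(2)[OF assms(2)]]
  show "smooth_at M M (\<lambda>x. inv x) (f p)" .
qed

lemma smooth_at_const_carrier:
  "smooth_manifold L \<Longrightarrow> p \<in> topspace (mtop L) \<Longrightarrow> g \<in> carrier G \<Longrightarrow> smooth_at L M (\<lambda>_. g) p"
  by (rule smooth_at_const[OF _ M]) (simp_all add: top)

lemma smooth_at_ident: "p \<in> carrier G \<Longrightarrow> smooth_at M M (\<lambda>x. x) p"
  by (rule smooth_at_id[OF M]) (simp add: top)

text \<open>The same choice as the one made inside \<open>differential\<close> at the identity, so
  that the differential of an automorphism there unfolds to a derivative in this chart.\<close>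

definition base_chart :: "('g, 'e) chart" where "base_chart = (SOME C. C \<in> charts_at M \<one>)"

lemma base_chart: "base_chart \<in> charts_at M \<one>"
proof -
  have "\<one> \<in> topspace (mtop M)" using top by simp
  then obtain A where "A \<in> atlas M" "\<one> \<in> fst A" using atlas_cover[OF M] by metis
  then have "A \<in> charts_at M \<one>" by (simp add: charts_at_def)
  then show ?thesis unfolding base_chart_def by (rule someI)
qed

text \<open>Translated so that the identity has coordinate 0, the point at which \<open>tame\<close>
  is stated. This chart need not belong to \<open>atlas M\<close>, so tangent vectors are still read
  at \<open>base_chart\<close>.\<close>

definition CC :: "('g, 'e) chart" where
  "CC = (fst base_chart, \<lambda>g. snd base_chart g - snd base_chart \<one>)"

abbreviation y where "y \<equiv> snd CC"
abbreviation \<psi> where "\<psi> \<equiv> chart_inv CC"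

lemma base_chart_max: "base_chart \<in> max_atlas M" "\<one> \<in> fst base_chart"
  using base_chart atlas_subset_max_atlas[OF M] by (auto simp: charts_at_def)

lemma smooth_at_translation: "c \<in> E \<Longrightarrow> x \<in> E \<Longrightarrow> smooth_at (subspace_mfd E) (subspace_mfd E) (\<lambda>x. x + c) x"
  by (rule smooth_at_subspaceI[OF subE subE smooth_germ_add[OF smooth_germ_linear[OF linear_id, unfolded id_def] smooth_germ_const] _ open_UNIV])
     (auto intro: subspace_add[OF subE])

lemma CC_max: "CC \<in> max_atlas M"
proof -
  let ?C = base_chart and ?c = "snd base_chart \<one>"
  note C = base_chart_max
  note ch = max_atlas_is_chart[OF C(1)]
  have c: "?c \<in> E" "- ?c \<in> E" using is_chart_model[OF ch C(2)] subspace_neg[OF subE] by auto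
  show ?thesis
    unfolding CC_def
  proof (rule max_atlasI[OF M, where V = "(\<lambda>x. x + - ?c) ` (snd ?C ` fst ?C)" and \<xi> = "\<lambda>x. chart_inv ?C (x + ?c)"])
    show "openin (mtop M) (fst ?C)" using ch by (simp add: is_chart_def)
    have "openin (top_of_set E) (snd ?C ` fst ?C)" using ch by (simp add: is_chart_def)
    then obtain Q where Q: "open Q" "snd ?C ` fst ?C = E \<inter> Q" by (auto simp: openin_open)
    have "(\<lambda>x. x + - ?c) ` (E \<inter> Q) = E \<inter> (\<lambda>x. x + ?c) -` Q"
    proof (intro equalityI subsetI)
      fix x assume "x \<in> E \<inter> (\<lambda>x. x + ?c) -` Q"
      then show "x \<in> (\<lambda>x. x + - ?c) ` (E \<inter> Q)" using c subE by (intro image_eqI[of _ _ "x + ?c"]) (auto intro: subspace_add)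
    qed (use c subE in \<open>auto intro: subspace_diff\<close>)
    moreover have "open ((\<lambda>x. x + ?c) -` Q)" by (intro open_vimage Q(1) continuous_intros)
    ultimately show "openin (top_of_set E) ((\<lambda>x. x + - ?c) ` (snd ?C ` fst ?C))" using Q(2) by auto
    show "(\<lambda>g. snd ?C g - ?c) ` fst ?C = (\<lambda>x. x + - ?c) ` (snd ?C ` fst ?C)" by (simp add: image_image)
    show "chart_inv ?C (snd ?C q - ?c + ?c) = q" if "q \<in> fst ?C" for q using chart_inv_snd[OF ch that] by simp
    show "smooth_at M (subspace_mfd E) (\<lambda>g. snd ?C g - ?c) q" if q: "q \<in> fst ?C" for q
      using smooth_at_compose[OF M ME ME smooth_at_chart[OF M C(1) q] smooth_at_translation[OF c(2)]]
        is_chart_model[OF ch q] by simp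
    show "smooth_at (subspace_mfd E) M (\<lambda>x. chart_inv ?C (x + ?c)) x" if x: "x \<in> (\<lambda>x. x + - ?c) ` (snd ?C ` fst ?C)" for x
    proof (rule smooth_at_compose[OF ME ME M smooth_at_translation[OF c(1)]])
      show "x \<in> E" using x c is_chart_model[OF ch] subE by (auto intro: subspace_diff)
      show "smooth_at (subspace_mfd E) M (chart_inv ?C) (x + ?c)"
        using x by (intro smooth_at_chart_inv[OF M C(1)]) auto
    qed
  qed
qed

lemma CC_chart: "is_chart M CC" by (rule max_atlas_is_chart[OF CC_max])
lemma CC_open: "openin (mtop M) (fst CC)" using CC_chart by (simp add: is_chart_def)
lemma CC_carrier: "g \<in> fst CC \<Longrightarrow> g \<in> carrier G" using is_chart_subset[OF CC_chart] top by auto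
lemma CC_one [simp]: "\<one> \<in> fst CC" "y \<one> = 0" using base_chart_max by (auto simp: CC_def)
lemma yE: "g \<in> fst CC \<Longrightarrow> y g \<in> E" by (rule is_chart_model[OF CC_chart])
lemma \<psi>y: "g \<in> fst CC \<Longrightarrow> \<psi> (y g) = g" by (rule chart_inv_snd[OF CC_chart])
lemma \<psi>0 [simp]: "\<psi> 0 = \<one>" using \<psi>y[OF CC_one(1)] by simp
lemma smooth_at_y: "g \<in> fst CC \<Longrightarrow> smooth_at M (subspace_mfd E) y g" by (rule smooth_at_chart[OF M CC_max])
lemma smooth_at_\<psi>: "g \<in> fst CC \<Longrightarrow> smooth_at (subspace_mfd E) M \<psi> (y g)" by (rule smooth_at_chart_inv[OF M CC_max]) simp
lemma smooth_at_\<psi>0: "smooth_at (subspace_mfd E) M \<psi> 0" using smooth_at_\<psi>[OF CC_one(1)] by simp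

lemma nhd_coord:
  assumes "openin (mtop M) W" "\<one> \<in> W"
  obtains \<delta> where "\<delta> > 0" "\<And>x. x \<in> E \<Longrightarrow> norm x \<le> \<delta> \<Longrightarrow> \<psi> x \<in> W \<and> \<psi> x \<in> fst CC \<and> y (\<psi> x) = x"
proof -
  obtain Q where Q: "open Q" "y \<one> \<in> Q"
    "\<And>x. x \<in> E \<Longrightarrow> x \<in> Q \<Longrightarrow> \<psi> x \<in> W \<and> \<psi> x \<in> fst CC \<and> y (\<psi> x) = x"
    using chart_nhd[OF CC_chart assms CC_one(1)] by metis
  obtain \<delta> where "\<delta> > 0" "\<And>x. norm x \<le> \<delta> \<Longrightarrow> x \<in> Q" using open_contains_cball_subspace[OF Q(1)] Q(2) by auto
  then show thesis using that Q(3) by blast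
qed

definition Bd :: "real \<Rightarrow> 'g set" where "Bd r = {g \<in> fst CC. norm (y g) < r}"

lemma Bd_open: "openin (mtop M) (Bd r)"
  using chart_open_vimage[OF CC_chart open_ball[of 0 r]] by (simp add: Bd_def dist_norm)
lemma Bd_one [simp]: "r > 0 \<Longrightarrow> \<one> \<in> Bd r" by (simp add: Bd_def)
lemma Bd_carrier: "g \<in> Bd r \<Longrightarrow> g \<in> carrier G" using CC_carrier by (simp add: Bd_def)
lemma Bd_mono: "r \<le> s \<Longrightarrow> Bd r \<subseteq> Bd s" by (auto simp: Bd_def)

lemma nhd_Bd:
  assumes "openin (mtop M) W" "\<one> \<in> W"
  obtains \<delta> where "\<delta> > 0" "Bd \<delta> \<subseteq> W"
proof -
  obtain \<delta> where "\<delta> > 0" "\<And>x. x \<in> E \<Longrightarrow> norm x \<le> \<delta> \<Longrightarrow> \<psi> x \<in> W" using nhd_coord[OF assms] by metis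
  then show thesis using that[of \<delta>] yE \<psi>y by (force simp: Bd_def)
qed

abbreviation "EE \<equiv> E \<times> E"

lemma subEE: "subspace EE" using subE subE by (rule subspace_Times)
lemma MEE: "smooth_manifold (subspace_mfd EE)" by (rule smooth_manifold_subspace_mfd[OF subEE])

definition \<mu> :: "'e \<times> 'e \<Rightarrow> 'e" where "\<mu> z = y (\<psi> (fst z) \<otimes> \<psi> (snd z))"

lemma smooth_at_fst_snd:
  assumes "z \<in> EE"
  shows "smooth_at (subspace_mfd EE) (subspace_mfd E) fst z" "smooth_at (subspace_mfd EE) (subspace_mfd E) snd z"
proof -
  have "linear (fst :: 'e \<times> 'e \<Rightarrow> 'e)" "linear (snd :: 'e \<times> 'e \<Rightarrow> 'e)" by (simp_all add: linear_fst linear_snd)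
  from smooth_at_subspaceI[OF subEE subE smooth_germ_linear[OF this(1)] assms open_UNIV]
    smooth_at_subspaceI[OF subEE subE smooth_germ_linear[OF this(2)] assms open_UNIV]
  show "smooth_at (subspace_mfd EE) (subspace_mfd E) fst z" "smooth_at (subspace_mfd EE) (subspace_mfd E) snd z"
    by auto
qed

lemma smooth_at_\<mu>0: "smooth_at (subspace_mfd EE) (subspace_mfd E) \<mu> 0"
proof -
  have 0: "0 \<in> EE" using E0 by (simp add: zero_prod_def)
  have "smooth_at (subspace_mfd EE) M (\<lambda>z. \<psi> (fst z)) 0" "smooth_at (subspace_mfd EE) M (\<lambda>z. \<psi> (snd z)) 0"
    using smooth_at_compose[OF MEE ME M smooth_at_fst_snd(1)[OF 0]] smooth_at_compose[OF MEE ME M smooth_at_fst_snd(2)[OF 0]]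
      smooth_at_\<psi>0 by auto
  then have "smooth_at (subspace_mfd EE) M (\<lambda>z. \<psi> (fst z) \<otimes> \<psi> (snd z)) 0" by (rule smooth_at_mult[OF MEE])
  from smooth_at_compose[OF MEE M ME this smooth_at_y] show ?thesis by (simp add: \<mu>_def[abs_def])
qed

text \<open>On each of the two axes multiplication is the identity in coordinates, and a linear map
  is determined by its restrictions to them.\<close>

lemma \<mu>_has_derivative:
  obtains D where "(\<mu> has_derivative D) (at 0 within EE)" "\<And>v. v \<in> EE \<Longrightarrow> D v = fst v + snd v"
proof -
  have 0: "0 \<in> EE" using E0 by (simp add: zero_prod_def)
  obtain D where D: "(\<mu> has_derivative D) (at 0 within EE)"
    using smooth_germ_has_derivative[OF smooth_at_subspaceD(1)[OF subEE subE smooth_at_\<mu>0] 0] .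
  have l: "linear D" using D by (rule has_derivative_linear)
  obtain \<delta> where \<delta>: "\<delta> > 0" "\<And>x. x \<in> E \<Longrightarrow> norm x \<le> \<delta> \<Longrightarrow> \<psi> x \<in> fst CC \<and> y (\<psi> x) = x"
    using nhd_coord[OF CC_open] by auto
  have key: "D v = w" if v: "v \<in> EE" and w: "w \<in> E" "\<And>t. norm (t *\<^sub>R w) \<le> \<delta> \<Longrightarrow> \<mu> (t *\<^sub>R v) = t *\<^sub>R w" for v w
  proof -
    have d: "((\<lambda>t. t *\<^sub>R w) has_vector_derivative w) (at (0::real))"
      by (auto intro!: derivative_eq_intros)
    have "\<forall>\<^sub>F t in nhds (0::real). norm (t *\<^sub>R w) < \<delta>"
    proof (rule order_tendstoD(2)[where y = 0])
      have "((\<lambda>t::real. norm (t *\<^sub>R w)) \<longlongrightarrow> norm (0 *\<^sub>R w)) (nhds 0)" by (intro tendsto_intros) (simp add: filterlim_ident)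
      then show "((\<lambda>t::real. norm (t *\<^sub>R w)) \<longlongrightarrow> 0) (nhds 0)" by simp
    qed (rule \<delta>(1))
    then obtain S where S: "open S" "0 \<in> S" "\<And>t. t \<in> S \<Longrightarrow> norm (t *\<^sub>R w) < \<delta>" unfolding eventually_nhds by auto
    have "((\<lambda>t. \<mu> (0 + t *\<^sub>R v)) has_vector_derivative w) (at 0)"
      by (rule has_vector_derivative_transform_within_open[OF d S(1,2)]) (use S(3) w(2) in \<open>auto simp: less_imp_le\<close>)
    with has_derivative_along_subspace[OF subEE 0 D v] show ?thesis by (rule vector_derivative_unique_at)
  qed
  have "D v = fst v + snd v" if vE: "v \<in> EE" for v
  proof -
    obtain a b where v: "v = (a, b)" "a \<in> E" "b \<in> E" using vE by blast
    have "D (a, 0) = a" "D (0, b) = b"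
      by (rule key; use v E0 \<delta>(2) CC_carrier subspace_scale[OF subE] in \<open>auto simp: \<mu>_def\<close>)+
    then have "D ((a, 0) + (0, b)) = a + b" using linear_add[OF l] by metis
    then show ?thesis using v by simp
  qed
  with D show thesis by (rule that)
qed

lemma tame_\<mu>: "tame EE \<mu> (\<lambda>z. fst z + snd z)"
proof -
  obtain D where D: "(\<mu> has_derivative D) (at 0 within EE)" "\<And>v. v \<in> EE \<Longrightarrow> D v = fst v + snd v"
    using \<mu>_has_derivative by blast
  have "tame EE \<mu> D"
    by (rule smooth_imp_tame[OF subEE smooth_at_subspaceD(1)[OF subEE subE smooth_at_\<mu>0] _ D(1)]) (simp add: \<mu>_def)
  moreover have "linear (\<lambda>z::'e \<times> 'e. fst z + snd z)" by (auto intro!: linearI simp: algebra_simps)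
  ultimately show ?thesis using D(2) subEE by (rule tame_linear_cong)
qed

end

text \<open>\<open>rt\<close> is the square root near the identity, \<open>lg\<close> the logarithm
  in coordinates, obtained from rescaled iterated roots, and \<open>ex\<close> its local inverse.
  Roots live on \<open>Bd R\<close>; the smaller radius \<open>r0\<close> is where \<open>lg\<close>
  and \<open>ex\<close> invert each other.\<close>

locale lie_log = lie G M for G :: "'g monoid" (structure) and M :: "('g, 'e::euclidean_space) mfd" +
  fixes rt :: "'g \<Rightarrow> 'g" and lg :: "'g \<Rightarrow> 'e" and ex :: "'e \<Rightarrow> 'g" and R r0 :: real
  assumes R: "R > 0" and r0: "r0 > 0" "r0 \<le> R"
    and \<psi>R: "\<And>x. x \<in> E \<Longrightarrow> norm x \<le> R \<Longrightarrow> \<psi> x \<in> fst CC \<and> y (\<psi> x) = x"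
    and rt: "\<And>g. g \<in> Bd R \<Longrightarrow> rt g \<in> Bd R \<and> norm (y (rt g)) \<le> (2/3) * norm (y g) \<and> rt g \<otimes> rt g = g \<and> smooth_at M M rt g"
    and rt_sq: "\<And>g. g \<in> Bd R \<Longrightarrow> rt (g \<otimes> g) = g"
    and lg: "\<And>g. g \<in> Bd R \<Longrightarrow> (\<lambda>n. 2 ^ n *\<^sub>R y ((rt ^^ n) g)) \<longlonglongrightarrow> lg g"
    and ex: "\<And>X. X \<in> E \<Longrightarrow> norm X < r0 \<Longrightarrow> ex X \<in> Bd R \<and> lg (ex X) = X"
    and ex_lg: "\<And>g. g \<in> Bd r0 \<Longrightarrow> ex (lg g) = g"
    and tame_ex: "tame E (\<lambda>X. y (ex X)) (\<lambda>v. v)" and tame_lg: "tame E (\<lambda>x. lg (\<psi> x)) (\<lambda>v. v)"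

section \<open>Existence of the local square root and its linearisation\<close>

context lie
begin

text \<open>Half the squaring map has derivative the identity at 0, so it can be inverted;
  substituting \<open>(1/2) *\<^sub>R x\<close> into the inverse yields a root with derivative 1/2,
  the form that the linearisation theorem requires.\<close>

lemma local_square_root:
  obtains g \<delta> where "\<delta> > 0"
    "\<And>x. x \<in> E \<Longrightarrow> norm x \<le> \<delta> \<Longrightarrow> \<psi> x \<in> fst CC \<and> y (\<psi> x) = x \<and> smooth_germ E g x \<and> g x \<in> E \<and> norm (g x) \<le> \<delta>
       \<and> \<psi> (g x) \<in> fst CC \<and> y (\<psi> (g x)) = g x \<and> \<psi> (g x) \<otimes> \<psi> (g x) = \<psi> x \<and> (\<forall>h\<in>fst CC. y h = x \<longrightarrow> \<psi> (g (y (h \<otimes> h))) = h)"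
    "tame E g (\<lambda>v. (1/2) *\<^sub>R v)"
proof -
  define sq where "sq = (\<lambda>x. y (\<psi> x \<otimes> \<psi> x))"
  have "smooth_at (subspace_mfd E) M (\<lambda>x. \<psi> x \<otimes> \<psi> x) 0"
    by (rule smooth_at_mult[OF ME smooth_at_\<psi>0 smooth_at_\<psi>0])
  note sqM = this
  have "smooth_at (subspace_mfd E) (subspace_mfd E) sq 0"
    using smooth_at_compose[OF ME M ME sqM smooth_at_y] by (simp add: sq_def)
  note sq = smooth_at_subspaceD[OF subE subE this]
  define f where "f = (\<lambda>x. (1/2) *\<^sub>R sq x)"
  have f0: "f 0 = 0" by (simp add: f_def sq_def)
  have fg: "smooth_germ E f 0"
    unfolding f_def by (rule smooth_germ_compose_linear[OF sq(1) E0]) (simp add: linear_scaleR)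
  obtain W1 where W1: "openin (mtop (subspace_mfd E)) W1" "0 \<in> W1" "(\<lambda>x. \<psi> x \<otimes> \<psi> x) ` W1 \<subseteq> fst CC"
    using smooth_at_continuous[OF ME sqM CC_open] by auto
  obtain W2 where W2: "open W2" "W1 = E \<inter> W2" using W1(1) by (auto simp: openin_open)
  obtain \<delta>0 where \<delta>0: "\<delta>0 > 0" "\<And>x. x \<in> E \<Longrightarrow> norm x \<le> \<delta>0 \<Longrightarrow> \<psi> x \<in> fst CC \<and> y (\<psi> x) = x"
    using nhd_coord[OF CC_open CC_one(1)] by metis
  obtain Q where Q: "open Q" "0 \<in> Q" "\<forall>x\<in>E. x \<in> Q \<longrightarrow> sq x \<in> E" using sq(2) by blast
  define W where "W = W2 \<inter> ball 0 \<delta>0 \<inter> Q"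
  have W: "open W" "0 \<in> W" using W1 W2 Q \<delta>0 by (auto simp: W_def)
  have Wp: "\<psi> x \<in> fst CC" "y (\<psi> x) = x" "\<psi> x \<otimes> \<psi> x \<in> fst CC" "f x \<in> E" if "x \<in> E" "x \<in> W" for x
    using that \<delta>0(2)[of x] W1(3) W2(2) Q(3) subE by (auto simp: W_def f_def subspace_scale image_subset_iff)
  obtain D where D: "(\<mu> has_derivative D) (at 0 within EE)" "\<And>v. v \<in> EE \<Longrightarrow> D v = fst v + snd v"
    using \<mu>_has_derivative by blast
  have "linear (\<lambda>x::'e. (x, x))" by (auto intro!: linearI)
  then have dd: "((\<lambda>x::'e. (x, x)) has_derivative (\<lambda>x. (x, x))) (at 0 within E)"
    using linear_imp_has_derivative by blast
  have "((\<lambda>x. \<mu> (x, x)) has_derivative (\<lambda>v. D (v, v))) (at 0 within E)"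
    by (rule has_derivative_chain_subspace[OF dd E0 open_UNIV UNIV_I, where E' = EE]) (use D(1) in \<open>auto simp: zero_prod_def\<close>)
  then have "(sq has_derivative (\<lambda>v. D (v, v))) (at 0 within E)" by (simp add: sq_def \<mu>_def)
  then have fd: "(f has_derivative (\<lambda>v. (1/2) *\<^sub>R D (v, v))) (at 0 within E)"
    unfolding f_def by (rule has_derivative_scaleR_right)
  have fd1: "(1/2) *\<^sub>R D (v, v) = v" if "v \<in> E" for v
    using D(2)[of "(v, v)"] that by (simp flip: scaleR_2)
  obtain U V k where UV: "open U" "open V" "0 \<in> U" "U \<subseteq> W" "f 0 \<in> V"
    "f ` (E \<inter> U) = E \<inter> V" "k ` (E \<inter> V) = E \<inter> U"
    "\<And>x. x \<in> E \<Longrightarrow> x \<in> U \<Longrightarrow> k (f x) = x" "\<And>x. x \<in> E \<Longrightarrow> x \<in> V \<Longrightarrow> f (k x) = x"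
    "\<And>x. x \<in> E \<Longrightarrow> x \<in> V \<Longrightarrow> smooth_germ E k x"
  proof (rule smooth_germ_inverse[OF subE E0 fg W Wp(4) fd fd1])
    fix U V k assume "open U" "open V" "0 \<in> U" "U \<subseteq> W" "f 0 \<in> V"
      "f ` (E \<inter> U) = E \<inter> V" "k ` (E \<inter> V) = E \<inter> U"
      "\<And>x. x \<in> E \<Longrightarrow> x \<in> U \<Longrightarrow> k (f x) = x" "\<And>x. x \<in> E \<Longrightarrow> x \<in> V \<Longrightarrow> f (k x) = x"
      "\<And>x. x \<in> E \<Longrightarrow> x \<in> V \<Longrightarrow> smooth_germ E k x"
    then show thesis by (rule that)
  qed
  define g where "g = (\<lambda>x. k ((1/2) *\<^sub>R x))"
  have V0: "0 \<in> V" using UV(5) f0 by simp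
  have k0: "k 0 = 0" using UV(8)[OF E0 UV(3)] f0 by simp
  have half: "linear (\<lambda>x::'e. (1/2) *\<^sub>R x)" by (simp add: linear_scaleR)
  have halfE: "(1/2) *\<^sub>R x \<in> E" if "x \<in> E" for x using that subE by (simp add: subspace_scale)
  have gg: "smooth_germ E g x" if "x \<in> E" "(1/2) *\<^sub>R x \<in> V" for x
    unfolding g_def
    by (rule smooth_germ_compose[OF smooth_germ_linear[OF half] that(1) open_UNIV UNIV_I, where E' = E])
       (use that UV(10) halfE in auto)
  have g0: "g 0 = 0" by (simp add: g_def k0)
  obtain Dk where Dk: "(k has_derivative Dk) (at 0 within E)"
    using smooth_germ_has_derivative[OF UV(10)[OF E0 V0] E0] .
  have kE: "k x \<in> E" if "x \<in> E" "x \<in> V" for x using UV(7) that by blast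
  have Dk1: "Dk v = v" if v: "v \<in> E" for v
  proof -
    have "((\<lambda>x. f (k x)) has_derivative (\<lambda>v. (1/2) *\<^sub>R D (Dk v, Dk v))) (at 0 within E)"
      by (rule has_derivative_chain_subspace[OF Dk E0 UV(2) V0 kE]) (use fd k0 in auto)
    then have "((\<lambda>x. x) has_derivative (\<lambda>v. (1/2) *\<^sub>R D (Dk v, Dk v))) (at 0 within E)"
      by (rule has_derivative_within_local[OF _ UV(2) V0 E0]) (use UV(9) in auto)
    from has_derivative_unique_subspace[OF subE E0 has_derivative_ident this v]
    have "v = (1/2) *\<^sub>R D (Dk v, Dk v)" .
    also have "\<dots> = Dk v" by (rule fd1, rule has_derivative_in_subspace[OF Dk subE E0 UV(2) V0 kE subE v])
    finally show ?thesis by simp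
  qed
  have hd: "((\<lambda>x::'e. (1/2) *\<^sub>R x) has_derivative (\<lambda>x. (1/2) *\<^sub>R x)) (at 0 within E)"
    using linear_imp_has_derivative[OF half] .
  have gd: "(g has_derivative (\<lambda>v. Dk ((1/2) *\<^sub>R v))) (at 0 within E)"
    unfolding g_def by (rule has_derivative_chain_subspace[OF hd E0 open_UNIV UNIV_I halfE]) (use Dk in auto)
  have "tame E g (\<lambda>v. Dk ((1/2) *\<^sub>R v))"
    by (rule smooth_imp_tame[OF subE gg g0 gd]) (use E0 V0 in auto)
  then have tg: "tame E g (\<lambda>v. (1/2) *\<^sub>R v)"
    using half by (rule tame_linear_cong) (use Dk1 halfE subE in auto)
  obtain \<delta>1 where \<delta>1: "\<delta>1 > 0" "\<And>x. norm x \<le> \<delta>1 \<Longrightarrow> x \<in> U" using open_contains_cball_subspace[OF UV(1,3)] by metis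
  obtain \<delta>2 where \<delta>2: "\<delta>2 > 0" "\<And>x. norm x \<le> \<delta>2 \<Longrightarrow> x \<in> V" using open_contains_cball_subspace[OF UV(2) V0] by metis
  obtain Rg c where Rg: "Rg > 0" "Rg \<le> min \<delta>1 \<delta>2" "c \<ge> 0" "tame_on E g (\<lambda>v. (1/2) *\<^sub>R v) Rg c"
    using tameE[OF tg, of "min \<delta>1 \<delta>2"] \<delta>1(1) \<delta>2(1) by (metis min_less_iff_conj)
  \<comment> \<open>\<open>Rg\<close> keeps \<open>x\<close> in both neighbourhoods \<open>U\<close>
    and \<open>V\<close>; now \<open>c' * Rg' \<le> 1/2\<close> gives
    \<open>norm (g x) \<le> norm x\<close>, so that the ball is mapped into itself.\<close>
  obtain Rg' c' where Rg': "Rg' > 0" "Rg' \<le> min Rg (1/2)" "tame_on E g (\<lambda>v. (1/2) *\<^sub>R v) Rg' c'" "c' * Rg' \<le> min Rg (1/2)"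
    using tameE[OF tg, of "min Rg (1/2)"] Rg(1) by (metis min_less_iff_conj half_gt_zero zero_less_one)
  show thesis
  proof (rule that[of Rg' g])
    show "Rg' > 0" by fact
    show "tame E g (\<lambda>v. (1/2) *\<^sub>R v)" by (rule tg)
    fix x assume x: "x \<in> E" "norm x \<le> Rg'"
    have xs: "x \<in> U" "x \<in> V" using \<delta>1(2)[of x] \<delta>2(2)[of x] x Rg(2) Rg'(2) by auto
    have "norm ((1/2) *\<^sub>R x) \<le> norm x" by simp
    then have "norm ((1/2) *\<^sub>R x) \<le> \<delta>2" using x Rg(2) Rg'(2) by linarith
    then have hV: "(1/2) *\<^sub>R x \<in> V" by (rule \<delta>2(2))
    have gx: "g x \<in> E" "g x \<in> U" using UV(7) halfE[OF x(1)] hV unfolding g_def by blast+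
    have fgx: "f (g x) = (1/2) *\<^sub>R x" unfolding g_def using UV(9)[OF halfE[OF x(1)] hV] .
    have xW: "x \<in> W" "g x \<in> W" using xs gx UV(4) by auto
    note w = Wp[OF x(1) xW(1)] and wg = Wp[OF gx(1) xW(2)]
    have "sq (g x) = x" using arg_cong[OF fgx, of "\<lambda>v. 2 *\<^sub>R v"] by (simp add: f_def)
    then have sqr: "\<psi> (g x) \<otimes> \<psi> (g x) = \<psi> x"
      using \<psi>y[OF wg(3)] by (simp add: sq_def)
    have "norm (g x - (1/2) *\<^sub>R x) \<le> c' * Rg' * norm x"
      using tame_onD1[OF Rg'(3) x(1) E0 x(2) _ order_refl] Rg'(1) g0 by simp
    also have "\<dots> \<le> (1/2) * norm x" using Rg'(4) by (intro mult_right_mono) auto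
    finally have "norm (g x) \<le> norm x" using norm_triangle_ineq2[of "g x" "(1/2) *\<^sub>R x"] by simp
    moreover have "\<psi> (g (y (h \<otimes> h))) = h" if h: "h \<in> fst CC" "y h = x" for h
    proof -
      have hx: "h = \<psi> x" using \<psi>y[OF h(1)] h(2) by simp
      then have "y (h \<otimes> h) = sq x" by (simp add: sq_def)
      then have "g (y (h \<otimes> h)) = k (f x)" by (simp add: g_def f_def)
      then show ?thesis using UV(8)[OF x(1) xs(1)] hx by simp
    qed
    ultimately show "\<psi> x \<in> fst CC \<and> y (\<psi> x) = x \<and> smooth_germ E g x \<and> g x \<in> E \<and> norm (g x) \<le> Rg'
       \<and> \<psi> (g x) \<in> fst CC \<and> y (\<psi> (g x)) = g x \<and> \<psi> (g x) \<otimes> \<psi> (g x) = \<psi> x \<and> (\<forall>h\<in>fst CC. y h = x \<longrightarrow> \<psi> (g (y (h \<otimes> h))) = h)"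
      using w wg gx gg[OF x(1) hV] sqr x(2) by auto
  qed
qed

theorem lie_log_exists: "\<exists>rt lg ex R r0. lie_log G M rt lg ex R r0"
proof -
  obtain g \<delta> where \<delta>: "\<delta> > 0"
    and g: "\<And>x. x \<in> E \<Longrightarrow> norm x \<le> \<delta> \<Longrightarrow> \<psi> x \<in> fst CC \<and> y (\<psi> x) = x \<and> smooth_germ E g x \<and> g x \<in> E \<and> norm (g x) \<le> \<delta>
       \<and> \<psi> (g x) \<in> fst CC \<and> y (\<psi> (g x)) = g x \<and> \<psi> (g x) \<otimes> \<psi> (g x) = \<psi> x \<and> (\<forall>h\<in>fst CC. y h = x \<longrightarrow> \<psi> (g (y (h \<otimes> h))) = h)"
    and tg: "tame E g (\<lambda>v. (1/2) *\<^sub>R v)"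
    by (rule local_square_root, rule that, assumption+)
  obtain \<Phi> R1 where R1: "R1 > 0" and t\<Phi>: "tame E \<Phi> (\<lambda>v. v)"
    and \<Phi>E: "\<And>x. x \<in> E \<Longrightarrow> norm x \<le> R1 \<Longrightarrow> \<Phi> x \<in> E \<and> g x \<in> E \<and> norm (g x) \<le> (2/3) * norm x"
    and \<Phi>: "\<And>x. x \<in> E \<Longrightarrow> norm x \<le> R1 \<Longrightarrow> (\<lambda>n. 2 ^ n *\<^sub>R (g ^^ n) x) \<longlonglongrightarrow> \<Phi> x"
    by (rule koenigs_linearization[OF subE tg \<delta>]) (use g in auto)
  obtain \<epsilon> R2 where R2: "R2 > 0" and t\<epsilon>: "tame E \<epsilon> (\<lambda>v. v)"
    and \<epsilon>: "\<And>X. X \<in> E \<Longrightarrow> norm X \<le> R2 \<Longrightarrow> \<epsilon> X \<in> E \<and> \<Phi> (\<epsilon> X) = X \<and> norm (\<epsilon> X) \<le> 2 * norm X"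
    and \<epsilon>': "\<And>x. x \<in> E \<Longrightarrow> norm x \<le> R2 \<Longrightarrow> \<epsilon> (\<Phi> x) = x"
    by (rule tame_local_inverse[OF subE t\<Phi> R1]) (use \<Phi>E in auto)
  define R where "R = min R1 \<delta>"
  \<comment> \<open>\<open>\<epsilon>\<close> at most doubles norms, so half of \<open>R\<close>
    keeps \<open>ex\<close> in \<open>Bd R\<close>.\<close>
  define r0 where "r0 = min R2 (R / 2)"
  have R: "R > 0" "R \<le> R1" "R \<le> \<delta>" using R1 \<delta> by (auto simp: R_def)
  have r0: "r0 > 0" "r0 \<le> R2" "2 * r0 \<le> R" using R R2 by (auto simp: r0_def)
  define rt where "rt = (\<lambda>h. \<psi> (g (y h)))"
  define lg where "lg = (\<lambda>h. \<Phi> (y h))"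
  define ex where "ex = (\<lambda>X. \<psi> (\<epsilon> X))"
  have Bd: "h \<in> fst CC" "y h \<in> E" "norm (y h) \<le> R" "norm (y h) \<le> R1" "norm (y h) \<le> \<delta>" "norm (y h) < R" if "h \<in> Bd R" for h
    using that yE R by (auto simp: Bd_def)
  have rt1: "rt h \<in> Bd R \<and> y (rt h) = g (y h) \<and> norm (y (rt h)) \<le> (2/3) * norm (y h)" if h: "h \<in> Bd R" for h
  proof -
    note b = Bd[OF h]
    have "norm (g (y h)) \<le> (2/3) * norm (y h)" using \<Phi>E b by auto
    moreover from this have "norm (g (y h)) < R" using b(6) norm_ge_zero[of "y h"] by linarith
    ultimately show ?thesis using g[OF b(2,5)] by (auto simp: rt_def Bd_def)
  qed
  have rtn: "(rt ^^ n) h \<in> Bd R \<and> y ((rt ^^ n) h) = (g ^^ n) (y h)" if "h \<in> Bd R" for h n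
    by (induction n) (use that rt1 in auto)
  have "lie_log G M rt lg ex R r0"
  proof (intro lie_log.intro lie_axioms lie_log_axioms.intro)
    show "R > 0" "r0 > 0" "r0 \<le> R" using R r0 by auto
    show "\<psi> x \<in> fst CC \<and> y (\<psi> x) = x" if "x \<in> E" "norm x \<le> R" for x using g[of x] that R by auto
    show "rt h \<in> Bd R \<and> norm (y (rt h)) \<le> (2/3) * norm (y h) \<and> rt h \<otimes> rt h = h \<and> smooth_at M M rt h" if h: "h \<in> Bd R" for h
    proof -
      note b = Bd[OF h]
      note gh = g[OF b(2,5)]
      have "smooth_at (subspace_mfd E) (subspace_mfd E) g (y h)"
      proof (rule smooth_at_subspaceI[OF subE subE _ b(2) open_ball[of 0 R]])
        show "smooth_germ E g (y h)" using gh by simp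
        show "g x \<in> E" if "x \<in> E" "x \<in> ball 0 R" for x using g[of x] that R by auto
      qed (use b in auto)
      moreover have "smooth_at (subspace_mfd E) M \<psi> (g (y h))" using smooth_at_\<psi>[of "\<psi> (g (y h))"] gh by simp
      ultimately have "smooth_at (subspace_mfd E) M (\<lambda>x. \<psi> (g x)) (y h)" by (rule smooth_at_compose[OF ME ME M])
      from smooth_at_compose[OF M ME M smooth_at_y[OF b(1)] this] have "smooth_at M M rt h" by (simp add: rt_def[abs_def])
      moreover have "rt h \<otimes> rt h = h" using gh \<psi>y[OF b(1)] by (simp add: rt_def)
      ultimately show ?thesis using rt1[OF h] by blast
    qed
    show "rt (h \<otimes> h) = h" if h: "h \<in> Bd R" for h
      using g[OF Bd(2,5)[OF h]] Bd(1)[OF h] by (simp add: rt_def)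
    show "(\<lambda>n. 2 ^ n *\<^sub>R y ((rt ^^ n) h)) \<longlonglongrightarrow> lg h" if h: "h \<in> Bd R" for h
      using \<Phi>[OF Bd(2,4)[OF h]] rtn[OF h] by (simp add: lg_def)
    show "ex X \<in> Bd R \<and> lg (ex X) = X" if X: "X \<in> E" "norm X < r0" for X
    proof -
      have e: "\<epsilon> X \<in> E" "\<Phi> (\<epsilon> X) = X" "norm (\<epsilon> X) \<le> 2 * norm X" using \<epsilon>[of X] X r0 by auto
      then have "norm (\<epsilon> X) < R" using X r0 by auto
      then show ?thesis using g[OF e(1)] e R by (auto simp: ex_def lg_def Bd_def)
    qed
    show "ex (lg h) = h" if h: "h \<in> Bd r0" for h
    proof -
      have "h \<in> fst CC" "norm (y h) \<le> R2" using h r0 by (auto simp: Bd_def)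
      then show ?thesis using \<epsilon>'[OF yE] \<psi>y by (simp add: ex_def lg_def)
    qed
    show "tame E (\<lambda>X. y (ex X)) (\<lambda>v. v)"
    proof (rule tame_cong[OF t\<epsilon> r0(1) E0 subE])
      fix X assume X: "X \<in> E" "norm X \<le> r0"
      then have e: "\<epsilon> X \<in> E" "norm (\<epsilon> X) \<le> 2 * norm X" using \<epsilon>[of X] r0 by auto
      then have "norm (\<epsilon> X) \<le> \<delta>" using X r0 R by auto
      then show "\<epsilon> X = y (ex X)" using g[OF e(1)] by (simp add: ex_def)
    qed
    show "tame E (\<lambda>x. lg (\<psi> x)) (\<lambda>v. v)"
      by (rule tame_cong[OF t\<Phi> \<delta> E0 subE]) (use g in \<open>auto simp: lg_def\<close>)
  qed
  then show ?thesis by blast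
qed

end

text \<open>The deviation from the linear part is at most
  \<open>c * norm (x n) * norm (2 ^ n *\<^sub>R x n)\<close>, a null sequence times a bounded one.
  By this limit the logarithm passes through homomorphisms and products.\<close>

lemma tame_scaled_limit:
  assumes "tame E f L" "subspace E" "\<And>n. x n \<in> E" "x \<longlonglongrightarrow> 0" "(\<lambda>n. 2 ^ n *\<^sub>R x n) \<longlonglongrightarrow> l"
  shows "(\<lambda>n. 2 ^ n *\<^sub>R f (x n)) \<longlonglongrightarrow> L l"
proof -
  obtain R c where R: "R > 0" "R \<le> 1" "c \<ge> 0" "tame_on E f L R c" "c * R \<le> 1" using tameE[OF assms(1), of 1] by auto
  have L: "linear L" "f 0 = 0" using assms(1) by (auto simp: tame_def)
  have "(\<lambda>n. norm (x n)) \<longlonglongrightarrow> 0" using assms(4) tendsto_norm_zero by blast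
  then have ev: "\<forall>\<^sub>F n in sequentially. norm (x n) < R" using R(1) by (rule order_tendstoD(2))
  have "(\<lambda>n. 2 ^ n *\<^sub>R f (x n) - L (2 ^ n *\<^sub>R x n)) \<longlonglongrightarrow> 0"
  proof (rule Lim_null_comparison)
    show "\<forall>\<^sub>F n in sequentially. norm (2 ^ n *\<^sub>R f (x n) - L (2 ^ n *\<^sub>R x n)) \<le> c * norm (x n) * norm (2 ^ n *\<^sub>R x n)"
      using ev
    proof (rule eventually_mono)
      fix n assume "norm (x n) < R"
      then have "norm (f (x n) - L (x n)) \<le> c * norm (x n) * norm (x n)"
        using tame_onD1[OF R(4) assms(3)[of n] subspace_0[OF assms(2)] order_refl] L(2) by simp
      then have "2 ^ n * norm (f (x n) - L (x n)) \<le> 2 ^ n * (c * norm (x n) * norm (x n))" by simp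
      moreover have "2 ^ n *\<^sub>R f (x n) - L (2 ^ n *\<^sub>R x n) = 2 ^ n *\<^sub>R (f (x n) - L (x n))"
        by (simp add: linear_cmul[OF L(1)] scaleR_diff_right)
      ultimately show "norm (2 ^ n *\<^sub>R f (x n) - L (2 ^ n *\<^sub>R x n)) \<le> c * norm (x n) * norm (2 ^ n *\<^sub>R x n)"
        by (simp add: mult_ac)
    qed
    have "(\<lambda>n. c * norm (x n) * norm (2 ^ n *\<^sub>R x n)) \<longlonglongrightarrow> c * norm (0::'a) * norm l"
      by (intro tendsto_intros assms)
    then show "(\<lambda>n. c * norm (x n) * norm (2 ^ n *\<^sub>R x n)) \<longlonglongrightarrow> 0" by simp
  qed
  moreover have "(\<lambda>n. L (2 ^ n *\<^sub>R x n)) \<longlonglongrightarrow> L l"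
    using bounded_linear.tendsto[OF _ assms(5), of L] L(1) by (simp add: linear_conv_bounded_linear)
  ultimately show ?thesis using tendsto_add by fastforce
qed

context lie
begin

lemma small_binary:
  assumes "smooth_at (subspace_mfd EE) M (\<lambda>z. F (\<psi> (fst z)) (\<psi> (snd z))) 0" "openin (mtop M) W" "F \<one> \<one> \<in> W"
  obtains \<delta> where "\<delta> > 0" "\<And>a b. a \<in> Bd \<delta> \<Longrightarrow> b \<in> Bd \<delta> \<Longrightarrow> F a b \<in> W"
proof -
  obtain S where S: "openin (mtop (subspace_mfd EE)) S" "0 \<in> S" "(\<lambda>z. F (\<psi> (fst z)) (\<psi> (snd z))) ` S \<subseteq> W"
    using smooth_at_continuous[OF MEE assms(1,2)] assms(3) by auto
  obtain Q where Q: "open Q" "S = EE \<inter> Q" using S(1) by (auto simp: openin_open)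
  obtain \<delta> where \<delta>: "\<delta> > 0" "\<And>x. norm x \<le> \<delta> \<Longrightarrow> x \<in> Q" using open_contains_cball_subspace[OF Q(1)] S(2) Q(2) by blast
  show thesis
  proof (rule that[of "\<delta> / 2"])
    fix a b assume ab: "a \<in> Bd (\<delta> / 2)" "b \<in> Bd (\<delta> / 2)"
    have "norm (y a, y b) \<le> norm (y a) + norm (y b)" by (rule norm_Pair_le)
    also have "\<dots> \<le> \<delta>" using ab by (simp add: Bd_def)
    finally have "(y a, y b) \<in> S" using \<delta>(2) ab yE Q(2) by (auto simp: Bd_def)
    then have "F (\<psi> (y a)) (\<psi> (y b)) \<in> W" using S(3) by force
    then show "F a b \<in> W" using ab \<psi>y by (simp add: Bd_def)
  qed (use \<delta> in simp)
qed

lemma smooth_at_pair0: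
  "smooth_at (subspace_mfd EE) M (\<lambda>z. \<psi> (fst z)) 0" "smooth_at (subspace_mfd EE) M (\<lambda>z. \<psi> (snd z)) 0"
proof -
  have 0: "0 \<in> EE" using E0 by (simp add: zero_prod_def)
  show "smooth_at (subspace_mfd EE) M (\<lambda>z. \<psi> (fst z)) 0" "smooth_at (subspace_mfd EE) M (\<lambda>z. \<psi> (snd z)) 0"
    using smooth_at_compose[OF MEE ME M smooth_at_fst_snd(1)[OF 0]] smooth_at_compose[OF MEE ME M smooth_at_fst_snd(2)[OF 0]]
      smooth_at_\<psi>0 by auto
qed

abbreviation dCC :: "('g \<Rightarrow> 'g) \<Rightarrow> 'e \<Rightarrow> 'e" where "dCC \<theta> \<equiv> cderiv M CC CC \<theta> \<one>"

lemma tame_coord: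
  assumes "smooth_at M M \<theta> \<one>" "\<theta> \<one> = \<one>"
  shows "tame E (\<lambda>x. y (\<theta> (\<psi> x))) (dCC \<theta>)"
proof -
  have c: "\<theta> \<one> \<in> fst CC" using assms by simp
  have "smooth_germ E (y \<circ> \<theta> \<circ> \<psi>) 0"
    using smooth_at_charts(1)[OF M M assms(1) CC_max CC_one(1) CC_max c] by simp
  moreover have "((y \<circ> \<theta> \<circ> \<psi>) has_derivative dCC \<theta>) (at 0 within E)"
    using cderiv_has_derivative[OF M M assms(1) CC_max CC_one(1) CC_max c] by simp
  ultimately have "tame E (y \<circ> \<theta> \<circ> \<psi>) (dCC \<theta>)" by (intro smooth_imp_tame[OF subE]) (simp_all add: assms)
  then show ?thesis by (simp add: o_def)
qed

lemma dCC_linear: "smooth_at M M \<theta> \<one> \<Longrightarrow> \<theta> \<one> = \<one> \<Longrightarrow> linear (dCC \<theta>)"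
  using tame_coord by (simp add: tame_def)

lemma dCC_in: "smooth_at M M \<theta> \<one> \<Longrightarrow> \<theta> \<one> = \<one> \<Longrightarrow> v \<in> E \<Longrightarrow> dCC \<theta> v \<in> E"
  by (rule cderiv_in[OF M M _ CC_max CC_one(1) CC_max]) auto

lemma smooth_at_conj: "g \<in> carrier G \<Longrightarrow> p \<in> carrier G \<Longrightarrow> smooth_at M M (\<lambda>x. g \<otimes> x \<otimes> inv g) p"
  by (intro smooth_at_mult M smooth_at_const_carrier smooth_at_ident) (simp_all add: top)

end

section \<open>Logarithm and exponential as group-theoretic maps\<close>

context lie_log
begin

lemma rtn:
  assumes "g \<in> Bd s" "s \<le> R"
  shows "(rt ^^ n) g \<in> Bd s" "norm (y ((rt ^^ n) g)) \<le> (2/3) ^ n * norm (y g)"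
proof -
  have "(rt ^^ n) g \<in> Bd s \<and> norm (y ((rt ^^ n) g)) \<le> (2/3) ^ n * norm (y g)"
  proof (induction n)
    case (Suc n)
    let ?h = "(rt ^^ n) g"
    have h: "?h \<in> Bd R" using Suc Bd_mono[OF assms(2)] by blast
    have "norm (y (rt ?h)) \<le> (2/3) * norm (y ?h)" "rt ?h \<in> fst CC" using rt[OF h] by (auto simp: Bd_def)
    moreover have "norm (y ?h) < s" using Suc by (simp add: Bd_def)
    then have "norm (y (rt ?h)) < s" using calculation(1) norm_ge_zero[of "y ?h"] by linarith
    ultimately show ?case using Suc by (simp add: Bd_def)
  qed (use assms in auto)
  then show "(rt ^^ n) g \<in> Bd s" "norm (y ((rt ^^ n) g)) \<le> (2/3) ^ n * norm (y g)" by auto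
qed

lemma rtn_tendsto_0:
  assumes "g \<in> Bd R" shows "(\<lambda>n. y ((rt ^^ n) g)) \<longlonglongrightarrow> 0"
proof (rule Lim_null_comparison)
  show "\<forall>\<^sub>F n in sequentially. norm (y ((rt ^^ n) g)) \<le> (2/3) ^ n * norm (y g)" using rtn(2)[OF assms] by auto
  show "(\<lambda>n. (2/3) ^ n * norm (y g)) \<longlonglongrightarrow> 0" by (intro tendsto_mult_left_zero LIMSEQ_power_zero) simp
qed

lemma root_unique: "b \<in> Bd R \<Longrightarrow> c \<in> Bd R \<Longrightarrow> b \<otimes> b = c \<otimes> c \<Longrightarrow> b = c"
  by (metis rt_sq)

lemma Bd_yE: "g \<in> Bd s \<Longrightarrow> y g \<in> E" using yE by (simp add: Bd_def)

lemma lg_E: assumes "g \<in> Bd R" shows "lg g \<in> E"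
  by (rule closed_sequentially[OF closed_subspace[OF subE] _ lg[OF assms]])
     (intro subspace_scale[OF subE] Bd_yE[OF rtn(1)[OF assms order_refl]])

text \<open>\<open>\<theta>\<close> takes roots to roots by uniqueness, so the iterated roots of
  \<open>\<theta> a\<close> are the images of those of \<open>a\<close>; rescaling then leaves only
  the derivative of \<open>\<theta>\<close>.\<close>

lemma hom_log:
  assumes hom: "\<And>a b. a \<in> carrier G \<Longrightarrow> b \<in> carrier G \<Longrightarrow> \<theta> (a \<otimes> b) = \<theta> a \<otimes> \<theta> b"
    and s: "s \<le> R" "\<And>a. a \<in> Bd s \<Longrightarrow> \<theta> a \<in> Bd R" and sm: "smooth_at M M \<theta> \<one>" "\<theta> \<one> = \<one>"
    and a: "a \<in> Bd s"
  shows "lg (\<theta> a) = dCC \<theta> (lg a)"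
proof -
  have aR: "a \<in> Bd R" using a Bd_mono[OF s(1)] by blast
  have step: "rt (\<theta> b) = \<theta> (rt b)" if b: "b \<in> Bd s" for b
  proof (rule root_unique)
    have bR: "b \<in> Bd R" using b Bd_mono[OF s(1)] by blast
    show "rt (\<theta> b) \<in> Bd R" using rt s(2)[OF b] by blast
    have rb: "rt b \<in> Bd s" using rtn(1)[OF b s(1), of 1] by simp
    show "\<theta> (rt b) \<in> Bd R" using s(2)[OF rb] .
    show "rt (\<theta> b) \<otimes> rt (\<theta> b) = \<theta> (rt b) \<otimes> \<theta> (rt b)"
      using rt[OF s(2)[OF b]] rt[OF bR] hom[of "rt b" "rt b"] Bd_carrier[OF rb] by simp
  qed
  have it: "(rt ^^ n) (\<theta> a) = \<theta> ((rt ^^ n) a)" for n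
    by (induction n) (simp_all add: step rtn(1)[OF a s(1)])
  have x: "y ((rt ^^ n) a) \<in> E" "\<psi> (y ((rt ^^ n) a)) = (rt ^^ n) a" for n
    using Bd_yE[OF rtn(1)[OF a s(1)]] \<psi>y rtn(1)[OF a s(1)] by (auto simp: Bd_def)
  have "(\<lambda>n. 2 ^ n *\<^sub>R y (\<theta> (\<psi> (y ((rt ^^ n) a))))) \<longlonglongrightarrow> dCC \<theta> (lg a)"
    by (rule tame_scaled_limit[OF tame_coord[OF sm] subE x(1) rtn_tendsto_0[OF aR] lg[OF aR]])
  then have "(\<lambda>n. 2 ^ n *\<^sub>R y ((rt ^^ n) (\<theta> a))) \<longlonglongrightarrow> dCC \<theta> (lg a)" by (simp add: x it)
  then show ?thesis using lg[OF s(2)[OF a]] LIMSEQ_unique by blast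
qed

lemma small_radius:
  obtains s where "s > 0" "s \<le> r0" "\<And>a b. a \<in> Bd s \<Longrightarrow> b \<in> Bd s \<Longrightarrow> a \<otimes> b \<in> Bd r0"
    "\<And>a b. a \<in> Bd s \<Longrightarrow> b \<in> Bd s \<Longrightarrow> b \<otimes> a \<otimes> inv b \<in> Bd r0" "\<And>a. a \<in> Bd s \<Longrightarrow> inv a \<in> Bd r0"
proof -
  note p = smooth_at_pair0
  have o: "\<one> \<in> Bd r0" using r0 by simp
  have s1: "smooth_at (subspace_mfd EE) M (\<lambda>z. \<psi> (fst z) \<otimes> \<psi> (snd z)) 0" by (intro smooth_at_mult MEE p)
  have s2: "smooth_at (subspace_mfd EE) M (\<lambda>z. \<psi> (snd z) \<otimes> \<psi> (fst z) \<otimes> inv (\<psi> (snd z))) 0"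
    by (intro smooth_at_mult smooth_at_inverse MEE p)
  have s3: "smooth_at (subspace_mfd EE) M (\<lambda>z. inv (\<psi> (fst z))) 0"
    by (intro smooth_at_inverse MEE p)
  obtain d1 where d1: "d1 > 0" "\<And>a b. a \<in> Bd d1 \<Longrightarrow> b \<in> Bd d1 \<Longrightarrow> a \<otimes> b \<in> Bd r0"
    using small_binary[OF s1 Bd_open] o by auto
  obtain d2 where d2: "d2 > 0" "\<And>a b. a \<in> Bd d2 \<Longrightarrow> b \<in> Bd d2 \<Longrightarrow> b \<otimes> a \<otimes> inv b \<in> Bd r0"
    using small_binary[OF s2 Bd_open] o by auto
  obtain d3 where d3: "d3 > 0" "\<And>a b. a \<in> Bd d3 \<Longrightarrow> b \<in> Bd d3 \<Longrightarrow> inv a \<in> Bd r0"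
    using small_binary[OF s3 Bd_open] o by auto
  define s where "s = min (min d1 d2) (min d3 r0)"
  have "s > 0" "s \<le> r0" and sub: "Bd s \<subseteq> Bd d1" "Bd s \<subseteq> Bd d2" "Bd s \<subseteq> Bd d3"
    using d1 d2 d3 r0 by (auto simp: s_def intro!: Bd_mono)
  moreover have "a \<otimes> b \<in> Bd r0" "b \<otimes> a \<otimes> inv b \<in> Bd r0" "inv a \<in> Bd r0" if "a \<in> Bd s" "b \<in> Bd s" for a b
    using d1(2)[of a b] d2(2)[of a b] d3(2)[of a b] that sub by auto
  ultimately show thesis by (intro that[of s]) auto
qed

text \<open>Roots of commuting elements commute, so the iterated roots of
  \<open>a \<otimes> b\<close> are the products of those of \<open>a\<close> and \<open>b\<close>;
  in the rescaled limit multiplication becomes addition.\<close>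

lemma log_mult:
  assumes s: "s \<le> R" "\<And>a b. a \<in> Bd s \<Longrightarrow> b \<in> Bd s \<Longrightarrow> a \<otimes> b \<in> Bd R"
    "\<And>a b. a \<in> Bd s \<Longrightarrow> b \<in> Bd s \<Longrightarrow> b \<otimes> a \<otimes> inv b \<in> Bd R"
    and ab: "a \<in> Bd s" "b \<in> Bd s" "a \<otimes> b = b \<otimes> a"
  shows "lg (a \<otimes> b) = lg a + lg b"
proof -
  have sR: "g \<in> Bd R" if "g \<in> Bd s" for g using that Bd_mono[OF s(1)] by blast
  have rs: "rt g \<in> Bd s" if "g \<in> Bd s" for g using rtn(1)[OF that s(1), of 1] by simp
  \<comment> \<open>The conjugate of \<open>rt a\<close> by \<open>b\<close> is another small root
    of \<open>a\<close>.\<close>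
  have comm: "rt a \<otimes> b = b \<otimes> rt a" if "a \<in> Bd s" "b \<in> Bd s" "a \<otimes> b = b \<otimes> a" for a b
  proof -
    have c: "a \<in> carrier G" "b \<in> carrier G" "rt a \<in> carrier G" using that rs Bd_carrier by blast+
    have rr: "rt a \<otimes> rt a = a" using rt[OF sR[OF that(1)]] by simp
    have "b \<otimes> rt a \<otimes> inv b = rt a"
    proof (rule root_unique)
      show "b \<otimes> rt a \<otimes> inv b \<in> Bd R" by (rule s(3)[OF rs[OF that(1)] that(2)])
      show "rt a \<in> Bd R" using sR[OF rs[OF that(1)]] .
      have "(b \<otimes> rt a \<otimes> inv b) \<otimes> (b \<otimes> rt a \<otimes> inv b) = b \<otimes> (rt a \<otimes> ((inv b \<otimes> b) \<otimes> (rt a \<otimes> inv b)))"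
      proof -
        have "inv b \<otimes> (b \<otimes> (rt a \<otimes> inv b)) = rt a \<otimes> inv b" using c by (simp flip: m_assoc)
        then show ?thesis using c by (simp add: m_assoc)
      qed
      also have "\<dots> = b \<otimes> (rt a \<otimes> rt a) \<otimes> inv b" using c by (simp add: m_assoc)
      also have "\<dots> = a \<otimes> b \<otimes> inv b" by (simp add: rr that(3))
      also have "\<dots> = rt a \<otimes> rt a" using c rr by (simp add: m_assoc)
      finally show "(b \<otimes> rt a \<otimes> inv b) \<otimes> (b \<otimes> rt a \<otimes> inv b) = rt a \<otimes> rt a" .
    qed
    then have "b \<otimes> rt a \<otimes> inv b \<otimes> b = rt a \<otimes> b" by simp
    then show ?thesis using c by (simp add: m_assoc)
  qed
  have step: "rt (a \<otimes> b) = rt a \<otimes> rt b \<and> rt a \<otimes> rt b = rt b \<otimes> rt a" if "a \<in> Bd s" "b \<in> Bd s" "a \<otimes> b = b \<otimes> a" for a b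
  proof
    have c: "a \<in> carrier G" "b \<in> carrier G" "rt a \<in> carrier G" "rt b \<in> carrier G" using that rs Bd_carrier by blast+
    have 1: "rt a \<otimes> b = b \<otimes> rt a" by (rule comm[OF that])
    show 2: "rt a \<otimes> rt b = rt b \<otimes> rt a" using comm[OF that(2) rs[OF that(1)]] 1 by simp
    show "rt (a \<otimes> b) = rt a \<otimes> rt b"
    proof (rule root_unique)
      show "rt (a \<otimes> b) \<in> Bd R" using rt s(2)[OF that(1,2)] by blast
      show "rt a \<otimes> rt b \<in> Bd R" using s(2) rs that by blast
      have "(rt a \<otimes> rt b) \<otimes> (rt a \<otimes> rt b) = rt a \<otimes> (rt b \<otimes> rt a) \<otimes> rt b" using c by (simp add: m_assoc)
      also have "\<dots> = (rt a \<otimes> rt a) \<otimes> (rt b \<otimes> rt b)" unfolding 2[symmetric] using c by (simp add: m_assoc)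
      also have "\<dots> = a \<otimes> b" using rt[OF sR[OF that(1)]] rt[OF sR[OF that(2)]] by simp
      finally show "rt (a \<otimes> b) \<otimes> rt (a \<otimes> b) = rt a \<otimes> rt b \<otimes> (rt a \<otimes> rt b)"
        using rt[OF s(2)[OF that(1,2)]] by simp
    qed
  qed
  have it: "(rt ^^ n) (a \<otimes> b) = (rt ^^ n) a \<otimes> (rt ^^ n) b \<and> (rt ^^ n) a \<otimes> (rt ^^ n) b = (rt ^^ n) b \<otimes> (rt ^^ n) a" for n
  proof (induction n)
    case (Suc n)
    then show ?case using step[OF rtn(1)[OF ab(1) s(1)] rtn(1)[OF ab(2) s(1)], of n n] by simp
  qed (use ab in auto)
  have xa: "y ((rt ^^ n) a) \<in> E" "\<psi> (y ((rt ^^ n) a)) = (rt ^^ n) a" if "a \<in> Bd s" for n a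
    using Bd_yE[OF rtn(1)[OF that s(1)]] \<psi>y rtn(1)[OF that s(1)] by (auto simp: Bd_def)
  have "(\<lambda>n. 2 ^ n *\<^sub>R \<mu> (y ((rt ^^ n) a), y ((rt ^^ n) b))) \<longlonglongrightarrow> (\<lambda>z. fst z + snd z) (lg a, lg b)"
  proof (rule tame_scaled_limit[OF tame_\<mu> subEE])
    show "(y ((rt ^^ n) a), y ((rt ^^ n) b)) \<in> EE" for n using xa ab by auto
    show "(\<lambda>n. (y ((rt ^^ n) a), y ((rt ^^ n) b))) \<longlonglongrightarrow> 0"
      unfolding zero_prod_def by (intro tendsto_Pair rtn_tendsto_0 sR ab)
    have "(\<lambda>n. (2 ^ n *\<^sub>R y ((rt ^^ n) a), 2 ^ n *\<^sub>R y ((rt ^^ n) b))) \<longlonglongrightarrow> (lg a, lg b)"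
      by (intro tendsto_Pair lg sR ab)
    then show "(\<lambda>n. 2 ^ n *\<^sub>R (y ((rt ^^ n) a), y ((rt ^^ n) b))) \<longlonglongrightarrow> (lg a, lg b)" by simp
  qed
  then have "(\<lambda>n. 2 ^ n *\<^sub>R y ((rt ^^ n) (a \<otimes> b))) \<longlonglongrightarrow> lg a + lg b"
    using it by (simp add: \<mu>_def xa ab)
  then show ?thesis using lg[OF s(2)[OF ab(1,2)]] LIMSEQ_unique by blast
qed

lemma ex_small:
  assumes "s > 0"
  obtains \<delta> where "\<delta> > 0" "\<delta> \<le> r0" "\<And>X. X \<in> E \<Longrightarrow> norm X < \<delta> \<Longrightarrow> ex X \<in> Bd s"
proof -
  obtain R' K where K: "R' > 0" "K \<ge> 1" "\<And>X. X \<in> E \<Longrightarrow> norm X \<le> R' \<Longrightarrow> norm (y (ex X)) \<le> K * norm X"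
    using tame_lipschitz[OF tame_ex subE] by metis
  define \<delta> where "\<delta> = min (min R' r0) (s / K)"
  show thesis
  proof (rule that[of \<delta>])
    show "\<delta> > 0" "\<delta> \<le> r0" using K assms r0 by (auto simp: \<delta>_def)
    fix X assume X: "X \<in> E" "norm X < \<delta>"
    then have "norm (y (ex X)) \<le> K * norm X" "norm X < s / K" using K(3) by (auto simp: \<delta>_def)
    then have "norm (y (ex X)) < s" using K(2) by (simp add: field_simps)
    moreover have "ex X \<in> fst CC" using ex[of X] X by (auto simp: Bd_def \<delta>_def)
    ultimately show "ex X \<in> Bd s" by (simp add: Bd_def)
  qed
qed

text \<open>Conjugation by \<open>ex X\<close> fixes \<open>ex X\<close>, so its derivative fixes
  \<open>X\<close> and with it the line through \<open>X\<close>; by injectivity of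
  \<open>lg\<close> near the identity it fixes \<open>ex (t *\<^sub>R X)\<close>. Once the factors
  commute, additivity of \<open>lg\<close> applies.\<close>

lemma ex_add_exists:
  "\<exists>r2>0. r2 \<le> r0 \<and> (\<forall>X\<in>E. \<forall>s t. norm (s *\<^sub>R X) < r2 \<longrightarrow> norm (t *\<^sub>R X) < r2 \<longrightarrow>
     ex (s *\<^sub>R X) \<otimes> ex (t *\<^sub>R X) = ex ((s + t) *\<^sub>R X))"
proof -
  obtain s where s: "s > 0" "s \<le> r0" "\<And>a b. a \<in> Bd s \<Longrightarrow> b \<in> Bd s \<Longrightarrow> a \<otimes> b \<in> Bd r0"
    "\<And>a b. a \<in> Bd s \<Longrightarrow> b \<in> Bd s \<Longrightarrow> b \<otimes> a \<otimes> inv b \<in> Bd r0" by (rule small_radius, rule that, assumption+)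
  have r0R: "g \<in> Bd R" if "g \<in> Bd r0" for g using that Bd_mono[OF r0(2)] by blast
  have sR: "s \<le> R" using s(2) r0(2) by simp
  obtain r2 where r2: "r2 > 0" "r2 \<le> r0" "\<And>X. X \<in> E \<Longrightarrow> norm X < r2 \<Longrightarrow> ex X \<in> Bd s" using ex_small[OF s(1)] by metis
  have lgex: "lg (ex X) = X" if "X \<in> E" "norm X < r2" for X using ex[of X] that r2(2) by auto
  have comm: "ex X \<otimes> ex (t *\<^sub>R X) = ex (t *\<^sub>R X) \<otimes> ex X" if X: "X \<in> E" "norm X < r2" "\<bar>t\<bar> \<le> 1" for X t
  proof -
    let ?a = "ex X" and ?b = "ex (t *\<^sub>R X)"
    have "norm (t *\<^sub>R X) \<le> 1 * norm X" using X(3) unfolding norm_scaleR by (intro mult_right_mono) auto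
    then have tX: "t *\<^sub>R X \<in> E" "norm (t *\<^sub>R X) < r2" using X subspace_scale[OF subE] by auto
    have a: "?a \<in> Bd s" "?a \<in> carrier G" and b: "?b \<in> Bd s" "?b \<in> carrier G" using r2(3) X tX Bd_carrier by blast+
    let ?\<theta> = "\<lambda>x. ?a \<otimes> x \<otimes> inv ?a"
    have \<theta>1: "?\<theta> \<one> = \<one>" using a by simp
    have sm: "smooth_at M M ?\<theta> \<one>" using smooth_at_conj a by simp
    have log: "lg (?\<theta> x) = dCC ?\<theta> (lg x)" if "x \<in> Bd s" for x
    proof (rule hom_log[OF _ sR _ sm \<theta>1 that])
      fix u v assume "u \<in> carrier G" "v \<in> carrier G"
      then have "inv ?a \<otimes> (?a \<otimes> (v \<otimes> inv ?a)) = v \<otimes> inv ?a" using a by (simp flip: m_assoc)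
      then show "?\<theta> (u \<otimes> v) = ?\<theta> u \<otimes> ?\<theta> v" using a \<open>u \<in> carrier G\<close> \<open>v \<in> carrier G\<close> by (simp add: m_assoc)
    next
      show "?\<theta> x \<in> Bd R" if "x \<in> Bd s" for x using s(4)[OF that a(1)] r0R by blast
    qed
    have "?\<theta> ?a = ?a" using a by (simp add: m_assoc)
    then have "dCC ?\<theta> X = X" using log[OF a(1)] lgex X by simp
    then have "dCC ?\<theta> (t *\<^sub>R X) = t *\<^sub>R X" using linear_cmul[OF dCC_linear[OF sm \<theta>1]] by simp
    then have "lg (?\<theta> ?b) = lg ?b" using log[OF b(1)] lgex tX by simp
    moreover have "?b \<in> Bd r0" using b(1) Bd_mono[OF s(2)] by blast
    ultimately have "?\<theta> ?b = ?b" using ex_lg s(4)[OF b(1) a(1)] by metis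
    then have "?a \<otimes> ?b \<otimes> inv ?a \<otimes> ?a = ?b \<otimes> ?a" by simp
    then show ?thesis using a b by (simp add: m_assoc)
  qed
  have "ex (u *\<^sub>R X) \<otimes> ex (v *\<^sub>R X) = ex ((u + v) *\<^sub>R X)"
    if X: "X \<in> E" "norm (u *\<^sub>R X) < r2" "norm (v *\<^sub>R X) < r2" for X u v
  proof -
    have XE: "u *\<^sub>R X \<in> E" "v *\<^sub>R X \<in> E" using X subspace_scale[OF subE] by auto
    \<comment> \<open>The multiple with the larger coefficient plays the role of \<open>X\<close> in
      \<open>comm\<close>, so that the ratio stays within 1. If the divisor \<open>u\<close> is 0
      then so is \<open>v\<close>, and the quotient 0 is still correct.\<close>
    have comm': "ex (u *\<^sub>R X) \<otimes> ex (v *\<^sub>R X) = ex (v *\<^sub>R X) \<otimes> ex (u *\<^sub>R X)"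
    proof (cases "\<bar>v\<bar> \<le> \<bar>u\<bar>")
      case True
      then have a: "\<bar>v / u\<bar> \<le> 1" by (auto simp: divide_le_eq_1)
      have e: "(v / u) *\<^sub>R (u *\<^sub>R X) = v *\<^sub>R X" using True by (cases "u = 0") auto
      show ?thesis using comm[OF XE(1) X(2) a] unfolding e .
    next
      case False
      then have a: "\<bar>u / v\<bar> \<le> 1" by (auto simp: divide_le_eq_1)
      have e: "(u / v) *\<^sub>R (v *\<^sub>R X) = u *\<^sub>R X" using False by (cases "v = 0") auto
      show ?thesis using comm[OF XE(2) X(3) a] unfolding e by simp
    qed
    have B: "ex (u *\<^sub>R X) \<in> Bd s" "ex (v *\<^sub>R X) \<in> Bd s" using r2(3) XE X by auto
    have "lg (ex (u *\<^sub>R X) \<otimes> ex (v *\<^sub>R X)) = lg (ex (u *\<^sub>R X)) + lg (ex (v *\<^sub>R X))"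
      by (rule log_mult[OF sR _ _ B comm']) (use s r0R in blast)+
    also have "\<dots> = (u + v) *\<^sub>R X" using lgex XE X by (simp add: scaleR_add_left)
    finally show ?thesis using ex_lg[OF s(3)[OF B]] by simp
  qed
  then show ?thesis using r2 by blast
qed

definition r2 :: real where
  "r2 = (SOME r2. r2 > 0 \<and> r2 \<le> r0 \<and> (\<forall>X\<in>E. \<forall>s t. norm (s *\<^sub>R X) < r2 \<longrightarrow> norm (t *\<^sub>R X) < r2 \<longrightarrow>
     ex (s *\<^sub>R X) \<otimes> ex (t *\<^sub>R X) = ex ((s + t) *\<^sub>R X)))"

lemma r2: "r2 > 0" "r2 \<le> r0" and ex_add: "\<And>X s t. X \<in> E \<Longrightarrow> norm (s *\<^sub>R X) < r2 \<Longrightarrow> norm (t *\<^sub>R X) < r2 \<Longrightarrow>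
     ex (s *\<^sub>R X) \<otimes> ex (t *\<^sub>R X) = ex ((s + t) *\<^sub>R X)"
  using someI_ex[of "\<lambda>r2. r2 > 0 \<and> r2 \<le> r0 \<and> (\<forall>X\<in>E. \<forall>s t. norm (s *\<^sub>R X) < r2 \<longrightarrow> norm (t *\<^sub>R X) < r2 \<longrightarrow>
     ex (s *\<^sub>R X) \<otimes> ex (t *\<^sub>R X) = ex ((s + t) *\<^sub>R X))"] ex_add_exists
  unfolding r2_def[symmetric] by blast+

lemma ex_carrier: "X \<in> E \<Longrightarrow> norm X < r2 \<Longrightarrow> ex X \<in> carrier G"
  using ex r2 Bd_carrier by fastforce

lemma ex_zero [simp]: "ex 0 = \<one>"
  using ex_add[OF E0, of 0 0] ex_carrier[OF E0] r2 by (simp add: r_cancel_one')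

lemma ex_pow: "X \<in> E \<Longrightarrow> norm (real m *\<^sub>R X) < r2 \<Longrightarrow> ex (real m *\<^sub>R X) = ex X [^] m"
proof (induction m)
  case (Suc m)
  have 1: "norm (real m *\<^sub>R X) \<le> norm (real (Suc m) *\<^sub>R X)" "norm (1 *\<^sub>R X) \<le> norm (real (Suc m) *\<^sub>R X)"
    unfolding norm_scaleR by (intro mult_right_mono; simp)+
  then have "norm (real m *\<^sub>R X) < r2" "norm (1 *\<^sub>R X) < r2" using Suc.prems by linarith+
  from ex_add[OF Suc.prems(1) this] Suc.IH[OF Suc.prems(1) this(1)] show ?case
    by (simp add: algebra_simps)
qed simp

text \<open>Any \<open>N\<close> that brings \<open>X / N\<close> into the domain of
  \<open>ex\<close> gives the same power, by \<open>Exp_eq\<close>. \<open>Suc\<close> makes the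
  bound strict and \<open>N\<close> positive.\<close>

definition Exp :: "'e \<Rightarrow> 'g" where
  "Exp X = (let N = Suc (nat \<lceil>norm X / r2\<rceil>) in ex ((1 / real N) *\<^sub>R X) [^] N)"

text \<open>Two admissible subdivisions are both compared with their common refinement into
  \<open>K * N\<close> parts.\<close>

lemma Exp_eq:
  assumes X: "X \<in> E" and N: "N > 0" "norm X < r2 * real N"
  shows "Exp X = ex ((1 / real N) *\<^sub>R X) [^] N"
proof -
  define K where "K = Suc (nat \<lceil>norm X / r2\<rceil>)"
  have K0: "K > 0" by (simp add: K_def)
  have "norm X / r2 < real K" unfolding K_def by linarith
  then have K: "norm X < r2 * real K" using r2(1) by (simp add: field_simps)
  have key: "ex ((1 / real A) *\<^sub>R X) [^] A = ex ((1 / real (A * B)) *\<^sub>R X) [^] (A * B)"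
    if "A > 0" "B > 0" "norm X < r2 * real A" for A B :: nat
  proof -
    let ?Z = "(1 / real (A * B)) *\<^sub>R X"
    have ZE: "?Z \<in> E" using X subE by (simp add: subspace_scale)
    have Z: "real B *\<^sub>R ?Z = (1 / real A) *\<^sub>R X" using that by simp
    have n: "norm ((1 / real A) *\<^sub>R X) < r2" using that by (simp add: field_simps)
    then have "norm (real B *\<^sub>R ?Z) < r2" unfolding Z .
    from ex_pow[OF ZE this] have e: "ex ((1 / real A) *\<^sub>R X) = ex ?Z [^] B" unfolding Z .
    have "norm ?Z \<le> norm ((1 / real A) *\<^sub>R X)"
      unfolding norm_scaleR using that by (intro mult_right_mono) (auto simp: field_simps)
    then have "ex ?Z \<in> carrier G" using ex_carrier[OF ZE] n by auto
    then show ?thesis unfolding e by (simp add: nat_pow_pow mult.commute)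
  qed
  have "Exp X = ex ((1 / real K) *\<^sub>R X) [^] K" by (simp add: Exp_def K_def Let_def)
  also have "\<dots> = ex ((1 / real (K * N)) *\<^sub>R X) [^] (K * N)" by (rule key[OF K0 N(1) K])
  also have "\<dots> = ex ((1 / real N) *\<^sub>R X) [^] N" using key[OF N(1) K0 N(2)] by (simp add: mult.commute)
  finally show ?thesis .
qed

lemma Exp_small: "X \<in> E \<Longrightarrow> norm X < r2 \<Longrightarrow> Exp X = ex X"
  using Exp_eq[of X 1] ex_carrier by simp

lemma Exp_bound: obtains N :: nat where "N > 0" "a < r2 * real N"
proof -
  obtain N :: nat where N: "a / r2 < real N" using reals_Archimedean2 by blast
  then have "a < r2 * real (Suc N)" using r2(1) by (simp add: field_simps)
  then show thesis by (rule that[rotated]) simp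
qed

lemma Exp_carrier: assumes "X \<in> E" shows "Exp X \<in> carrier G"
proof -
  obtain N where N: "N > 0" "norm X < r2 * real N" using Exp_bound .
  have "norm ((1 / real N) *\<^sub>R X) < r2" using N by (simp add: field_simps)
  then show ?thesis using Exp_eq[OF assms N] ex_carrier subspace_scale[OF subE assms] by simp
qed

lemma Exp_add:
  assumes X: "X \<in> E" shows "Exp ((s + t) *\<^sub>R X) = Exp (s *\<^sub>R X) \<otimes> Exp (t *\<^sub>R X)"
proof -
  obtain N where N: "N > 0" "norm (s *\<^sub>R X) + norm (t *\<^sub>R X) < r2 * real N" using Exp_bound .
  have 1: "norm (s *\<^sub>R X) < r2 * real N" "norm (t *\<^sub>R X) < r2 * real N" using N(2) norm_ge_zero[of "s *\<^sub>R X"] norm_ge_zero[of "t *\<^sub>R X"] by linarith+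
  have 2: "norm ((s + t) *\<^sub>R X) < r2 * real N" using N(2) norm_triangle_ineq[of "s *\<^sub>R X" "t *\<^sub>R X"] by (simp add: scaleR_add_left)
  have sc: "(1 / real N) *\<^sub>R u *\<^sub>R X = (u / real N) *\<^sub>R X" for u by simp
  have E': "u *\<^sub>R X \<in> E" for u using X subE by (simp add: subspace_scale)
  have n: "norm ((u / real N) *\<^sub>R X) < r2" if "norm (u *\<^sub>R X) < r2 * real N" for u using that N(1) by (simp add: field_simps)
  let ?a = "ex ((s / real N) *\<^sub>R X)" and ?b = "ex ((t / real N) *\<^sub>R X)"
  have c: "?a \<in> carrier G" "?b \<in> carrier G" using ex_carrier E' n 1 by auto
  have "?a \<otimes> ?b = ex (((s + t) / real N) *\<^sub>R X)" "?b \<otimes> ?a = ex (((s + t) / real N) *\<^sub>R X)"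
    using ex_add[OF X n[OF 1(1)] n[OF 1(2)]] ex_add[OF X n[OF 1(2)] n[OF 1(1)]] by (simp_all add: add_divide_distrib add.commute)
  then have "Exp ((s + t) *\<^sub>R X) = (?a \<otimes> ?b) [^] N" "?a \<otimes> ?b = ?b \<otimes> ?a" using Exp_eq[OF E' N(1) 2] sc by auto
  then show ?thesis using Exp_eq[OF E' N(1) 1(1)] Exp_eq[OF E' N(1) 1(2)] sc pow_mult_distrib[OF _ c] by simp
qed

lemma Exp_zero [simp]: "Exp 0 = \<one>"
  using Exp_small[OF E0] r2 by simp

lemma Exp_uminus: "X \<in> E \<Longrightarrow> Exp (- X) = inv (Exp X)"
proof -
  assume X: "X \<in> E"
  have "Exp (- X) \<otimes> Exp X = \<one>" using Exp_add[OF X, of "-1" 1] by simp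
  then show ?thesis using inv_equality Exp_carrier X subspace_neg[OF subE] by metis
qed

lemma Exp_double: "X \<in> E \<Longrightarrow> Exp (2 *\<^sub>R X) = Exp X \<otimes> Exp X"
  using Exp_add[of X 1 1] by simp

lemma hom_pow_scale:
  assumes "\<And>s t::real. \<gamma> (s + t) = \<gamma> s \<otimes> \<gamma> t" "\<And>t. \<gamma> t \<in> carrier G"
  shows "\<gamma> (real n * t) = \<gamma> t [^] n"
proof (induction n)
  case 0
  have "\<gamma> 0 \<otimes> \<gamma> 0 = \<gamma> 0" using assms(1)[of 0 0] by simp
  then show ?case using assms(2)[of 0] by (simp add: r_cancel_one')
next
  case (Suc n)
  have "\<gamma> (real (Suc n) * t) = \<gamma> (real n * t + t)" by (simp add: algebra_simps)
  then show ?case using Suc assms(1) by simp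
qed

text \<open>Dividing the parameter by \<open>2 ^ n\<close> amounts to taking \<open>n\<close>
  successive roots, so \<open>lg (\<gamma> t)\<close> is the limit of difference quotients at 0 and
  equals \<open>t *\<^sub>R X\<close>. Hence \<open>\<gamma> t = ex (t *\<^sub>R X)\<close> for
  small \<open>t\<close>, and powers extend this to all \<open>t\<close>.\<close>

theorem one_parameter_Exp:
  assumes hom: "\<And>s t::real. \<gamma> (s + t) = \<gamma> s \<otimes> \<gamma> t" "\<And>t. \<gamma> t \<in> carrier G"
    and cont: "\<And>W. openin (mtop M) W \<Longrightarrow> \<one> \<in> W \<Longrightarrow> \<exists>\<delta>>0. \<forall>t. \<bar>t\<bar> < \<delta> \<longrightarrow> \<gamma> t \<in> W"
    and d: "((\<lambda>t. y (\<gamma> t)) has_vector_derivative X) (at 0)"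
  shows "X \<in> E" "\<gamma> t = Exp (t *\<^sub>R X)"
proof -
  have \<gamma>0: "\<gamma> 0 = \<one>" using hom_pow_scale[OF hom, of 0 0] by simp
  obtain \<delta> where \<delta>: "\<delta> > 0" "\<And>t. \<bar>t\<bar> < \<delta> \<Longrightarrow> \<gamma> t \<in> Bd r0" using cont[OF Bd_open, of r0] r0 by auto
  have B: "\<gamma> t \<in> Bd R" if "\<bar>t\<bar> < \<delta>" for t using \<delta>(2)[OF that] Bd_mono[OF r0(2)] by blast
  have lgt: "lg (\<gamma> t) = t *\<^sub>R X" if t: "\<bar>t\<bar> < \<delta>" for t
  proof (cases "t = 0")
    case True
    have "lg \<one> = 0" using ex[OF E0] r0 ex_zero by simp
    then show ?thesis using True \<gamma>0 by simp
  next
    case False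
    have small: "\<bar>t / 2 ^ n\<bar> < \<delta>" for n
    proof -
      have "\<bar>t\<bar> / 2 ^ n \<le> \<bar>t\<bar> / 1" by (intro divide_left_mono) auto
      then show ?thesis using t by (simp add: abs_divide)
    qed
    have it: "(rt ^^ n) (\<gamma> t) = \<gamma> (t / 2 ^ n)" for n
    proof (induction n)
      case (Suc n)
      have "\<gamma> (t / 2 ^ n) = \<gamma> (t / 2 ^ Suc n) \<otimes> \<gamma> (t / 2 ^ Suc n)" by (simp flip: hom(1))
      then show ?case using Suc rt_sq[OF B[OF small[of "Suc n"]]] by simp
    qed simp
    have "(\<lambda>h. norm (y (\<gamma> h) - h *\<^sub>R X) / \<bar>h\<bar>) \<midarrow>0\<rightarrow> 0"
      using d unfolding has_vector_derivative_def has_derivative_at by (simp add: \<gamma>0)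
    moreover have "filterlim (\<lambda>n. t / 2 ^ n) (at 0) sequentially"
      unfolding filterlim_at
    proof
      show "\<forall>\<^sub>F n in sequentially. t / 2 ^ n \<in> UNIV \<and> t / 2 ^ n \<noteq> 0" using False by simp
      have "(\<lambda>n. t * (1/2) ^ n) \<longlonglongrightarrow> 0" by (intro tendsto_mult_right_zero LIMSEQ_power_zero) simp
      then show "(\<lambda>n. t / 2 ^ n) \<longlonglongrightarrow> 0" by (simp add: power_divide)
    qed
    ultimately have "(\<lambda>n. norm (y (\<gamma> (t / 2 ^ n)) - (t / 2 ^ n) *\<^sub>R X) / \<bar>t / 2 ^ n\<bar>) \<longlonglongrightarrow> 0"
      by (rule filterlim_compose)
    then have "(\<lambda>n. \<bar>t\<bar> * (norm (y (\<gamma> (t / 2 ^ n)) - (t / 2 ^ n) *\<^sub>R X) / \<bar>t / 2 ^ n\<bar>)) \<longlonglongrightarrow> 0"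
      by (rule tendsto_mult_right_zero)
    moreover have "\<bar>t\<bar> * (norm (y (\<gamma> (t / 2 ^ n)) - (t / 2 ^ n) *\<^sub>R X) / \<bar>t / 2 ^ n\<bar>)
        = norm (2 ^ n *\<^sub>R y (\<gamma> (t / 2 ^ n)) - t *\<^sub>R X)" for n
    proof -
      have "2 ^ n *\<^sub>R y (\<gamma> (t / 2 ^ n)) - t *\<^sub>R X = 2 ^ n *\<^sub>R (y (\<gamma> (t / 2 ^ n)) - (t / 2 ^ n) *\<^sub>R X)"
        by (simp add: scaleR_diff_right)
      then show ?thesis using False by (simp add: abs_divide)
    qed
    ultimately have "(\<lambda>n. 2 ^ n *\<^sub>R y (\<gamma> (t / 2 ^ n)) - t *\<^sub>R X) \<longlonglongrightarrow> 0"
      by (simp add: tendsto_norm_zero_iff)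
    then have "(\<lambda>n. 2 ^ n *\<^sub>R y ((rt ^^ n) (\<gamma> t))) \<longlonglongrightarrow> t *\<^sub>R X" by (simp add: it LIM_zero_iff)
    then show ?thesis using lg[OF B[OF t]] LIMSEQ_unique by blast
  qed
  have "(\<delta> / 2) *\<^sub>R X \<in> E" using lg_E[OF B[of "\<delta> / 2"]] lgt[of "\<delta> / 2"] \<delta>(1) by simp
  then have "(2 / \<delta>) *\<^sub>R (\<delta> / 2) *\<^sub>R X \<in> E" by (rule subspace_scale[OF subE])
  then show X: "X \<in> E" using \<delta>(1) by simp
  have loc: "\<gamma> t = ex (t *\<^sub>R X)" if "\<bar>t\<bar> < \<delta>" for t
    using ex_lg[OF \<delta>(2)[OF that]] lgt[OF that] by simp
  obtain N1 :: nat where N1: "N1 > 0" "norm (t *\<^sub>R X) < r2 * real N1" using Exp_bound .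
  obtain N2 :: nat where N2: "\<bar>t\<bar> / \<delta> < real N2" using reals_Archimedean2 by blast
  define N where "N = N1 + N2"
  have "r2 * real N1 \<le> r2 * real N" using r2 by (simp add: N_def)
  then have N: "N > 0" "norm (t *\<^sub>R X) < r2 * real N" using N1 by (auto simp: N_def)
  have "\<bar>t\<bar> / \<delta> < real N" using N2 by (simp add: N_def)
  then have tN: "\<bar>t / real N\<bar> < \<delta>" using N(1) \<delta>(1) by (simp add: field_simps abs_divide)
  have "\<gamma> t = \<gamma> (t / real N) [^] N" using hom_pow_scale[OF hom, of N "t / real N"] N(1) by simp
  also have "\<dots> = ex ((t / real N) *\<^sub>R X) [^] N" by (simp add: loc[OF tN])
  also have "\<dots> = Exp (t *\<^sub>R X)" using Exp_eq[OF subspace_scale[OF subE X] N] by simp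
  finally show "\<gamma> t = Exp (t *\<^sub>R X)" .
qed

end

section \<open>Comparison with one-parameter subgroups and tangent vectors\<close>

lemma real_mfd_eq: "real_mfd = subspace_mfd UNIV"
  by (simp add: real_mfd_def subspace_mfd_def)

lemma smooth_manifold_real: "smooth_manifold real_mfd"
  unfolding real_mfd_eq by (rule smooth_manifold_subspace_mfd) simp

lemma real_chart: "(UNIV, id) \<in> max_atlas real_mfd"
  unfolding real_mfd_eq by (rule subspace_mfd_max_atlas) simp

lemma curve_has_vector_derivative:
  assumes "smooth_manifold M" "smooth_at real_mfd M \<gamma> t" "C \<in> max_atlas M" "\<gamma> t \<in> fst C"
  shows "((\<lambda>t. snd C (\<gamma> t)) has_vector_derivative cderiv real_mfd (UNIV, id) C \<gamma> t 1) (at t)"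
proof -
  have 1: "chart_inv (UNIV, id) x = x" for x :: real by (rule chart_inv_id) simp
  have m: "model real_mfd = UNIV" by (simp add: real_mfd_def)
  have t: "t \<in> fst (UNIV, id)" by simp
  let ?D = "cderiv real_mfd (UNIV, id) C \<gamma> t"
  have "((snd C \<circ> \<gamma> \<circ> chart_inv (UNIV, id)) has_derivative ?D) (at t)"
    using cderiv_has_derivative[OF smooth_manifold_real assms(1,2) real_chart t assms(3,4)] by (simp add: m)
  then have d: "((\<lambda>t. snd C (\<gamma> t)) has_derivative ?D) (at t)" by (simp add: o_def 1)
  have "?D = (\<lambda>h. h *\<^sub>R ?D 1)"
  proof
    show "?D h = h *\<^sub>R ?D 1" for h using linear_cmul[OF has_derivative_linear[OF d], of h 1] by simp
  qed
  from has_derivative_eq_rhs[OF d this] show ?thesis unfolding has_vector_derivative_def .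
qed

lemma tame_has_derivative:
  assumes "tame E f L" "subspace E"
  shows "(f has_derivative L) (at 0 within E)"
proof -
  obtain R c where R: "R > 0" "R \<le> 1" "c \<ge> 0" "tame_on E f L R c" "c * R \<le> 1" using tameE[OF assms(1), of 1] by auto
  have L: "bounded_linear L" "f 0 = 0" using assms(1) by (auto simp: tame_def linear_conv_bounded_linear)
  show ?thesis
    unfolding has_derivative_within_alt
  proof (intro conjI allI impI L(1))
    fix e :: real assume e: "e > 0"
    show "\<exists>d>0. \<forall>x\<in>E. norm (x - 0) < d \<longrightarrow> norm (f x - f 0 - L (x - 0)) \<le> e * norm (x - 0)"
    proof (intro exI[of _ "min R (e / (c + 1))"] conjI ballI impI)
      show "min R (e / (c + 1)) > 0" using R e by simp
      fix x assume x: "x \<in> E" "norm (x - 0) < min R (e / (c + 1))"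
      then have "norm (f x - f 0 - L (x - 0)) \<le> c * norm x * norm (x - 0)"
        using R by (intro tame_onD1[OF R(4)]) (auto simp: subspace_0[OF assms(2)])
      also have "\<dots> \<le> e * norm (x - 0)"
      proof (rule mult_right_mono)
        have "c * norm x \<le> (c + 1) * (e / (c + 1))" using x R by (intro mult_mono) auto
        then show "c * norm x \<le> e" using R by simp
      qed simp
      finally show "norm (f x - f 0 - L (x - 0)) \<le> e * norm (x - 0)" .
    qed
  qed
qed

lemma charts_at_max: "smooth_manifold M \<Longrightarrow> C \<in> charts_at M p \<Longrightarrow> C \<in> max_atlas M \<and> p \<in> fst C"
  using atlas_subset_max_atlas by (auto simp: charts_at_def)

lemma coord_vector_cderiv:
  "coord_vector M C p u C' = (if C' \<in> charts_at M p then cderiv M C C' (\<lambda>x. x) p u else 0)"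
  by (simp add: coord_vector_def cderiv_def o_def)

lemma coord_vector_self:
  assumes "smooth_manifold M" "C \<in> charts_at M p" "u \<in> model M"
  shows "coord_vector M C p u C = u"
  using assms charts_at_max[OF assms(1,2)] by (simp add: coord_vector_cderiv cderiv_id)

text \<open>The consistency demanded by \<open>tangent_space\<close> is the chain rule for three
  charts around \<open>p\<close>.\<close>

lemma coord_vector_tangent:
  assumes M: "smooth_manifold M" and C: "C \<in> charts_at M p" and u: "u \<in> model M"
  shows "coord_vector M C p u \<in> tangent_space M p"
  unfolding tangent_space_def
proof (intro CollectI ballI conjI)
  fix C' assume C': "C' \<in> charts_at M p"
  note c = charts_at_max[OF M C] and c' = charts_at_max[OF M C']
  have p: "p \<in> topspace (mtop M)" using c is_chart_subset[OF max_atlas_is_chart] by blast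
  note sm = smooth_at_id[OF M p]
  show v: "coord_vector M C p u C' \<in> model M"
    unfolding coord_vector_cderiv using C' cderiv_in[OF M M sm, of C C' u] c c' u by simp
  show "coord_vector M C p u = coord_vector M C' p (coord_vector M C p u C')"
  proof
    fix C''
    show "coord_vector M C p u C'' = coord_vector M C' p (coord_vector M C p u C') C''"
    proof (cases "C'' \<in> charts_at M p")
      case True
      then show ?thesis
        using C' cderiv_compose[OF M M M sm sm, of C C' C'' u] c c' charts_at_max[OF M True] u
        by (simp add: coord_vector_cderiv)
    qed (simp add: coord_vector_def)
  qed
qed

lemma tangent_space_model: "v \<in> tangent_space M p \<Longrightarrow> C \<in> charts_at M p \<Longrightarrow> v C \<in> model M"
  by (simp add: tangent_space_def)

lemma tangent_space_cderiv:
  "v \<in> tangent_space M p \<Longrightarrow> C \<in> charts_at M p \<Longrightarrow>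
    v C' = (if C' \<in> charts_at M p then cderiv M C C' (\<lambda>x. x) p (v C) else 0)"
  unfolding coord_vector_cderiv[symmetric] tangent_space_def by (metis (mono_tags, lifting) mem_Collect_eq)

context lie
begin

lemma smooth_at_pow: "p \<in> carrier G \<Longrightarrow> smooth_at M M (\<lambda>x. x [^] (n::nat)) p"
proof (induction n)
  case 0
  then show ?case using smooth_at_const_carrier[OF M, of p \<one>] top by simp
next
  case (Suc n)
  then show ?case using smooth_at_mult[OF M Suc.IH smooth_at_ident] by simp
qed

text \<open>The two charts differ by a translation.\<close>

lemma cderiv_base_CC:
  assumes u: "u \<in> E"
  shows "cderiv M base_chart CC (\<lambda>x. x) \<one> u = u" "cderiv M CC base_chart (\<lambda>x. x) \<one> u = u"
proof -
  note b = base_chart_max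
  note ch = max_atlas_is_chart[OF b(1)]
  let ?c = "snd base_chart \<one>"
  have o: "openin (mtop M) (fst base_chart)" using ch by (simp add: is_chart_def)
  obtain Q where Q: "open Q" "?c \<in> Q" "\<And>x. x \<in> E \<Longrightarrow> x \<in> Q \<Longrightarrow> snd base_chart (chart_inv base_chart x) = x"
    using chart_nhd[OF ch o b(2) b(2)] by metis
  have d: "((\<lambda>x. x - ?c) has_derivative (\<lambda>v. v)) (at ?c within E)" by (auto intro!: derivative_eq_intros)
  have "((snd CC \<circ> (\<lambda>x. x) \<circ> chart_inv base_chart) has_derivative (\<lambda>v. v)) (at ?c within E)"
    by (rule has_derivative_within_local[OF d Q(1,2) is_chart_model[OF ch b(2)]]) (use Q(3) in \<open>auto simp: CC_def\<close>)
  from cderiv_unique[OF M b this u] show "cderiv M base_chart CC (\<lambda>x. x) \<one> u = u" .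
  obtain Q where Q: "open Q" "0 \<in> Q" "\<And>x. x \<in> E \<Longrightarrow> x \<in> Q \<Longrightarrow> y (\<psi> x) = x"
    using chart_nhd[OF CC_chart CC_open CC_one(1) CC_one(1)] CC_one(2) by metis
  have d: "((\<lambda>x. x + ?c) has_derivative (\<lambda>v. v)) (at 0 within E)" by (auto intro!: derivative_eq_intros)
  have "((snd base_chart \<circ> (\<lambda>x. x) \<circ> \<psi>) has_derivative (\<lambda>v. v)) (at 0 within E)"
    by (rule has_derivative_within_local[OF d Q(1,2) E0]) (use Q(3) in \<open>auto simp: CC_def algebra_simps\<close>)
  from cderiv_unique[OF M CC_max CC_one(1) _ u, of base_chart "\<lambda>x. x", unfolded CC_one, OF this]
  show "cderiv M CC base_chart (\<lambda>x. x) \<one> u = u" .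
qed

lemma cderiv_base_base:
  assumes s: "smooth_at M M \<theta> \<one>" "\<theta> \<one> = \<one>" and u: "u \<in> E"
  shows "cderiv M base_chart base_chart \<theta> \<one> u = dCC \<theta> u"
proof -
  note b = base_chart_max
  note i = smooth_at_ident[OF one_closed]
  have s': "smooth_at M M (\<lambda>x. x) (\<theta> \<one>)" using i s(2) by simp
  have "cderiv M base_chart base_chart \<theta> \<one> u = cderiv M CC base_chart \<theta> \<one> (cderiv M base_chart CC (\<lambda>x. x) \<one> u)"
    using cderiv_compose[OF M M M i s(1), of base_chart CC base_chart u] b CC_max s(2) u by simp
  also have "\<dots> = cderiv M CC base_chart \<theta> \<one> u" by (simp add: cderiv_base_CC u)
  also have "\<dots> = cderiv M CC base_chart (\<lambda>x. x) (\<theta> \<one>) (dCC \<theta> u)"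
    using cderiv_compose[OF M M M s(1) s', of CC CC base_chart u] b CC_max s(2) u by simp
  also have "\<dots> = dCC \<theta> u" using cderiv_base_CC(2)[OF dCC_in[OF s u]] s(2) by simp
  finally show ?thesis .
qed

end

context lie_log
begin

text \<open>Additivity of \<open>ex\<close> along a line turns differentiability at 0 into an
  autonomous differential equation with smooth right-hand side for the curve, and the equation
  raises the class of the curve step by step. This is smoothness in \<open>t\<close> for fixed
  \<open>X\<close>, not in \<open>X\<close>.\<close>

lemma ex_curve_smooth:
  assumes X: "X \<in> E"
  obtains \<delta> where "\<delta> > 0" "\<And>k. Ck_on k (ball 0 \<delta>) (\<lambda>t. y (ex (t *\<^sub>R X)))" "\<And>t. \<bar>t\<bar> < \<delta> \<Longrightarrow> norm (t *\<^sub>R X) < r2"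
    "((\<lambda>t. y (ex (t *\<^sub>R X))) has_vector_derivative X) (at 0)"
proof -
  let ?c = "\<lambda>t. y (ex (t *\<^sub>R X))"
  have tX: "t *\<^sub>R X \<in> E" for t using X subE by (simp add: subspace_scale)
  have d0: "(?c has_vector_derivative X) (at 0)"
    using has_derivative_along_subspace[OF subE E0 tame_has_derivative[OF tame_ex subE] X] by simp
  have 0: "0 \<in> EE" using E0 by (simp add: zero_prod_def)
  obtain Q \<mu>' where Q: "open Q" "0 \<in> Q" "\<And>k. Ck_on k Q \<mu>'" "\<And>z. z \<in> EE \<Longrightarrow> z \<in> Q \<Longrightarrow> \<mu>' z = \<mu> z"
    using smooth_germE[OF smooth_at_subspaceD(1)[OF subEE subE smooth_at_\<mu>0] open_UNIV] by (metis UNIV_I)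
  \<comment> \<open>The left-invariant vector field of \<open>X\<close> in coordinates.\<close>
  define V where "V = (\<lambda>x. frechet_derivative \<mu>' (at (x, 0)) (0, X))"
  define Q' where "Q' = (\<lambda>x::'e. (x, 0::'e)) -` Q"
  have Q': "open Q'" unfolding Q'_def by (intro open_vimage Q(1) continuous_intros)
  have l: "linear (\<lambda>x::'e. (x, 0::'e))" by (auto intro!: linearI)
  have CV: "Ck_on k Q' V" for k
    unfolding V_def
  proof (rule Ck_on_compose[OF Q' Q(1), where f = "\<lambda>x. (x, 0)" and g = "\<lambda>z. frechet_derivative \<mu>' (at z) (0, X)"])
    show "Ck_on k Q' (\<lambda>x. (x, 0::'e))" by (rule Ck_on_subset[OF Ck_on_linear[OF l]]) simp
    show "Ck_on k Q (\<lambda>z. frechet_derivative \<mu>' (at z) (0, X))" using Q(3)[of "Suc k"] by simp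
  qed (auto simp: Q'_def)
  obtain \<rho> where \<rho>: "\<rho> > 0" "\<And>z. norm z \<le> \<rho> \<Longrightarrow> z \<in> Q" using open_contains_cball_subspace[OF Q(1,2)] by metis
  obtain R' K where K: "R' > 0" "K \<ge> 1" "\<And>X. X \<in> E \<Longrightarrow> norm X \<le> R' \<Longrightarrow> norm (y (ex X)) \<le> K * norm X"
    using tame_lipschitz[OF tame_ex subE] by metis
  \<comment> \<open>The bound \<open>\<rho> / (2 * K)\<close> keeps each coordinate within
    \<open>\<rho> / 2\<close>, so that pairs of points of the curve stay in the domain
    \<open>Q\<close> of \<open>\<mu>'\<close>.\<close>
  define \<eta> where "\<eta> = min r2 (min R' (\<rho> / (2 * K)))"
  have \<eta>: "\<eta> > 0" "\<eta> \<le> r2" using r2 K \<rho> by (auto simp: \<eta>_def)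
  define \<delta> where "\<delta> = \<eta> / (norm X + 1)"
  have \<delta>: "\<delta> > 0" using \<eta> by (simp add: \<delta>_def add_nonneg_pos)
  have small: "norm (t *\<^sub>R X) < \<eta>" if "\<bar>t\<bar> < \<delta>" for t
  proof -
    have "norm (t *\<^sub>R X) \<le> \<bar>t\<bar> * (norm X + 1)" by (simp add: distrib_left)
    also have "\<dots> < \<eta>" using that pos_less_divide_eq[of "norm X + 1" "\<bar>t\<bar>" \<eta>] by (simp add: \<delta>_def add_nonneg_pos)
    finally show ?thesis .
  qed
  have cn: "norm (?c t) \<le> \<rho> / 2" if "\<bar>t\<bar> < \<delta>" for t
  proof -
    have "norm (?c t) \<le> K * norm (t *\<^sub>R X)" using small[OF that] by (intro K tX) (auto simp: \<eta>_def)
    also have "\<dots> \<le> K * (\<rho> / (2 * K))" using small[OF that] K by (intro mult_left_mono) (auto simp: \<eta>_def)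
    finally show ?thesis using K by simp
  qed
  have cQ: "(?c t, ?c s) \<in> Q" if "\<bar>t\<bar> < \<delta>" "\<bar>s\<bar> < \<delta>" for t s
    using norm_Pair_le[of "?c t" "?c s"] cn[OF that(1)] cn[OF that(2)] by (intro \<rho>(2)) linarith
  have exB: "ex (t *\<^sub>R X) \<in> fst CC" if "\<bar>t\<bar> < \<delta>" for t
    using ex[OF tX, of t] small[OF that] \<eta> r2 by (simp add: Bd_def)
  have c0: "?c 0 = 0" by simp
  have cQ': "?c t \<in> Q'" if "\<bar>t\<bar> < \<delta>" for t using cQ[OF that, of 0] \<delta> c0 by (simp add: Q'_def)
  have d: "(?c has_vector_derivative V (?c t)) (at t)" if t: "\<bar>t\<bar> < \<delta>" for t
  proof -
    have q: "(?c t, 0) \<in> Q" using cQ'[OF t] by (simp add: Q'_def)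
    have "((\<lambda>s. (?c t, ?c s)) has_derivative (\<lambda>h. (0, h *\<^sub>R X))) (at 0)"
      using d0 unfolding has_vector_derivative_def by (intro has_derivative_Pair has_derivative_const)
    moreover have "(\<mu>' has_derivative frechet_derivative \<mu>' (at (?c t, 0))) (at (?c t, ?c 0))"
      using Ck_on_SucD[OF Q(3) q] by simp
    ultimately have "(\<mu>' \<circ> (\<lambda>s. (?c t, ?c s)) has_derivative frechet_derivative \<mu>' (at (?c t, 0)) \<circ> (\<lambda>h. (0, h *\<^sub>R X))) (at 0)"
      by (rule diff_chain_at)
    moreover have "frechet_derivative \<mu>' (at (?c t, 0)) (0, h *\<^sub>R X) = h *\<^sub>R V (?c t)" for h
      using linear_cmul[OF has_derivative_linear[OF Ck_on_SucD[OF Q(3) q]], of h "(0, X)"] by (simp add: V_def)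
    ultimately have "((\<lambda>s. \<mu>' (?c t, ?c s)) has_vector_derivative V (?c t)) (at 0)"
      by (simp add: has_vector_derivative_def o_def)
    then have s: "((\<lambda>s. ?c (t + s)) has_vector_derivative V (?c t)) (at 0)"
    proof (rule has_vector_derivative_transform_within_open[OF _ open_ball[of 0 \<delta>]])
      show "0 \<in> ball (0::real) \<delta>" using \<delta> by simp
      fix s :: real assume "s \<in> ball 0 \<delta>"
      then have s: "\<bar>s\<bar> < \<delta>" by simp
      have "\<mu>' (?c t, ?c s) = \<mu> (?c t, ?c s)" using Q(4) cQ[OF t s] yE exB t s by simp
      also have "\<dots> = y (ex (t *\<^sub>R X) \<otimes> ex (s *\<^sub>R X))" using \<psi>y exB t s by (simp add: \<mu>_def)
      also have "\<dots> = ?c (t + s)" using ex_add[OF X] small t s \<eta> by (smt (verit))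
      finally show "\<mu>' (?c t, ?c s) = ?c (t + s)" .
    qed
    have "((\<lambda>u. u - t) has_vector_derivative 1) (at t)" by (auto intro!: derivative_eq_intros)
    moreover have "((\<lambda>s. ?c (t + s)) has_vector_derivative V (?c t)) (at (t - t))" using s by simp
    ultimately have "((\<lambda>s. ?c (t + s)) \<circ> (\<lambda>u. u - t) has_vector_derivative (1 *\<^sub>R V (?c t))) (at t)"
      by (rule vector_diff_chain_at)
    then show ?thesis by (simp add: o_def)
  qed
  have "Ck_on k (ball 0 \<delta>) ?c" for k
  proof (induction k)
    case 0
    show ?case
      using d by (auto intro!: continuous_at_imp_continuous_on has_vector_derivative_continuous)
  next
    case (Suc k)
    show ?case
    proof (rule Ck_on_SucI[OF open_ball])
      show "(?c has_derivative (\<lambda>h. h *\<^sub>R V (?c t))) (at t)" if "t \<in> ball 0 \<delta>" for t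
        using d[of t] that by (simp add: has_vector_derivative_def)
      have "Ck_on k (ball 0 \<delta>) (\<lambda>t. V (?c t))"
        using cQ' by (intro Ck_on_compose[OF open_ball Q' _ Suc CV]) auto
      then show "Ck_on k (ball 0 \<delta>) (\<lambda>t. h *\<^sub>R V (?c t))" for h
        by (intro Ck_on_scaleR[OF open_ball Ck_on_const])
    qed
  qed
  then show thesis using that[of \<delta>] \<delta> small \<eta> d0 by (meson less_le_trans)
qed

text \<open>Smoothness at \<open>t0\<close> is smoothness at 0 followed by left translation by
  \<open>Exp (t0 *\<^sub>R X)\<close>.\<close>

lemma smooth_at_Exp_curve:
  assumes X: "X \<in> E"
  shows "smooth_at real_mfd M (\<lambda>t. Exp (t *\<^sub>R X)) t0"
proof -
  let ?c = "\<lambda>t. y (ex (t *\<^sub>R X))"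
  obtain \<delta> where \<delta>: "\<delta> > 0" "\<And>k. Ck_on k (ball 0 \<delta>) ?c" "\<And>t. \<bar>t\<bar> < \<delta> \<Longrightarrow> norm (t *\<^sub>R X) < r2"
    using ex_curve_smooth[OF X] by metis
  have tX: "t *\<^sub>R X \<in> E" for t using X subE by (simp add: subspace_scale)
  have exB: "ex (t *\<^sub>R X) \<in> fst CC" if "\<bar>t\<bar> < \<delta>" for t
    using ex[OF tX, of t] \<delta>(3)[OF that] r2 by (simp add: Bd_def)
  have c0: "smooth_at (subspace_mfd UNIV) (subspace_mfd E) ?c 0"
  proof (rule smooth_at_subspaceI[OF subspace_UNIV subE])
    show "smooth_germ UNIV ?c 0" by (rule smooth_germI[OF open_ball _ \<delta>(2)]) (use \<delta>(1) in auto)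
    show "?c s \<in> E" if "s \<in> ball 0 \<delta>" for s using yE[OF exB] that by simp
  qed (use \<delta> in auto)
  have "smooth_at (subspace_mfd E) M \<psi> (?c 0)" using smooth_at_\<psi>0 by simp
  from smooth_at_compose[OF smooth_manifold_real[unfolded real_mfd_eq] ME M c0 this]
  have "smooth_at real_mfd M (\<lambda>t. \<psi> (?c t)) 0" unfolding real_mfd_eq .
  then have s0: "smooth_at real_mfd M (\<lambda>t. Exp (t *\<^sub>R X)) 0"
  proof (rule smooth_at_local[OF smooth_manifold_real])
    show "openin (mtop real_mfd) (ball 0 \<delta>)" by (simp add: real_mfd_def)
    show "\<psi> (?c t) = Exp (t *\<^sub>R X)" if "t \<in> ball 0 \<delta>" for t
      using \<psi>y[OF exB] Exp_small[OF tX \<delta>(3)] that by simp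
  qed (use \<delta> in simp)
  have "smooth_germ UNIV (\<lambda>t::real. t) t0" using smooth_germ_linear[OF linear_id] by (simp add: id_def)
  then have "smooth_germ UNIV (\<lambda>t. t + (- t0)) t0" by (rule smooth_germ_add[OF _ smooth_germ_const UNIV_I])
  then have sh: "smooth_at real_mfd real_mfd (\<lambda>t. t + (- t0)) t0"
    unfolding real_mfd_eq
    by (rule smooth_at_subspaceI[OF subspace_UNIV subspace_UNIV _ UNIV_I open_UNIV UNIV_I UNIV_I])
  have s0': "smooth_at real_mfd M (\<lambda>t. Exp (t *\<^sub>R X)) (t0 + - t0)" using s0 by simp
  note smooth_at_compose[OF smooth_manifold_real smooth_manifold_real M sh s0']
  then have "smooth_at real_mfd M (\<lambda>t. Exp (t0 *\<^sub>R X) \<otimes> Exp ((t + (- t0)) *\<^sub>R X)) t0"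
    by (intro smooth_at_mult smooth_manifold_real smooth_at_const_carrier Exp_carrier tX) (auto simp: real_mfd_def)
  moreover have "Exp (t0 *\<^sub>R X) \<otimes> Exp ((t + (- t0)) *\<^sub>R X) = Exp (t *\<^sub>R X)" for t
    using Exp_add[OF X, of t0 "t + (- t0)"] by simp
  ultimately show ?thesis by simp
qed

lemma Exp_curve_derivative:
  assumes X: "X \<in> E"
  shows "((\<lambda>t. y (Exp (t *\<^sub>R X))) has_vector_derivative X) (at 0)"
proof -
  obtain \<delta> where \<delta>: "\<delta> > 0" "\<And>t. \<bar>t\<bar> < \<delta> \<Longrightarrow> norm (t *\<^sub>R X) < r2"
    "((\<lambda>t. y (ex (t *\<^sub>R X))) has_vector_derivative X) (at 0)"
    using ex_curve_smooth[OF X] by metis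
  show ?thesis
    by (rule has_vector_derivative_transform_within_open[OF \<delta>(3) open_ball[of 0 \<delta>]])
       (use \<delta> Exp_small subspace_scale[OF subE X] in auto)
qed

lemma one_parameter_subgroup_Exp:
  assumes X: "X \<in> E" shows "one_parameter_subgroup G M (\<lambda>t. Exp (t *\<^sub>R X))"
  unfolding one_parameter_subgroup_def
  using smooth_at_imp_smooth_map[OF smooth_manifold_real M smooth_at_Exp_curve[OF X]] Exp_add[OF X] by blast

lemma smooth_one_parameter_Exp:
  assumes hom: "\<And>s t::real. \<gamma> (s + t) = \<gamma> s \<otimes> \<gamma> t" and s: "\<And>t. smooth_at real_mfd M \<gamma> t"
  shows "cderiv real_mfd (UNIV, id) CC \<gamma> 0 1 \<in> E" "\<gamma> t = Exp (t *\<^sub>R cderiv real_mfd (UNIV, id) CC \<gamma> 0 1)"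
proof -
  have c: "\<gamma> t \<in> carrier G" for t using smooth_at_topspace(2)[OF s] top by blast
  have \<gamma>0: "\<gamma> 0 = \<one>" using hom_pow_scale[OF hom c, of 0 0] by simp
  have cont: "\<exists>\<delta>>0. \<forall>t. \<bar>t\<bar> < \<delta> \<longrightarrow> \<gamma> t \<in> W" if W: "openin (mtop M) W" "\<one> \<in> W" for W
  proof -
    obtain S where S: "openin (mtop real_mfd) S" "0 \<in> S" "\<gamma> ` S \<subseteq> W"
      using smooth_at_continuous[OF smooth_manifold_real s W(1)] W(2) \<gamma>0 by metis
    then have "open S" by (simp add: real_mfd_def)
    then obtain \<delta> where \<delta>: "\<delta> > 0" "ball 0 \<delta> \<subseteq> S" using S(2) open_contains_ball by metis
    have "\<gamma> t \<in> W" if "\<bar>t\<bar> < \<delta>" for t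
    proof -
      have "t \<in> ball 0 \<delta>" using that by simp
      then show ?thesis using \<delta>(2) S(3) by blast
    qed
    then show ?thesis using \<delta>(1) by blast
  qed
  have "\<gamma> 0 \<in> fst CC" using \<gamma>0 by simp
  note d = curve_has_vector_derivative[OF M s CC_max this]
  show "cderiv real_mfd (UNIV, id) CC \<gamma> 0 1 \<in> E" "\<gamma> t = Exp (t *\<^sub>R cderiv real_mfd (UNIV, id) CC \<gamma> 0 1)"
    using one_parameter_Exp[OF hom c cont d] by blast+
qed

lemma Exp_curve_cderiv:
  assumes X: "X \<in> E" shows "cderiv real_mfd (UNIV, id) CC (\<lambda>t. Exp (t *\<^sub>R X)) 0 1 = X"
  using curve_has_vector_derivative[OF M smooth_at_Exp_curve[OF X] CC_max, of 0] Exp_curve_derivative[OF X]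
  by (auto intro: vector_derivative_unique_at)

text \<open>\<open>\<theta> (Exp (t *\<^sub>R X))\<close> is a one-parameter subgroup with initial
  velocity \<open>dCC \<theta> X\<close>.\<close>

lemma Exp_hom:
  assumes hom: "\<And>a b. a \<in> carrier G \<Longrightarrow> b \<in> carrier G \<Longrightarrow> \<theta> (a \<otimes> b) = \<theta> a \<otimes> \<theta> b"
    and s: "\<And>p. p \<in> carrier G \<Longrightarrow> smooth_at M M \<theta> p" "\<theta> \<one> = \<one>" and X: "X \<in> E"
  shows "\<theta> (Exp X) = Exp (dCC \<theta> X)"
proof -
  have tX: "Exp (t *\<^sub>R X) \<in> carrier G" for t using X subE by (intro Exp_carrier subspace_scale)
  have h: "\<theta> (Exp ((u + v) *\<^sub>R X)) = \<theta> (Exp (u *\<^sub>R X)) \<otimes> \<theta> (Exp (v *\<^sub>R X))" for u v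
    using Exp_add[OF X] hom tX by simp
  have s': "smooth_at real_mfd M (\<lambda>t. \<theta> (Exp (t *\<^sub>R X))) t" for t
    using smooth_at_compose[OF smooth_manifold_real M M smooth_at_Exp_curve[OF X] s(1)[OF tX]] .
  have "cderiv real_mfd (UNIV, id) CC (\<lambda>t. \<theta> (Exp (t *\<^sub>R X))) 0 1 = dCC \<theta> (cderiv real_mfd (UNIV, id) CC (\<lambda>t. Exp (t *\<^sub>R X)) 0 1)"
    using cderiv_compose[OF smooth_manifold_real M M smooth_at_Exp_curve[OF X] s(1)[OF tX], of "(UNIV, id)" 0 CC CC 1]
      real_chart CC_max s(2) by (simp add: real_mfd_def)
  then have "cderiv real_mfd (UNIV, id) CC (\<lambda>t. \<theta> (Exp (t *\<^sub>R X))) 0 1 = dCC \<theta> X" by (simp add: Exp_curve_cderiv[OF X])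
  then show ?thesis using smooth_one_parameter_Exp(2)[OF h s', of 1] by simp
qed

text \<open>A tangent vector is determined by its component in \<open>base_chart\<close>, so the
  condition on the velocity amounts to one vector equation. Existence and uniqueness of the curve
  then resolve the definite description in \<open>lie_exp\<close>.\<close>

lemma lie_exp_eq:
  assumes v: "v \<in> lie_algebra G M"
  shows "v base_chart \<in> E" "lie_exp G M v = Exp (v base_chart)"
proof -
  let ?X = "v base_chart"
  have vT: "v \<in> tangent_space M \<one>" using v by (simp add: lie_algebra_def)
  show X: "?X \<in> E" by (rule tangent_space_model[OF vT base_chart])
  have vel: "velocity M \<gamma> 0 = v \<longleftrightarrow> cderiv real_mfd (UNIV, id) CC \<gamma> 0 1 = ?X"
    if s: "smooth_at real_mfd M \<gamma> 0" and g0: "\<gamma> 0 = \<one>" for \<gamma>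
  proof -
    let ?w = "\<lambda>C. cderiv real_mfd (UNIV, id) C \<gamma> 0 1"
    have m: "model real_mfd = UNIV" by (simp add: real_mfd_def)
    have velC: "velocity M \<gamma> 0 C = (if C \<in> charts_at M \<one> then ?w C else 0)" for C
    proof (cases "C \<in> charts_at M \<one>")
      case True
      have "\<gamma> 0 \<in> fst C" "C \<in> max_atlas M" using charts_at_max[OF M True] g0 by auto
      from curve_has_vector_derivative[OF M s this(2,1)] show ?thesis
        using True by (simp add: velocity_def g0 vector_derivative_at o_def)
    qed (simp add: velocity_def g0)
    have i: "smooth_at M M (\<lambda>x. x) (\<gamma> 0)" using smooth_at_ident[OF one_closed] g0 by simp
    have wC: "?w C = cderiv M base_chart C (\<lambda>x. x) \<one> (?w base_chart)" if "C \<in> charts_at M \<one>" for C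
      using cderiv_compose[OF smooth_manifold_real M M s i real_chart _ base_chart_max(1) _ _ _, of C 1]
        charts_at_max[OF M that] base_chart_max g0 m by simp
    have wCC: "?w CC = ?w base_chart"
    proof (rule vector_derivative_unique_at)
      have "\<gamma> 0 \<in> fst CC" using g0 by simp
      then show "((\<lambda>t. y (\<gamma> t)) has_vector_derivative ?w CC) (at 0)"
        by (rule curve_has_vector_derivative[OF M s CC_max])
      have "\<gamma> 0 \<in> fst base_chart" using g0 base_chart_max by simp
      from curve_has_vector_derivative[OF M s base_chart_max(1) this]
      have "((\<lambda>t. snd base_chart (\<gamma> t) - snd base_chart \<one>) has_vector_derivative ?w base_chart - 0) (at 0)"
        by (intro has_vector_derivative_diff has_vector_derivative_const)
      then show "((\<lambda>t. y (\<gamma> t)) has_vector_derivative ?w base_chart) (at 0)" by (simp add: CC_def)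
    qed
    show ?thesis
    proof
      assume "velocity M \<gamma> 0 = v"
      then show "?w CC = ?X" using velC[of base_chart] base_chart wCC by auto
    next
      assume a: "?w CC = ?X"
      show "velocity M \<gamma> 0 = v"
      proof
        fix C show "velocity M \<gamma> 0 C = v C"
          using velC[of C] wC[of C] a wCC tangent_space_cderiv[OF vT base_chart, of C] by simp
      qed
    qed
  qed
  have "(THE \<gamma>. one_parameter_subgroup G M \<gamma> \<and> velocity M \<gamma> 0 = v) = (\<lambda>t. Exp (t *\<^sub>R ?X))"
  proof (rule the_equality)
    have "velocity M (\<lambda>t. Exp (t *\<^sub>R ?X)) 0 = v"
      using vel[OF smooth_at_Exp_curve[OF X]] Exp_curve_cderiv[OF X] by simp
    then show "one_parameter_subgroup G M (\<lambda>t. Exp (t *\<^sub>R ?X)) \<and> velocity M (\<lambda>t. Exp (t *\<^sub>R ?X)) 0 = v"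
      using one_parameter_subgroup_Exp[OF X] by blast
  next
    fix \<gamma> assume g: "one_parameter_subgroup G M \<gamma> \<and> velocity M \<gamma> 0 = v"
    then have hom: "\<And>s t. \<gamma> (s + t) = \<gamma> s \<otimes> \<gamma> t" and sm: "smooth_map real_mfd M \<gamma>"
      by (auto simp: one_parameter_subgroup_def)
    have s: "smooth_at real_mfd M \<gamma> t" for t
      by (rule smooth_map_imp_smooth_at[OF smooth_manifold_real M sm]) (simp add: real_mfd_def)
    have "\<gamma> 0 = \<one>" using hom_pow_scale[OF hom, of 0 0] smooth_at_topspace(2)[OF s] top by simp
    then have "cderiv real_mfd (UNIV, id) CC \<gamma> 0 1 = ?X" using vel[OF s] g by simp
    then show "\<gamma> = (\<lambda>t. Exp (t *\<^sub>R ?X))" using smooth_one_parameter_Exp(2)[OF hom s] by auto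
  qed
  then show "lie_exp G M v = Exp ?X" by (simp add: lie_exp_def)
qed

text \<open>All components of a tangent vector are linear images of the one in
  \<open>base_chart\<close>, and the derivative of \<open>\<sigma>\<close> is the same in
  \<open>base_chart\<close> and in \<open>CC\<close>; so an equation between families becomes an
  equation between vectors.\<close>

lemma minus_eigenspace_iff:
  assumes s: "smooth_at M M \<sigma> \<one>" "\<sigma> \<one> = \<one>" and v: "v \<in> lie_algebra G M"
  shows "v \<in> minus_eigenspace G M \<sigma> \<longleftrightarrow> dCC \<sigma> (v base_chart) = - v base_chart"
proof -
  let ?X = "v base_chart"
  have vT: "v \<in> tangent_space M \<one>" using v by (simp add: lie_algebra_def)
  have X: "?X \<in> E" by (rule tangent_space_model[OF vT base_chart])
  have dX: "dCC \<sigma> ?X \<in> E" by (rule dCC_in[OF s X])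
  note b = base_chart_max
  have i: "smooth_at M M (\<lambda>x. x) (\<sigma> \<one>)" using smooth_at_ident[OF one_closed] s(2) by simp
  have D: "differential M M \<sigma> \<one> v C = (if C \<in> charts_at M \<one> then cderiv M base_chart C (\<lambda>x. x) \<one> (dCC \<sigma> ?X) else 0)" for C
  proof (cases "C \<in> charts_at M \<one>")
    case True
    note c = charts_at_max[OF M True]
    have "differential M M \<sigma> \<one> v C = cderiv M base_chart C \<sigma> \<one> ?X"
      using True by (simp add: differential_def s(2) cderiv_def Let_def flip: base_chart_def)
    also have "\<dots> = cderiv M base_chart C (\<lambda>x. x) (\<sigma> \<one>) (cderiv M base_chart base_chart \<sigma> \<one> ?X)"
      using cderiv_compose[OF M M M s(1) i b, of base_chart C ?X] b c s(2) X by simp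
    finally show ?thesis using True cderiv_base_base[OF s X] s(2) by simp
  qed (simp add: differential_def s(2))
  have lin: "linear (cderiv M base_chart C (\<lambda>x. x) \<one>)" if "C \<in> charts_at M \<one>" for C
    using cderiv_linear[OF M M smooth_at_ident[OF one_closed] b, of C] charts_at_max[OF M that] by simp
  have V: "- v C = (if C \<in> charts_at M \<one> then cderiv M base_chart C (\<lambda>x. x) \<one> (- ?X) else 0)" for C
    using tangent_space_cderiv[OF vT base_chart, of C] linear_neg[OF lin, of C ?X] by auto
  show ?thesis
  proof
    assume "v \<in> minus_eigenspace G M \<sigma>"
    then have "differential M M \<sigma> \<one> v base_chart = - v base_chart" by (simp add: minus_eigenspace_def)
    then show "dCC \<sigma> ?X = - ?X"
      using D[of base_chart] base_chart cderiv_id[OF M b dX] by simp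
  next
    assume a: "dCC \<sigma> ?X = - ?X"
    have "differential M M \<sigma> \<one> v = (\<lambda>C. - v C)"
    proof
      show "differential M M \<sigma> \<one> v C = - v C" for C by (rule trans[OF D[of C, unfolded a] V[of C, symmetric]])
    qed
    then show "v \<in> minus_eigenspace G M \<sigma>" using v by (simp add: minus_eigenspace_def)
  qed
qed

lemma symmetric_subset_eq:
  assumes s: "smooth_at M M \<sigma> \<one>" "\<sigma> \<one> = \<one>"
  shows "symmetric_subset G M \<sigma> = Exp ` {X \<in> E. dCC \<sigma> X = - X}"
proof (intro equalityI subsetI)
  fix g assume "g \<in> symmetric_subset G M \<sigma>"
  then obtain v where v: "v \<in> minus_eigenspace G M \<sigma>" "g = lie_exp G M v" by (auto simp: symmetric_subset_def)
  then have vL: "v \<in> lie_algebra G M" by (simp add: minus_eigenspace_def)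
  show "g \<in> Exp ` {X \<in> E. dCC \<sigma> X = - X}"
    using v lie_exp_eq[OF vL] minus_eigenspace_iff[OF s vL] by auto
next
  fix g assume "g \<in> Exp ` {X \<in> E. dCC \<sigma> X = - X}"
  then obtain X where X: "X \<in> E" "dCC \<sigma> X = - X" "g = Exp X" by auto
  let ?v = "coord_vector M base_chart \<one> X"
  have vL: "?v \<in> lie_algebra G M" using coord_vector_tangent[OF M base_chart X(1)] by (simp add: lie_algebra_def)
  have vb: "?v base_chart = X" by (rule coord_vector_self[OF M base_chart X(1)])
  have "?v \<in> minus_eigenspace G M \<sigma>" using minus_eigenspace_iff[OF s vL] X(2) vb by simp
  moreover have "lie_exp G M ?v = g" using lie_exp_eq[OF vL] vb X(3) by simp
  ultimately show "g \<in> symmetric_subset G M \<sigma>" unfolding symmetric_subset_def by blast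
qed

text \<open>One \<open>N\<close> serves all \<open>X\<close> within distance 1 of \<open>X0\<close>.
  There \<open>Exp\<close> is a power map after \<open>ex\<close>, which is Lipschitz near 0 because
  it is tame.\<close>

lemma Exp_continuous: "continuous_map (top_of_set E) (mtop M) Exp"
  unfolding continuous_map_def
proof (intro conjI allI impI)
  show "Exp \<in> topspace (top_of_set E) \<rightarrow> topspace (mtop M)" using Exp_carrier top by auto
  fix W assume W: "openin (mtop M) W"
  obtain R' K where K: "R' > 0" "K \<ge> 1" "\<And>X Y. X \<in> E \<Longrightarrow> Y \<in> E \<Longrightarrow> norm X \<le> R' \<Longrightarrow> norm Y \<le> R' \<Longrightarrow> norm (y (ex X) - y (ex Y)) \<le> K * norm (X - Y)"
    using tame_lipschitz[OF tame_ex subE] by metis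
  have "openin (top_of_set E) {X \<in> E. Exp X \<in> W}"
  proof (subst openin_subopen, intro ballI)
    fix X0 assume "X0 \<in> {X \<in> E. Exp X \<in> W}"
    then have X0: "X0 \<in> E" "Exp X0 \<in> W" by auto
    obtain N0 :: nat where N0: "N0 > 0" "norm X0 + 1 < r2 * real N0" using Exp_bound .
    obtain N1 :: nat where N1: "(norm X0 + 1) / R' < real N1" using reals_Archimedean2 by blast
    define N where "N = N0 + N1"
    have N: "N > 0" using N0 by (simp add: N_def)
    have "r2 * real N0 \<le> r2 * real N" using r2 by (simp add: N_def)
    then have Nr: "norm X0 + 1 < r2 * real N" using N0 by linarith
    have "(norm X0 + 1) / R' < real N" using N1 by (simp add: N_def)
    then have NR: "norm X0 + 1 < R' * real N" using K(1) by (simp add: field_simps)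
    have b: "norm X < r2 * real N" "norm ((1 / real N) *\<^sub>R X) \<le> R'" "norm ((1 / real N) *\<^sub>R X) < r2" "(1 / real N) *\<^sub>R X \<in> E"
      if "X \<in> E" "norm (X - X0) < 1" for X
    proof -
      have "norm X < norm X0 + 1" using norm_triangle_ineq2[of X X0] that by linarith
      then show "norm X < r2 * real N" "norm ((1 / real N) *\<^sub>R X) \<le> R'" "norm ((1 / real N) *\<^sub>R X) < r2"
        using Nr NR N by (auto simp: field_simps)
      show "(1 / real N) *\<^sub>R X \<in> E" using that subE by (simp add: subspace_scale)
    qed
    let ?g = "\<lambda>X. ex ((1 / real N) *\<^sub>R X)"
    have gc: "?g X \<in> fst CC" if "X \<in> E" "norm (X - X0) < 1" for X
      using ex[OF b(4)[OF that]] b(3)[OF that] r2 by (simp add: Bd_def)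
    have E_g: "Exp X = ?g X [^] N" if "X \<in> E" "norm (X - X0) < 1" for X by (rule Exp_eq[OF that(1) N b(1)[OF that]])
    have g0: "?g X0 \<in> fst CC" using gc[OF X0(1)] by simp
    have W0: "?g X0 [^] N \<in> W" using X0(2) E_g[OF X0(1)] by simp
    obtain W' where W': "openin (mtop M) W'" "?g X0 \<in> W'" "(\<lambda>x. x [^] N) ` W' \<subseteq> W"
      using smooth_at_continuous[OF M smooth_at_pow[OF CC_carrier[OF g0]] W W0] .
    obtain Q where Q: "open Q" "y (?g X0) \<in> Q" "\<And>x. x \<in> E \<Longrightarrow> x \<in> Q \<Longrightarrow> \<psi> x \<in> W'"
      using chart_nhd[OF CC_chart W'(1,2) g0] by metis
    obtain \<rho> where \<rho>: "\<rho> > 0" "ball (y (?g X0)) \<rho> \<subseteq> Q" using Q(1,2) open_contains_ball by metis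
    show "\<exists>T. openin (top_of_set E) T \<and> X0 \<in> T \<and> T \<subseteq> {X \<in> E. Exp X \<in> W}"
    proof (intro exI[of _ "E \<inter> ball X0 (min 1 (\<rho> / K))"] conjI subsetI)
      show "X0 \<in> E \<inter> ball X0 (min 1 (\<rho> / K))" using X0 \<rho> K by simp
      fix X assume X: "X \<in> E \<inter> ball X0 (min 1 (\<rho> / K))"
      then have X1: "X \<in> E" "norm (X - X0) < 1" "norm (X - X0) < \<rho> / K" by (auto simp: dist_norm norm_minus_commute)
      have "norm (y (?g X) - y (?g X0)) \<le> K * norm ((1 / real N) *\<^sub>R X - (1 / real N) *\<^sub>R X0)"
        using b[OF X1(1,2)] b[OF X0(1)] by (intro K(3)) auto
      also have "\<dots> = K * ((1 / real N) * norm (X - X0))" by (simp flip: scaleR_diff_right)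
      also have "\<dots> \<le> K * (1 * norm (X - X0))" using K N by (intro mult_left_mono mult_right_mono) auto
      also have "\<dots> < \<rho>" using X1(3) K by (simp add: field_simps)
      finally have "y (?g X) \<in> Q" using \<rho>(2) by (auto simp: dist_norm norm_minus_commute)
      then have "?g X \<in> W'" using Q(3)[OF yE] gc[OF X1(1,2)] \<psi>y by metis
      then show "X \<in> {X \<in> E. Exp X \<in> W}" using W'(3) E_g[OF X1(1,2)] X1(1) by auto
    qed auto
  qed
  then show "openin (top_of_set E) {x \<in> topspace (top_of_set E). Exp x \<in> W}" by simp
qed

lemma Exp_inj_small:
  obtains \<delta> where "\<delta> > 0" "\<And>X Y. X \<in> E \<Longrightarrow> Y \<in> E \<Longrightarrow> norm X < \<delta> \<Longrightarrow> norm Y < \<delta> \<Longrightarrow> Exp X = Exp Y \<Longrightarrow> X = Y"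
  by (rule that[of r2]) (use r2 ex Exp_small in \<open>auto, metis less_le_trans\<close>)

end

section \<open>Submersions and the symmetric triple\<close>

text \<open>A linear right inverse of the differential spans a transversal through \<open>p\<close>.
  On it the coordinate expression of \<open>\<pi>\<close> has the identity as derivative and can be
  inverted.\<close>

theorem submersion_local_section:
  assumes M: "smooth_manifold M" and Q: "smooth_manifold Q" and \<pi>: "submersion M Q \<pi>" and p: "p \<in> topspace (mtop M)"
  obtains s W where "openin (mtop Q) W" "\<pi> p \<in> W" "s (\<pi> p) = p" "smooth_at Q M s (\<pi> p)" "\<And>q. q \<in> W \<Longrightarrow> \<pi> (s q) = q"
proof -
  let ?E = "model M" and ?F = "model Q"
  have E: "subspace ?E" and F: "subspace ?F" using M Q smooth_manifold_subspace by blast+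
  have F0: "0 \<in> ?F" using F by (rule subspace_0)
  note ME = smooth_manifold_subspace_mfd[OF E] and MF = smooth_manifold_subspace_mfd[OF F]
  have sm\<pi>: "smooth_map M Q \<pi>" using \<pi> by (simp add: submersion_def)
  have s\<pi>: "smooth_at M Q \<pi> q" if "q \<in> topspace (mtop M)" for q by (rule smooth_map_imp_smooth_at[OF M Q sm\<pi> that])
  have \<pi>p: "\<pi> p \<in> topspace (mtop Q)" using smooth_at_topspace(2)[OF s\<pi>[OF p]] .
  \<comment> \<open>The chart that \<open>differential\<close> itself selects at \<open>p\<close>,
    so that surjectivity on tangent spaces can be read in coordinates.\<close>
  define C where "C = (SOME C. C \<in> charts_at M p)"
  obtain A where "A \<in> atlas M" "p \<in> fst A" using atlas_cover[OF M p] by metis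
  then have "A \<in> charts_at M p" by (simp add: charts_at_def)
  then have C: "C \<in> charts_at M p" unfolding C_def by (rule someI)
  obtain C1 where "C1 \<in> atlas Q" "\<pi> p \<in> fst C1" using atlas_cover[OF Q \<pi>p] by metis
  then have C1: "C1 \<in> charts_at Q (\<pi> p)" by (simp add: charts_at_def)
  note c = charts_at_max[OF M C] and c1 = charts_at_max[OF Q C1]
  note ch = max_atlas_is_chart[OF conjunct1[OF c]] and ch1 = max_atlas_is_chart[OF conjunct1[OF c1]]
  let ?g = "snd C1 \<circ> \<pi> \<circ> chart_inv C" and ?D = "cderiv M C C1 \<pi> p" and ?x0 = "snd C p"
  have x0: "?x0 \<in> ?E" using is_chart_model[OF ch] c by blast
  have D: "(?g has_derivative ?D) (at ?x0 within ?E)"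
    using cderiv_has_derivative[OF M Q s\<pi>[OF p]] c c1 by blast
  have onto: "w \<in> ?D ` ?E" if w: "w \<in> ?F" for w
  proof -
    have "coord_vector Q C1 (\<pi> p) w \<in> tangent_space Q (\<pi> p)" by (rule coord_vector_tangent[OF Q C1 w])
    then obtain v where v: "v \<in> tangent_space M p" "coord_vector Q C1 (\<pi> p) w = differential M Q \<pi> p v"
      using \<pi> p unfolding submersion_def by blast
    have "w = differential M Q \<pi> p v C1" using v(2) coord_vector_self[OF Q C1 w] by simp
    also have "\<dots> = ?D (v C)" using C1 by (simp add: differential_def cderiv_def Let_def flip: C_def)
    finally show ?thesis using tangent_space_model[OF v(1) C] by blast
  qed
  obtain r where r: "range r \<subseteq> ?E" "linear r" "\<forall>v\<in>?D ` ?E. ?D (r v) = v"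
    using linear_exists_right_inverse_on[OF has_derivative_linear[OF D] E] by blast
  have rE: "r w \<in> ?E" for w using r(1) by blast
  define h where "h = (\<lambda>w. ?x0 + r w)"
  have hE: "h w \<in> ?E" for w unfolding h_def by (rule subspace_add[OF E x0 rE])
  have h0: "h 0 = ?x0" by (simp add: h_def linear_0[OF r(2)])
  have hg: "smooth_germ ?F h w" if "w \<in> ?F" for w
    unfolding h_def by (rule smooth_germ_add[OF smooth_germ_const smooth_germ_linear[OF r(2)] that])
  have sh: "smooth_at (subspace_mfd ?F) (subspace_mfd ?E) h w" if "w \<in> ?F" for w
    by (rule smooth_at_subspaceI[OF F E hg[OF that] that open_UNIV UNIV_I hE])
  have dh: "(h has_derivative r) (at 0 within ?F)"
    unfolding h_def using linear_imp_has_derivative[OF r(2)] by (auto intro!: derivative_eq_intros)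
  define f where "f = (\<lambda>w. ?g (h w))"
  have f0: "f 0 = snd C1 (\<pi> p)" using chart_inv_snd[OF ch] c by (simp add: f_def h0)
  have fg: "smooth_germ ?F f 0"
    unfolding f_def
    by (rule smooth_germ_compose[OF hg[OF F0] F0 open_UNIV UNIV_I hE])
       (use smooth_at_charts(1)[OF M Q s\<pi>[OF p], of C C1] c c1 h0 in \<open>simp add: o_def\<close>)
  have fd: "(f has_derivative (\<lambda>v. ?D (r v))) (at 0 within ?F)"
    unfolding f_def by (rule has_derivative_chain_subspace[OF dh F0 open_UNIV UNIV_I hE]) (use D h0 in \<open>simp add: o_def\<close>)
  have fd1: "?D (r v) = v" if "v \<in> ?F" for v using r(3) onto[OF that] by blast
  obtain Z where Z: "open Z" "?x0 \<in> Z"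
    "\<forall>x\<in>?E. x \<in> Z \<longrightarrow> chart_inv C x \<in> fst C \<and> snd C (chart_inv C x) = x \<and> \<pi> (chart_inv C x) \<in> fst C1"
    using smooth_at_charts(2)[OF M Q s\<pi>[OF p]] c c1 by blast
  have hc: "continuous_on UNIV h"
    unfolding h_def using r(2) by (intro continuous_intros linear_continuous_on) (simp add: linear_conv_bounded_linear)
  have W: "open (h -` Z)" "0 \<in> h -` Z" using open_vimage[OF Z(1) hc] Z(2) h0 by auto
  have fF: "f x \<in> ?F" if "x \<in> ?F" "x \<in> h -` Z" for x
    using Z(3) hE that is_chart_model[OF ch1] by (auto simp: f_def)
  show thesis
  proof (rule smooth_germ_inverse[OF F F0 fg W fF fd fd1])
    fix U V k assume UV: "open U" "open V" "0 \<in> U" "U \<subseteq> h -` Z" "f 0 \<in> V"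
      "f ` (?F \<inter> U) = ?F \<inter> V" "k ` (?F \<inter> V) = ?F \<inter> U"
      "\<And>x. x \<in> ?F \<Longrightarrow> x \<in> U \<Longrightarrow> k (f x) = x" "\<And>x. x \<in> ?F \<Longrightarrow> x \<in> V \<Longrightarrow> f (k x) = x"
      "\<And>x. x \<in> ?F \<Longrightarrow> x \<in> V \<Longrightarrow> smooth_germ ?F k x"
    have k0: "k (f 0) = 0" using UV(8)[OF F0 UV(3)] .
    have f0F: "f 0 \<in> ?F" using fF[OF F0 W(2)] .
    have kF: "k x \<in> ?F" if "x \<in> ?F" "x \<in> V" for x using UV(7) that by blast
    define s where "s = (\<lambda>q. chart_inv C (h (k (snd C1 q))))"
    have s1: "smooth_at Q (subspace_mfd ?F) (snd C1) (\<pi> p)" using smooth_at_chart[OF Q] c1 by blast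
    have s2: "smooth_at (subspace_mfd ?F) (subspace_mfd ?F) k (snd C1 (\<pi> p))"
      unfolding f0[symmetric] by (rule smooth_at_subspaceI[OF F F UV(10)[OF f0F UV(5)] f0F UV(2,5) kF])
    have s3: "smooth_at (subspace_mfd ?F) (subspace_mfd ?E) h (k (snd C1 (\<pi> p)))"
      unfolding f0[symmetric] k0 by (rule sh[OF F0])
    have s4: "smooth_at (subspace_mfd ?E) M (chart_inv C) (h (k (snd C1 (\<pi> p))))"
      unfolding f0[symmetric] k0 h0 using c by (intro smooth_at_chart_inv[OF M]) auto
    note s12 = smooth_at_compose[OF Q MF MF s1 s2]
    note s123 = smooth_at_compose[OF Q MF ME s12 s3]
    note s1234 = smooth_at_compose[OF Q ME M s123 s4]
    show thesis
    proof (rule that[of "{q \<in> fst C1. snd C1 q \<in> V}" s])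
      show "openin (mtop Q) {q \<in> fst C1. snd C1 q \<in> V}" by (rule chart_open_vimage[OF ch1 UV(2)])
      show "\<pi> p \<in> {q \<in> fst C1. snd C1 q \<in> V}" using c1 UV(5) f0 by simp
      show "s (\<pi> p) = p" using chart_inv_snd[OF ch] c by (simp add: s_def k0 h0 flip: f0)
      show "smooth_at Q M s (\<pi> p)" using s1234 by (simp add: s_def[abs_def])
      fix q assume q: "q \<in> {q \<in> fst C1. snd C1 q \<in> V}"
      let ?y = "snd C1 q"
      have y: "?y \<in> ?F" "?y \<in> V" using q is_chart_model[OF ch1] by auto
      have "k ?y \<in> U" using UV(7) y by blast
      then have "h (k ?y) \<in> Z" using UV(4) by blast
      then have 1: "\<pi> (s q) \<in> fst C1" unfolding s_def using Z(3) hE by blast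
      have 2: "snd C1 (\<pi> (s q)) = ?y" using UV(9)[OF y] by (simp add: f_def s_def)
      have "\<pi> (s q) = chart_inv C1 (snd C1 (\<pi> (s q)))" by (rule chart_inv_snd[OF ch1 1, symmetric])
      also have "\<dots> = q" unfolding 2 by (rule chart_inv_snd[OF ch1]) (use q in simp)
      finally show "\<pi> (s q) = q" .
    qed
  qed
qed

text \<open>Near \<open>\<pi> p\<close> the map \<open>F\<close> is \<open>f\<close> after a local
  section through \<open>p\<close>.\<close>

theorem smooth_at_descend:
  assumes M: "smooth_manifold M" and Q: "smooth_manifold Q" and N: "smooth_manifold N" and \<pi>: "submersion M Q \<pi>"
    and f: "smooth_at M N f p" and F: "\<And>q. q \<in> topspace (mtop M) \<Longrightarrow> F (\<pi> q) = f q"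
  shows "smooth_at Q N F (\<pi> p)"
proof -
  obtain s W where s: "openin (mtop Q) W" "\<pi> p \<in> W" "s (\<pi> p) = p" "smooth_at Q M s (\<pi> p)" "\<And>q. q \<in> W \<Longrightarrow> \<pi> (s q) = q"
    using submersion_local_section[OF M Q \<pi> smooth_at_topspace(1)[OF f]] by metis
  obtain W' where W': "openin (mtop Q) W'" "\<pi> p \<in> W'" "s ` W' \<subseteq> topspace (mtop M)"
    using smooth_at_continuous[OF Q s(4) openin_topspace smooth_at_topspace(2)[OF s(4)]] by metis
  have f': "smooth_at M N f (s (\<pi> p))" using f s(3) by simp
  note smooth_at_compose[OF Q M N s(4) f']
  then show ?thesis
  proof (rule smooth_at_local[OF Q _ openin_Int[OF s(1) W'(1)]])
    show "f (s q) = F q" if "q \<in> W \<inter> W'" for q using that s(5) F[of "s q"] W'(3) by (metis IntD1 IntD2 image_subset_iff)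
  qed (use s W' in auto)
qed

section \<open>The involution, the twisted action and the adjoint action of \<open>K\<close>\<close>

locale symm = lie_log G M rt lg ex R r0
  for G :: "'g monoid" (structure) and M :: "('g, 'e::euclidean_space) mfd" and rt lg ex R r0 +
  fixes \<sigma> :: "'g \<Rightarrow> 'g" and K :: "'g set"
  assumes triple: "riemannian_symmetric_triple G M \<sigma> K"
begin

lemma \<sigma>_carrier [simp]: "g \<in> carrier G \<Longrightarrow> \<sigma> g \<in> carrier G"
  and \<sigma>_mult: "g \<in> carrier G \<Longrightarrow> h \<in> carrier G \<Longrightarrow> \<sigma> (g \<otimes> h) = \<sigma> g \<otimes> \<sigma> h"
  and \<sigma>_\<sigma> [simp]: "g \<in> carrier G \<Longrightarrow> \<sigma> (\<sigma> g) = g"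
  and K_def: "K = {g \<in> carrier G. \<sigma> g = g}"
  and connected: "connected_space (mtop M)"
  using triple by (auto simp: riemannian_symmetric_triple_def lie_automorphism_def iso_def hom_def)

lemma smooth_at_\<sigma>: "p \<in> carrier G \<Longrightarrow> smooth_at M M \<sigma> p"
proof -
  assume p: "p \<in> carrier G"
  have "smooth_map M M \<sigma>" using triple by (simp add: riemannian_symmetric_triple_def lie_automorphism_def diffeomorphism_def)
  from smooth_map_imp_smooth_at[OF M M this] p show ?thesis by (simp add: top)
qed

lemma \<sigma>_one [simp]: "\<sigma> \<one> = \<one>"
  using \<sigma>_mult[of \<one> \<one>] by (simp add: r_cancel_one')

lemma \<sigma>_inv: "g \<in> carrier G \<Longrightarrow> \<sigma> (inv g) = inv (\<sigma> g)"
  using \<sigma>_mult[of "inv g" g] by (simp add: inv_equality)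

definition F where "F = {h \<in> carrier G. \<sigma> h = inv h}"

definition \<kappa> where "\<kappa> g = g \<otimes> inv (\<sigma> g)"

definition \<tau> where "\<tau> g h = g \<otimes> h \<otimes> inv (\<sigma> g)"

lemma \<kappa>_carrier [simp]: "g \<in> carrier G \<Longrightarrow> \<kappa> g \<in> carrier G" by (simp add: \<kappa>_def)
lemma \<tau>_carrier [simp]: "g \<in> carrier G \<Longrightarrow> h \<in> carrier G \<Longrightarrow> \<tau> g h \<in> carrier G" by (simp add: \<tau>_def)

lemma \<tau>_one: "g \<in> carrier G \<Longrightarrow> \<tau> g \<one> = \<kappa> g" by (simp add: \<tau>_def \<kappa>_def)

lemma \<tau>_mult: "a \<in> carrier G \<Longrightarrow> b \<in> carrier G \<Longrightarrow> h \<in> carrier G \<Longrightarrow> \<tau> (a \<otimes> b) h = \<tau> a (\<tau> b h)"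
  by (simp add: \<tau>_def \<sigma>_mult inv_mult_group m_assoc)

lemma \<tau>_\<kappa>: "a \<in> carrier G \<Longrightarrow> b \<in> carrier G \<Longrightarrow> \<tau> a (\<kappa> b) = \<kappa> (a \<otimes> b)"
  by (simp add: \<tau>_def \<kappa>_def \<sigma>_mult inv_mult_group m_assoc)

lemma \<tau>_inv: "a \<in> carrier G \<Longrightarrow> h \<in> carrier G \<Longrightarrow> \<tau> (inv a) (\<tau> a h) = h" "a \<in> carrier G \<Longrightarrow> h \<in> carrier G \<Longrightarrow> \<tau> a (\<tau> (inv a) h) = h"
  using \<tau>_mult[of "inv a" a h] \<tau>_mult[of a "inv a" h] by (simp_all add: \<tau>_def[of \<one>])

lemma \<tau>_F: "g \<in> carrier G \<Longrightarrow> h \<in> F \<Longrightarrow> \<tau> g h \<in> F"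
  by (simp add: F_def \<tau>_def \<sigma>_mult \<sigma>_inv inv_mult_group m_assoc)

lemma one_F: "\<one> \<in> F" by (simp add: F_def)

lemma \<kappa>_F: "g \<in> carrier G \<Longrightarrow> \<kappa> g \<in> F" using \<tau>_F[OF _ one_F] \<tau>_one by metis

lemma K_carrier: "k \<in> K \<Longrightarrow> k \<in> carrier G" by (simp add: K_def)

lemma K_subgroup: "subgroup K G"
  by (rule subgroupI) (auto simp: K_def \<sigma>_inv \<sigma>_mult intro: exI[of _ \<one>])

lemma smooth_at_\<tau>: "g \<in> carrier G \<Longrightarrow> p \<in> carrier G \<Longrightarrow> smooth_at M M (\<tau> g) p"
  unfolding \<tau>_def[abs_def]
  by (intro smooth_at_mult M smooth_at_const_carrier smooth_at_ident) (simp_all add: top)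

lemma smooth_at_\<kappa>: "p \<in> carrier G \<Longrightarrow> smooth_at M M \<kappa> p"
  unfolding \<kappa>_def[abs_def] by (intro smooth_at_mult smooth_at_inverse M smooth_at_\<sigma> smooth_at_ident)

text \<open>Identifies the fibres of \<open>\<kappa>\<close> with the left cosets of
  \<open>K\<close>, which makes \<open>\<phi>\<close> well defined and injective.\<close>

lemma inv_mult_in_K_iff: "g \<in> carrier G \<Longrightarrow> h \<in> carrier G \<Longrightarrow> inv h \<otimes> g \<in> K \<longleftrightarrow> \<kappa> g = \<kappa> h"
proof -
  assume c: "g \<in> carrier G" "h \<in> carrier G"
  have "inv h \<otimes> g \<in> K \<longleftrightarrow> inv (\<sigma> h) \<otimes> \<sigma> g = inv h \<otimes> g" using c by (simp add: K_def \<sigma>_mult \<sigma>_inv)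
  also have "\<dots> \<longleftrightarrow> h \<otimes> inv (\<sigma> h) \<otimes> \<sigma> g = g"
    using c by (metis inv_closed inv_solve_left m_assoc m_closed \<sigma>_carrier)
  also have "\<dots> \<longleftrightarrow> h \<otimes> inv (\<sigma> h) = g \<otimes> inv (\<sigma> g)"
    using c by (metis inv_closed inv_solve_right m_closed \<sigma>_carrier)
  finally show ?thesis by (auto simp: \<kappa>_def)
qed

lemma coset_eq_iff:
  assumes c: "g \<in> carrier G" "h \<in> carrier G"
  shows "g <# K = h <# K \<longleftrightarrow> \<kappa> g = \<kappa> h"
proof
  assume "g <# K = h <# K"
  moreover have "g \<in> g <# K" using c subgroup.one_closed[OF K_subgroup] by (force simp: l_coset_def)
  ultimately obtain k where "k \<in> K" "g = h \<otimes> k" by (auto simp: l_coset_def)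
  then show "\<kappa> g = \<kappa> h" using inv_mult_in_K_iff[OF c] c K_carrier by (simp flip: m_assoc)
next
  have sub: "g <# K \<subseteq> h <# K" if e: "\<kappa> g = \<kappa> h" and c: "g \<in> carrier G" "h \<in> carrier G" for g h
  proof
    fix x assume "x \<in> g <# K"
    then obtain k where k: "k \<in> K" "x = g \<otimes> k" by (auto simp: l_coset_def)
    have "inv h \<otimes> g \<otimes> k \<in> K" using inv_mult_in_K_iff[OF c] e k subgroup.m_closed[OF K_subgroup] by blast
    moreover have "x = h \<otimes> (inv h \<otimes> g \<otimes> k)" using c k K_carrier by (simp flip: m_assoc)
    ultimately show "x \<in> h <# K" by (auto simp: l_coset_def)
  qed
  assume "\<kappa> g = \<kappa> h"
  then show "g <# K = h <# K" using sub c by (metis subset_antisym)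
qed

abbreviation A where "A \<equiv> dCC \<sigma>"
text \<open>The eigenspace \<pp> in the coordinates of \<open>CC\<close>: a linear subspace of the
  model, so that it can also serve as the slice that cuts out the orbit.\<close>

definition pE where "pE = {X \<in> E. A X = - X}"
abbreviation conj where "conj k \<equiv> \<lambda>x. k \<otimes> x \<otimes> inv k"
abbreviation Ad where "Ad k \<equiv> dCC (conj k)"

lemma A_linear: "linear A" by (rule dCC_linear[OF smooth_at_\<sigma>]) simp_all

lemma subpE: "subspace pE"
proof -
  have "subspace {X. A X = - X}"
    by (rule subspaceI) (auto simp: linear_0[OF A_linear] linear_add[OF A_linear] linear_cmul[OF A_linear])
  moreover have "pE = E \<inter> {X. A X = - X}" by (auto simp: pE_def)
  ultimately show ?thesis using subE subspace_inter by metis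
qed

lemma pE_E: "X \<in> pE \<Longrightarrow> X \<in> E" by (simp add: pE_def)

lemma \<sigma>_Exp: "X \<in> E \<Longrightarrow> \<sigma> (Exp X) = Exp (A X)"
  by (rule Exp_hom[OF \<sigma>_mult smooth_at_\<sigma>]) auto

lemma \<sigma>_Exp_p: "X \<in> pE \<Longrightarrow> \<sigma> (Exp X) = inv (Exp X)"
  using \<sigma>_Exp Exp_uminus by (simp add: pE_def)

lemma \<kappa>_Exp: "X \<in> pE \<Longrightarrow> \<kappa> (Exp X) = Exp X \<otimes> Exp X"
  using Exp_carrier pE_E by (simp add: \<kappa>_def \<sigma>_Exp_p)

lemma conj_hom: "k \<in> carrier G \<Longrightarrow> a \<in> carrier G \<Longrightarrow> b \<in> carrier G \<Longrightarrow> conj k (a \<otimes> b) = conj k a \<otimes> conj k b"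
proof -
  assume c: "k \<in> carrier G" "a \<in> carrier G" "b \<in> carrier G"
  then have "inv k \<otimes> (k \<otimes> (b \<otimes> inv k)) = b \<otimes> inv k" by (simp flip: m_assoc)
  then show ?thesis using c by (simp add: m_assoc)
qed

lemma Exp_Ad: "k \<in> carrier G \<Longrightarrow> X \<in> E \<Longrightarrow> conj k (Exp X) = Exp (Ad k X)"
  by (rule Exp_hom[OF conj_hom smooth_at_conj]) auto

lemma Ad_E: "k \<in> carrier G \<Longrightarrow> X \<in> E \<Longrightarrow> Ad k X \<in> E"
  by (rule dCC_in[OF smooth_at_conj]) auto

text \<open>\<open>\<sigma>\<close> fixes \<open>k\<close> and therefore commutes with conjugation
  by it.\<close>

lemma Ad_p:
  assumes k: "k \<in> K" and X: "X \<in> pE" shows "Ad k X \<in> pE"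
proof -
  have kc: "k \<in> carrier G" "\<sigma> k = k" using k by (auto simp: K_def)
  have XE: "X \<in> E" "A X = - X" using X by (auto simp: pE_def)
  have s\<sigma>: "smooth_at M M \<sigma> \<one>" "smooth_at M M \<sigma> (conj k \<one>)" using smooth_at_\<sigma> kc by auto
  have sc: "smooth_at M M (conj k) \<one>" "smooth_at M M (conj k) (\<sigma> \<one>)" using smooth_at_conj kc by auto
  have "A (Ad k X) = cderiv M CC CC (\<lambda>x. \<sigma> (conj k x)) \<one> X"
    using cderiv_compose[OF M M M sc(1) s\<sigma>(2), of CC CC CC X] CC_max kc XE by simp
  also have "\<dots> = cderiv M CC CC (\<lambda>x. conj k (\<sigma> x)) \<one> X"
    by (rule cderiv_local[OF M M smooth_at_compose[OF M M M s\<sigma>(1) sc(2)] CC_max CC_one(1) CC_max _ openin_topspace _ _ XE(1)])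
       (use kc in \<open>auto simp: top \<sigma>_mult \<sigma>_inv\<close>)
  also have "\<dots> = Ad k (A X)"
    using cderiv_compose[OF M M M s\<sigma>(1) sc(2), of CC CC CC X] CC_max kc XE by simp
  also have "\<dots> = - Ad k X" using XE linear_neg[OF dCC_linear[OF sc(1)]] kc by simp
  finally show ?thesis using Ad_E[OF kc(1) XE(1)] by (simp add: pE_def)
qed

text \<open>\<open>\<sigma> h = inv h\<close> becomes \<open>A (lg h) = - lg h\<close>, because
  \<open>lg\<close> intertwines \<open>\<sigma>\<close> with its derivative and is additive on the
  commuting pair \<open>h\<close>, \<open>inv h\<close>.\<close>

lemma log_F:
  obtains s where "s > 0" "s \<le> r0" "\<And>h. h \<in> F \<Longrightarrow> h \<in> Bd s \<Longrightarrow> lg h \<in> pE \<and> Exp (lg h) = h"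
proof -
  obtain s1 where s1: "s1 > 0" "s1 \<le> r0" "\<And>a b. a \<in> Bd s1 \<Longrightarrow> b \<in> Bd s1 \<Longrightarrow> a \<otimes> b \<in> Bd r0"
    "\<And>a b. a \<in> Bd s1 \<Longrightarrow> b \<in> Bd s1 \<Longrightarrow> b \<otimes> a \<otimes> inv b \<in> Bd r0" by (rule small_radius, rule that, assumption+)
  have r0R: "g \<in> Bd R" if "g \<in> Bd r0" for g using that Bd_mono[OF r0(2)] by blast
  have one: "\<one> \<in> Bd R" "\<one> \<in> Bd s1" using R s1 by auto
  have "\<sigma> \<one> \<in> Bd R" "inv \<one> \<in> Bd s1" using one by auto
  obtain W1 where W1: "openin (mtop M) W1" "\<one> \<in> W1" "\<sigma> ` W1 \<subseteq> Bd R"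
    using smooth_at_continuous[OF M smooth_at_\<sigma> Bd_open \<open>\<sigma> \<one> \<in> Bd R\<close>] by auto
  have si: "smooth_at M M (\<lambda>x. inv x) \<one>" by (rule smooth_at_inverse[OF M smooth_at_ident]) simp
  obtain W2 where W2: "openin (mtop M) W2" "\<one> \<in> W2" "(\<lambda>x. inv x) ` W2 \<subseteq> Bd s1"
    using smooth_at_continuous[OF M si Bd_open \<open>inv \<one> \<in> Bd s1\<close>] by auto
  obtain s2 where s2: "s2 > 0" "Bd s2 \<subseteq> W1 \<inter> W2" using nhd_Bd[OF openin_Int[OF W1(1) W2(1)]] W1 W2 by auto
  obtain R' L where L: "R' > 0" "L \<ge> 1" "\<And>x. x \<in> E \<Longrightarrow> norm x \<le> R' \<Longrightarrow> norm (lg (\<psi> x)) \<le> L * norm x"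
    using tame_lipschitz[OF tame_lg subE] by metis
  \<comment> \<open>The bound \<open>r2 / L\<close> forces \<open>norm (lg h) < r2\<close>, where
    \<open>Exp\<close> and \<open>ex\<close> agree.\<close>
  define s where "s = min (min s1 s2) (min R' (r2 / L))"
  have s: "s > 0" "s \<le> s1" "s \<le> s2" "s \<le> R'" "s \<le> r2 / L" using s1 s2 L r2 by (auto simp: s_def)
  show thesis
  proof (rule that[of s])
    show "s > 0" "s \<le> r0" using s s1 by auto
    fix h assume h: "h \<in> F" "h \<in> Bd s"
    have hB: "h \<in> Bd s1" "h \<in> Bd s2" "h \<in> Bd r0" using h(2) Bd_mono s s1 by (meson order_trans subsetD)+
    have hc: "h \<in> carrier G" "\<sigma> h = inv h" using h(1) by (auto simp: F_def)
    have ih: "inv h \<in> Bd s1" using W2(3) s2(2) hB(2) by blast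
    have s2R: "min s1 s2 \<le> R" using s1 r0 by auto
    have "lg (\<sigma> h) = A (lg h)"
    proof (rule hom_log[OF \<sigma>_mult s2R _ smooth_at_\<sigma>])
      show "\<sigma> a \<in> Bd R" if "a \<in> Bd (min s1 s2)" for a
        using W1(3) s2(2) that Bd_mono[of "min s1 s2" s2] by auto
      show "h \<in> Bd (min s1 s2)" using hB by (auto simp: Bd_def)
    qed auto
    have "lg (h \<otimes> inv h) = lg h + lg (inv h)"
      by (rule log_mult[of s1]) (use s1 r0 r0R ih hB hc in auto)
    moreover have "lg \<one> = 0" using ex[OF E0] r0 ex_zero by simp
    ultimately have "lg (inv h) = - lg h" using hc by (simp add: eq_neg_iff_add_eq_0 add.commute)
    then have "A (lg h) = - lg h" using \<open>lg (\<sigma> h) = A (lg h)\<close> hc by simp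
    moreover have "lg h \<in> E" using lg_E r0R hB by blast
    moreover have "norm (lg h) < r2"
    proof -
      have y: "h \<in> fst CC" "norm (y h) < s" using h(2) by (auto simp: Bd_def)
      then have "norm (lg h) \<le> L * norm (y h)" using L(3)[OF yE] \<psi>y s by simp
      also have "\<dots> < L * (r2 / L)" using y s L by (intro mult_strict_left_mono) auto
      finally show ?thesis using L by simp
    qed
    ultimately show "lg h \<in> pE \<and> Exp (lg h) = h" using Exp_small ex_lg[OF hB(3)] by (simp add: pE_def)
  qed
qed

text \<open>With \<open>Z\<close> half the logarithm of \<open>\<kappa> h\<close>, the elements
  \<open>h\<close> and \<open>Exp Z\<close> have the same image under \<open>\<kappa>\<close> and so
  differ by a factor in \<open>K\<close>: a polar decomposition near the identity.\<close>

lemma \<sigma>_F_nhd: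
  obtains W where "openin (mtop M) W" "\<one> \<in> W" "\<And>h. h \<in> W \<Longrightarrow> \<exists>Z\<in>pE. \<exists>k\<in>K. h = Exp Z \<otimes> k"
proof -
  obtain s where s: "s > 0" "\<And>h. h \<in> F \<Longrightarrow> h \<in> Bd s \<Longrightarrow> lg h \<in> pE \<and> Exp (lg h) = h" using log_F by metis
  have k1: "\<kappa> \<one> \<in> Bd s" using s by (simp add: \<kappa>_def)
  obtain W where W: "openin (mtop M) W" "\<one> \<in> W" "\<kappa> ` W \<subseteq> Bd s"
    using smooth_at_continuous[OF M smooth_at_\<kappa>[OF one_closed] Bd_open k1] .
  show thesis
  proof (rule that[OF W(1,2)])
    fix h assume h: "h \<in> W"
    have hc: "h \<in> carrier G" using openin_subset[OF W(1)] h top by blast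
    have k: "\<kappa> h \<in> F" "\<kappa> h \<in> Bd s" using \<kappa>_F[OF hc] W(3) h by auto
    define Z where "Z = (1/2) *\<^sub>R lg (\<kappa> h)"
    have Z: "Z \<in> pE" "Z \<in> E" using s(2)[OF k] subspace_scale[OF subpE] pE_E by (auto simp: Z_def)
    have "\<kappa> (Exp Z) = Exp (2 *\<^sub>R Z)" using \<kappa>_Exp[OF Z(1)] Exp_double[OF Z(2)] by simp
    also have "\<dots> = \<kappa> h" using s(2)[OF k] by (simp add: Z_def)
    finally have "inv (Exp Z) \<otimes> h \<in> K" using inv_mult_in_K_iff[OF hc Exp_carrier[OF Z(2)]] by simp
    moreover have "h = Exp Z \<otimes> (inv (Exp Z) \<otimes> h)" using hc Exp_carrier[OF Z(2)] by (simp flip: m_assoc)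
    ultimately show "\<exists>Z\<in>pE. \<exists>k\<in>K. h = Exp Z \<otimes> k" using Z(1) by blast
  qed
qed

end

section \<open>The invariant form on \<pp>\<close>

context symm
begin

abbreviation proj where "proj g \<equiv> g <# K"

lemma \<kappa>_Exp_double: "X \<in> pE \<Longrightarrow> \<kappa> (Exp X) = Exp (2 *\<^sub>R X)"
  using \<kappa>_Exp Exp_double pE_E by simp

lemma \<kappa>_one [simp]: "\<kappa> \<one> = \<one>" by (simp add: \<kappa>_def)

text \<open>Along \<open>Exp (t *\<^sub>R X)\<close> the map \<open>\<kappa>\<close> doubles the
  parameter. Since \<open>\<kappa>\<close> factors through the cosets, it follows that the
  differential of the projection is injective on \<pp>.\<close>

lemma d\<kappa>:
  assumes X: "X \<in> pE" shows "dCC \<kappa> X = 2 *\<^sub>R X"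
proof -
  have XE: "X \<in> E" "2 *\<^sub>R X \<in> E" using X pE_E subE subspace_scale by blast+
  have m: "model real_mfd = UNIV" by (simp add: real_mfd_def)
  have tX: "t *\<^sub>R X \<in> pE" for t using subspace_scale[OF subpE X] .
  have "\<kappa> (Exp (t *\<^sub>R X)) = Exp (t *\<^sub>R (2 *\<^sub>R X))" for t using \<kappa>_Exp_double[OF tX, of t] by (simp add: mult.commute)
  moreover have "cderiv real_mfd (UNIV, id) CC (\<lambda>t. \<kappa> (Exp (t *\<^sub>R X))) 0 1 = dCC \<kappa> (cderiv real_mfd (UNIV, id) CC (\<lambda>t. Exp (t *\<^sub>R X)) 0 1)"
    using cderiv_compose[OF smooth_manifold_real M M smooth_at_Exp_curve[OF XE(1), of 0] smooth_at_\<kappa>, of "(UNIV, id)" CC CC 1]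
      real_chart CC_max m by simp
  ultimately show ?thesis using Exp_curve_cderiv[OF XE(1)] Exp_curve_cderiv[OF XE(2)] by simp
qed

lemma proj_mult_left: "a \<in> carrier G \<Longrightarrow> b \<in> carrier G \<Longrightarrow> a <# proj b = proj (a \<otimes> b)"
  using lcos_m_assoc[OF subgroup.subset[OF K_subgroup]] by simp

lemma \<kappa>_K: "k \<in> K \<Longrightarrow> \<kappa> k = \<one>"
  by (auto simp: \<kappa>_def K_def)

lemma \<kappa>_mult_K: "g \<in> carrier G \<Longrightarrow> k \<in> K \<Longrightarrow> \<kappa> (g \<otimes> k) = \<kappa> g"
  using \<tau>_\<kappa>[of g k] K_carrier \<kappa>_K \<tau>_one by simp

lemma descended_\<kappa>:
  obtains \<phi> where "\<And>g. g \<in> carrier G \<Longrightarrow> \<phi> (proj g) = \<kappa> g"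
proof (rule that)
  fix g assume g: "g \<in> carrier G"
  let ?g = "SOME g'. g' \<in> carrier G \<and> proj g' = proj g"
  have "?g \<in> carrier G \<and> proj ?g = proj g" by (rule someI[of _ g]) (use g in simp)
  then have "\<kappa> ?g = \<kappa> g" using coset_eq_iff g by blast
  then show "(\<lambda>q. \<kappa> (SOME g'. g' \<in> carrier G \<and> proj g' = q)) (proj g) = \<kappa> g" by simp
qed

text \<open>The metric at the base point is pulled back along the differential of the projection.
  Positivity is claimed on \<pp>, where that differential is injective because
  \<open>\<kappa>\<close> factors through the projection with derivative twice the identity.
  Invariance under \<open>Ad k\<close> comes from the left translation by \<open>k\<close>, which
  fixes the base point.\<close>

theorem invariant_form:
  obtains b :: "'e \<Rightarrow> 'e \<Rightarrow> real" where "bilinear b" "\<And>u v. b u v = b v u"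
    "\<And>u. u \<in> pE \<Longrightarrow> u \<noteq> 0 \<Longrightarrow> b u u > 0" "\<And>k u. k \<in> K \<Longrightarrow> u \<in> E \<Longrightarrow> b (Ad k u) (Ad k u) = b u u"
proof -
  obtain Q h where coset: "coset_manifold G M K Q" and metric: "riemannian_metric Q h" and inv: "invariant_metric G Q h"
    using triple by (auto simp: riemannian_symmetric_triple_def)
  have Qm: "smooth_manifold Q" and sub: "submersion M Q proj" using coset by (auto simp: coset_manifold_def)
  let ?o = "proj \<one>"
  have sp: "smooth_at M Q proj g" if "g \<in> carrier G" for g
    using smooth_map_imp_smooth_at[OF M Qm _, of proj g] sub that top by (simp add: submersion_def)
  have oQ: "?o \<in> topspace (mtop Q)" using smooth_at_topspace(2)[OF sp[OF one_closed]] .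
  \<comment> \<open>Again the chart that \<open>differential\<close> selects, now at the base point
    of the coset manifold.\<close>
  define C1 where "C1 = (SOME C. C \<in> charts_at Q ?o)"
  obtain A' where "A' \<in> atlas Q" "?o \<in> fst A'" using atlas_cover[OF Qm oQ] by metis
  then have "A' \<in> charts_at Q ?o" by (simp add: charts_at_def)
  then have C1: "C1 \<in> charts_at Q ?o" unfolding C1_def by (rule someI)
  have c1: "C1 \<in> max_atlas Q" "?o \<in> fst C1" using charts_at_max[OF Qm C1] by auto
  define D where "D = cderiv M CC C1 proj \<one>"
  have Dl: "linear D" unfolding D_def by (rule cderiv_linear[OF M Qm sp[OF one_closed] CC_max CC_one(1) c1])
  have DE: "D u \<in> model Q" if "u \<in> E" for u
    unfolding D_def by (rule cderiv_in[OF M Qm sp[OF one_closed] CC_max CC_one(1) c1 that])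
  define cv where "cv = (\<lambda>w. coord_vector Q C1 ?o w)"
  have cvT: "cv w \<in> tangent_space Q ?o" if "w \<in> model Q" for w
    unfolding cv_def by (rule coord_vector_tangent[OF Qm C1 that])
  have cvl: "cv (a *\<^sub>R u + c *\<^sub>R v) = (\<lambda>C. a *\<^sub>R cv u C + c *\<^sub>R cv v C)" for a c u v
  proof
    fix C
    show "cv (a *\<^sub>R u + c *\<^sub>R v) C = a *\<^sub>R cv u C + c *\<^sub>R cv v C"
    proof (cases "C \<in> charts_at Q ?o")
      case True
      have "linear (cderiv Q C1 C (\<lambda>x. x) ?o)"
        using cderiv_linear[OF Qm Qm smooth_at_id[OF Qm oQ] c1, of C] charts_at_max[OF Qm True] by simp
      then show ?thesis using True by (simp add: cv_def coord_vector_cderiv linear_add linear_cmul)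
    qed (simp add: cv_def coord_vector_cderiv)
  qed
  \<comment> \<open>\<open>bilinear\<close> speaks of the whole coordinate type, whereas the
    differential is meaningful on \<open>E\<close> only; a linear retraction onto \<open>E\<close>
    bridges the two.\<close>
  obtain pr :: "'e \<Rightarrow> 'e" where pr: "linear pr" "\<And>v. pr v \<in> E" "\<And>v. v \<in> E \<Longrightarrow> pr v = v"
    using subspace_projection[OF subE] by blast
  define V where "V = (\<lambda>u. cv (D (pr u)))"
  have VT: "V u \<in> tangent_space Q ?o" for u unfolding V_def by (intro cvT DE pr)
  have Vl: "V (a *\<^sub>R u + c *\<^sub>R v) = (\<lambda>C. a *\<^sub>R V u C + c *\<^sub>R V v C)" for a c u v
    unfolding V_def by (simp add: linear_add[OF pr(1)] linear_cmul[OF pr(1)] linear_add[OF Dl] linear_cmul[OF Dl] cvl)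
  define b where "b = (\<lambda>u v. h ?o (V u) (V v))"
  have sym: "b u v = b v u" for u v
    using metric oQ VT unfolding riemannian_metric_def b_def by blast
  have hl: "h ?o (\<lambda>C. a *\<^sub>R x C + c *\<^sub>R y C) w = a * h ?o x w + c * h ?o y w"
    if "x \<in> tangent_space Q ?o" "y \<in> tangent_space Q ?o" "w \<in> tangent_space Q ?o" for x y w a c
    using metric oQ that unfolding riemannian_metric_def by blast
  have bl: "b (a *\<^sub>R u + c *\<^sub>R v) w = a * b u w + c * b v w" for a c u v w
    unfolding b_def Vl by (rule hl[OF VT VT VT])
  have lin1: "linear (\<lambda>u. b u w)" for w
  proof (rule linearI)
    show "b (u + v) w = b u w + b v w" for u v using bl[of 1 u 1 v w] by simp
    show "b (a *\<^sub>R u) w = a *\<^sub>R b u w" for a u using bl[of a u 0 0 w] by simp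
  qed
  have lin2: "linear (b u)" for u
  proof -
    have "b u = (\<lambda>w. b w u)" by (rule ext) (rule sym)
    then show ?thesis using lin1[of u] by metis
  qed
  have bil: "bilinear b" unfolding bilinear_def using lin1 lin2 by blast
  have pos: "b u u > 0" if u: "u \<in> pE" "u \<noteq> 0" for u
  proof -
    have uE: "u \<in> E" using u pE_E by blast
    obtain \<phi> where \<phi>: "\<And>g. g \<in> carrier G \<Longrightarrow> \<phi> (proj g) = \<kappa> g" using descended_\<kappa> by blast
    have s\<phi>: "smooth_at Q M \<phi> ?o"
      by (rule smooth_at_descend[OF M Qm M sub smooth_at_\<kappa>[OF one_closed]]) (use \<phi> top in auto)
    have \<kappa>1: "\<kappa> \<one> = \<one>" by (simp add: \<kappa>_def)
    have \<phi>o: "\<phi> ?o \<in> fst CC" using \<phi>[OF one_closed] \<kappa>1 by simp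
    have "dCC \<kappa> u = cderiv M CC CC (\<lambda>g. \<phi> (proj g)) \<one> u"
      by (rule cderiv_local[OF M M _ CC_max CC_one(1) CC_max _ openin_topspace _ _ uE])
         (use smooth_at_compose[OF M Qm M sp[OF one_closed] s\<phi>] \<phi>o \<phi> top in auto)
    also have "\<dots> = cderiv Q C1 CC \<phi> ?o (D u)"
      unfolding D_def by (rule cderiv_compose[OF M Qm M sp[OF one_closed] s\<phi> CC_max CC_one(1) c1 CC_max \<phi>o uE])
    finally have "cderiv Q C1 CC \<phi> ?o (D u) = 2 *\<^sub>R u" using d\<kappa>[OF u(1)] by simp
    moreover have "cderiv Q C1 CC \<phi> ?o 0 = 0"
      using linear_0[OF cderiv_linear[OF Qm M s\<phi> c1 CC_max \<phi>o]] .
    ultimately have "D u \<noteq> 0" using u(2) by auto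
    moreover have "V u C1 = D u"
      unfolding V_def cv_def using pr(3)[OF uE] coord_vector_self[OF Qm C1 DE[OF uE]] by simp
    ultimately have "V u \<noteq> (\<lambda>C. 0)" by metis
    moreover have "\<forall>x\<in>tangent_space Q ?o. x \<noteq> (\<lambda>C. 0) \<longrightarrow> h ?o x x > 0"
      using metric oQ unfolding riemannian_metric_def by blast
    ultimately show ?thesis using VT[of u] unfolding b_def by simp
  qed
  have invt: "b (Ad k u) (Ad k u) = b u u" if k: "k \<in> K" and u: "u \<in> E" for k u
  proof -
    have kc: "k \<in> carrier G" using k K_carrier by blast
    let ?l = "\<lambda>q. k <# q"
    have lo: "?l ?o = ?o"
      using proj_mult_left[OF kc one_closed] coset_eq_iff[OF kc one_closed] \<kappa>_K[OF k] kc by (simp add: \<kappa>_def[of \<one>])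
    have sm1: "smooth_at M Q (\<lambda>g. proj (k \<otimes> g)) \<one>"
    proof (rule smooth_at_compose[OF M M Qm])
      show "smooth_at M M (\<lambda>g. k \<otimes> g) \<one>" by (intro smooth_at_mult M smooth_at_const_carrier smooth_at_ident) (simp_all add: top kc)
      show "smooth_at M Q proj (k \<otimes> \<one>)" using sp kc by simp
    qed
    have sl: "smooth_at Q Q ?l ?o"
      by (rule smooth_at_descend[OF M Qm Qm sub sm1]) (use proj_mult_left kc top in auto)
    have loC: "?l ?o \<in> fst C1" using lo c1 by simp
    have sc: "smooth_at M M (conj k) \<one>" using smooth_at_conj kc by simp
    have c1': "conj k \<one> = \<one>" using kc by simp
    have sp': "smooth_at M Q proj (conj k \<one>)" unfolding c1' by (rule sp[OF one_closed])
    \<comment> \<open>The right factor \<open>inv k\<close> is absorbed by the coset, so conjugation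
      by \<open>k\<close> descends to left translation.\<close>
    have pc: "proj (conj k g) = ?l (proj g)" if g: "g \<in> carrier G" for g
    proof -
      have "\<kappa> (conj k g) = \<kappa> (k \<otimes> g)" using \<kappa>_mult_K[of "k \<otimes> g" "inv k"] kc g subgroup.m_inv_closed[OF K_subgroup k] by simp
      then show ?thesis using proj_mult_left[OF kc g] coset_eq_iff kc g by simp
    qed
    have "D (Ad k u) = cderiv M CC C1 (\<lambda>g. proj (conj k g)) \<one> u"
      using cderiv_compose[OF M M Qm sc sp' CC_max CC_one(1) CC_max _ c1(1) _ u] c1' c1 CC_one by (simp add: D_def)
    also have "\<dots> = cderiv M CC C1 (\<lambda>g. ?l (proj g)) \<one> u"
      by (rule cderiv_local[OF M Qm _ CC_max CC_one(1) c1(1) _ openin_topspace _ _ u])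
         (use smooth_at_compose[OF M Qm Qm sp[OF one_closed] sl] loC pc top in auto)
    also have "\<dots> = cderiv Q C1 C1 ?l ?o (D u)"
      unfolding D_def by (rule cderiv_compose[OF M Qm Qm sp[OF one_closed] sl CC_max CC_one(1) c1 c1(1) loC u])
    finally have DAd: "D (Ad k u) = cderiv Q C1 C1 ?l ?o (D u)" .
    have V1: "V w = cv (D w)" if "w \<in> E" for w using pr(3)[OF that] by (simp add: V_def)
    have "differential Q Q ?l ?o (V u) = V (Ad k u)"
    proof
      fix C
      show "differential Q Q ?l ?o (V u) C = V (Ad k u) C"
      proof (cases "C \<in> charts_at Q ?o")
        case True
        note cC = charts_at_max[OF Qm True]
        have Vu: "V u C1 = D u" unfolding V1[OF u] cv_def by (rule coord_vector_self[OF Qm C1 DE[OF u]])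
        have i: "smooth_at Q Q (\<lambda>x. x) (?l ?o)" unfolding lo by (rule smooth_at_id[OF Qm oQ])
        have "differential Q Q ?l ?o (V u) C = cderiv Q C1 C ?l ?o (D u)"
          using True by (simp add: differential_def lo cderiv_def Let_def Vu flip: C1_def)
        also have "\<dots> = cderiv Q C1 C (\<lambda>x. x) (?l ?o) (cderiv Q C1 C1 ?l ?o (D u))"
          using cderiv_compose[OF Qm Qm Qm sl i c1 c1(1) loC, of C "D u"] cC lo DE[OF u] by simp
        also have "\<dots> = V (Ad k u) C"
          using True unfolding V1[OF Ad_E[OF kc u]] DAd[symmetric] cv_def by (simp add: coord_vector_cderiv lo)
        finally show ?thesis .
      qed (simp add: V1[OF Ad_E[OF kc u]] cv_def coord_vector_cderiv differential_def lo)
    qed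
    moreover have "h (?l ?o) (differential Q Q ?l ?o (V u)) (differential Q Q ?l ?o (V u)) = h ?o (V u) (V u)"
      using inv kc oQ VT unfolding invariant_metric_def by blast
    ultimately show ?thesis by (simp add: b_def lo)
  qed
  show thesis by (rule that[OF bil sym pos invt])
qed

end

section \<open>Shortening broken geodesics\<close>

lemma tame_subset: "tame E f L \<Longrightarrow> E' \<subseteq> E \<Longrightarrow> tame E' f L"
  unfolding tame_def tame_on_def by (meson subsetD)

text \<open>The second difference of \<open>Z\<close> across the diagonal point \<open>((X + Y) / 2, (X + Y) / 2)\<close> controls
  \<open>Z (X, Y) + Z (Y, X)\<close>, so the symmetry of \<open>b (Z (X, Y)) (Z (X, Y))\<close> eliminates the first-order
  term in \<open>X - Y\<close>; this replaces the Gauss lemma.\<close>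

lemma symmetric_tame_strict:
  fixes Z :: "'a::euclidean_space \<times> 'a \<Rightarrow> 'a"
  assumes P: "subspace P" and Z: "tame (P \<times> P) Z (\<lambda>z. fst z + snd z)"
    and diag: "\<And>X. X \<in> P \<Longrightarrow> norm X < \<rho> \<Longrightarrow> Z (X, X) = 2 *\<^sub>R X" "\<rho> > 0"
    and b: "bilinear b" "\<And>u v. b u v = b v u" "c > 0" "\<And>u. u \<in> P \<Longrightarrow> c * (norm u)\<^sup>2 \<le> b u u"
    and symm: "\<And>X Y. X \<in> P \<Longrightarrow> Y \<in> P \<Longrightarrow> norm X < \<rho> \<Longrightarrow> norm Y < \<rho> \<Longrightarrow> b (Z (X, Y)) (Z (X, Y)) = b (Z (Y, X)) (Z (Y, X))"
  obtains \<epsilon> where "\<epsilon> > 0" "\<And>X Y. X \<in> P \<Longrightarrow> Y \<in> P \<Longrightarrow> norm X < \<epsilon> \<Longrightarrow> norm Y < \<epsilon> \<Longrightarrow> X \<noteq> Y \<Longrightarrow>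
     b (Z (X, Y)) (Z (X, Y)) < 2 * b X X + 2 * b Y Y"
proof -
  have "bounded_bilinear b" using b(1) by (simp add: bilinear_conv_bounded_bilinear)
  then obtain \<beta> where \<beta>: "\<beta> > 0" "\<And>u v. \<bar>b u v\<bar> \<le> norm u * norm v * \<beta>"
    using bounded_bilinear.pos_bounded[of b] unfolding real_norm_def by metis
  obtain R C where R: "R > 0" "R \<le> 1" "C \<ge> 0" "tame_on (P \<times> P) Z (\<lambda>z. fst z + snd z) R C"
    using tameE[OF Z, of 1] by (metis zero_less_one)
  define M where "M = \<beta> * C + \<beta> * C\<^sup>2"
  have M0: "M \<ge> 0" using \<beta>(1) R(3) by (simp add: M_def)
  \<comment> \<open>By the last bound \<open>8 * (M * \<epsilon>) \<le> c\<close>, so the collected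
    error \<open>8 * (M * \<epsilon>) * (norm D)\<^sup>2\<close> stays strictly below
    \<open>2 * b D D\<close>. The other bounds keep the pairs in the tame ball and half of
    \<open>S\<close> in the range of \<open>diag\<close>.\<close>
  define \<epsilon> where "\<epsilon> = min (min (R / 4) (\<rho> / 2)) (c / (8 * (M + 1)))"
  have \<epsilon>: "\<epsilon> > 0" "\<epsilon> \<le> R / 4" "\<epsilon> \<le> \<rho> / 2" "\<epsilon> \<le> c / (8 * (M + 1))"
  proof -
    have 1: "\<epsilon> \<le> min (R / 4) (\<rho> / 2)" unfolding \<epsilon>_def by (rule min.cobounded1)
    show "\<epsilon> \<le> R / 4" "\<epsilon> \<le> \<rho> / 2" using order_trans[OF 1 min.cobounded1] order_trans[OF 1 min.cobounded2] by auto
    show "\<epsilon> \<le> c / (8 * (M + 1))" unfolding \<epsilon>_def by (rule min.cobounded2)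
    show "\<epsilon> > 0" using R diag(2) b(3) M0 by (simp add: \<epsilon>_def)
  qed
  have add: "b (u + v) w = b u w + b v w" "b w (u + v) = b w u + b w v" for u v w
    using b(1) by (simp_all add: bilinear_ladd bilinear_radd)
  have "b (Z (X, Y)) (Z (X, Y)) < 2 * b X X + 2 * b Y Y"
    if X: "X \<in> P" "norm X < \<epsilon>" and Y: "Y \<in> P" "norm Y < \<epsilon>" and ne: "X \<noteq> Y" for X Y
  proof -
    define S where "S = X + Y"
    define D where "D = X - Y"
    have SD: "S \<in> P" "D \<in> P" unfolding S_def D_def using P X Y by (auto intro: subspace_add subspace_diff)
    have XY: "X = (1/2) *\<^sub>R S + (1/2) *\<^sub>R D" "Y = (1/2) *\<^sub>R S - (1/2) *\<^sub>R D"
      unfolding S_def D_def by (simp_all add: algebra_simps flip: scaleR_add_left)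
    define m where "m = ((1/2) *\<^sub>R S, (1/2) *\<^sub>R S)"
    define d where "d = ((1/2) *\<^sub>R D, - (1/2) *\<^sub>R D)"
    have md: "m + d = (X, Y)" "m - d = (Y, X)" by (simp_all add: m_def d_def XY)
    have mP: "m \<in> P \<times> P" "d \<in> P \<times> P" unfolding m_def d_def using SD P by (auto intro!: subspace_scale subspace_neg)
    have Sn: "norm S \<le> 2 * \<epsilon>" using norm_triangle_ineq[of X Y] X Y by (simp add: S_def)
    have nd: "norm d \<le> norm D"
      using norm_Pair_le[of "(1/2) *\<^sub>R D" "- (1/2) *\<^sub>R D"] by (simp add: d_def)
    have nm: "norm m \<le> 2 * \<epsilon>"
      using norm_Pair_le[of "(1/2) *\<^sub>R S" "(1/2) *\<^sub>R S"] Sn by (simp add: m_def)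
    have nXY: "norm (X, Y) \<le> 2 * \<epsilon>" "norm (Y, X) \<le> 2 * \<epsilon>"
      using norm_Pair_le[of X Y] norm_Pair_le[of Y X] X Y by simp_all
    have half: "norm ((1/2) *\<^sub>R S) < \<rho>" "(1/2) *\<^sub>R S \<in> P" using Sn \<epsilon> diag(2) SD P by (auto intro: subspace_scale)
    have Zm: "Z m = S" using diag(1)[OF half(2,1)] by (simp add: m_def)
    define u where "u = Z (X, Y) - S"
    define v where "v = Z (Y, X) - S"
    have R2: "2 * \<epsilon> \<le> R" using \<epsilon> R by simp
    have uv: "norm (u + v) \<le> C * (norm D)\<^sup>2"
    proof -
      have "norm (Z (m + d) + Z (m - d) - 2 *\<^sub>R Z m) \<le> C * (norm d)\<^sup>2"
        by (rule tame_onD2[OF R(4) mP]) (use md nXY nm R2 in auto)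
      also have "\<dots> \<le> C * (norm D)\<^sup>2" using nd R by (intro mult_left_mono power_mono) auto
      moreover have "u + v = Z (m + d) + Z (m - d) - 2 *\<^sub>R Z m" unfolding md Zm u_def v_def by (simp add: scaleR_2)
      ultimately show ?thesis by simp
    qed
    have smallu: "norm w \<le> C * (2 * \<epsilon>) * norm D" if "w = u \<or> w = v" for w
    proof -
      have dz: "(\<lambda>z. fst z + snd z) d = 0" "(\<lambda>z. fst z + snd z) (- d) = 0" by (simp_all add: d_def)
      have cancel: "(m + d) - m = d" "(m - d) - m = - d" by simp_all
      have "norm (Z (m + d) - Z m - (\<lambda>z. fst z + snd z) ((m + d) - m)) \<le> C * (2 * \<epsilon>) * norm ((m + d) - m)"
        by (rule tame_onD1[OF R(4)]) (use mP md nXY nm R2 X Y in auto)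
      from this[unfolded cancel, unfolded dz, unfolded md(1) Zm diff_0_right]
      have nu: "norm u \<le> C * (2 * \<epsilon>) * norm d" unfolding u_def .
      have "norm (Z (m - d) - Z m - (\<lambda>z. fst z + snd z) ((m - d) - m)) \<le> C * (2 * \<epsilon>) * norm ((m - d) - m)"
        by (rule tame_onD1[OF R(4)]) (use mP md nXY nm R2 X Y in auto)
      from this[unfolded cancel, unfolded dz, unfolded md(2) Zm diff_0_right norm_minus_cancel]
      have nv: "norm v \<le> C * (2 * \<epsilon>) * norm d" unfolding v_def .
      moreover have "C * (2 * \<epsilon>) * norm d \<le> C * (2 * \<epsilon>) * norm D" using nd R \<epsilon> by (intro mult_left_mono) auto
      ultimately show ?thesis using that nu nv by auto
    qed
    have bww: "b w w \<le> \<beta> * C\<^sup>2 * (4 * \<epsilon>\<^sup>2) * (norm D)\<^sup>2" if "w = u \<or> w = v" for w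
    proof -
      have "b w w \<le> norm w * norm w * \<beta>" using \<beta>(2)[of w w] by simp
      also have "\<dots> \<le> (C * (2 * \<epsilon>) * norm D) * (C * (2 * \<epsilon>) * norm D) * \<beta>"
        using smallu[OF that] \<beta>(1) R \<epsilon> by (intro mult_mono) auto
      also have "\<dots> = \<beta> * C\<^sup>2 * (4 * \<epsilon>\<^sup>2) * (norm D)\<^sup>2" by (simp add: power2_eq_square)
      finally show ?thesis .
    qed
    \<comment> \<open>Both orders are added, so that \<open>u\<close> and \<open>v\<close> enter to
      first order only through \<open>u + v\<close>, which is quadratic in \<open>D\<close>.\<close>
    have "2 * b (Z (X, Y)) (Z (X, Y)) = b (S + u) (S + u) + b (S + v) (S + v)"
      using symm[OF X(1) Y(1)] X Y \<epsilon> diag(2) by (simp add: u_def v_def)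
    also have "\<dots> = 2 * b S S + 2 * b S (u + v) + b u u + b v v"
      using b(2)[of u S] b(2)[of v S] by (simp add: add)
    also have "b S (u + v) \<le> 2 * \<epsilon> * (C * (norm D)\<^sup>2) * \<beta>"
    proof -
      have "b S (u + v) \<le> norm S * norm (u + v) * \<beta>" using \<beta>(2)[of S "u + v"] by simp
      also have "\<dots> \<le> 2 * \<epsilon> * (C * (norm D)\<^sup>2) * \<beta>" using Sn uv \<beta>(1) R \<epsilon> by (intro mult_mono) auto
      finally show ?thesis .
    qed
    finally have "2 * b (Z (X, Y)) (Z (X, Y)) \<le> 2 * b S S + 2 * (2 * \<epsilon> * (C * (norm D)\<^sup>2) * \<beta>) + 2 * (\<beta> * C\<^sup>2 * (4 * \<epsilon>\<^sup>2) * (norm D)\<^sup>2)"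
      using bww[of u] bww[of v] by simp
    also have "\<dots> \<le> 2 * b S S + 8 * (M * \<epsilon>) * (norm D)\<^sup>2"
    proof -
      have "\<epsilon>\<^sup>2 \<le> \<epsilon>" using \<epsilon> R by (simp add: power2_eq_square mult_left_le)
      then have "\<beta> * C\<^sup>2 * \<epsilon>\<^sup>2 \<le> \<beta> * C\<^sup>2 * \<epsilon>" using \<beta>(1) by (intro mult_left_mono) auto
      moreover have "0 \<le> \<epsilon> * C * \<beta>" using \<epsilon> R \<beta>(1) by simp
      ultimately have "4 * (\<epsilon> * C * \<beta>) + 8 * (\<beta> * C\<^sup>2 * \<epsilon>\<^sup>2) \<le> 8 * (M * \<epsilon>)" by (simp add: M_def algebra_simps)
      from mult_right_mono[OF this, of "(norm D)\<^sup>2"] show ?thesis by (simp add: algebra_simps)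
    qed
    also have "\<dots> < 2 * b S S + 2 * b D D"
    proof -
      have D0: "D \<noteq> 0" using ne by (simp add: D_def)
      have "8 * (M * \<epsilon>) \<le> 8 * ((M + 1) * (c / (8 * (M + 1))))" using M0 \<epsilon> by (intro mult_left_mono mult_mono) auto
      also have "\<dots> = c"
      proof -
        have "8 * (N * (c / (8 * N))) = c" if "N > 0" for N :: real using that by simp
        then show ?thesis using M0 by (metis add_nonneg_pos zero_less_one)
      qed
      finally have "8 * (M * \<epsilon>) * (norm D)\<^sup>2 \<le> c * (norm D)\<^sup>2" by (intro mult_right_mono) auto
      moreover have "c * (norm D)\<^sup>2 \<le> b D D" using b(4)[OF SD(2)] .
      moreover have "c * (norm D)\<^sup>2 > 0" using D0 b(3) by simp
      ultimately show ?thesis by linarith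
    qed
    \<comment> \<open>The parallelogram identity.\<close>
    also have "2 * b S S + 2 * b D D = 2 * (2 * b X X + 2 * b Y Y)"
    proof -
      have "b D D = b X X - b X Y - b Y X + b Y Y"
        unfolding D_def using bilinear_lsub[OF b(1)] bilinear_rsub[OF b(1)] by simp
      then show ?thesis by (simp add: S_def add)
    qed
    finally show ?thesis by simp
  qed
  then show thesis using that \<epsilon>(1) by blast
qed

section \<open>Products of two short exponentials\<close>

context symm
begin

text \<open>For \<open>X\<close> and \<open>Y\<close> in \<pp> the fourfold product is
  \<open>\<kappa> (Exp X \<otimes> Exp Y)\<close> when both are small, so half its logarithm is the
  \<open>Z\<close> for which \<open>Exp X \<otimes> Exp Y\<close> and \<open>Exp Z\<close> lie in
  the same coset. To first order the four factors add up to
  \<open>2 *\<^sub>R (X + Y)\<close>.\<close>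

lemma tame_log_product:
  "tame (pE \<times> pE) (\<lambda>z. (1/2) *\<^sub>R lg (ex (fst z) \<otimes> ex (snd z) \<otimes> (ex (snd z) \<otimes> ex (fst z)))) (\<lambda>z. fst z + snd z)"
proof -
  let ?PP = "pE \<times> pE"
  have PP: "subspace ?PP" by (rule subspace_Times[OF subpE subpE])
  have pEE: "pE \<subseteq> E" using pE_E by blast
  let ?e = "\<lambda>X. y (ex X)"
  have te: "tame pE ?e (\<lambda>v. v)" using tame_subset[OF tame_ex pEE] .
  have lf: "tame ?PP fst fst" "tame ?PP snd snd" by (rule tame_linear; simp add: linear_fst linear_snd)+
  have t1: "tame ?PP (\<lambda>z. ?e (fst z)) fst" "tame ?PP (\<lambda>z. ?e (snd z)) snd"
    using tame_compose[OF lf(1) PP te subpE zero_less_one] tame_compose[OF lf(2) PP te subpE zero_less_one] by auto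
  note smp = smooth_at_mult[OF MEE smooth_at_pair0]
  obtain s1 where s1: "s1 > 0" "\<And>a b. a \<in> Bd s1 \<Longrightarrow> b \<in> Bd s1 \<Longrightarrow> a \<otimes> b \<in> fst CC"
    using small_binary[OF smp CC_open] by auto
  obtain \<delta> where \<delta>: "\<delta> > 0" "\<delta> \<le> r0" "\<And>X. X \<in> E \<Longrightarrow> norm X < \<delta> \<Longrightarrow> ex X \<in> Bd s1" using ex_small[OF s1(1)] by metis
  have small: "ex (fst z) \<in> Bd s1" "ex (snd z) \<in> Bd s1" if "z \<in> ?PP" "norm z \<le> \<delta> / 2" for z
  proof -
    have "norm (fst z) < \<delta>" "norm (snd z) < \<delta>"
      using norm_fst_le[of "fst z" "snd z"] norm_snd_le[of "snd z" "fst z"] that \<delta>(1) by auto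
    then show "ex (fst z) \<in> Bd s1" "ex (snd z) \<in> Bd s1" using \<delta>(3) that pEE by auto
  qed
  have sCC: "g \<in> fst CC" "y g \<in> E" if "g \<in> Bd s1" for g using that yE by (auto simp: Bd_def)
  have \<delta>2: "\<delta> / 2 > 0" using \<delta> by simp
  have m1: "(?e (fst z), ?e (snd z)) \<in> EE" "(?e (snd z), ?e (fst z)) \<in> EE" if "z \<in> ?PP" "norm z \<le> \<delta> / 2" for z
    using small[OF that] sCC by auto
  have t2: "tame ?PP (\<lambda>z. \<mu> (?e (fst z), ?e (snd z))) (\<lambda>z. fst z + snd z)"
    using tame_compose[OF tame_Pair[OF t1] PP tame_\<mu> subEE \<delta>2 m1(1)] by simp
  have t3: "tame ?PP (\<lambda>z. \<mu> (?e (snd z), ?e (fst z))) (\<lambda>z. snd z + fst z)"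
    using tame_compose[OF tame_Pair[OF t1(2) t1(1)] PP tame_\<mu> subEE \<delta>2 m1(2)] by simp
  let ?a = "\<lambda>z. ex (fst z) \<otimes> ex (snd z)" and ?b = "\<lambda>z. ex (snd z) \<otimes> ex (fst z)"
  have me: "\<mu> (?e (fst z), ?e (snd z)) = y (?a z)" "\<mu> (?e (snd z), ?e (fst z)) = y (?b z)" "?a z \<in> fst CC" "?b z \<in> fst CC"
    if "z \<in> ?PP" "norm z \<le> \<delta> / 2" for z
    using small[OF that] s1(2) sCC \<psi>y by (auto simp: \<mu>_def)
  have m4: "(\<mu> (?e (fst z), ?e (snd z)), \<mu> (?e (snd z), ?e (fst z))) \<in> EE" if "z \<in> ?PP" "norm z \<le> \<delta> / 2" for z
    using me[OF that] yE by simp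
  have t4: "tame ?PP (\<lambda>z. \<mu> (\<mu> (?e (fst z), ?e (snd z)), \<mu> (?e (snd z), ?e (fst z)))) (\<lambda>z. (fst z + snd z) + (snd z + fst z))"
    using tame_compose[OF tame_Pair[OF t2 t3] PP tame_\<mu> subEE \<delta>2 m4] by simp
  have smq: "smooth_at (subspace_mfd EE) M (\<lambda>z. (\<psi> (fst z) \<otimes> \<psi> (snd z)) \<otimes> (\<psi> (snd z) \<otimes> \<psi> (fst z))) 0"
    by (intro smooth_at_mult MEE smooth_at_pair0)
  obtain s2 where s2: "s2 > 0" "\<And>a b. a \<in> Bd s2 \<Longrightarrow> b \<in> Bd s2 \<Longrightarrow> (a \<otimes> b) \<otimes> (b \<otimes> a) \<in> fst CC"
    using small_binary[OF smq CC_open] by auto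
  obtain \<delta>' where \<delta>': "\<delta>' > 0" "\<delta>' \<le> r0" "\<And>X. X \<in> E \<Longrightarrow> norm X < \<delta>' \<Longrightarrow> ex X \<in> Bd s2" using ex_small[OF s2(1)] by metis
  define \<eta> where "\<eta> = min (\<delta> / 2) (\<delta>' / 2)"
  have \<eta>: "\<eta> > 0" "\<eta> \<le> \<delta> / 2" "\<eta> < \<delta>'" using \<delta> \<delta>' by (auto simp: \<eta>_def)
  have prod: "?a z \<otimes> ?b z \<in> fst CC" "\<mu> (\<mu> (?e (fst z), ?e (snd z)), \<mu> (?e (snd z), ?e (fst z))) = y (?a z \<otimes> ?b z)"
    if z: "z \<in> ?PP" "norm z \<le> \<eta>" for z
  proof -
    have z': "norm z \<le> \<delta> / 2" using z \<eta> by simp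
    have "norm (fst z) < \<delta>'" "norm (snd z) < \<delta>'"
      using norm_fst_le[of "fst z" "snd z"] norm_snd_le[of "snd z" "fst z"] z \<eta> by auto
    then have "ex (fst z) \<in> Bd s2" "ex (snd z) \<in> Bd s2" using \<delta>'(3) z pEE by auto
    then show "?a z \<otimes> ?b z \<in> fst CC" using s2(2) by blast
    show "\<mu> (\<mu> (?e (fst z), ?e (snd z)), \<mu> (?e (snd z), ?e (fst z))) = y (?a z \<otimes> ?b z)"
      using me[OF z(1) z'] \<psi>y by (simp add: \<mu>_def[of "(y _, y _)"])
  qed
  have PP0: "0 \<in> ?PP" using PP by (rule subspace_0)
  have t5: "tame ?PP (\<lambda>z. y (?a z \<otimes> ?b z)) (\<lambda>z. (fst z + snd z) + (snd z + fst z))"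
    by (rule tame_cong[OF t4 \<eta>(1) PP0 PP prod(2)])
  have t6: "tame ?PP (\<lambda>z. lg (\<psi> (y (?a z \<otimes> ?b z)))) (\<lambda>z. (fst z + snd z) + (snd z + fst z))"
    by (rule tame_compose[OF t5 PP tame_lg subE \<eta>(1)]) (use prod(1) yE in auto)
  have t7: "tame ?PP (\<lambda>z. lg (?a z \<otimes> ?b z)) (\<lambda>z. (fst z + snd z) + (snd z + fst z))"
    by (rule tame_cong[OF t6 \<eta>(1) PP0 PP]) (use prod(1) \<psi>y in auto)
  have lh: "linear (\<lambda>v::'e. (1/2) *\<^sub>R v)" by (simp add: linear_scaleR)
  have t8: "tame ?PP (\<lambda>z. (1/2) *\<^sub>R lg (?a z \<otimes> ?b z)) (\<lambda>z. (1/2) *\<^sub>R ((fst z + snd z) + (snd z + fst z)))"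
    using tame_compose[OF t7 PP tame_linear[OF lh] subspace_UNIV zero_less_one] by simp
  have ls: "linear (\<lambda>z::'e \<times> 'e. fst z + snd z)" by (auto intro!: linearI simp: algebra_simps)
  show ?thesis
    by (rule tame_linear_cong[OF t8 ls _ PP]) (simp add: algebra_simps flip: scaleR_add_left)
qed

text \<open>If \<open>Exp X \<otimes> Exp Y = Exp Z \<otimes> k\<close>, then
  \<open>\<sigma>\<close> followed by inversion gives
  \<open>Exp Y \<otimes> Exp X = inv k \<otimes> Exp Z\<close>. Exchanging the factors therefore
  replaces \<open>Z\<close> by \<open>Ad (inv k) Z\<close>, which has the same length under
  \<open>b\<close>; this is the symmetry that the strict estimate asks for.\<close>

theorem midpoint_shortening:
  assumes b: "bilinear b" "\<And>u v. b u v = b v u" "c > 0" "\<And>u. u \<in> pE \<Longrightarrow> c * (norm u)\<^sup>2 \<le> b u u"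
    and inv: "\<And>k u. k \<in> K \<Longrightarrow> u \<in> E \<Longrightarrow> b (Ad k u) (Ad k u) = b u u"
  obtains \<epsilon> where "\<epsilon> > 0" "\<And>X Y. X \<in> pE \<Longrightarrow> Y \<in> pE \<Longrightarrow> norm X < \<epsilon> \<Longrightarrow> norm Y < \<epsilon> \<Longrightarrow> X \<noteq> Y \<Longrightarrow>
     \<exists>Z\<in>pE. \<exists>k\<in>K. Exp X \<otimes> Exp Y = Exp Z \<otimes> k \<and> b Z Z < 2 * b X X + 2 * b Y Y"
proof -
  define Z where "Z = (\<lambda>z. (1/2) *\<^sub>R lg (ex (fst z) \<otimes> ex (snd z) \<otimes> (ex (snd z) \<otimes> ex (fst z))))"
  have tZ: "tame (pE \<times> pE) Z (\<lambda>z. fst z + snd z)" unfolding Z_def by (rule tame_log_product)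
  have PP: "subspace (pE \<times> pE)" by (rule subspace_Times[OF subpE subpE])
  have "bounded_bilinear b" using b(1) by (simp add: bilinear_conv_bounded_bilinear)
  then obtain \<beta> where \<beta>: "\<beta> > 0" "\<And>u v. \<bar>b u v\<bar> \<le> norm u * norm v * \<beta>"
    using bounded_bilinear.pos_bounded[of b] unfolding real_norm_def by metis
  obtain s where s: "s > 0" "s \<le> r0" "\<And>h. h \<in> F \<Longrightarrow> h \<in> Bd s \<Longrightarrow> lg h \<in> pE \<and> Exp (lg h) = h" using log_F by metis
  obtain \<delta>0 where \<delta>0: "\<delta>0 > 0" "\<And>X Y. X \<in> E \<Longrightarrow> Y \<in> E \<Longrightarrow> norm X < \<delta>0 \<Longrightarrow> norm Y < \<delta>0 \<Longrightarrow> Exp X = Exp Y \<Longrightarrow> X = Y"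
    using Exp_inj_small by metis
  obtain RZ KZ where KZ: "RZ > 0" "KZ \<ge> 1" "\<And>z. z \<in> pE \<times> pE \<Longrightarrow> norm z \<le> RZ \<Longrightarrow> norm (Z z) \<le> KZ * norm z"
    using tame_lipschitz[OF tZ PP] by metis
  have smq: "smooth_at (subspace_mfd EE) M (\<lambda>z. (\<psi> (fst z) \<otimes> \<psi> (snd z)) \<otimes> (\<psi> (snd z) \<otimes> \<psi> (fst z))) 0"
    by (intro smooth_at_mult MEE smooth_at_pair0)
  have oB: "\<one> \<otimes> \<one> \<otimes> (\<one> \<otimes> \<one>) \<in> Bd s" using s by simp
  obtain s2 where s2: "s2 > 0" "\<And>a b. a \<in> Bd s2 \<Longrightarrow> b \<in> Bd s2 \<Longrightarrow> (a \<otimes> b) \<otimes> (b \<otimes> a) \<in> Bd s"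
    by (rule small_binary[OF smq Bd_open oB]) (rule that)
  obtain \<delta> where \<delta>: "\<delta> > 0" "\<delta> \<le> r0" "\<And>X. X \<in> E \<Longrightarrow> norm X < \<delta> \<Longrightarrow> ex X \<in> Bd s2" using ex_small[OF s2(1)] by metis
  \<comment> \<open>A bound for \<open>Ad k\<close> on \<pp> that is uniform in
    \<open>k \<in> K\<close>, from the comparison of the invariant form with the norm.\<close>
  define L where "L = sqrt (\<beta> / c) + 1"
  have L: "L \<ge> 1" using \<beta>(1) b(3) by (simp add: L_def)
  have AdL: "norm (Ad k u) \<le> L * norm u" if "k \<in> K" "u \<in> pE" for k u
  proof -
    have "c * (norm (Ad k u))\<^sup>2 \<le> b (Ad k u) (Ad k u)" using b(4)[OF Ad_p[OF that]] .
    also have "\<dots> = b u u" using inv that pE_E by blast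
    also have "\<dots> \<le> (norm u)\<^sup>2 * \<beta>" using \<beta>(2)[of u u] by (simp add: power2_eq_square)
    finally have "(norm (Ad k u))\<^sup>2 \<le> (\<beta> / c) * (norm u)\<^sup>2" using b(3) by (simp add: field_simps)
    then have "norm (Ad k u) \<le> sqrt ((\<beta> / c) * (norm u)\<^sup>2)" by (simp add: real_le_rsqrt)
    also have "\<dots> = sqrt (\<beta> / c) * sqrt ((norm u)\<^sup>2)" by (rule real_sqrt_mult)
    also have "\<dots> = sqrt (\<beta> / c) * norm u" by (simp only: real_sqrt_abs abs_norm_cancel)
    also have "\<dots> \<le> L * norm u" by (intro mult_right_mono) (auto simp: L_def)
    finally show ?thesis .
  qed
  \<comment> \<open>The denominator \<open>8 * KZ * L\<close> puts
    \<open>2 *\<^sub>R Z (X, Y)\<close> and its images under \<open>Ad k\<close> into the ball of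
    radius \<open>\<delta>0\<close> on which \<open>Exp\<close> is injective, so that equal
    exponentials have equal arguments.\<close>
  define \<rho> where "\<rho> = min (min (\<delta> / 2) (min r2 (\<delta>0 / 2))) (min (RZ / 2) (\<delta>0 / (8 * KZ * L)))"
  have \<rho>: "\<rho> > 0" "\<rho> < \<delta>" "\<rho> \<le> r2" "\<rho> < \<delta>0" "2 * \<rho> \<le> RZ" "\<rho> \<le> \<delta>0 / (8 * KZ * L)"
    using \<delta>(1) \<delta>0(1) KZ r2 L by (auto simp: \<rho>_def)
  have basic: "Z (X, Y) \<in> pE \<and> (\<exists>k\<in>K. Exp X \<otimes> Exp Y = Exp (Z (X, Y)) \<otimes> k) \<and> Exp (2 *\<^sub>R Z (X, Y)) = Exp X \<otimes> Exp Y \<otimes> (Exp Y \<otimes> Exp X)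
      \<and> norm (Z (X, Y)) * L < \<delta>0 / 2"
    if XY: "X \<in> pE" "Y \<in> pE" "norm X < \<rho>" "norm Y < \<rho>" for X Y
  proof -
    let ?a = "Exp X" and ?b = "Exp Y"
    have e: "?a = ex X" "?b = ex Y" using Exp_small XY pE_E \<rho> by auto
    have c: "?a \<in> carrier G" "?b \<in> carrier G" using Exp_carrier XY pE_E by auto
    have \<sigma>ab: "\<sigma> ?a = inv ?a" "\<sigma> ?b = inv ?b" using \<sigma>_Exp_p XY by auto
    let ?h = "?a \<otimes> ?b \<otimes> (?b \<otimes> ?a)"
    have \<kappa>: "\<kappa> (?a \<otimes> ?b) = ?h" using c by (simp add: \<kappa>_def \<sigma>_mult \<sigma>ab inv_mult_group)
    have hF: "?h \<in> F" using \<kappa>_F[of "?a \<otimes> ?b"] c \<kappa> by simp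
    have "ex X \<in> Bd s2" "ex Y \<in> Bd s2" using \<delta>(3) XY pE_E \<rho> by auto
    then have hB: "?h \<in> Bd s" using s2(2) e by simp
    have Zh: "Z (X, Y) = (1/2) *\<^sub>R lg ?h" by (simp add: Z_def e)
    have ZP: "Z (X, Y) \<in> pE" unfolding Zh using s(3)[OF hF hB] subspace_scale[OF subpE] by blast
    have E2: "Exp (2 *\<^sub>R Z (X, Y)) = ?h" unfolding Zh using s(3)[OF hF hB] by simp
    have Zc: "Exp (Z (X, Y)) \<in> carrier G" using Exp_carrier pE_E ZP by blast
    have "\<kappa> (?a \<otimes> ?b) = \<kappa> (Exp (Z (X, Y)))" using \<kappa>_Exp_double[OF ZP] E2 \<kappa> by simp
    then have k: "inv (Exp (Z (X, Y))) \<otimes> (?a \<otimes> ?b) \<in> K" using inv_mult_in_K_iff[of "?a \<otimes> ?b" "Exp (Z (X, Y))"] c Zc by simp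
    have "?a \<otimes> ?b = Exp (Z (X, Y)) \<otimes> (inv (Exp (Z (X, Y))) \<otimes> (?a \<otimes> ?b))" using c Zc by (simp flip: m_assoc)
    moreover have "norm (Z (X, Y)) * L < \<delta>0 / 2"
    proof -
      have n: "norm (X, Y) \<le> 2 * \<rho>" using norm_Pair_le[of X Y] XY by simp
      then have "norm (Z (X, Y)) \<le> KZ * norm (X, Y)" using KZ(3)[of "(X, Y)"] XY \<rho> by auto
      also have "\<dots> \<le> KZ * (2 * \<rho>)" using n KZ by (intro mult_left_mono) auto
      finally have "norm (Z (X, Y)) * L \<le> KZ * (2 * \<rho>) * L" using L by (intro mult_right_mono) auto
      also have "\<dots> \<le> KZ * (2 * (\<delta>0 / (8 * KZ * L))) * L" using \<rho>(6) KZ L by (intro mult_right_mono mult_left_mono) auto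
      also have "\<dots> = \<delta>0 / 4" using KZ(2) L by (simp add: field_simps)
      finally show ?thesis using \<delta>0(1) by linarith
    qed
    ultimately show ?thesis using ZP E2 k by blast
  qed
  have symm: "b (Z (X, Y)) (Z (X, Y)) = b (Z (Y, X)) (Z (Y, X))"
    if XY: "X \<in> pE" "Y \<in> pE" "norm X < \<rho>" "norm Y < \<rho>" for X Y
  proof -
    let ?a = "Exp X" and ?b = "Exp Y" and ?Z = "Z (X, Y)" and ?Z' = "Z (Y, X)"
    note 1 = basic[OF XY] and 2 = basic[OF XY(2,1,4,3)]
    have c: "?a \<in> carrier G" "?b \<in> carrier G" "Exp ?Z \<in> carrier G" using Exp_carrier XY pE_E 1 by auto
    obtain k where k: "k \<in> K" "?a \<otimes> ?b = Exp ?Z \<otimes> k" using 1 by blast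
    have kc: "k \<in> carrier G" "\<sigma> k = k" using k by (auto simp: K_def)
    have \<sigma>ab: "\<sigma> ?a = inv ?a" "\<sigma> ?b = inv ?b" "\<sigma> (Exp ?Z) = inv (Exp ?Z)" using \<sigma>_Exp_p XY 1 by auto
    have ba: "?b \<otimes> ?a = inv k \<otimes> Exp ?Z"
    proof -
      have "?b \<otimes> ?a = inv (\<sigma> (?a \<otimes> ?b))" using c by (simp add: \<sigma>_mult \<sigma>ab inv_mult_group)
      also have "\<dots> = inv k \<otimes> Exp ?Z" unfolding k(2) using c kc by (simp add: \<sigma>_mult \<sigma>ab inv_mult_group)
      finally show ?thesis .
    qed
    have ik: "inv k \<in> K" using subgroup.m_inv_closed[OF K_subgroup k(1)] .
    have ZE: "?Z \<in> E" "2 *\<^sub>R ?Z \<in> E" "?Z' \<in> E" using 1 2 pE_E subspace_scale[OF subE] by auto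
    have kc': "inv k \<in> carrier G" using kc by simp
    have AdE: "Ad (inv k) ?Z \<in> E" by (rule Ad_E[OF kc' ZE(1)])
    have "Exp (2 *\<^sub>R ?Z') = ?b \<otimes> ?a \<otimes> (?a \<otimes> ?b)" using 2 by blast
    also have "\<dots> = inv k \<otimes> (Exp ?Z \<otimes> Exp ?Z) \<otimes> k" unfolding ba k(2) using c kc by (simp add: m_assoc)
    also have "\<dots> = conj (inv k) (Exp (2 *\<^sub>R ?Z))" using Exp_double[OF ZE(1)] kc by simp
    also have "\<dots> = Exp (Ad (inv k) (2 *\<^sub>R ?Z))" by (rule Exp_Ad[OF kc' ZE(2)])
    also have "Ad (inv k) (2 *\<^sub>R ?Z) = 2 *\<^sub>R Ad (inv k) ?Z"
      by (rule linear_cmul[OF dCC_linear[OF smooth_at_conj[OF kc' one_closed]]]) (use kc in simp)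
    finally have "Exp (2 *\<^sub>R ?Z') = Exp (2 *\<^sub>R Ad (inv k) ?Z)" .
    then have "2 *\<^sub>R ?Z' = 2 *\<^sub>R Ad (inv k) ?Z"
    proof (rule \<delta>0(2)[rotated 4])
      show "2 *\<^sub>R ?Z' \<in> E" "2 *\<^sub>R Ad (inv k) ?Z \<in> E" using ZE AdE subspace_scale[OF subE] by auto
      have "norm ?Z' * 1 \<le> norm ?Z' * L" using L by (intro mult_left_mono) auto
      then show "norm (2 *\<^sub>R ?Z') < \<delta>0" using 2 by simp
      have "norm (Ad (inv k) ?Z) \<le> L * norm ?Z" using AdL[OF ik] 1 by blast
      then show "norm (2 *\<^sub>R Ad (inv k) ?Z) < \<delta>0" using 1 by (simp add: mult.commute)
    qed
    then have "?Z' = Ad (inv k) ?Z" by simp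
    then show ?thesis using inv[OF ik ZE(1)] by simp
  qed
  \<comment> \<open>The quarter makes room for \<open>4 *\<^sub>R X\<close> in the ball on which
    \<open>Exp\<close> is injective.\<close>
  have diag: "Z (X, X) = 2 *\<^sub>R X" if X: "X \<in> pE" "norm X < \<rho> / 4" for X
  proof -
    have XE: "X \<in> E" "2 *\<^sub>R X \<in> E" "2 *\<^sub>R (2 *\<^sub>R X) \<in> E" using X pE_E subspace_scale[OF subE] by auto
    note 1 = basic[OF X(1) X(1)]
    have X4: "norm X < \<rho>" using X(2) \<rho>(1) norm_ge_zero[of X] by linarith
    have "Exp (2 *\<^sub>R Z (X, X)) = Exp (2 *\<^sub>R (2 *\<^sub>R X))" using 1 X4 Exp_double[OF XE(1)] Exp_double[OF XE(2)] by simp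
    then have "2 *\<^sub>R Z (X, X) = 2 *\<^sub>R (2 *\<^sub>R X)"
    proof (rule \<delta>0(2)[rotated 4])
      show "2 *\<^sub>R Z (X, X) \<in> E" using 1 X4 pE_E subspace_scale[OF subE] by auto
      have "norm (Z (X, X)) * 1 \<le> norm (Z (X, X)) * L" using L by (intro mult_left_mono) auto
      then show "norm (2 *\<^sub>R Z (X, X)) < \<delta>0" using 1 X4 by simp
      show "norm (2 *\<^sub>R (2 *\<^sub>R X)) < \<delta>0" using X \<rho> by simp
    qed (use XE in auto)
    then show ?thesis by (simp only: scaleR_cancel_left) simp
  qed
  have symm': "b (Z (X, Y)) (Z (X, Y)) = b (Z (Y, X)) (Z (Y, X))"
    if XY: "X \<in> pE" "Y \<in> pE" "norm X < \<rho> / 4" "norm Y < \<rho> / 4" for X Y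
    using symm[OF XY(1,2)] XY(3,4) \<rho>(1) by simp
  have \<rho>4: "\<rho> / 4 > 0" using \<rho> by simp
  obtain \<epsilon> where \<epsilon>: "\<epsilon> > 0" "\<And>X Y. X \<in> pE \<Longrightarrow> Y \<in> pE \<Longrightarrow> norm X < \<epsilon> \<Longrightarrow> norm Y < \<epsilon> \<Longrightarrow> X \<noteq> Y \<Longrightarrow>
     b (Z (X, Y)) (Z (X, Y)) < 2 * b X X + 2 * b Y Y"
  proof (rule symmetric_tame_strict[OF subpE tZ diag \<rho>4 b symm'])
    fix \<epsilon> :: real assume "\<epsilon> > 0" "\<And>X Y. X \<in> pE \<Longrightarrow> Y \<in> pE \<Longrightarrow> norm X < \<epsilon> \<Longrightarrow> norm Y < \<epsilon> \<Longrightarrow> X \<noteq> Y \<Longrightarrow>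
     b (Z (X, Y)) (Z (X, Y)) < 2 * b X X + 2 * b Y Y"
    then show thesis by (rule that)
  qed auto
  show thesis
  proof (rule that[of "min \<epsilon> \<rho>"])
    show "min \<epsilon> \<rho> > 0" using \<epsilon> \<rho> by simp
    fix X Y assume "X \<in> pE" "Y \<in> pE" "norm X < min \<epsilon> \<rho>" "norm Y < min \<epsilon> \<rho>" "X \<noteq> Y"
    then show "\<exists>Z\<in>pE. \<exists>k\<in>K. Exp X \<otimes> Exp Y = Exp Z \<otimes> k \<and> b Z Z < 2 * b X X + 2 * b Y Y"
      using basic[of X Y] \<epsilon>(2)[of X Y] by (intro bexI[of _ "Z (X, Y)"]) auto
  qed
qed

end

text \<open>Turns the absence of kinks in a minimiser into equality of all its steps.\<close>

lemma list_adjacent_distinct: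
  assumes "\<nexists>us a b vs. xs = us @ a # b # vs \<and> a \<noteq> b" "xs \<noteq> []"
  shows "xs = replicate (length xs) (hd xs)"
  using assms
proof (induction xs)
  case (Cons x xs)
  show ?case
  proof (cases xs)
    case (Cons z zs)
    have 1: "\<nexists>us a b vs. xs = us @ a # b # vs \<and> a \<noteq> b"
    proof
      assume "\<exists>us a b vs. xs = us @ a # b # vs \<and> a \<noteq> b"
      then obtain us a b vs where "xs = us @ a # b # vs" "a \<noteq> b" by blast
      then have "x # xs = (x # us) @ a # b # vs" by simp
      then show False using Cons.prems(1) \<open>a \<noteq> b\<close> by blast
    qed
    have "x # xs = [] @ x # z # zs" using Cons by simp
    then have "x = z" using Cons.prems(1) by blast
    moreover have "xs = replicate (length xs) (hd xs)" using Cons.IH[OF 1] Cons by simp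
    ultimately show ?thesis using Cons by (metis length_Cons list.sel(1) replicate_Suc)
  qed simp
qed simp

section \<open>Chains of exponentials and their energy\<close>

context symm
begin

definition prodE :: "'e list \<Rightarrow> 'g" where "prodE Xs = foldr (\<lambda>X g. Exp X \<otimes> g) Xs \<one>"

lemma prodE_simps [simp]: "prodE [] = \<one>" "prodE (X # Xs) = Exp X \<otimes> prodE Xs"
  by (simp_all add: prodE_def)

lemma prodE_carrier [simp]: "set Xs \<subseteq> E \<Longrightarrow> prodE Xs \<in> carrier G"
  by (induction Xs) (auto intro: Exp_carrier)

lemma prodE_append: "set Xs \<subseteq> E \<Longrightarrow> set Ys \<subseteq> E \<Longrightarrow> prodE (Xs @ Ys) = prodE Xs \<otimes> prodE Ys"
  by (induction Xs) (auto simp: m_assoc Exp_carrier)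

text \<open>Factors from \<open>K\<close> can be collected at the right end of a chain at the price
  of applying \<open>Ad k\<close>, which preserves \<pp> and the energy.\<close>

lemma prodE_conj:
  assumes "k \<in> carrier G" "set Xs \<subseteq> E"
  shows "k \<otimes> prodE Xs = prodE (map (Ad k) Xs) \<otimes> k"
  using assms(2)
proof (induction Xs)
  case (Cons X Xs)
  have c: "Exp X \<in> carrier G" "prodE Xs \<in> carrier G" "prodE (map (Ad k) Xs) \<in> carrier G" "Exp (Ad k X) \<in> carrier G"
  proof -
    have "set (map (Ad k) Xs) \<subseteq> E" using Cons.prems Ad_E[OF assms(1)] by auto
    then show "prodE (map (Ad k) Xs) \<in> carrier G" by (rule prodE_carrier)
  qed (use Cons.prems Ad_E[OF assms(1)] Exp_carrier in auto)
  have "k \<otimes> Exp X = Exp (Ad k X) \<otimes> k"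
  proof -
    have "conj k (Exp X) \<otimes> k = Exp (Ad k X) \<otimes> k" using Exp_Ad[OF assms(1), of X] Cons.prems by simp
    then show ?thesis using c assms(1) by (simp add: m_assoc)
  qed
  then have "k \<otimes> prodE (X # Xs) = Exp (Ad k X) \<otimes> (k \<otimes> prodE Xs)" using c assms(1) by (simp flip: m_assoc)
  then show ?case using Cons c assms(1) by (simp add: m_assoc)
qed (use assms in simp)

lemma prodE_replicate: "X \<in> E \<Longrightarrow> prodE (replicate n X) = Exp (real n *\<^sub>R X)"
proof (induction n)
  case (Suc n)
  then show ?case using Exp_add[of X 1 "real n"] by (simp add: algebra_simps)
qed simp

text \<open>By the local polar decomposition the reachable elements absorb left factors from a
  neighbourhood of the identity. They and their complement are therefore open, and \<open>G\<close>
  is connected.\<close>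

lemma reachable:
  assumes g: "g \<in> carrier G"
  obtains Xs k where "set Xs \<subseteq> pE" "k \<in> K" "g = prodE Xs \<otimes> k"
proof -
  obtain W where W: "openin (mtop M) W" "\<one> \<in> W" "\<And>h. h \<in> W \<Longrightarrow> \<exists>Z\<in>pE. \<exists>k\<in>K. h = Exp Z \<otimes> k"
    using \<sigma>_F_nhd by metis
  define H where "H = {g \<in> carrier G. \<exists>Xs. set Xs \<subseteq> pE \<and> (\<exists>k\<in>K. g = prodE Xs \<otimes> k)}"
  have pEE: "set Xs \<subseteq> E" if "set Xs \<subseteq> pE" for Xs using that pE_E by blast
  have step: "w \<otimes> g \<in> H" if w: "w \<in> W" and g: "g \<in> H" for w g
  proof -
    obtain Z k where Z: "Z \<in> pE" "k \<in> K" "w = Exp Z \<otimes> k" using W(3)[OF w] by blast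
    obtain Xs k' where Xs: "set Xs \<subseteq> pE" "k' \<in> K" "g = prodE Xs \<otimes> k'" using g by (auto simp: H_def)
    have c: "Exp Z \<in> carrier G" "k \<in> carrier G" "k' \<in> carrier G" "prodE Xs \<in> carrier G"
      using Z Xs pE_E Exp_carrier K_carrier pEE by auto
    have m: "set (map (Ad k) Xs) \<subseteq> pE" using Xs(1) Ad_p[OF Z(2)] by auto
    have c2: "prodE (map (Ad k) Xs) \<in> carrier G" using prodE_carrier pEE[OF m] by blast
    have "w \<otimes> g = Exp Z \<otimes> (k \<otimes> prodE Xs) \<otimes> k'" using c Z(3) Xs(3) by (simp add: m_assoc)
    also have "\<dots> = prodE (Z # map (Ad k) Xs) \<otimes> (k \<otimes> k')"
      using prodE_conj[OF c(2) pEE[OF Xs(1)]] c c2 by (simp add: m_assoc)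
    finally have e: "w \<otimes> g = prodE (Z # map (Ad k) Xs) \<otimes> (k \<otimes> k')" .
    have wc: "w \<otimes> g \<in> carrier G" using c Z(3) Xs(3) by simp
    have "set (Z # map (Ad k) Xs) \<subseteq> pE" using m Z(1) by simp
    moreover have "k \<otimes> k' \<in> K" using subgroup.m_closed[OF K_subgroup Z(2) Xs(2)] .
    ultimately show ?thesis unfolding H_def using e wc by blast
  qed
  have T: "topspace (mtop M) = carrier G" by (rule top)
  have "openin (mtop M) H"
  proof (subst openin_subopen, intro ballI)
    fix g assume g: "g \<in> H"
    then have gc: "g \<in> carrier G" by (simp add: H_def)
    have s: "smooth_at M M (\<lambda>x. x \<otimes> inv g) g"
      by (intro smooth_at_mult M smooth_at_const_carrier smooth_at_ident) (simp_all add: top gc)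
    have "g \<otimes> inv g \<in> W" using gc W by simp
    then obtain V where V: "openin (mtop M) V" "g \<in> V" "(\<lambda>x. x \<otimes> inv g) ` V \<subseteq> W"
      using smooth_at_continuous[OF M s W(1)] by metis
    have "V \<subseteq> H"
    proof
      fix x assume x: "x \<in> V"
      then have xc: "x \<in> carrier G" using openin_subset[OF V(1)] T by blast
      have "(x \<otimes> inv g) \<otimes> g \<in> H" using step[OF _ g] V(3) x by blast
      then show "x \<in> H" using xc gc by (simp add: m_assoc)
    qed
    then show "\<exists>T. openin (mtop M) T \<and> g \<in> T \<and> T \<subseteq> H" using V by blast
  qed
  moreover have "openin (mtop M) (topspace (mtop M) - H)"
  proof (subst openin_subopen, intro ballI)
    fix g assume g: "g \<in> topspace (mtop M) - H"
    then have gc: "g \<in> carrier G" using T by simp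
    \<comment> \<open>The roles of \<open>x\<close> and \<open>g\<close> are exchanged here: if some
      \<open>x\<close> near \<open>g\<close> were reachable, so would be
      \<open>g = (g \<otimes> inv x) \<otimes> x\<close>.\<close>
    have s: "smooth_at M M (\<lambda>x. g \<otimes> inv x) g"
      by (intro smooth_at_mult smooth_at_inverse M smooth_at_const_carrier smooth_at_ident) (simp_all add: top gc)
    have "g \<otimes> inv g \<in> W" using gc W by simp
    then obtain V where V: "openin (mtop M) V" "g \<in> V" "(\<lambda>x. g \<otimes> inv x) ` V \<subseteq> W"
      using smooth_at_continuous[OF M s W(1)] by metis
    have "V \<subseteq> topspace (mtop M) - H"
    proof
      fix x assume x: "x \<in> V"
      then have xc: "x \<in> carrier G" using openin_subset[OF V(1)] T by blast
      have "x \<notin> H"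
      proof
        assume "x \<in> H"
        then have "(g \<otimes> inv x) \<otimes> x \<in> H" using step[of "g \<otimes> inv x" x] V(3) x by blast
        then show False using xc gc g by (simp add: m_assoc)
      qed
      then show "x \<in> topspace (mtop M) - H" using xc T by simp
    qed
    then show "\<exists>T. openin (mtop M) T \<and> g \<in> T \<and> T \<subseteq> topspace (mtop M) - H" using V by blast
  qed
  moreover have "H \<subseteq> topspace (mtop M)" using T by (auto simp: H_def)
  ultimately have "closedin (mtop M) H" "openin (mtop M) H" by (auto simp: closedin_def)
  then have "H = {} \<or> H = topspace (mtop M)" using connected unfolding connected_space_clopen_in by blast
  moreover have "\<one> \<in> H"
  proof -
    have "\<one> = prodE [] \<otimes> \<one>" "\<one> \<in> K" "set [] \<subseteq> pE" using subgroup.one_closed[OF K_subgroup] by auto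
    then show ?thesis unfolding H_def by (intro CollectI conjI one_closed exI[of _ "[]"] bexI[of _ \<one>]) auto
  qed
  ultimately have "g \<in> H" using g T by auto
  then show thesis using that unfolding H_def by blast
qed

lemma continuous_mult:
  assumes "continuous_map X (mtop M) f" "continuous_map X (mtop M) g"
  shows "continuous_map X (mtop M) (\<lambda>x. f x \<otimes> g x)"
proof -
  have "continuous_map (prod_topology (mtop M) (mtop M)) (mtop M) (\<lambda>(x, y). x \<otimes> y)"
    using LG by (simp add: lie_group_def smooth_map_def prod_mfd_def)
  from continuous_map_compose[OF continuous_map_pairedI[OF assms] this] show ?thesis by (simp add: o_def)
qed

text \<open>Minimising the energy of \<open>N\<close>-step broken geodesics takes the place of the Hopf--Rinow
  theorem: a minimiser with short steps cannot have a kink.\<close>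

theorem energy_minimizer:
  assumes b: "bilinear b" "c > 0" "\<And>u. u \<in> pE \<Longrightarrow> c * (norm u)\<^sup>2 \<le> b u u"
    and Ys: "set Ys \<subseteq> pE" "\<kappa> (prodE Ys) = \<kappa> g"
  obtains Xs where "set Xs \<subseteq> pE" "\<kappa> (prodE Xs) = \<kappa> g" "length Xs = length Ys"
    "\<And>Zs. set Zs \<subseteq> pE \<Longrightarrow> \<kappa> (prodE Zs) = \<kappa> g \<Longrightarrow> length Zs = length Ys \<Longrightarrow>
      (\<Sum>X\<leftarrow>Xs. b X X) \<le> (\<Sum>Z\<leftarrow>Zs. b Z Z)"
proof -
  define N where "N = length Ys"
  define e0 where "e0 = (\<Sum>Y\<leftarrow>Ys. b Y Y)"
  \<comment> \<open>A chain of energy at most \<open>e0\<close> has all its steps in this ball, by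
    the lower bound on \<open>b\<close>. The minimum can thus be sought over the compact set of
    \<open>N\<close>-tuples in \<open>B\<close>; chains of larger energy already lose to
    \<open>Ys\<close>.\<close>
  define B where "B = pE \<inter> cball 0 (sqrt (e0 / c))"
  have bpos: "b u u \<ge> 0" if "u \<in> pE" for u using b(3)[OF that] b(2) by (smt (verit) mult_nonneg_nonneg zero_le_power2)
  define lst where "lst = (\<lambda>f :: nat \<Rightarrow> 'e. map f [0..<N])"
  define X where "X = product_topology (\<lambda>i. top_of_set B) {..<N}"
  have Bc: "compact B" unfolding B_def by (intro closed_Int_compact closed_subspace subpE compact_cball)
  have Xc: "compact_space X"
    unfolding X_def compact_space_product_topology using Bc by (simp add: compact_space_subtopology)
  have Xt: "topspace X = PiE {..<N} (\<lambda>i. B)" by (simp add: X_def)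
  have BE: "B \<subseteq> E" using pE_E by (auto simp: B_def)
  have Pc: "continuous_map X (mtop M) (\<lambda>f. prodE (map f [0..<n]))" if "n \<le> N" for n
    using that
  proof (induction n)
    case 0
    then show ?case using top by simp
  next
    case (Suc n)
    have "continuous_map X (top_of_set B) (\<lambda>f. f n)"
      unfolding X_def by (rule continuous_map_product_projection) (use Suc.prems in simp)
    moreover have "continuous_map (top_of_set B) (mtop M) Exp"
      using continuous_map_from_subtopology[OF Exp_continuous, of B] BE by (simp add: subtopology_subtopology Int_absorb1)
    ultimately have "continuous_map X (mtop M) (\<lambda>f. Exp (f n))"
      using continuous_map_compose by (fastforce simp: o_def)
    then have "continuous_map X (mtop M) (\<lambda>f. prodE (map f [0..<n]) \<otimes> Exp (f n))"
      using Suc by (intro continuous_mult) auto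
    then show ?case
    proof (rule continuous_map_eq)
      fix f assume f: "f \<in> topspace X"
      have "f i \<in> E" if "i < Suc n" for i using f that Suc.prems BE unfolding Xt by (auto simp: PiE_iff)
      then have "set (map f [0..<n]) \<subseteq> E" "set [f n] \<subseteq> E" by auto
      from prodE_append[OF this] show "prodE (map f [0..<n]) \<otimes> Exp (f n) = prodE (map f [0..<Suc n])"
        using Exp_carrier \<open>set [f n] \<subseteq> E\<close> by simp
    qed
  qed
  have "continuous_map (mtop M) (mtop M) \<kappa>"
    by (rule smooth_at_imp_continuous_map[OF M]) (simp add: top smooth_at_\<kappa>)
  from continuous_map_compose[OF Pc[OF order_refl] this]
  have kc: "continuous_map X (mtop M) (\<lambda>f. \<kappa> (prodE (lst f)))" by (simp add: o_def lst_def)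
  define S where "S = {f \<in> topspace X. \<kappa> (prodE (lst f)) \<in> {\<kappa> g}}"
  have lstY: "lst (\<lambda>i\<in>{..<N}. Zs ! i) = Zs" if "length Zs = N" for Zs
    unfolding lst_def using that by (intro nth_equalityI) auto
  have inX: "(\<lambda>i\<in>{..<N}. Zs ! i) \<in> topspace X"
    if Z: "set Zs \<subseteq> pE" "length Zs = N" "(\<Sum>Z\<leftarrow>Zs. b Z Z) \<le> e0" for Zs
  proof -
    have "Zs ! i \<in> B" if i: "i < N" for i
    proof -
      have Zi: "Zs ! i \<in> set Zs" using i Z(2) by simp
      have "b (Zs ! i) (Zs ! i) \<le> (\<Sum>Z\<leftarrow>Zs. b Z Z)"
        by (rule member_le_sum_list) (use Zi Z(1) bpos in auto)
      then have "c * (norm (Zs ! i))\<^sup>2 \<le> e0" using b(3) Zi Z by fastforce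
      then have "(norm (Zs ! i))\<^sup>2 \<le> e0 / c" using b(2) by (simp add: field_simps)
      then have "norm (Zs ! i) \<le> sqrt (e0 / c)" by (simp add: real_le_rsqrt)
      then show ?thesis using Zi Z(1) by (auto simp: B_def)
    qed
    then show ?thesis unfolding Xt by auto
  qed
  have YX: "(\<lambda>i\<in>{..<N}. Ys ! i) \<in> S" using inX[of Ys] lstY[of Ys] Ys by (simp add: S_def N_def e0_def)
  have "\<kappa> (prodE Ys) \<in> carrier G" using Ys(1) pE_E by (intro \<kappa>_carrier prodE_carrier) blast
  then have "closedin (mtop M) {\<kappa> g}"
    using M Ys(2) top unfolding smooth_manifold_def by (metis closedin_Hausdorff_singleton)
  then have "closedin X S" unfolding S_def by (rule closedin_continuous_map_preimage[OF kc])
  then have Sc: "compactin X S" using Xc by (simp add: closedin_compact_space)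
  have ec: "continuous_map X euclideanreal (\<lambda>f. \<Sum>i<N. b (f i) (f i))"
  proof (rule continuous_map_sum)
    fix i assume i: "i \<in> {..<N}"
    have 1: "continuous_map X (top_of_set B) (\<lambda>f. f i)" unfolding X_def by (rule continuous_map_product_projection[OF i])
    have "bounded_bilinear b" using b(1) by (simp add: bilinear_conv_bounded_bilinear)
    from bounded_bilinear.continuous_on[OF this continuous_on_id continuous_on_id]
    have "continuous_on B (\<lambda>u. b u u)" by (simp add: id_def)
    then have "continuous_map (top_of_set B) euclideanreal (\<lambda>u. b u u)" by simp
    from continuous_map_compose[OF 1 this] show "continuous_map X euclideanreal (\<lambda>f. b (f i) (f i))" by (simp add: o_def)
  qed simp
  have "compact ((\<lambda>f. \<Sum>i<N. b (f i) (f i)) ` S)" using image_compactin[OF Sc ec] by simp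
  moreover have "(\<lambda>f. \<Sum>i<N. b (f i) (f i)) ` S \<noteq> {}" using YX by blast
  ultimately obtain f where f: "f \<in> S" "\<And>f'. f' \<in> S \<Longrightarrow> (\<Sum>i<N. b (f i) (f i)) \<le> (\<Sum>i<N. b (f' i) (f' i))"
    using compact_attains_inf[of "(\<lambda>f. \<Sum>i<N. b (f i) (f i)) ` S"] by (auto simp: Bex_def Ball_def)
  have el: "(\<Sum>Z\<leftarrow>lst f. b Z Z) = (\<Sum>i<N. b (f i) (f i))" for f
    unfolding lst_def by (simp add: lessThan_atLeast0 interv_sum_list_conv_sum_set_nat o_def)
  show thesis
  proof (rule that[of "lst f"])
    have "f i \<in> B" if "i < N" for i using f(1) that unfolding S_def Xt by (auto simp: PiE_iff)
    then show "set (lst f) \<subseteq> pE" by (auto simp: lst_def B_def)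
    show "\<kappa> (prodE (lst f)) = \<kappa> g" using f(1) by (simp add: S_def)
    show "length (lst f) = length Ys" by (simp add: lst_def N_def)
    fix Zs assume Z: "set Zs \<subseteq> pE" "\<kappa> (prodE Zs) = \<kappa> g" "length Zs = length Ys"
    show "(\<Sum>X\<leftarrow>lst f. b X X) \<le> (\<Sum>Z\<leftarrow>Zs. b Z Z)"
    proof (cases "(\<Sum>Z\<leftarrow>Zs. b Z Z) \<le> e0")
      case True
      have ZS: "(\<lambda>i\<in>{..<N}. Zs ! i) \<in> S" using inX[OF Z(1) _ True] lstY[of Zs] Z by (simp add: S_def N_def)
      have "length Zs = N" using Z(3) by (simp add: N_def)
      from f(2)[OF ZS, unfolded el[symmetric], unfolded lstY[OF this]] show ?thesis .
    next
      case False
      have "(\<Sum>X\<leftarrow>lst f. b X X) \<le> (\<Sum>Y\<leftarrow>Ys. b Y Y)"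
        by (rule f(2)[OF YX, unfolded el[symmetric], unfolded lstY[OF N_def[symmetric]]])
      then show ?thesis using False by (simp add: e0_def)
    qed
  qed
qed

text \<open>A chain into the class of \<open>g\<close> is subdivided until a minimiser with equally
  many steps must have short steps. Shortening then rules out distinct neighbours, and a product of
  equal exponentials is a single one.\<close>

theorem \<kappa>_surj:
  assumes g: "g \<in> carrier G"
  obtains X where "X \<in> pE" "\<kappa> g = \<kappa> (Exp X)"
proof -
  obtain b :: "'e \<Rightarrow> 'e \<Rightarrow> real" where b: "bilinear b" "\<And>u v. b u v = b v u"
    "\<And>u. u \<in> pE \<Longrightarrow> u \<noteq> 0 \<Longrightarrow> b u u > 0" and inv: "\<And>k u. k \<in> K \<Longrightarrow> u \<in> E \<Longrightarrow> b (Ad k u) (Ad k u) = b u u"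
    by (rule invariant_form) (rule that)
  have bb: "bounded_bilinear b" using b(1) by (simp add: bilinear_conv_bounded_bilinear)
  have sc: "b (r *\<^sub>R u) (r *\<^sub>R u) = r\<^sup>2 * b u u" for r u
    using b(1) by (simp add: bilinear_lmul bilinear_rmul power2_eq_square)
  obtain c where c: "c > 0" "\<And>u. u \<in> pE \<Longrightarrow> c * (norm u)\<^sup>2 \<le> b u u"
  proof -
    let ?S = "pE \<inter> sphere 0 1"
    have S: "compact ?S" by (intro closed_Int_compact closed_subspace subpE compact_sphere)
    have ct: "continuous_on ?S (\<lambda>u. b u u)" using bounded_bilinear.continuous_on[OF bb continuous_on_id continuous_on_id] by (simp add: id_def)
    \<comment> \<open>If \<pp> is 0, its unit sphere is empty and any positive \<open>m\<close>
      works.\<close>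
    obtain m where m: "m > 0" "\<And>u. u \<in> ?S \<Longrightarrow> m \<le> b u u"
    proof (cases "?S = {}")
      case False
      then obtain u where u: "u \<in> ?S" "\<And>v. v \<in> ?S \<Longrightarrow> b u u \<le> b v v" using continuous_attains_inf[OF S _ ct] by blast
      then have "b u u > 0" using b(3)[of u] by force
      then show thesis using that[of "b u u"] u(2) by blast
    next
      case True
      then show thesis using that[of 1] by simp
    qed
    show thesis
    proof (rule that[OF m(1)])
      fix u assume u: "u \<in> pE"
      show "m * (norm u)\<^sup>2 \<le> b u u"
      proof (cases "u = 0")
        case True
        then show ?thesis using b(1) by (simp add: bilinear_lzero)
      next
        case False
        let ?v = "(1 / norm u) *\<^sub>R u"
        have "?v \<in> ?S" using False subspace_scale[OF subpE u] by simp
        from m(2)[OF this] have "m \<le> (1 / norm u)\<^sup>2 * b u u" unfolding sc .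
        then show ?thesis using False by (simp add: power_divide field_simps)
      qed
    qed
  qed
  obtain \<epsilon> where \<epsilon>: "\<epsilon> > 0" "\<And>X Y. X \<in> pE \<Longrightarrow> Y \<in> pE \<Longrightarrow> norm X < \<epsilon> \<Longrightarrow> norm Y < \<epsilon> \<Longrightarrow> X \<noteq> Y \<Longrightarrow>
     \<exists>Z\<in>pE. \<exists>k\<in>K. Exp X \<otimes> Exp Y = Exp Z \<otimes> k \<and> b Z Z < 2 * b X X + 2 * b Y Y"
    using midpoint_shortening[OF b(1,2) c inv] by metis
  have pEE: "set Xs \<subseteq> E" if "set Xs \<subseteq> pE" for Xs using that pE_E by blast
  obtain Xs k where Xs: "set Xs \<subseteq> pE" "k \<in> K" "g = prodE Xs \<otimes> k" using reachable[OF g] .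
  have \<kappa>Xs: "\<kappa> (prodE Xs) = \<kappa> g" using \<kappa>_mult_K[OF prodE_carrier[OF pEE[OF Xs(1)]] Xs(2)] Xs(3) by simp
  define e where "e = (\<Sum>X\<leftarrow>Xs. b X X)"
  \<comment> \<open>Subdivision into \<open>m'\<close> parts divides the energy \<open>e\<close> by
    \<open>m'\<close>, and a step \<open>V\<close> of a minimiser satisfies
    \<open>c * (norm V)\<^sup>2 \<le> e / m'\<close>. Hence \<open>m'\<close> above
    \<open>e / (c * \<epsilon>\<^sup>2)\<close> makes all steps shorter than
    \<open>\<epsilon>\<close>.\<close>
  obtain m :: nat where m0: "e / (c * \<epsilon>\<^sup>2) < real m" using reals_Archimedean2 by blast
  define m' where "m' = Suc m"
  have m: "m' > 0" "e < real m' * (c * \<epsilon>\<^sup>2)"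
  proof -
    have "e / (c * \<epsilon>\<^sup>2) < real m'" using m0 by (simp add: m'_def)
    then show "e < real m' * (c * \<epsilon>\<^sup>2)" using c(1) \<epsilon>(1) by (simp add: pos_divide_less_eq)
  qed (simp add: m'_def)
  define Ys where "Ys = concat (map (\<lambda>X. replicate m' ((1 / real m') *\<^sub>R X)) Xs)"
  have Ys: "set Ys \<subseteq> pE" "prodE Ys = prodE Xs" "(\<Sum>Y\<leftarrow>Ys. b Y Y) = e / real m'"
  proof -
    show 1: "set Ys \<subseteq> pE" using Xs(1) subspace_scale[OF subpE] by (auto simp: Ys_def)
    show "prodE Ys = prodE Xs"
      using Xs(1) unfolding Ys_def
    proof (induction Xs)
      case (Cons X Xs)
      let ?x = "(1 / real m') *\<^sub>R X"
      have XE: "?x \<in> E" "set Xs \<subseteq> pE" using Cons.prems subspace_scale[OF subpE] pE_E by auto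
      have s2: "set (concat (map (\<lambda>X. replicate m' ((1 / real m') *\<^sub>R X)) Xs)) \<subseteq> E"
        using XE(2) subspace_scale[OF subpE] pE_E by auto
      have "prodE (replicate m' ?x) = Exp X" using prodE_replicate[OF XE(1), of m'] m(1) by simp
      then show ?case using prodE_append[OF _ s2, of "replicate m' ?x"] XE Cons.IH[OF XE(2)] by (simp add: m(1))
    qed simp
    show "(\<Sum>Y\<leftarrow>Ys. b Y Y) = e / real m'"
      unfolding Ys_def e_def
    proof (induction Xs)
      case (Cons X Xs)
      have "real m' * b ((1 / real m') *\<^sub>R X) ((1 / real m') *\<^sub>R X) = b X X / real m'"
        unfolding sc using m(1) by (simp add: power2_eq_square)
      then show ?case using Cons by (simp add: map_replicate sum_list_replicate add_divide_distrib)
    qed simp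
  qed
  have \<kappa>Ys: "\<kappa> (prodE Ys) = \<kappa> g" using Ys(2) \<kappa>Xs by simp
  obtain Vs where Vs: "set Vs \<subseteq> pE" "\<kappa> (prodE Vs) = \<kappa> g" "length Vs = length Ys"
    "\<And>Zs. set Zs \<subseteq> pE \<Longrightarrow> \<kappa> (prodE Zs) = \<kappa> g \<Longrightarrow> length Zs = length Ys \<Longrightarrow> (\<Sum>X\<leftarrow>Vs. b X X) \<le> (\<Sum>Z\<leftarrow>Zs. b Z Z)"
  proof (rule energy_minimizer[OF b(1) c Ys(1) \<kappa>Ys])
    fix Vs assume "set Vs \<subseteq> pE" "\<kappa> (prodE Vs) = \<kappa> g" "length Vs = length Ys"
      "\<And>Zs. set Zs \<subseteq> pE \<Longrightarrow> \<kappa> (prodE Zs) = \<kappa> g \<Longrightarrow> length Zs = length Ys \<Longrightarrow> (\<Sum>X\<leftarrow>Vs. b X X) \<le> (\<Sum>Z\<leftarrow>Zs. b Z Z)"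
    then show thesis by (rule that)
  qed
  have bpos: "b u u \<ge> 0" if "u \<in> pE" for u using c(2)[OF that] c(1) by (smt (verit) mult_nonneg_nonneg zero_le_power2)
  have small: "norm V < \<epsilon>" if V: "V \<in> set Vs" for V
  proof -
    have "c * (norm V)\<^sup>2 \<le> b V V" using c(2) V Vs(1) by blast
    also have "\<dots> \<le> (\<Sum>X\<leftarrow>Vs. b X X)" by (rule member_le_sum_list) (use V Vs(1) bpos in auto)
    also have "\<dots> \<le> e / real m'" using Vs(4)[OF Ys(1) \<kappa>Ys refl] Ys(3) by simp
    also have "\<dots> < c * \<epsilon>\<^sup>2" using m by (simp add: field_simps)
    finally have "(norm V)\<^sup>2 < \<epsilon>\<^sup>2" using c(1) by simp
    then show ?thesis using \<epsilon>(1) by (simp add: power_less_imp_less_base)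
  qed
  have straight: "\<nexists>us x z vs. Vs = us @ x # z # vs \<and> x \<noteq> z"
  proof
    assume "\<exists>us x z vs. Vs = us @ x # z # vs \<and> x \<noteq> z"
    then obtain us x z vs where V: "Vs = us @ x # z # vs" "x \<noteq> z" by blast
    have mem: "set us \<subseteq> pE" "x \<in> pE" "z \<in> pE" "set vs \<subseteq> pE" using Vs(1) V(1) by auto
    obtain Z k where Z: "Z \<in> pE" "k \<in> K" "Exp x \<otimes> Exp z = Exp Z \<otimes> k" "b Z Z < 2 * b x x + 2 * b z z"
      using \<epsilon>(2)[OF mem(2,3)] small V by auto
    \<comment> \<open>Two equal halves of \<open>Z\<close> keep the number of steps, and their
      energy \<open>2 * b ?h ?h = b Z Z / 2\<close> is less than \<open>b x x + b z z\<close>. The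
      factor \<open>k\<close> moves to the end, where \<open>\<kappa>\<close> ignores it, and the
      \<open>Ad k\<close> it leaves behind does not change the energy of \<open>vs\<close>.\<close>
    let ?h = "(1/2) *\<^sub>R Z" and ?vs = "map (Ad k) vs"
    have h: "?h \<in> pE" using subspace_scale[OF subpE Z(1)] .
    have vs': "set ?vs \<subseteq> pE" using mem(4) Ad_p[OF Z(2)] by auto
    let ?Ws = "us @ ?h # ?h # ?vs"
    have c': "prodE us \<in> carrier G" "Exp x \<in> carrier G" "Exp z \<in> carrier G" "Exp Z \<in> carrier G" "prodE vs \<in> carrier G"
      "prodE ?vs \<in> carrier G" "k \<in> carrier G" "Exp ?h \<in> carrier G"
      using mem Z h pE_E Exp_carrier K_carrier prodE_carrier[OF pEE[OF mem(1)]] prodE_carrier[OF pEE[OF mem(4)]]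
        prodE_carrier[OF pEE[OF vs']] by auto
    have hh: "Exp ?h \<otimes> Exp ?h = Exp Z" using Exp_double[of ?h] pE_E h by simp
    have "prodE Vs = prodE us \<otimes> ((Exp x \<otimes> Exp z) \<otimes> prodE vs)"
      unfolding V(1) using prodE_append[of us "x # z # vs"] mem pEE pE_E c' by (simp add: m_assoc)
    also have "\<dots> = prodE us \<otimes> (Exp Z \<otimes> (k \<otimes> prodE vs))" unfolding Z(3) using c' by (simp add: m_assoc)
    also have "\<dots> = (prodE us \<otimes> ((Exp ?h \<otimes> Exp ?h) \<otimes> prodE ?vs)) \<otimes> k"
      unfolding hh prodE_conj[OF c'(7) pEE[OF mem(4)]] using c' by (simp add: m_assoc)
    also have "prodE us \<otimes> ((Exp ?h \<otimes> Exp ?h) \<otimes> prodE ?vs) = prodE ?Ws"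
    proof -
      have "set (?h # ?h # ?vs) \<subseteq> E" using h vs' pE_E by auto
      from prodE_append[OF pEE[OF mem(1)] this] show ?thesis using c' by (simp add: m_assoc)
    qed
    finally have eq: "prodE Vs = prodE ?Ws \<otimes> k" .
    have Ws: "set ?Ws \<subseteq> pE" using mem vs' h by auto
    have "\<kappa> (prodE ?Ws) = \<kappa> g"
      using eq \<kappa>_mult_K[OF prodE_carrier[OF pEE[OF Ws]] Z(2)] Vs(2) by simp
    from Vs(4)[OF Ws this] have le: "(\<Sum>X\<leftarrow>Vs. b X X) \<le> (\<Sum>X\<leftarrow>?Ws. b X X)" using V(1) Vs(3) by simp
    have "(\<Sum>X\<leftarrow>?vs. b X X) = (\<Sum>X\<leftarrow>vs. b X X)"
      unfolding map_map o_def by (rule arg_cong[where f = sum_list], rule map_cong) (use inv[OF Z(2)] mem(4) pE_E in auto)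
    moreover have "b ?h ?h = b Z Z / 4" using sc[of "1/2" Z] by (simp add: power2_eq_square)
    ultimately show False using le Z(4) unfolding V(1) by simp
  qed
  show thesis
  proof (cases "Vs = []")
    case True
    have "\<kappa> g = \<kappa> (Exp 0)" using Vs(2)[symmetric] True by simp
    then show ?thesis by (rule that[OF subspace_0[OF subpE]])
  next
    case False
    have V: "Vs = replicate (length Vs) (hd Vs)" by (rule list_adjacent_distinct[OF straight False])
    have hd: "hd Vs \<in> pE" using False Vs(1) by (simp add: subset_iff)
    have "prodE Vs = Exp (real (length Vs) *\<^sub>R hd Vs)" using prodE_replicate[OF pE_E[OF hd], of "length Vs"] V by simp
    then have "\<kappa> g = \<kappa> (Exp (real (length Vs) *\<^sub>R hd Vs))" using Vs(2) by simp
    then show ?thesis using that subspace_scale[OF subpE hd] by blast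
  qed
qed

end

section \<open>The orbit as a submanifold\<close>

context symm
begin

definition Orb where "Orb = \<kappa> ` carrier G"

lemma Orb_F: "Orb \<subseteq> F" using \<kappa>_F by (auto simp: Orb_def)

lemma F_carrier: "h \<in> F \<Longrightarrow> h \<in> carrier G" by (simp add: F_def)

lemma Orb_carrier: "h \<in> Orb \<Longrightarrow> h \<in> carrier G" using Orb_F F_carrier by blast

text \<open>Halving \<open>X\<close> exhibits \<open>Exp X\<close> as a value of
  \<open>\<kappa>\<close>; conversely \<open>\<kappa>_surj\<close> and doubling present each value
  of \<open>\<kappa>\<close> as an exponential.\<close>

lemma Exp_pE_eq_Orb: "Exp ` pE = Orb"
proof (intro equalityI subsetI)
  fix h assume "h \<in> Exp ` pE"
  then obtain X where X: "X \<in> pE" "h = Exp X" by blast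
  have "\<kappa> (Exp ((1/2) *\<^sub>R X)) = h" using \<kappa>_Exp_double[OF subspace_scale[OF subpE X(1)], of "1/2"] X(2) by simp
  then show "h \<in> Orb" unfolding Orb_def using Exp_carrier pE_E subspace_scale[OF subpE X(1)] by blast
next
  fix h assume "h \<in> Orb"
  then obtain g where g: "g \<in> carrier G" "h = \<kappa> g" by (auto simp: Orb_def)
  obtain X where X: "X \<in> pE" "\<kappa> g = \<kappa> (Exp X)" using \<kappa>_surj[OF g(1)] .
  then have "h = Exp (2 *\<^sub>R X)" using \<kappa>_Exp_double g by simp
  then show "h \<in> Exp ` pE" using subspace_scale[OF subpE X(1)] by blast
qed

lemma symmetric_subset_Orb: "symmetric_subset G M \<sigma> = Orb"
  using symmetric_subset_eq[OF smooth_at_\<sigma>[OF one_closed] \<sigma>_one] Exp_pE_eq_Orb by (simp add: pE_def)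

lemma \<tau>_Orb: "g \<in> carrier G \<Longrightarrow> h \<in> Orb \<Longrightarrow> \<tau> g h \<in> Orb"
proof -
  assume g: "g \<in> carrier G" and "h \<in> Orb"
  then obtain b where b: "b \<in> carrier G" "h = \<kappa> b" by (auto simp: Orb_def)
  have "\<tau> g h = \<kappa> (g \<otimes> b)" using \<tau>_\<kappa>[OF g b(1)] b(2) by simp
  then show ?thesis using g b(1) by (simp add: Orb_def)
qed

lemma \<tau>_Orb_iff: "g \<in> carrier G \<Longrightarrow> h \<in> carrier G \<Longrightarrow> \<tau> g h \<in> Orb \<longleftrightarrow> h \<in> Orb"
  using \<tau>_Orb[of g h] \<tau>_Orb[of "inv g" "\<tau> g h"] \<tau>_inv(1)[of g h] by auto

text \<open>The square root of \<open>h h\<^sub>0\<^sup>-\<^sup>1\<close> moves \<open>h\<^sub>0\<close> to \<open>h\<close>: it inherits the relation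
  \<open>\<sigma>' x = x\<^sup>-\<^sup>1\<close> for the involution \<open>\<sigma>' = h\<^sub>0 \<sigma> h\<^sub>0\<^sup>-\<^sup>1\<close> by uniqueness of roots.\<close>

lemma orbit_local_section:
  assumes h0: "h0 \<in> F"
  obtains s where "s > 0" "s \<le> R" "\<And>h. h \<in> F \<Longrightarrow> h \<otimes> inv h0 \<in> Bd s \<Longrightarrow> \<tau> (rt (h \<otimes> inv h0)) h0 = h"
proof -
  have h0c: "h0 \<in> carrier G" "\<sigma> h0 = inv h0" using h0 by (auto simp: F_def)
  let ?s = "\<lambda>x. h0 \<otimes> \<sigma> x \<otimes> inv h0"
  have s1: "smooth_at M M ?s \<one>"
    by (intro smooth_at_mult M smooth_at_const_carrier smooth_at_\<sigma>) (simp_all add: top h0c)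
  have s2: "smooth_at M M (\<lambda>x. inv x) \<one>" by (intro smooth_at_inverse M smooth_at_ident) simp
  have 1: "?s \<one> \<in> Bd R" "inv \<one> \<in> Bd R" using h0c R by auto
  obtain W1 where W1: "openin (mtop M) W1" "\<one> \<in> W1" "?s ` W1 \<subseteq> Bd R" using smooth_at_continuous[OF M s1 Bd_open 1(1)] .
  obtain W2 where W2: "openin (mtop M) W2" "\<one> \<in> W2" "(\<lambda>x. inv x) ` W2 \<subseteq> Bd R" using smooth_at_continuous[OF M s2 Bd_open 1(2)] .
  obtain d where d: "d > 0" "Bd d \<subseteq> W1 \<inter> W2" using nhd_Bd[OF openin_Int[OF W1(1) W2(1)]] W1(2) W2(2) by auto
  define s where "s = min d R"
  have s: "s > 0" "s \<le> R" "Bd s \<subseteq> W1 \<inter> W2" using d R Bd_mono[of s d] by (auto simp: s_def)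
  show thesis
  proof (rule that[OF s(1,2)])
    fix h assume h: "h \<in> F" "h \<otimes> inv h0 \<in> Bd s"
    have hc: "h \<in> carrier G" "\<sigma> h = inv h" using h(1) by (auto simp: F_def)
    define x where "x = h \<otimes> inv h0"
    have xB: "x \<in> Bd R" "x \<in> Bd s" using h(2) Bd_mono[OF s(2)] by (auto simp: x_def)
    define r where "r = rt x"
    have rB: "r \<in> Bd s" using rtn(1)[OF xB(2) s(2), of 1] by (simp add: r_def)
    have rc: "r \<in> carrier G" using rB Bd_carrier by blast
    have rr: "r \<otimes> r = x" using rt[OF xB(1)] by (simp add: r_def)
    have sx: "?s x = inv x" using hc h0c by (simp add: x_def \<sigma>_mult \<sigma>_inv inv_mult_group m_assoc)
    have "?s r \<otimes> ?s r = ?s x"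
    proof -
      have "inv h0 \<otimes> (h0 \<otimes> (\<sigma> r \<otimes> inv h0)) = \<sigma> r \<otimes> inv h0" using rc h0c by (simp flip: m_assoc)
      then show ?thesis unfolding rr[symmetric] using rc h0c by (simp add: \<sigma>_mult m_assoc)
    qed
    moreover have "inv r \<otimes> inv r = inv x" unfolding rr[symmetric] using rc by (simp add: inv_mult_group)
    ultimately have "?s r \<otimes> ?s r = inv r \<otimes> inv r" using sx by simp
    moreover have "?s r \<in> Bd R" "inv r \<in> Bd R" using rB s(3) W1(3) W2(3) by blast+
    ultimately have e: "?s r = inv r" using root_unique by blast
    \<comment> \<open>The relation for \<open>r\<close> lets \<open>inv (\<sigma> r)\<close> pass
      through \<open>h0\<close>, so that \<open>\<tau> r h0\<close> becomes
      \<open>r \<otimes> r \<otimes> h0\<close>.\<close>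
    have "h0 \<otimes> inv (\<sigma> r) = r \<otimes> h0"
    proof -
      have "inv (?s r) = r" using e rc by simp
      then have "h0 \<otimes> (inv (\<sigma> r) \<otimes> inv h0) = r" using rc h0c by (simp add: inv_mult_group m_assoc)
      then have "h0 \<otimes> (inv (\<sigma> r) \<otimes> inv h0) \<otimes> h0 = r \<otimes> h0" by simp
      then show ?thesis using rc h0c by (simp add: m_assoc)
    qed
    then have "\<tau> r h0 = r \<otimes> (r \<otimes> h0)" using rc h0c by (simp add: \<tau>_def m_assoc)
    also have "\<dots> = x \<otimes> h0" using rr rc h0c by (simp flip: m_assoc)
    also have "\<dots> = h" using hc h0c by (simp add: x_def m_assoc)
    finally show "\<tau> (rt (h \<otimes> inv h0)) h0 = h" by (simp add: r_def x_def)
  qed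
qed

lemma translated_Bd:
  assumes "h0 \<in> carrier G" "s > 0"
  obtains V where "openin (mtop M) V" "h0 \<in> V" "\<And>h. h \<in> V \<Longrightarrow> h \<otimes> inv h0 \<in> Bd s"
proof -
  have sm: "smooth_at M M (\<lambda>x. x \<otimes> inv h0) h0"
    by (intro smooth_at_mult M smooth_at_const_carrier smooth_at_ident) (simp_all add: top assms)
  have "h0 \<otimes> inv h0 \<in> Bd s" using assms by simp
  from smooth_at_continuous[OF M sm Bd_open this] show thesis using that by (metis image_subset_iff)
qed

lemma Orb_closed: "closedin (mtop M) Orb"
proof -
  have H: "Hausdorff_space (mtop M)" using M by (simp add: smooth_manifold_def)
  have c1: "continuous_map (mtop M) (mtop M) \<sigma>"
    by (rule smooth_at_imp_continuous_map[OF M]) (simp add: top smooth_at_\<sigma>)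
  have c2: "continuous_map (mtop M) (mtop M) (\<lambda>x. inv x)"
    by (rule smooth_at_imp_continuous_map[OF M]) (intro smooth_at_inverse M smooth_at_ident, simp add: top)
  have "closedin (mtop M) {x \<in> topspace (mtop M). \<sigma> x = inv x}"
    using closedin_continuous_maps_eq[OF H c1 c2] .
  then have Fc: "closedin (mtop M) F" by (simp add: F_def top)
  have "openin (mtop M) (topspace (mtop M) - Orb)"
  proof (subst openin_subopen, intro ballI)
    fix x assume x: "x \<in> topspace (mtop M) - Orb"
    show "\<exists>T. openin (mtop M) T \<and> x \<in> T \<and> T \<subseteq> topspace (mtop M) - Orb"
    proof (cases "x \<in> F")
      case False
      then show ?thesis using Fc Orb_F x by (intro exI[of _ "topspace (mtop M) - F"]) auto
    next
      case True
      obtain s where s: "s > 0" "s \<le> R" "\<And>h. h \<in> F \<Longrightarrow> h \<otimes> inv x \<in> Bd s \<Longrightarrow> \<tau> (rt (h \<otimes> inv x)) x = h"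
        using orbit_local_section[OF True] by metis
      obtain V where V: "openin (mtop M) V" "x \<in> V" "\<And>h. h \<in> V \<Longrightarrow> h \<otimes> inv x \<in> Bd s"
        using translated_Bd[OF F_carrier[OF True] s(1)] by metis
      \<comment> \<open>A point of \<open>Orb\<close> near \<open>x\<close> would lie in the orbit
        of \<open>x\<close>, and \<open>x\<close> would then belong to \<open>Orb\<close>.\<close>
      have "h \<notin> Orb" if h: "h \<in> V" for h
      proof
        assume hO: "h \<in> Orb"
        have b: "h \<otimes> inv x \<in> Bd s" using V(3)[OF h] .
        then have "rt (h \<otimes> inv x) \<in> carrier G" using rt Bd_mono[OF s(2)] Bd_carrier by blast
        moreover have "\<tau> (rt (h \<otimes> inv x)) x = h" using s(3)[OF _ b] hO Orb_F by blast
        ultimately have "x \<in> Orb" using \<tau>_Orb_iff[of "rt (h \<otimes> inv x)" x] hO F_carrier[OF True] by simp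
        then show False using x by simp
      qed
      then show ?thesis using V openin_subset[OF V(1)] by (intro exI[of _ V]) auto
    qed
  qed
  moreover have "Orb \<subseteq> topspace (mtop M)" using Orb_carrier top by blast
  ultimately show ?thesis by (simp add: closedin_def)
qed

lemma A_A: "X \<in> E \<Longrightarrow> A (A X) = X"
proof -
  assume X: "X \<in> E"
  have s: "smooth_at M M \<sigma> \<one>" "smooth_at M M \<sigma> (\<sigma> \<one>)" using smooth_at_\<sigma> by auto
  have "A (A X) = cderiv M CC CC (\<lambda>x. \<sigma> (\<sigma> x)) \<one> X"
    using cderiv_compose[OF M M M s, of CC CC CC X] CC_max X by simp
  also have "\<dots> = cderiv M CC CC (\<lambda>x. x) \<one> X"
    by (rule cderiv_local[OF M M smooth_at_ident[OF one_closed] CC_max CC_one(1) CC_max CC_one(1) openin_topspace _ _ X]) (auto simp: top)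
  also have "\<dots> = X" by (rule cderiv_id[OF M CC_max CC_one(1) X])
  finally show ?thesis .
qed

text \<open>Averaging the chart over the involution \<open>\<iota> g = \<sigma>(g)\<^sup>-\<^sup>1\<close>, whose fixed point set is \<open>F\<close>,
  makes \<open>\<iota>\<close> linear in the new chart.\<close>

lemma slice_chart_one:
  obtains C where "C \<in> max_atlas M" "\<one> \<in> fst C" "snd C ` (fst C \<inter> Orb) = snd C ` fst C \<inter> pE"
proof -
  define \<iota> where "\<iota> = (\<lambda>g. inv (\<sigma> g))"
  define L where "L = (\<lambda>v. - A v)"
  have \<iota>c: "\<iota> g \<in> carrier G" "\<iota> (\<iota> g) = g" if "g \<in> carrier G" for g using that by (simp_all add: \<iota>_def \<sigma>_inv)
  have \<iota>1: "\<iota> \<one> = \<one>" by (simp add: \<iota>_def)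
  have \<iota>F: "g \<in> F \<longleftrightarrow> \<iota> g = g" if "g \<in> carrier G" for g
    using that by (auto simp: F_def \<iota>_def) (metis inv_inv \<sigma>_carrier)+
  have s\<iota>: "smooth_at M M \<iota> p" if "p \<in> carrier G" for p
    unfolding \<iota>_def by (intro smooth_at_inverse M smooth_at_\<sigma> that)
  have Ll: "linear L" unfolding L_def using linear_compose[OF A_linear linear_uminus] by (simp add: o_def)
  have LE: "L v \<in> E" if "v \<in> E" for v
    using that dCC_in[OF smooth_at_\<sigma>[OF one_closed] \<sigma>_one that] subspace_neg[OF subE] by (simp add: L_def)
  have LL: "L (L v) = v" if "v \<in> E" for v using A_A[OF that] linear_neg[OF A_linear] by (simp add: L_def)
  have pL: "v \<in> pE \<longleftrightarrow> v \<in> E \<and> L v = v" for v by (auto simp: pE_def L_def minus_equation_iff)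
  have dCC\<iota>: "dCC \<iota> v = L v" if v: "v \<in> E" for v
  proof -
    have LvE: "L v \<in> E" by (rule LE[OF v])
    have "\<iota> (Exp (t *\<^sub>R v)) = Exp (t *\<^sub>R L v)" for t
    proof -
      have tE: "t *\<^sub>R v \<in> E" by (rule subspace_scale[OF subE v])
      have "\<iota> (Exp (t *\<^sub>R v)) = inv (Exp (A (t *\<^sub>R v)))" by (simp add: \<iota>_def \<sigma>_Exp[OF tE])
      also have "\<dots> = Exp (- A (t *\<^sub>R v))" using Exp_uminus dCC_in[OF smooth_at_\<sigma>[OF one_closed] \<sigma>_one tE] by simp
      also have "- A (t *\<^sub>R v) = t *\<^sub>R L v" by (simp add: L_def linear_cmul[OF A_linear])
      finally show ?thesis .
    qed
    moreover have "cderiv real_mfd (UNIV, id) CC (\<lambda>t. \<iota> (Exp (t *\<^sub>R v))) 0 1 = dCC \<iota> (cderiv real_mfd (UNIV, id) CC (\<lambda>t. Exp (t *\<^sub>R v)) 0 1)"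
    proof -
      have m: "model real_mfd = UNIV" by (simp add: real_mfd_def)
      have i: "smooth_at M M \<iota> (Exp (0 *\<^sub>R v))" by (rule s\<iota>) simp
      show ?thesis
        using cderiv_compose[OF smooth_manifold_real M M smooth_at_Exp_curve[OF v, of 0] i, of "(UNIV, id)" CC CC 1]
          real_chart CC_max \<iota>1 m by simp
    qed
    ultimately show ?thesis using Exp_curve_cderiv[OF v] Exp_curve_cderiv[OF LvE] by simp
  qed
  \<comment> \<open>\<open>\<iota>\<close> and \<open>L\<close> are involutions, so
    \<open>\<Psi> (\<iota> g) = L (\<Psi> g)\<close>. Where \<open>\<Psi>\<close> is injective,
    \<open>\<iota> g = g\<close> thus means that \<open>\<Psi> g\<close> lies in the fixed space
    \<open>pE\<close> of \<open>L\<close>. As \<open>L\<close> is also the derivative of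
    \<open>\<iota>\<close>, the factor 1/2 makes the derivative of \<open>\<Psi>\<close> in
    \<open>CC\<close> the identity.\<close>
  define \<Psi> where "\<Psi> = (\<lambda>g. (1/2) *\<^sub>R (y g + L (y (\<iota> g))))"
  define f where "f = (\<lambda>x. \<Psi> (\<psi> x))"
  note sy1 = smooth_at_compose[OF M M ME s\<iota>[OF one_closed], of y]
  have sy2: "smooth_at M (subspace_mfd E) (\<lambda>x. y (\<iota> x)) \<one>" by (rule sy1) (use smooth_at_y \<iota>1 in simp)
  from smooth_at_charts(1)[OF M ME this CC_max CC_one(1) subspace_mfd_max_atlas[OF subE]]
  have g2: "smooth_germ E (\<lambda>x. y (\<iota> (\<psi> x))) 0" by (simp add: o_def \<iota>1 E0)
  obtain \<delta>0 where \<delta>0: "\<delta>0 > 0" "\<And>x. x \<in> E \<Longrightarrow> norm x \<le> \<delta>0 \<Longrightarrow> \<psi> x \<in> fst CC \<and> y (\<psi> x) = x"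
    using nhd_coord[OF CC_open CC_one(1)] by metis
  have b0: "0 \<in> ball (0::'e) \<delta>0" using \<delta>0 by simp
  have lid: "smooth_germ E (\<lambda>x. x) 0" using smooth_germ_linear[OF linear_id] by (simp add: id_def)
  have half: "linear (\<lambda>v::'e. (1/2) *\<^sub>R v)" by (simp add: linear_scaleR)
  have gf': "smooth_germ E (\<lambda>x. (1/2) *\<^sub>R (x + L (y (\<iota> (\<psi> x))))) 0"
    by (intro smooth_germ_compose_linear[OF _ E0 half] smooth_germ_add[OF lid _ E0] smooth_germ_compose_linear[OF g2 E0 Ll])
  have fg: "smooth_germ E f 0"
    by (rule smooth_germ_local[OF gf' open_ball b0]) (use \<delta>0 in \<open>auto simp: f_def \<Psi>_def\<close>)
  have "((\<lambda>x. y (\<iota> (\<psi> x))) has_derivative dCC \<iota>) (at 0 within E)"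
    using cderiv_has_derivative[OF M M s\<iota>[OF one_closed] CC_max CC_one(1) CC_max] by (simp add: \<iota>1 o_def)
  then have d1: "((\<lambda>x. L (y (\<iota> (\<psi> x)))) has_derivative (\<lambda>v. L (dCC \<iota> v))) (at 0 within E)"
    using bounded_linear.has_derivative[of L] Ll by (simp add: linear_conv_bounded_linear)
  have d2: "((\<lambda>x. (1/2) *\<^sub>R (x + L (y (\<iota> (\<psi> x))))) has_derivative (\<lambda>v. (1/2) *\<^sub>R (v + L (dCC \<iota> v)))) (at 0 within E)"
    by (intro has_derivative_scaleR_right has_derivative_add has_derivative_ident d1)
  have fd: "(f has_derivative (\<lambda>v. (1/2) *\<^sub>R (v + L (dCC \<iota> v)))) (at 0 within E)"
    by (rule has_derivative_within_local[OF d2 open_ball b0 E0]) (use \<delta>0 in \<open>auto simp: f_def \<Psi>_def\<close>)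
  have fd1: "(1/2) *\<^sub>R (v + L (dCC \<iota> v)) = v" if "v \<in> E" for v
    using dCC\<iota>[OF that] LL[OF that] by (simp flip: scaleR_2)
  obtain s where s: "s > 0" "s \<le> R" "\<And>h. h \<in> F \<Longrightarrow> h \<otimes> inv \<one> \<in> Bd s \<Longrightarrow> \<tau> (rt (h \<otimes> inv \<one>)) \<one> = h"
    using orbit_local_section[OF one_F] by metis
  \<comment> \<open>Near the identity the orbit fills \<open>F\<close>, so it is enough to
    straighten \<open>F\<close>.\<close>
  have FO: "h \<in> Orb" if "h \<in> F" "h \<in> Bd s" for h
  proof -
    have "\<tau> (rt h) \<one> = h" using s(3)[OF that(1)] that F_carrier by simp
    moreover have "rt h \<in> carrier G" using rt that(2) Bd_mono[OF s(2)] Bd_carrier by blast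
    ultimately show ?thesis using \<tau>_one unfolding Orb_def by (metis imageI)
  qed
  have "\<iota> \<one> \<in> fst CC" using \<iota>1 by simp
  then obtain W1 where W1: "openin (mtop M) W1" "\<one> \<in> W1" "\<iota> ` W1 \<subseteq> fst CC"
    using smooth_at_continuous[OF M s\<iota>[OF one_closed] CC_open] by metis
  have o: "openin (mtop M) (W1 \<inter> Bd s)" "\<one> \<in> W1 \<inter> Bd s" using W1 s Bd_open by auto
  obtain \<delta>1 where \<delta>1: "\<delta>1 > 0" "\<And>x. x \<in> E \<Longrightarrow> norm x \<le> \<delta>1 \<Longrightarrow> \<psi> x \<in> W1 \<inter> Bd s"
    using nhd_coord[OF o] by metis
  define W where "W = ball (0::'e) (min \<delta>0 \<delta>1)"
  have W: "open W" "0 \<in> W" using \<delta>0 \<delta>1 by (auto simp: W_def)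
  have Wp: "\<psi> x \<in> fst CC" "y (\<psi> x) = x" "\<psi> x \<in> W1" "\<psi> x \<in> Bd s" "y (\<iota> (\<psi> x)) \<in> E" if "x \<in> E" "x \<in> W" for x
    using \<delta>0(2)[of x] \<delta>1(2)[of x] that W1(3) yE by (auto simp: W_def)
  have fE: "f x \<in> E" if "x \<in> E" "x \<in> W" for x
    unfolding f_def \<Psi>_def using Wp[OF that] that LE subE by (auto intro!: subspace_scale subspace_add)
  show thesis
  proof (rule smooth_germ_inverse[OF subE E0 fg W fE fd fd1])
    fix U V k assume UV: "open U" "open V" "0 \<in> U" "U \<subseteq> W" "f 0 \<in> V"
      "f ` (E \<inter> U) = E \<inter> V" "k ` (E \<inter> V) = E \<inter> U"
      "\<And>x. x \<in> E \<Longrightarrow> x \<in> U \<Longrightarrow> k (f x) = x" "\<And>x. x \<in> E \<Longrightarrow> x \<in> V \<Longrightarrow> f (k x) = x"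
      "\<And>x. x \<in> E \<Longrightarrow> x \<in> U \<Longrightarrow> smooth_germ E f x" "\<And>x. x \<in> E \<Longrightarrow> x \<in> V \<Longrightarrow> smooth_germ E k x"
    define T where "T = {g \<in> fst CC. y g \<in> U}"
    have T: "openin (mtop M) T" unfolding T_def by (rule chart_open_vimage[OF CC_chart UV(1)])
    have Tc: "g \<in> carrier G" "g \<in> fst CC" "y g \<in> E" "y g \<in> U" "\<psi> (y g) = g" "g \<in> Bd s" if "g \<in> T" for g
    proof -
      show 1: "g \<in> fst CC" "y g \<in> U" using that by (auto simp: T_def)
      show "g \<in> carrier G" "y g \<in> E" "\<psi> (y g) = g" using CC_carrier yE \<psi>y 1 by auto
      then show "g \<in> Bd s" using Wp(4)[of "y g"] 1 UV(4) by auto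
    qed
    \<comment> \<open>The largest part of \<open>T\<close> invariant under \<open>\<iota>\<close>:
      injectivity of \<open>\<Psi>\<close> has to be applied to \<open>g\<close> and
      \<open>\<iota> g\<close> together.\<close>
    define T' where "T' = {g \<in> T. \<iota> g \<in> T}"
    have T'o: "openin (mtop M) T'"
    proof -
      have "continuous_map (mtop M) (mtop M) \<iota>"
        by (rule smooth_at_imp_continuous_map[OF M]) (simp add: top s\<iota>)
      then have "openin (mtop M) {g \<in> topspace (mtop M). \<iota> g \<in> T}" by (rule openin_continuous_map_preimage[OF _ T])
      then have "openin (mtop M) (T \<inter> {g \<in> topspace (mtop M). \<iota> g \<in> T})" using T by blast
      moreover have "T \<inter> {g \<in> topspace (mtop M). \<iota> g \<in> T} = T'" using openin_subset[OF T] by (auto simp: T'_def)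
      ultimately show ?thesis by simp
    qed
    have T'1: "\<one> \<in> T'" using UV(3) \<iota>1 by (simp add: T'_def T_def)
    define \<xi> where "\<xi> = (\<lambda>v. \<psi> (k v))"
    have kU: "k v \<in> E" "k v \<in> U" if "v \<in> E" "v \<in> V" for v using UV(7) that by blast+
    have \<xi>T: "\<xi> v \<in> T" "y (\<xi> v) = k v" if "v \<in> E" "v \<in> V" for v
      using kU[OF that] Wp(1,2)[of "k v"] UV(4) by (auto simp: \<xi>_def T_def)
    have s\<xi>: "smooth_at (subspace_mfd E) M \<xi> v" if v: "v \<in> E" "v \<in> V" for v
    proof -
      have 1: "smooth_at (subspace_mfd E) (subspace_mfd E) k v"
        by (rule smooth_at_subspaceI[OF subE subE UV(11)[OF v] v(1) UV(2) v(2) kU(1)])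
      have "k v = y (\<xi> v)" using \<xi>T[OF v] by simp
      then have 2: "smooth_at (subspace_mfd E) M \<psi> (k v)" using smooth_at_\<psi>[of "\<xi> v"] \<xi>T[OF v] Tc by simp
      from smooth_at_compose[OF ME ME M 1 2] show ?thesis by (simp add: \<xi>_def)
    qed
    have fy: "f (y g) = \<Psi> g" if "g \<in> T" for g using Tc[OF that] by (simp add: f_def)
    have \<Psi>V: "\<Psi> g \<in> E" "\<Psi> g \<in> V" "\<xi> (\<Psi> g) = g" if "g \<in> T" for g
    proof -
      have "f (y g) \<in> E \<inter> V" using UV(6) Tc[OF that] by blast
      then show "\<Psi> g \<in> E" "\<Psi> g \<in> V" using fy[OF that] by auto
      show "\<xi> (\<Psi> g) = g" using UV(8)[of "y g"] Tc[OF that] fy[OF that] by (simp add: \<xi>_def)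
    qed
    have \<Psi>\<xi>: "\<Psi> (\<xi> v) = v" if "v \<in> E" "v \<in> V" for v
      using fy[OF \<xi>T(1)[OF that]] \<xi>T(2)[OF that] UV(9)[OF that] by simp
    define V' where "V' = {v \<in> E \<inter> V. \<xi> v \<in> T'}"
    have V'o: "openin (top_of_set E) V'"
    proof -
      have EV: "openin (top_of_set E) (E \<inter> V)" using UV(2) by auto
      have "continuous_map (subtopology (top_of_set E) (E \<inter> V)) (mtop M) \<xi>"
        using smooth_at_imp_continuous_map_open[OF ME _ s\<xi>, of "E \<inter> V"] EV by simp
      from openin_continuous_map_preimage[OF this T'o]
      have "openin (subtopology (top_of_set E) (E \<inter> V)) V'" by (simp add: V'_def)
      then show ?thesis using openin_trans_full[OF _ EV] by blast
    qed
    have im: "\<Psi> ` T' = V'"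
    proof (intro equalityI subsetI)
      fix v assume "v \<in> \<Psi> ` T'"
      then obtain g where g: "g \<in> T'" "v = \<Psi> g" by blast
      then have "g \<in> T" by (simp add: T'_def)
      then show "v \<in> V'" using \<Psi>V g by (simp add: V'_def)
    next
      fix v assume "v \<in> V'"
      then show "v \<in> \<Psi> ` T'" using \<Psi>\<xi> unfolding V'_def by (metis (no_types, lifting) IntD1 IntD2 image_eqI mem_Collect_eq)
    qed
    have s\<Psi>: "smooth_at M (subspace_mfd E) \<Psi> g" if g: "g \<in> T" for g
    proof -
      have 1: "smooth_at (subspace_mfd E) (subspace_mfd E) f (y g)"
        using UV(4) fE by (intro smooth_at_subspaceI[OF subE subE UV(10)[OF Tc(3,4)[OF g]] Tc(3)[OF g] UV(1) Tc(4)[OF g]]) auto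
      from smooth_at_compose[OF M ME ME smooth_at_y[OF Tc(2)[OF g]] 1]
      show ?thesis by (rule smooth_at_local[OF M _ T g]) (simp add: fy)
    qed
    have chart: "(T', \<Psi>) \<in> max_atlas M"
    proof (rule max_atlasI[OF M T'o V'o im])
      show "\<xi> (\<Psi> q) = q" if "q \<in> T'" for q using \<Psi>V that by (simp add: T'_def)
      show "smooth_at M (subspace_mfd E) \<Psi> q" if "q \<in> T'" for q using s\<Psi> that by (simp add: T'_def)
      show "smooth_at (subspace_mfd E) M \<xi> x" if "x \<in> V'" for x using s\<xi> that by (simp add: V'_def)
    qed
    have \<Psi>\<iota>: "\<Psi> (\<iota> g) = L (\<Psi> g)" if g: "g \<in> T'" for g
    proof -
      have gT: "g \<in> T" "\<iota> g \<in> T" using g by (auto simp: T'_def)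
      have "L (\<Psi> g) = (1/2) *\<^sub>R (L (y g) + L (L (y (\<iota> g))))" by (simp add: \<Psi>_def linear_cmul[OF Ll] linear_add[OF Ll])
      then show ?thesis using LL[OF Tc(3)[OF gT(2)]] \<iota>c(2)[OF Tc(1)[OF gT(1)]] by (simp add: \<Psi>_def add.commute)
    qed
    have key: "g \<in> Orb \<longleftrightarrow> \<Psi> g \<in> pE" if g: "g \<in> T'" for g
    proof
      have gT: "g \<in> T" "\<iota> g \<in> T" using g by (auto simp: T'_def)
      note gc = Tc(1)[OF gT(1)]
      show "\<Psi> g \<in> pE" if "g \<in> Orb"
      proof -
        have "\<iota> g = g" using that Orb_F \<iota>F[OF gc] by blast
        then show ?thesis using \<Psi>\<iota>[OF g] pL \<Psi>V(1)[OF gT(1)] by simp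
      qed
      show "g \<in> Orb" if "\<Psi> g \<in> pE"
      proof -
        have "\<Psi> (\<iota> g) = \<Psi> g" using \<Psi>\<iota>[OF g] pL that by simp
        then have "\<iota> g = g" using \<Psi>V(3)[OF gT(1)] \<Psi>V(3)[OF gT(2)] by simp
        then show ?thesis using FO Tc(6)[OF gT(1)] \<iota>F[OF gc] by blast
      qed
    qed
    show thesis
    proof (rule that[OF chart])
      show "\<one> \<in> fst (T', \<Psi>)" using T'1 by simp
      show "snd (T', \<Psi>) ` (fst (T', \<Psi>) \<inter> Orb) = snd (T', \<Psi>) ` fst (T', \<Psi>) \<inter> pE" using key by auto
    qed
  qed
qed

text \<open>\<open>\<tau> g\<close> is smooth with smooth inverse, preserves \<open>Orb\<close> and
  takes the identity to \<open>\<kappa> g\<close>. The slice chart at the identity can thus be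
  transported to every point of the orbit, always with the same subspace \<open>pE\<close>.\<close>

lemma Orb_embedded: "embedded_submanifold M pE Orb"
  unfolding embedded_submanifold_def
proof (intro conjI ballI)
  show "Orb \<subseteq> topspace (mtop M)" using Orb_carrier top by blast
  show "subspace pE" by (rule subpE)
  show "pE \<subseteq> E" using pE_E by blast
  fix p assume "p \<in> Orb"
  then obtain g where g: "g \<in> carrier G" "p = \<kappa> g" by (auto simp: Orb_def)
  obtain C where C: "C \<in> max_atlas M" "\<one> \<in> fst C" "snd C ` (fst C \<inter> Orb) = snd C ` fst C \<inter> pE" using slice_chart_one by metis
  note ch = max_atlas_is_chart[OF C(1)]
  have cc: "q \<in> carrier G" if "q \<in> fst C" for q using is_chart_subset[OF ch] top that by blast
  define U where "U = {h \<in> carrier G. \<tau> (inv g) h \<in> fst C}"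
  have ct: "continuous_map (mtop M) (mtop M) (\<tau> (inv g))"
    by (rule smooth_at_imp_continuous_map[OF M]) (simp add: top smooth_at_\<tau> g)
  have Uo: "openin (mtop M) U"
    using openin_continuous_map_preimage[OF ct, of "fst C"] ch top by (simp add: U_def is_chart_def)
  have UC: "\<tau> (inv g) ` U = fst C"
  proof (intro equalityI subsetI)
    fix q assume q: "q \<in> fst C"
    then have "\<tau> g q \<in> U" using g cc \<tau>_inv(1)[OF g(1)] by (simp add: U_def)
    then show "q \<in> \<tau> (inv g) ` U" using \<tau>_inv(1)[OF g(1) cc[OF q]] by force
  qed (auto simp: U_def)
  have "(U, \<lambda>h. snd C (\<tau> (inv g) h)) \<in> max_atlas M"
  proof (rule max_atlasI[OF M Uo, where V = "snd C ` fst C" and \<xi> = "\<lambda>x. \<tau> g (chart_inv C x)"])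
    show "openin (top_of_set E) (snd C ` fst C)" using ch by (simp add: is_chart_def)
    show "(\<lambda>h. snd C (\<tau> (inv g) h)) ` U = snd C ` fst C" unfolding UC[symmetric] by (simp add: image_image)
    fix q assume "q \<in> U"
    then have q: "q \<in> carrier G" "\<tau> (inv g) q \<in> fst C" by (auto simp: U_def)
    show "\<tau> g (chart_inv C (snd C (\<tau> (inv g) q))) = q" using chart_inv_snd[OF ch q(2)] \<tau>_inv(2)[OF g(1) q(1)] by simp
    have "smooth_at M M (\<tau> (inv g)) q" using smooth_at_\<tau> g q by simp
    from smooth_at_compose[OF M M ME this smooth_at_chart[OF M C(1) q(2)]]
    show "smooth_at M (subspace_mfd E) (\<lambda>h. snd C (\<tau> (inv g) h)) q" .
  next
    fix x assume x: "x \<in> snd C ` fst C"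
    then have "chart_inv C x \<in> carrier G" using chart_inv_snd[OF ch] cc by auto
    then have "smooth_at M M (\<tau> g) (chart_inv C x)" using smooth_at_\<tau> g by simp
    from smooth_at_compose[OF ME M M smooth_at_chart_inv[OF M C(1) x] this]
    show "smooth_at (subspace_mfd E) M (\<lambda>x. \<tau> g (chart_inv C x)) x" .
  qed
  moreover have "(\<lambda>h. snd C (\<tau> (inv g) h)) ` (U \<inter> Orb) = (\<lambda>h. snd C (\<tau> (inv g) h)) ` U \<inter> pE"
  proof -
    have "\<tau> (inv g) ` (U \<inter> Orb) = fst C \<inter> Orb"
    proof (intro equalityI subsetI)
      fix q assume "q \<in> \<tau> (inv g) ` (U \<inter> Orb)"
      then show "q \<in> fst C \<inter> Orb" using UC \<tau>_Orb g by auto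
    next
      fix q assume q: "q \<in> fst C \<inter> Orb"
      then obtain h where h: "h \<in> U" "q = \<tau> (inv g) h" using UC by blast
      then have "h \<in> Orb" using \<tau>_Orb_iff[of "inv g" h] g q by (simp add: U_def)
      then show "q \<in> \<tau> (inv g) ` (U \<inter> Orb)" using h by blast
    qed
    then have "(\<lambda>h. snd C (\<tau> (inv g) h)) ` (U \<inter> Orb) = snd C ` (fst C \<inter> Orb)" by (metis image_image)
    also have "\<dots> = (\<lambda>h. snd C (\<tau> (inv g) h)) ` U \<inter> pE"
      using C(3) arg_cong[OF UC, of "(`) (snd C)"] by (simp add: image_image)
    finally show ?thesis .
  qed
  moreover have "p \<in> U"
  proof -
    have "\<tau> (inv g) p = \<one>" using \<tau>_inv(1)[OF g(1) one_closed] \<tau>_one[OF g(1)] g(2) by simp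
    then show ?thesis using g C(2) by (simp add: U_def)
  qed
  ultimately show "\<exists>C\<in>slice_charts M pE Orb. p \<in> fst C"
    by (intro bexI[of _ "(U, \<lambda>h. snd C (\<tau> (inv g) h))"]) (auto simp: slice_charts_def)
qed

text \<open>Smoothness into and out of \<open>Orb\<close> is tested in slice charts, which are
  restrictions of charts of \<open>M\<close>, for whatever \<open>W\<close> cuts out
  \<open>Orb\<close>. For the inverse this calls for an extension of it, near each point, to a
  smooth map on an open set of \<open>G\<close>.\<close>

theorem diffeomorphism_\<kappa>:
  assumes coset: "coset_manifold G M K Q" and W: "embedded_submanifold M W Orb"
    and \<phi>: "\<And>g. g \<in> carrier G \<Longrightarrow> \<phi> (proj g) = \<kappa> g"
  shows "diffeomorphism Q (submfd M W Orb) \<phi>"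
proof -
  let ?N = "submfd M W Orb"
  have Qm: "smooth_manifold Q" and sub: "submersion M Q proj" and Qt: "topspace (mtop Q) = lcosets\<^bsub>G\<^esub> K"
    using coset by (auto simp: coset_manifold_def)
  have lc: "q \<in> topspace (mtop Q) \<longleftrightarrow> (\<exists>g\<in>carrier G. q = proj g)" for q
    unfolding Qt by (auto simp: LCOSETS_def)
  have Nt: "topspace (mtop ?N) = Orb" using Orb_carrier top by (auto simp: submfd_def)
  have Nm: "mtop ?N = subtopology (mtop M) Orb" by (simp add: submfd_def)
  have sp: "smooth_at M Q proj g" if "g \<in> carrier G" for g
    using smooth_map_imp_smooth_at[OF M Qm _, of proj g] sub that top by (simp add: submersion_def)
  have s\<phi>: "smooth_at Q M \<phi> q" if qt: "q \<in> topspace (mtop Q)" for q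
  proof -
    obtain g where g: "g \<in> carrier G" "q = proj g" using qt[unfolded lc] by (rule bexE)
    show ?thesis unfolding g(2) by (rule smooth_at_descend[OF M Qm M sub smooth_at_\<kappa>[OF g(1)]]) (use \<phi> top in auto)
  qed
  have inj: "inj_on \<phi> (topspace (mtop Q))"
  proof (rule inj_onI)
    fix p q assume p: "p \<in> topspace (mtop Q)" and q: "q \<in> topspace (mtop Q)" and e: "\<phi> p = \<phi> q"
    obtain a where "a \<in> carrier G" "p = proj a" using p[unfolded lc] by (rule bexE)
    moreover obtain b where "b \<in> carrier G" "q = proj b" using q[unfolded lc] by (rule bexE)
    ultimately show "p = q" using e \<phi>[of a] \<phi>[of b] coset_eq_iff[of a b] by simp
  qed
  have img: "\<phi> ` topspace (mtop Q) = Orb"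
  proof (intro equalityI subsetI)
    fix h assume "h \<in> \<phi> ` topspace (mtop Q)"
    then show "h \<in> Orb" using lc \<phi> by (auto simp: Orb_def)
  next
    fix h assume "h \<in> Orb"
    then obtain g where "g \<in> carrier G" "h = \<phi> (proj g)" using \<phi> by (auto simp: Orb_def)
    then show "h \<in> \<phi> ` topspace (mtop Q)" using lc by blast
  qed
  define \<theta> where "\<theta> = inv_into (topspace (mtop Q)) \<phi>"
  have \<theta>: "\<theta> (\<kappa> g) = proj g" if g: "g \<in> carrier G" for g
    unfolding \<theta>_def using inv_into_f_f[OF inj, of "proj g"] lc g \<phi>[OF g] by auto
  \<comment> \<open>The extension is
    \<open>h \<mapsto> proj (rt (h \<otimes> inv h0) \<otimes> g0)\<close>: for \<open>h\<close> in
    the orbit the root moves \<open>h0 = \<kappa> g0\<close> to \<open>h\<close>, hence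
    \<open>g0\<close> to an element that \<open>\<kappa>\<close> maps to \<open>h\<close>.\<close>
  have loc: "\<exists>T V. openin (mtop M) V \<and> h0 \<in> V \<and> smooth_at M Q T h0 \<and> (\<forall>h\<in>V \<inter> Orb. T h = \<theta> h)" if h0: "h0 \<in> Orb" for h0
  proof -
    obtain g0 where g0: "g0 \<in> carrier G" "h0 = \<kappa> g0" using h0 by (auto simp: Orb_def)
    have h0F: "h0 \<in> F" "h0 \<in> carrier G" using h0 Orb_F F_carrier by blast+
    obtain s where s: "s > 0" "s \<le> R" "\<And>h. h \<in> F \<Longrightarrow> h \<otimes> inv h0 \<in> Bd s \<Longrightarrow> \<tau> (rt (h \<otimes> inv h0)) h0 = h"
      using orbit_local_section[OF h0F(1)] by metis
    obtain V where V: "openin (mtop M) V" "h0 \<in> V" "\<And>h. h \<in> V \<Longrightarrow> h \<otimes> inv h0 \<in> Bd s"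
      using translated_Bd[OF h0F(2) s(1)] by metis
    let ?T = "\<lambda>h. proj (rt (h \<otimes> inv h0) \<otimes> g0)"
    have 1: "smooth_at M M (\<lambda>h. h \<otimes> inv h0) h0"
      by (intro smooth_at_mult M smooth_at_const_carrier smooth_at_ident) (simp_all add: top h0F)
    have B: "h0 \<otimes> inv h0 \<in> Bd R" using h0F R by simp
    then have 2: "smooth_at M M rt (h0 \<otimes> inv h0)" using rt by blast
    have 3: "smooth_at M M (\<lambda>h. rt (h \<otimes> inv h0) \<otimes> g0) h0"
      by (rule smooth_at_mult[OF M smooth_at_compose[OF M M M 1 2] smooth_at_const_carrier[OF M]]) (simp_all add: top h0F g0)
    have "rt (h0 \<otimes> inv h0) \<in> carrier G" using rt[OF B] Bd_carrier by blast
    then have 4: "smooth_at M Q proj (rt (h0 \<otimes> inv h0) \<otimes> g0)" using sp g0 by simp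
    have "?T h = \<theta> h" if h: "h \<in> V \<inter> Orb" for h
    proof -
      have b: "h \<otimes> inv h0 \<in> Bd s" using V(3) h by blast
      then have c: "rt (h \<otimes> inv h0) \<in> carrier G" using rt Bd_mono[OF s(2)] Bd_carrier by blast
      have "\<kappa> (rt (h \<otimes> inv h0) \<otimes> g0) = \<tau> (rt (h \<otimes> inv h0)) h0" using \<tau>_\<kappa>[OF c g0(1)] g0(2) by simp
      also have "\<dots> = h" using s(3)[OF _ b] h Orb_F by blast
      finally show ?thesis using \<theta>[of "rt (h \<otimes> inv h0) \<otimes> g0"] c g0 by simp
    qed
    then show ?thesis using V smooth_at_compose[OF M M Qm 3 4] by blast
  qed
  have "smooth_map Q ?N \<phi>"
    unfolding smooth_map_def
  proof (intro conjI ballI)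
    have "continuous_map (mtop Q) (mtop M) \<phi>" by (rule smooth_at_imp_continuous_map[OF Qm s\<phi>])
    then show "continuous_map (mtop Q) (mtop ?N) \<phi>"
      unfolding Nm using img by (auto simp: continuous_map_in_subtopology)
    fix C C' assume C: "C \<in> atlas Q" and C': "C' \<in> atlas ?N"
    obtain D where D: "D \<in> slice_charts M W Orb" "C' = (fst D \<inter> Orb, snd D)" using C' by (auto simp: submfd_def)
    have DM: "D \<in> max_atlas M" using D(1) by (simp add: slice_charts_def)
    have CQ: "C \<in> max_atlas Q" using C atlas_subset_max_atlas[OF Qm] by blast
    note ch = max_atlas_is_chart[OF CQ]
    show "smooth_on (snd C ` (fst C \<inter> \<phi> -` fst C')) (snd C' \<circ> \<phi> \<circ> chart_inv C)"
      unfolding smooth_on_iff_germ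
    proof
      fix x assume "x \<in> snd C ` (fst C \<inter> \<phi> -` fst C')"
      then obtain q where q: "q \<in> fst C" "\<phi> q \<in> fst D" "x = snd C q" using D(2) by auto
      have "q \<in> topspace (mtop Q)" using is_chart_subset[OF ch] q by blast
      from smooth_at_charts(1)[OF Qm M s\<phi>[OF this] CQ q(1) DM q(2)]
      have "smooth_germ (model Q) (snd D \<circ> \<phi> \<circ> chart_inv C) x" unfolding q(3) .
      then show "smooth_germ (snd C ` (fst C \<inter> \<phi> -` fst C')) (snd C' \<circ> \<phi> \<circ> chart_inv C) x"
        unfolding D(2) snd_conv by (rule smooth_germ_mono) (use is_chart_model[OF ch] in auto)
    qed
  qed
  moreover have "smooth_map ?N Q \<theta>"
    unfolding smooth_map_def
  proof (intro conjI ballI)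
    show "continuous_map (mtop ?N) (mtop Q) \<theta>"
      unfolding continuous_map_def Nt
    proof (intro conjI allI impI)
      show "\<theta> \<in> Orb \<rightarrow> topspace (mtop Q)" unfolding \<theta>_def using img by (metis Pi_I inv_into_into)
      fix Z assume Z: "openin (mtop Q) Z"
      show "openin (mtop ?N) {x \<in> Orb. \<theta> x \<in> Z}"
      proof (subst openin_subopen, intro ballI)
        fix h0 assume "h0 \<in> {x \<in> Orb. \<theta> x \<in> Z}"
        then have h0: "h0 \<in> Orb" "\<theta> h0 \<in> Z" by auto
        obtain T V where TV: "openin (mtop M) V" "h0 \<in> V" "smooth_at M Q T h0" "\<forall>h\<in>V \<inter> Orb. T h = \<theta> h" using loc[OF h0(1)] by blast
        have "T h0 \<in> Z" using TV h0 by simp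
        then obtain W' where W': "openin (mtop M) W'" "h0 \<in> W'" "T ` W' \<subseteq> Z" using smooth_at_continuous[OF M TV(3) Z] by metis
        show "\<exists>S. openin (mtop ?N) S \<and> h0 \<in> S \<and> S \<subseteq> {x \<in> Orb. \<theta> x \<in> Z}"
        proof (intro exI[of _ "(W' \<inter> V) \<inter> Orb"] conjI)
          show "openin (mtop ?N) (W' \<inter> V \<inter> Orb)" unfolding Nm openin_subtopology using W' TV by blast
          show "h0 \<in> W' \<inter> V \<inter> Orb" using W' TV h0 by simp
          show "W' \<inter> V \<inter> Orb \<subseteq> {x \<in> Orb. \<theta> x \<in> Z}" using W'(3) TV(4) by (auto simp: image_subset_iff)
        qed
      qed
    qed
    fix C C' assume C: "C \<in> atlas ?N" and C': "C' \<in> atlas Q"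
    obtain D where D: "D \<in> slice_charts M W Orb" "C = (fst D \<inter> Orb, snd D)" using C by (auto simp: submfd_def)
    have DM: "D \<in> max_atlas M" using D(1) by (simp add: slice_charts_def)
    have CQ: "C' \<in> max_atlas Q" using C' atlas_subset_max_atlas[OF Qm] by blast
    note ch = max_atlas_is_chart[OF DM]
    have injD: "inj_on (snd D) (fst D \<inter> Orb)" using is_chart_inj[OF ch] by (rule inj_on_subset) simp
    \<comment> \<open>\<open>C\<close> is \<open>D\<close> restricted to \<open>Orb\<close>, so its
      \<open>chart_inv\<close> agrees with that of \<open>D\<close> on the coordinates of orbit
      points.\<close>
    have ci: "chart_inv C (snd D h) = h" if "h \<in> fst D" "h \<in> Orb" for h
      unfolding chart_inv_def D(2) fst_conv snd_conv using inv_into_f_f[OF injD] that by simp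
    show "smooth_on (snd C ` (fst C \<inter> \<theta> -` fst C')) (snd C' \<circ> \<theta> \<circ> chart_inv C)"
      unfolding smooth_on_iff_germ
    proof
      fix x assume "x \<in> snd C ` (fst C \<inter> \<theta> -` fst C')"
      then obtain h0 where h0: "h0 \<in> fst D" "h0 \<in> Orb" "\<theta> h0 \<in> fst C'" "x = snd D h0" using D(2) by auto
      obtain T V where TV: "openin (mtop M) V" "h0 \<in> V" "smooth_at M Q T h0" "\<forall>h\<in>V \<inter> Orb. T h = \<theta> h" using loc[OF h0(2)] by blast
      have Th: "T h0 \<in> fst C'" using TV h0 by simp
      obtain Z where Z: "open Z" "snd D h0 \<in> Z" "\<And>x. x \<in> E \<Longrightarrow> x \<in> Z \<Longrightarrow> chart_inv D x \<in> V"
        using chart_nhd[OF ch TV(1,2) h0(1)] by metis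
      from smooth_at_charts(1)[OF M Qm TV(3) DM h0(1) CQ Th]
      have "smooth_germ E (snd C' \<circ> T \<circ> chart_inv D) x" unfolding h0(4) .
      then show "smooth_germ (snd C ` (fst C \<inter> \<theta> -` fst C')) (snd C' \<circ> \<theta> \<circ> chart_inv C) x"
      proof (rule smooth_germ_local[OF _ Z(1)])
        show "x \<in> Z" using Z h0 by simp
        fix z assume z: "z \<in> snd C ` (fst C \<inter> \<theta> -` fst C')" "z \<in> Z"
        then obtain h where h: "h \<in> fst D" "h \<in> Orb" "z = snd D h" using D(2) by auto
        have zE: "z \<in> E" using is_chart_model[OF ch h(1)] h(3) by simp
        have "chart_inv D z = h" using chart_inv_snd[OF ch h(1)] h(3) by simp
        moreover have "h \<in> V" using Z(3)[OF zE z(2)] calculation by simp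
        ultimately show "z \<in> E \<and> (snd C' \<circ> T \<circ> chart_inv D) z = (snd C' \<circ> \<theta> \<circ> chart_inv C) z"
          using zE ci[OF h(1,2)] h TV(4) by simp
      qed
    qed
  qed
  moreover have "bij_betw \<phi> (topspace (mtop Q)) (topspace (mtop ?N))"
    unfolding Nt bij_betw_def using inj img by blast
  ultimately show ?thesis unfolding diffeomorphism_def \<theta>_def by blast
qed

end

text \<open>\<open>\<phi>\<close> is chosen before \<open>W\<close>, so that one map is a
  diffeomorphism for every description of \<open>P\<close> by slices; the existence of such a
  description is part of the claim.\<close>

theorem corollary2p6:
  fixes G :: "'g monoid" and M :: "('g, 'e::euclidean_space) mfd"
    and \<sigma> :: "'g \<Rightarrow> 'g" and K P :: "'g set" and Q :: "('g set, 'e) mfd"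
  assumes triple: "riemannian_symmetric_triple G M \<sigma> K"
    and quotient: "coset_manifold G M K Q"
    and P: "P = symmetric_subset G M \<sigma>"
  shows "closedin (mtop M) P \<and> (\<exists>W. embedded_submanifold M W P) \<and>
    (\<exists>\<phi>. (\<forall>g\<in>carrier G. \<phi> (g <#\<^bsub>G\<^esub> K) = g \<otimes>\<^bsub>G\<^esub> inv\<^bsub>G\<^esub> (\<sigma> g)) \<and>
         (\<forall>W. embedded_submanifold M W P \<longrightarrow> diffeomorphism Q (submfd M W P) \<phi>) \<and>
         (\<forall>g\<in>carrier G. \<forall>x\<in>lcosets\<^bsub>G\<^esub> K. \<phi> (g <#\<^bsub>G\<^esub> x) = twisted_conj G \<sigma> g (\<phi> x)))"
proof -
  interpret lie G M
    by unfold_locales (use triple in \<open>simp add: riemannian_symmetric_triple_def\<close>)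
  obtain rt lg ex R r0 where "lie_log G M rt lg ex R r0" using lie_log_exists by blast
  then interpret symm G M rt lg ex R r0 \<sigma> K
    by (intro symm.intro symm_axioms.intro triple)
  have PO: "P = Orb" using P symmetric_subset_Orb by simp
  obtain \<phi> where \<phi>: "\<And>g. g \<in> carrier G \<Longrightarrow> \<phi> (g <#\<^bsub>G\<^esub> K) = \<kappa> g" using descended_\<kappa> by blast
  have "\<phi> (g <#\<^bsub>G\<^esub> x) = twisted_conj G \<sigma> g (\<phi> x)" if g: "g \<in> carrier G" and x: "x \<in> lcosets\<^bsub>G\<^esub> K" for g x
  proof -
    obtain a where a: "a \<in> carrier G" "x = a <#\<^bsub>G\<^esub> K" using x by (auto simp: LCOSETS_def)
    have "\<phi> (g <#\<^bsub>G\<^esub> x) = \<kappa> (g \<otimes>\<^bsub>G\<^esub> a)" using proj_mult_left[OF g a(1)] \<phi> g a by simp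
    also have "\<dots> = \<tau> g (\<phi> x)" using \<tau>_\<kappa>[OF g a(1)] \<phi>[OF a(1)] a(2) by simp
    finally show ?thesis by (simp add: \<tau>_def twisted_conj_def)
  qed
  then show ?thesis
    unfolding PO using Orb_closed Orb_embedded diffeomorphism_\<kappa>[OF quotient _ \<phi>] \<phi>
    by (intro conjI exI[of _ pE] exI[of _ \<phi>]) (auto simp: \<kappa>_def)
qed

end
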